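(* Suppose that the almost complex structure $J$ on the $6$-manifold $M$ satisfies $\bar\partial\omega=0$ while $\psi$ is nowhere vanishing, where $\omega=\omega(J)$ and $\psi=\psi(J)$. Then $J$ is critical for all of the functionals $F_c(J)=\int_M c_1\,\Phi(J)+c_2\,\tfrac{i}{8}\psi(J)\wedge\overline{\psi(J)}$ ($c_1,c_2\in\mathbb{R}$) and its Nijenhuis tensor is of real type.
   Context: For an almost complex structure $J$ on a $6$-manifold $M$, a complex-valued $1$-form $\alpha$ is of type $(1,0)$ iff $\alpha(Jv)=i\,\alpha(v)$. The exterior derivative decomposes by type as $d=d^{2,-1}+\partial+\bar\partial+d^{-1,2}$, with $d^{r,s}$ of bidegree $(r,s)$, $\bar\partial=d^{0,1}$. A $J$-complex local coframing on an open set $U$ is a column $\alpha=(\alpha^1,\alpha^2,\alpha^3)$ of pointwise linearly independent $(1,0)$-forms. $N(\alpha):U\to M_{3\times3}(\mathbb{C})$ is defined by $$d^{-1,2}\alpha=N(\alpha)\begin{pmatrix}\overline{\alpha^2\wedge\alpha^3}\\ \overline{\alpha^3\wedge\alpha^1}\\ \overline{\alpha^1\wedge\alpha^2}\end{pmatrix}.$$ $Q$ is the symmetric bilinear map $M_{3\times3}(\mathbb{C})^2\to M_{3\times3}(\mathbb{C})$ with $Q(a,a)=\det(a)a^{-1}$ (the adjugate), and $P$ the symmetric trilinear form with $P(a,a,a)=\det a$. The following are independent of the choice of $\alpha$, hence globally defined: $$\Phi(J)=\tfrac{i}{8}|\det N(\alpha)|^2\,\alpha^1\wedge\alpha^2\wedge\alpha^3\wedge\overline{\alpha^1}\wedge\overline{\alpha^2}\wedge\overline{\alpha^3},\quad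 \omega(J)=\tfrac{i}{2}\,{}^t\alpha\wedge Q\bigl({}^tN(\alpha),\overline{N(\alpha)}\bigr)\wedge\overline\alpha,$$ $$\psi(J)=P\bigl(\overline{N(\alpha)},\overline{N(\alpha)},{}^tN(\alpha)\bigr)\,\alpha^1\wedge\alpha^2\wedge\alpha^3.$$ The Nijenhuis tensor of $J$ is of real type if, at each point, $N(\alpha)$ is a complex multiple of a Hermitian symmetric matrix (this is independent of $\alpha$). $M$ carries the orientation induced by $J$. $J$ is critical for $F_c$ if the first variation of $F_c$ vanishes for all smooth compactly supported variations of $J$ through almost complex structures (all smooth variations if $M$ is compact). *)

theory Defs
  imports "HOL-Analysis.Analysis"
begin

section \<open>Smooth maps and smooth 6-manifolds\<close>

text \<open>Meant for open \<open>S\<close> in a finite-dimensional space, where it is the usual notion of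
  \<open>C\<^sup>k\<close>: all iterated directional derivatives up to order \<open>k\<close> exist and are continuous.\<close>

primrec Ck_on :: "nat \<Rightarrow> 'a::real_normed_vector set \<Rightarrow> ('a \<Rightarrow> 'b::real_normed_vector) \<Rightarrow> bool" where
  "Ck_on 0 S f \<longleftrightarrow> continuous_on S f"
| "Ck_on (Suc k) S f \<longleftrightarrow>
     (\<forall>x\<in>S. f differentiable at x) \<and> (\<forall>v. Ck_on k S (\<lambda>x. frechet_derivative f (at x) v))"

definition smooth_on :: "'a::real_normed_vector set \<Rightarrow> ('a \<Rightarrow> 'b::real_normed_vector) \<Rightarrow> bool" where
  "smooth_on S f \<longleftrightarrow> (\<forall>k. Ck_on k S f)"

type_synonym 'm chart = "'m set \<times> ('m \<Rightarrow> real^6)"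

abbreviation chart_dom :: "'m chart \<Rightarrow> 'm set" where "chart_dom c \<equiv> fst c"
abbreviation chart_map :: "'m chart \<Rightarrow> 'm \<Rightarrow> real^6" where "chart_map c \<equiv> snd c"
abbreviation chart_img :: "'m chart \<Rightarrow> (real^6) set" where "chart_img c \<equiv> chart_map c ` chart_dom c"
abbreviation chart_inv :: "'m chart \<Rightarrow> real^6 \<Rightarrow> 'm" where
  "chart_inv c \<equiv> inv_into (chart_dom c) (chart_map c)"
abbreviation transition :: "'m chart \<Rightarrow> 'm chart \<Rightarrow> real^6 \<Rightarrow> real^6" where
  "transition c d \<equiv> chart_map d \<circ> chart_inv c"
abbreviation overlap :: "'m chart \<Rightarrow> 'm chart \<Rightarrow> (real^6) set" where
  "overlap c d \<equiv> chart_map c ` (chart_dom c \<inter> chart_dom d)"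

text \<open>The underlying set of the manifold is the whole type; Hausdorffness and second
  countability are type class constraints.\<close>

definition smooth_atlas :: "'m::{t2_space,second_countable_topology} chart set \<Rightarrow> bool" where
  "smooth_atlas A \<longleftrightarrow>
     (\<Union>c\<in>A. chart_dom c) = UNIV \<and>
     (\<forall>c\<in>A. open (chart_dom c) \<and> open (chart_img c) \<and>
        homeomorphism (chart_dom c) (chart_img c) (chart_map c) (chart_inv c)) \<and>
     (\<forall>c\<in>A. \<forall>d\<in>A. smooth_on (overlap c d) (transition c d))"


section \<open>Almost complex structures\<close>

text \<open>Tensor fields on the manifold are given classically, by their coordinate expressions in
  the charts of the atlas: \<open>J c x\<close> is the matrix of \<open>J\<close> in the chart \<open>c\<close> at the point with
  coordinates \<open>x\<close>. Values outside \<open>chart_img c\<close> are irrelevant.\<close>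

type_synonym field = "real^6 \<Rightarrow> real^6^6"

definition almost_complex ::
  "'m::{t2_space,second_countable_topology} chart set \<Rightarrow> ('m chart \<Rightarrow> field) \<Rightarrow> bool" where
  "almost_complex A J \<longleftrightarrow>
     (\<forall>c\<in>A. smooth_on (chart_img c) (J c) \<and> (\<forall>x\<in>chart_img c. J c x ** J c x = - mat 1)) \<and>
     (\<forall>c\<in>A. \<forall>d\<in>A. \<forall>x\<in>overlap c d. \<forall>v.
        frechet_derivative (transition c d) (at x) (J c x *v v) =
        J d (transition c d x) *v frechet_derivative (transition c d) (at x) v)"


section \<open>Complex-valued exterior forms in coordinates\<close>

text \<open>An element of the complexified exterior algebra of the dual of \<open>\<real>\<^sup>6\<close> is a function on
  lists of vectors; its part of degree \<open>k\<close> is its restriction to lists of length \<open>k\<close>, so a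
  homogeneous form of degree \<open>k\<close> vanishes on lists of any other length. The normalisation of
  the wedge product is \<open>(a \<and> b)(u, v) = a u * b v - a v * b u\<close> for 1-forms.\<close>

type_synonym form = "(real^6) list \<Rightarrow> complex"
type_synonym form_field = "real^6 \<Rightarrow> form"

definition shuffle_sign :: "nat \<Rightarrow> nat set \<Rightarrow> complex" where
  "shuffle_sign n S = (-1) ^ card {(i, j). i \<in> S \<and> j \<in> {..<n} - S \<and> j < i}"

definition wedge :: "form \<Rightarrow> form \<Rightarrow> form" (infixr "\<and>\<^sub>f" 75) where
  "(a \<and>\<^sub>f b) vs =
     (\<Sum>S\<in>Pow {..<length vs}. shuffle_sign (length vs) S * a (nths vs S) * b (nths vs (- S)))"

definition cnj_form :: "form \<Rightarrow> form" where
  "cnj_form a vs = cnj (a vs)"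

text \<open>The usual formula for \<open>d\<close> on constant vector fields, whose brackets vanish.\<close>

definition ext_d :: "form_field \<Rightarrow> form_field" where
  "ext_d \<eta> x vs = (\<Sum>i<length vs. (-1) ^ i *
     frechet_derivative (\<lambda>y. \<eta> y (take i vs @ drop (Suc i) vs)) (at x) (vs ! i))"

text \<open>The component of type \<open>(p,q)\<close> with respect to the complex structure \<open>A\<close>. It is the sum, over
  all choices \<open>S\<close> of \<open>p\<close> slots, of the complex multilinear extension of \<open>\<eta>\<close> evaluated at
  \<open>(v - \<i> A v) / 2\<close> (the \<open>(1,0)\<close>-part of \<open>v\<close>) in the slots of \<open>S\<close> and at \<open>(v + \<i> A v) / 2\<close> in the
  others; the sum over \<open>T\<close> expands this by multilinearity. In particular the \<open>(1,0)\<close>-component of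
  \<open>\<alpha>\<close> is \<open>v \<mapsto> (\<alpha> v - \<i> \<alpha> (A v)) / 2\<close>.\<close>

definition type_part :: "real^6^6 \<Rightarrow> int \<Rightarrow> int \<Rightarrow> form \<Rightarrow> form" where
  "type_part A p q \<eta> vs =
     (if int (length vs) = p + q then
        (\<Sum>S | S \<subseteq> {..<length vs} \<and> int (card S) = p. \<Sum>T\<in>Pow {..<length vs}.
           (1/2) ^ length vs * (\<Prod>j\<in>T. if j \<in> S then - \<i> else \<i>) *
           \<eta> (map (\<lambda>j. if j \<in> T then A *v (vs ! j) else vs ! j) [0..<length vs]))
      else 0)"

text \<open>The part \<open>d\<^sup>r\<^sup>,\<^sup>s\<close> of bidegree \<open>(r,s)\<close> of the exterior derivative.\<close>

definition d_part :: "field \<Rightarrow> int \<Rightarrow> int \<Rightarrow> form_field \<Rightarrow> form_field" where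
  "d_part J r s \<eta> x vs =
     (\<Sum>p\<in>{0..3}. \<Sum>q\<in>{0..3}.
        type_part (J x) (p + r) (q + s) (ext_d (\<lambda>y. type_part (J y) p q (\<eta> y)) x) vs)"

abbreviation del_bar :: "field \<Rightarrow> form_field \<Rightarrow> form_field" where
  "del_bar J \<equiv> d_part J 0 1"


section \<open>The algebraic maps \<open>Q\<close> and \<open>P\<close>\<close>

definition cnj_mat :: "complex^3^3 \<Rightarrow> complex^3^3" where
  "cnj_mat a = (\<chi> i j. cnj (a $ i $ j))"

text \<open>Entry \<open>(i,j)\<close> is the cofactor of entry \<open>(j,i)\<close>: row \<open>j\<close> is replaced by the \<open>i\<close>-th unit vector.\<close>

definition adjugate :: "complex^3^3 \<Rightarrow> complex^3^3" where
  "adjugate a = (\<chi> i j. det (\<chi> k. if k = j then axis i 1 else a $ k))"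

text \<open>\<open>Q = adj_pol\<close> and \<open>P = det_pol\<close>, by polarisation of the adjugate and of the determinant.\<close>

definition adj_pol :: "complex^3^3 \<Rightarrow> complex^3^3 \<Rightarrow> complex^3^3" where
  "adj_pol a b =
     (\<chi> i j. (adjugate (a + b) $ i $ j - adjugate a $ i $ j - adjugate b $ i $ j) / 2)"

definition det_pol :: "complex^3^3 \<Rightarrow> complex^3^3 \<Rightarrow> complex^3^3 \<Rightarrow> complex" where
  "det_pol a b c = (det (a + b + c) - det (a + b) - det (b + c) - det (a + c)
                + det a + det b + det c) / 6"

lemma adjugate_mult: "a ** adjugate a = mat (det a)"
  by (simp add: vec_eq_iff forall_3 matrix_matrix_mult_def adjugate_def det_3 sum_3 mat_def axis_def)
     (simp add: algebra_simps)

lemma adj_pol_same: "adj_pol a a = adjugate a"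
  by (simp add: vec_eq_iff forall_3 adj_pol_def adjugate_def det_3 axis_def)

lemma adj_pol_commute: "adj_pol a b = adj_pol b a"
  by (simp add: vec_eq_iff adj_pol_def add.commute)

lemma adj_pol_add: "adj_pol (a + b) c = adj_pol a c + adj_pol b c"
  by (simp add: vec_eq_iff forall_3 adj_pol_def adjugate_def det_3 axis_def
        flip: add_divide_distrib) algebra

lemma adj_pol_scale: "adj_pol (\<chi> i j. s * a $ i $ j) c = (\<chi> i j. s * adj_pol a c $ i $ j)"
  by (simp add: vec_eq_iff forall_3 adj_pol_def adjugate_def det_3 axis_def) algebra

lemma det_pol_same: "det_pol a a a = det a"
  by (simp add: det_pol_def det_3)

lemma det_pol_commute: "det_pol a b c = det_pol b a c" "det_pol a b c = det_pol a c b"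
  by (simp_all add: det_pol_def add_ac)

lemma det_pol_add: "det_pol (a + b) c d = det_pol a c d + det_pol b c d"
  by (simp add: det_pol_def det_3 flip: add_divide_distrib) algebra

lemma det_pol_scale: "det_pol (\<chi> i j. s * a $ i $ j) c d = s * det_pol a c d"
  by (simp add: det_pol_def det_3) algebra


section \<open>Coframings and the invariant forms\<close>

text \<open>A \<open>J\<close>-complex local coframing on the open set \<open>U\<close>, in coordinates. As all notions below are
  local, it is enough to consider coframings on open subsets of coordinate domains.\<close>

definition coframing :: "field \<Rightarrow> (real^6) set \<Rightarrow> (3 \<Rightarrow> form_field) \<Rightarrow> bool" where
  "coframing J U \<alpha> \<longleftrightarrow>
     open U \<and>
     (\<forall>i v. smooth_on U (\<lambda>x. \<alpha> i x [v])) \<and>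
     (\<forall>x\<in>U.
        (\<forall>i. (\<forall>vs. length vs \<noteq> 1 \<longrightarrow> \<alpha> i x vs = 0) \<and> linear (\<lambda>v. \<alpha> i x [v]) \<and>
             (\<forall>v. \<alpha> i x [J x *v v] = \<i> * \<alpha> i x [v])) \<and>
        (\<forall>k::3 \<Rightarrow> complex. (\<forall>v. (\<Sum>i\<in>UNIV. k i * \<alpha> i x [v]) = 0) \<longrightarrow> (\<forall>i. k i = 0)))"

definition cyclic_pair :: "(3 \<Rightarrow> form_field) \<Rightarrow> real^6 \<Rightarrow> 3 \<Rightarrow> form" where
  "cyclic_pair \<alpha> x j =
     (if j = 1 then \<alpha> 2 x \<and>\<^sub>f \<alpha> 3 x else if j = 2 then \<alpha> 3 x \<and>\<^sub>f \<alpha> 1 x else \<alpha> 1 x \<and>\<^sub>f \<alpha> 2 x)"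

definition Nij :: "field \<Rightarrow> (3 \<Rightarrow> form_field) \<Rightarrow> real^6 \<Rightarrow> complex^3^3" where
  "Nij J \<alpha> x = (THE N. \<forall>i vs. d_part J (-1) 2 (\<alpha> i) x vs =
     (\<Sum>j\<in>UNIV. N $ i $ j * cnj_form (cyclic_pair \<alpha> x j) vs))"

definition vol_30 :: "(3 \<Rightarrow> form_field) \<Rightarrow> real^6 \<Rightarrow> form" where
  "vol_30 \<alpha> x = \<alpha> 1 x \<and>\<^sub>f \<alpha> 2 x \<and>\<^sub>f \<alpha> 3 x"

definition Phi_of :: "field \<Rightarrow> (3 \<Rightarrow> form_field) \<Rightarrow> form_field" where
  "Phi_of J \<alpha> x vs = \<i> / 8 * of_real ((cmod (det (Nij J \<alpha> x)))\<^sup>2) *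
     (\<alpha> 1 x \<and>\<^sub>f \<alpha> 2 x \<and>\<^sub>f \<alpha> 3 x \<and>\<^sub>f
      cnj_form (\<alpha> 1 x) \<and>\<^sub>f cnj_form (\<alpha> 2 x) \<and>\<^sub>f cnj_form (\<alpha> 3 x)) vs"

definition omega_of :: "field \<Rightarrow> (3 \<Rightarrow> form_field) \<Rightarrow> form_field" where
  "omega_of J \<alpha> x vs = \<i> / 2 * (\<Sum>i\<in>UNIV. \<Sum>j\<in>UNIV.
     adj_pol (transpose (Nij J \<alpha> x)) (cnj_mat (Nij J \<alpha> x)) $ i $ j * (\<alpha> i x \<and>\<^sub>f cnj_form (\<alpha> j x)) vs)"

definition psi_of :: "field \<Rightarrow> (3 \<Rightarrow> form_field) \<Rightarrow> form_field" where
  "psi_of J \<alpha> x vs =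
     det_pol (cnj_mat (Nij J \<alpha> x)) (cnj_mat (Nij J \<alpha> x)) (transpose (Nij J \<alpha> x)) * vol_30 \<alpha> x vs"

text \<open>The common value at \<open>x\<close> of an expression that does not depend on the coframing near \<open>x\<close>.\<close>

definition invariant_form :: "(field \<Rightarrow> (3 \<Rightarrow> form_field) \<Rightarrow> form_field) \<Rightarrow> field \<Rightarrow> form_field" where
  "invariant_form E J x = (THE \<eta>. \<exists>U \<alpha>. coframing J U \<alpha> \<and> x \<in> U \<and> \<eta> = E J \<alpha> x)"

definition Phi :: "field \<Rightarrow> form_field" where "Phi = invariant_form Phi_of"
definition omega :: "field \<Rightarrow> form_field" where "omega = invariant_form omega_of"
definition psi :: "field \<Rightarrow> form_field" where "psi = invariant_form psi_of"

definition real_type ::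
  "'m::{t2_space,second_countable_topology} chart set \<Rightarrow> ('m chart \<Rightarrow> field) \<Rightarrow> bool" where
  "real_type A J \<longleftrightarrow>
     (\<forall>c\<in>A. \<forall>x\<in>chart_img c. \<forall>U \<alpha>. coframing (J c) U \<alpha> \<and> x \<in> U \<longrightarrow>
        (\<exists>s H. (\<forall>i j. H $ i $ j = cnj (H $ j $ i)) \<and> Nij (J c) \<alpha> x = (\<chi> i j. s * H $ i $ j)))"


section \<open>Integration and the functionals\<close>

text \<open>The sign of the standard frame of \<open>\<real>\<^sup>6\<close> for the orientation induced by a complex structure
  \<open>A\<close>, in which the frames \<open>u, A u, v, A v, w, A w\<close> are positive.\<close>

definition orient_sign :: "real^6^6 \<Rightarrow> real" where
  "orient_sign A = (THE s. \<exists>u v w.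
     let D = det (vector [u, A *v u, v, A *v v, w, A *v w] :: real^6^6) in D \<noteq> 0 \<and> s = sgn D)"

text \<open>The integral over \<open>K\<close> of a 6-form \<open>\<theta>\<close>, for the orientation induced by \<open>J\<close>: \<open>K\<close> is cut into
  finitely many disjoint Borel pieces \<open>B c\<close>, each well inside a chart. For compact \<open>K\<close> and continuous
  \<open>\<theta>\<close>, such a decomposition exists and the sum does not depend on it.\<close>

definition form_integral ::
  "'m::{t2_space,second_countable_topology} chart set \<Rightarrow> ('m chart \<Rightarrow> field) \<Rightarrow> 'm set \<Rightarrow>
   ('m chart \<Rightarrow> form_field) \<Rightarrow> complex" where
  "form_integral A J K \<theta> = (THE I. \<exists>C B.
     finite C \<and> C \<subseteq> A \<and> disjoint_family_on B C \<and> (\<Union>c\<in>C. B c) = K \<and>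
     (\<forall>c\<in>C. B c \<in> sets borel \<and> closure (B c) \<subseteq> chart_dom c) \<and>
     I = (\<Sum>c\<in>C. LINT x:chart_map c ` B c|lborel.
            of_real (orient_sign (J c x)) * \<theta> c x (map (\<lambda>i. axis i 1) [1, 2, 3, 4, 5, 6])))"

definition F_form :: "real \<Rightarrow> real \<Rightarrow> field \<Rightarrow> form_field" where
  "F_form c1 c2 J x vs =
     of_real c1 * Phi J x vs + of_real c2 * (\<i> / 8) * (psi J x \<and>\<^sub>f cnj_form (psi J x)) vs"

text \<open>A smooth variation \<open>Jt\<close> of \<open>J\<close> through almost complex structures with parameter in
  \<open>]-\<epsilon>, \<epsilon>[\<close>, supported in the compact set \<open>K\<close>. If the manifold is compact then \<open>K = UNIV\<close> is
  allowed, so that all smooth variations are covered.\<close>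

definition variation ::
  "'m::{t2_space,second_countable_topology} chart set \<Rightarrow> ('m chart \<Rightarrow> field) \<Rightarrow> real \<Rightarrow> 'm set \<Rightarrow>
   (real \<Rightarrow> 'm chart \<Rightarrow> field) \<Rightarrow> bool" where
  "variation A J \<epsilon> K Jt \<longleftrightarrow>
     0 < \<epsilon> \<and> compact K \<and>
     (\<forall>t\<in>{-\<epsilon><..<\<epsilon>}. almost_complex A (Jt t)) \<and>
     (\<forall>c\<in>A. smooth_on ({-\<epsilon><..<\<epsilon>} \<times> chart_img c) (\<lambda>(t, x). Jt t c x)) \<and>
     (\<forall>c\<in>A. \<forall>x\<in>chart_img c. Jt 0 c x = J c x) \<and>
     (\<forall>t\<in>{-\<epsilon><..<\<epsilon>}. \<forall>c\<in>A. \<forall>p\<in>chart_dom c - K. Jt t c (chart_map c p) = J c (chart_map c p))"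

text \<open>Over a noncompact manifold the total integral may diverge; as usual, the first variation is
  that of the integral over a compact set containing the support of the variation, outside of
  which the integrand does not change.\<close>

definition critical ::
  "'m::{t2_space,second_countable_topology} chart set \<Rightarrow> ('m chart \<Rightarrow> field) \<Rightarrow> real \<Rightarrow> real \<Rightarrow> bool" where
  "critical A J c1 c2 \<longleftrightarrow>
     (\<forall>\<epsilon> K Jt. variation A J \<epsilon> K Jt \<longrightarrow>
        ((\<lambda>t. form_integral A J K (\<lambda>c. F_form c1 c2 (Jt t c))) has_vector_derivative 0) (at 0))"

end

theory Submission
  imports Defs
begin

text \<open>Let \<open>n\<close> be the Nijenhuis tensor and \<open>\<beta> = d\<omega>\<close>. A trace formula writes \<open>\<omega>\<close> as a polynomial in \<open>J\<close>
  and \<open>n\<close>, and \<open>\<omega>(n(u,v),w)\<close> summed cyclically is \<open>12 Im \<psi>(u,v,w)\<close>. Differentiating \<open>\<omega>(Ju,v) = -\<omega>(u,Jv)\<close>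
  shows that this sum is four times the \<open>(3,0)+(0,3)\<close>-part of \<open>\<beta>\<close>. So if \<open>\<partial>\<close>-bar of \<open>\<omega>\<close> vanishes, then
  \<open>\<beta> = 3 Im \<psi>\<close>. The \<open>(2,2)\<close>-part of \<open>d\<beta> = 0\<close> is \<open>\<beta>(n(u,v),w,z) + \<beta>(n(w,z),u,v) = 0\<close>, which says
  that \<open>P N\<close> is Hermitian, where \<open>P \<noteq> 0\<close> is the coefficient of \<open>\<psi>\<close>: the tensor is of real type.

  For a variation with velocity \<open>s\<close> put \<open>\<tau>(u,v) = \<omega>(su,v) + \<omega>(u,sv)\<close>. The first variation of \<open>n\<close>,
  contracted with \<open>\<omega>\<close>, is the \<open>(3,0)+(0,3)\<close>-part of \<open>d\<tau>\<close> up to \<open>J\<close>. For \<open>N\<close> of real type the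
  differentials of \<open>\<bar>det N\<bar>\<^sup>2\<close> and \<open>\<bar>P\<bar>\<^sup>2\<close> at \<open>N\<close> agree, so that both integrands have the same
  variation, a multiple of \<open>d\<tau> \<and> \<beta> = d(\<tau> \<and> \<beta>)\<close>, and Stokes' theorem applies.\<close>

section \<open>Calculus of smooth maps\<close>

text \<open>The invariants are defined through coframings, but when J varies no coframing stays of
  type (1,0). Two devices deal with this. Expressions in J and n alone (\<open>omega_pt\<close>,
  \<open>cyclic_sum\<close>) show \<omega> to be smooth and \<omega>, \<psi> to be independent of
  the coframing. For det N, a coframe at one point is projected to the neighbouring structures
  (\<open>proj_cof\<close>) and N is written with fixed vectors (\<open>N_proj\<close>), an explicit
  expression that can be differentiated. Types are treated in real form: signed sums of insertions
  of J replace projections, and all vectors stay in \<open>real^6\<close>. The two sides of the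
  variation formula are linked by one number q, the contraction of Q with the variation of N: its
  product with the coefficient P of \<psi> governs both differentials, and q determines the
  (3,0)+(0,3)-part of d\<tau>. Since \<tau> vanishes off K, cut-off functions are required near K
  only, and class C^1 is enough. Naturality of \<open>ext_d\<close> under chart changes never
  enters: \<beta> is transported through its formula in terms of \<psi>, and d\<tau> \<and> \<beta>
  by differentiating the transformation law of the integrand.\<close>

lemma frechet_derivative_eqI:
  "(f has_derivative f') (at x) \<Longrightarrow> frechet_derivative f (at x) = f'"
  using frechet_derivative_at by metis

lemma has_derivative_frechet:
  "f differentiable at x \<Longrightarrow> (f has_derivative frechet_derivative f (at x)) (at x)"
  by (simp add: frechet_derivative_works)

lemma has_derivative_cong_open:
  assumes "open S" "x \<in> S" "\<And>y. y \<in> S \<Longrightarrow> f y = g y"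
  shows "(f has_derivative f') (at x) \<longleftrightarrow> (g has_derivative f') (at x)"
  using has_derivative_transform_within_open[OF _ assms(1,2), of f f' UNIV g]
    has_derivative_transform_within_open[OF _ assms(1,2), of g f' UNIV f] assms(3) by auto

lemma frechet_derivative_cong_open:
  assumes "open S" "x \<in> S" "\<And>y. y \<in> S \<Longrightarrow> f y = g y"
  shows "frechet_derivative f (at x) = frechet_derivative g (at x)"
  unfolding frechet_derivative_def using has_derivative_cong_open[OF assms] by simp

lemma differentiable_cong_open:
  assumes "open S" "x \<in> S" "\<And>y. y \<in> S \<Longrightarrow> f y = g y"
  shows "f differentiable at x \<longleftrightarrow> g differentiable at x"
  unfolding differentiable_def using has_derivative_cong_open[OF assms] by simp

section \<open>Closure properties of the classes C^k\<close>

lemma Ck_on_cong: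
  assumes "open S" "\<And>x. x \<in> S \<Longrightarrow> f x = g x"
  shows "Ck_on k S f \<longleftrightarrow> Ck_on k S g"
  using assms(2)
proof (induction k arbitrary: f g)
  case 0
  then show ?case by (simp cong: continuous_on_cong)
next
  case (Suc k)
  have "Ck_on k S (\<lambda>x. frechet_derivative f (at x) v) = Ck_on k S (\<lambda>x. frechet_derivative g (at x) v)" for v
    by (rule Suc.IH) (simp add: frechet_derivative_cong_open[OF assms(1) _ Suc.prems])
  moreover have "(\<forall>x\<in>S. f differentiable at x) = (\<forall>x\<in>S. g differentiable at x)"
    by (simp add: differentiable_cong_open[OF assms(1) _ Suc.prems])
  ultimately show ?case by simp
qed

lemma Ck_on_subset: "Ck_on k S f \<Longrightarrow> T \<subseteq> S \<Longrightarrow> Ck_on k T f"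
  by (induction k arbitrary: f) (auto intro: continuous_on_subset)

lemma Ck_on_continuous: "Ck_on k S f \<Longrightarrow> continuous_on S f"
proof (cases k)
  case (Suc n)
  assume "Ck_on k S f"
  then have "f differentiable_on S"
    using Suc by (auto simp: differentiable_on_def intro: differentiable_at_withinI)
  then show ?thesis by (rule differentiable_imp_continuous_on)
qed simp

lemma Ck_on_SucD: "Ck_on (Suc k) S f \<Longrightarrow> Ck_on k S f"
proof (induction k arbitrary: f)
  case 0
  then show ?case using Ck_on_continuous[of "Suc 0"] by simp
next
  case (Suc k)
  then show ?case by (metis Ck_on.simps(2))
qed

text \<open>Differentiability at a point already refers to a full neighbourhood, so that only the
  continuity clause sees the set; localisation then holds for every \<open>S\<close>, open or
  not.\<close>

lemma Ck_on_local:
  assumes "\<And>x. x \<in> S \<Longrightarrow> \<exists>T. open T \<and> x \<in> T \<and> Ck_on k (S \<inter> T) f"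
  shows "Ck_on k S f"
  using assms
proof (induction k arbitrary: f)
  case 0
  show ?case unfolding Ck_on.simps continuous_on_eq_continuous_within
  proof
    fix x assume x: "x \<in> S"
    then obtain T where T: "open T" "x \<in> T" "continuous_on (S \<inter> T) f" using 0 by force
    then have "continuous (at x within (S \<inter> T)) f" using x by (simp add: continuous_on_eq_continuous_within)
    moreover have "at x within (S \<inter> T) = at x within S"
      by (rule at_within_nhd[of x T]) (use T in auto)
    ultimately show "continuous (at x within S) f" by simp
  qed
next
  case (Suc k)
  have "Ck_on k S (\<lambda>x. frechet_derivative f (at x) v)" for v
    by (rule Suc.IH) (metis Suc.prems Ck_on.simps(2))
  moreover have "\<forall>x\<in>S. f differentiable at x" using Suc.prems by (metis Ck_on.simps(2) IntI)
  ultimately show ?case by simp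
qed

lemma Ck_on_const: "Ck_on k S (\<lambda>x. c)"
proof (induction k arbitrary: c)
  case 0
  then show ?case by simp
next
  case (Suc k)
  then show ?case by (simp add: frechet_derivative_eqI[OF has_derivative_const])
qed

text \<open>Any formula for the derivative that is valid on the open set may replace
  \<open>frechet_derivative\<close>. The inductions for sums, products, inverses and slices enter
  through this rule.\<close>

lemma Ck_on_SucI:
  assumes "open S" "\<And>x. x \<in> S \<Longrightarrow> (f has_derivative f' x) (at x)"
    and "\<And>v. Ck_on k S (\<lambda>x. f' x v)"
  shows "Ck_on (Suc k) S f"
proof -
  have "Ck_on k S (\<lambda>x. frechet_derivative f (at x) v)" for v
    using assms(3)[of v]
    by (subst Ck_on_cong[OF assms(1), where g = "\<lambda>x. f' x v"]) (simp_all add: frechet_derivative_eqI[OF assms(2)])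
  then show ?thesis using assms(2) by (auto simp: differentiable_def)
qed

lemma Ck_on_has_derivative:
  "Ck_on (Suc k) S f \<Longrightarrow> x \<in> S \<Longrightarrow> (f has_derivative frechet_derivative f (at x)) (at x)"
  by (simp add: has_derivative_frechet)

lemma Ck_on_add:
  assumes "open S"
  shows "Ck_on k S f \<Longrightarrow> Ck_on k S g \<Longrightarrow> Ck_on k S (\<lambda>x. f x + g x)"
proof (induction k arbitrary: f g)
  case 0
  then show ?case by (simp add: continuous_on_add)
next
  case (Suc k)
  show ?case
    by (rule Ck_on_SucI[OF assms has_derivative_add[OF has_derivative_frechet has_derivative_frechet]])
       (use Suc in auto)
qed

lemma (in bounded_linear) Ck_on:
  assumes "open S"
  shows "Ck_on k S g \<Longrightarrow> Ck_on k S (\<lambda>x. f (g x))"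
proof (induction k arbitrary: g)
  case 0
  then show ?case by (simp add: continuous_on)
next
  case (Suc k)
  show ?case
    by (rule Ck_on_SucI[OF assms has_derivative[OF has_derivative_frechet]]) (use Suc in auto)
qed

lemma (in bounded_bilinear) Ck_on:
  assumes "open S"
  shows "Ck_on k S f \<Longrightarrow> Ck_on k S g \<Longrightarrow> Ck_on k S (\<lambda>x. prod (f x) (g x))"
proof (induction k arbitrary: f g)
  case 0
  then show ?case by (simp add: continuous_on)
next
  case (Suc k)
  show ?case
  proof (rule Ck_on_SucI[OF assms FDERIV[OF has_derivative_frechet has_derivative_frechet]])
    fix v
    show "Ck_on k S (\<lambda>x. prod (f x) (frechet_derivative g (at x) v) + prod (frechet_derivative f (at x) v) (g x))"
      \<comment> \<open>Each term of the product rule differentiates one factor only; the other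
        factor is lowered to order \<open>k\<close>.\<close>
      using Suc.prems Suc.prems[THEN Ck_on_SucD] by (intro Ck_on_add assms Suc.IH) simp_all
  qed (use Suc.prems in auto)
qed

lemma Ck_on_inverse:
  fixes f :: "'a::real_normed_vector \<Rightarrow> 'b::real_normed_field"
  assumes "open S" "\<And>x. x \<in> S \<Longrightarrow> f x \<noteq> 0"
  shows "Ck_on k S f \<Longrightarrow> Ck_on k S (\<lambda>x. inverse (f x))"
proof (induction k)
  case 0
  then show ?case using assms by (simp add: continuous_on_inverse)
next
  case (Suc k)
  show ?case
  proof (rule Ck_on_SucI[OF assms(1)])
    fix x assume "x \<in> S"
    then show "((\<lambda>x. inverse (f x)) has_derivative
        (\<lambda>h. - (inverse (f x) * frechet_derivative f (at x) h * inverse (f x)))) (at x)"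
      using Suc.prems assms(2) by (intro Deriv.has_derivative_inverse) (auto simp: has_derivative_frechet)
  next
    fix v
    show "Ck_on k S (\<lambda>x. - (inverse (f x) * frechet_derivative f (at x) v * inverse (f x)))"
      using Suc Ck_on_SucD[OF Suc.prems]
      by (intro bounded_linear.Ck_on[OF bounded_linear_minus[OF bounded_linear_ident]]
          bounded_bilinear.Ck_on[OF bounded_bilinear_mult] assms(1)) auto
  qed
qed

lemma smooth_on_const: "smooth_on S (\<lambda>x. c)"
  by (simp add: smooth_on_def Ck_on_const)

lemma smooth_on_cong:
  "open S \<Longrightarrow> (\<And>x. x \<in> S \<Longrightarrow> f x = g x) \<Longrightarrow> smooth_on S f \<longleftrightarrow> smooth_on S g"
  using Ck_on_cong by (metis smooth_on_def)

lemma smooth_on_subset: "smooth_on S f \<Longrightarrow> T \<subseteq> S \<Longrightarrow> smooth_on T f"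
  by (meson Ck_on_subset smooth_on_def)

lemma smooth_on_local:
  assumes "\<And>x. x \<in> S \<Longrightarrow> \<exists>T. open T \<and> x \<in> T \<and> smooth_on (S \<inter> T) f"
  shows "smooth_on S f"
  unfolding smooth_on_def by (intro allI Ck_on_local) (metis assms smooth_on_def)

lemma smooth_on_add: "open S \<Longrightarrow> smooth_on S f \<Longrightarrow> smooth_on S g \<Longrightarrow> smooth_on S (\<lambda>x. f x + g x)"
  by (simp add: smooth_on_def Ck_on_add)

lemma smooth_on_linear:
  "bounded_linear L \<Longrightarrow> open S \<Longrightarrow> smooth_on S f \<Longrightarrow> smooth_on S (\<lambda>x. L (f x))"
  by (simp add: smooth_on_def bounded_linear.Ck_on)

lemma smooth_on_bilinear:
  "bounded_bilinear B \<Longrightarrow> open S \<Longrightarrow> smooth_on S f \<Longrightarrow> smooth_on S g \<Longrightarrow> smooth_on S (\<lambda>x. B (f x) (g x))"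
  by (simp add: smooth_on_def bounded_bilinear.Ck_on)

lemmas smooth_on_mult = smooth_on_bilinear[OF bounded_bilinear_mult]
lemmas smooth_on_scaleR = smooth_on_bilinear[OF bounded_bilinear_scaleR]
lemmas smooth_on_minus = smooth_on_linear[OF bounded_linear_minus[OF bounded_linear_ident]]

lemma smooth_on_diff: "open S \<Longrightarrow> smooth_on S f \<Longrightarrow> smooth_on S g \<Longrightarrow> smooth_on S (\<lambda>x. f x - g x)"
  using smooth_on_add[OF _ _ smooth_on_minus] by fastforce

lemma smooth_on_inverse:
  fixes f :: "'a::real_normed_vector \<Rightarrow> 'b::real_normed_field"
  shows "open S \<Longrightarrow> smooth_on S f \<Longrightarrow> (\<And>x. x \<in> S \<Longrightarrow> f x \<noteq> 0) \<Longrightarrow> smooth_on S (\<lambda>x. inverse (f x))"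
  by (simp add: smooth_on_def Ck_on_inverse)

lemma smooth_on_sum:
  "open S \<Longrightarrow> (\<And>i. i \<in> I \<Longrightarrow> smooth_on S (f i)) \<Longrightarrow> smooth_on S (\<lambda>x. \<Sum>i\<in>I. f i x)"
  by (induction I rule: infinite_finite_induct) (auto simp: smooth_on_const smooth_on_add)

lemma smooth_on_cnj: "open S \<Longrightarrow> smooth_on S f \<Longrightarrow> smooth_on S (\<lambda>x. cnj (f x))"
  by (rule smooth_on_linear[OF bounded_linear_cnj])

lemma smooth_on_frechet: "smooth_on S f \<Longrightarrow> smooth_on S (\<lambda>x. frechet_derivative f (at x) v)"
  unfolding smooth_on_def using Ck_on.simps(2) by blast

lemma smooth_on_differentiable: "smooth_on S f \<Longrightarrow> x \<in> S \<Longrightarrow> f differentiable at x"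
  unfolding smooth_on_def using Ck_on.simps(2) by blast

lemma smooth_on_has_derivative:
  "smooth_on S f \<Longrightarrow> x \<in> S \<Longrightarrow> (f has_derivative frechet_derivative f (at x)) (at x)"
  by (simp add: has_derivative_frechet smooth_on_differentiable)

lemma smooth_on_continuous: "smooth_on S f \<Longrightarrow> continuous_on S f"
  using Ck_on.simps(1) smooth_on_def by blast

section \<open>Slices of functions of time and position\<close>

lemma has_derivative_slice:
  assumes "(f has_derivative f') (at (t, x))"
  shows "((\<lambda>y. f (t, y)) has_derivative (\<lambda>v. f' (0, v))) (at x)"
  by (rule has_derivative_compose[OF has_derivative_Pair[OF has_derivative_const has_derivative_ident] assms])

lemma has_vector_derivative_slice:
  assumes "(f has_derivative f') (at (t, x))"
  shows "((\<lambda>s. f (s, x)) has_vector_derivative f' (1, 0)) (at t)"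
proof -
  have "((\<lambda>s. f (s, x)) has_derivative (\<lambda>h. f' (h, 0))) (at t)"
    by (rule has_derivative_compose[OF has_derivative_Pair[OF has_derivative_ident has_derivative_const] assms])
  moreover have "(\<lambda>h. f' (h, 0)) = (\<lambda>h. h *\<^sub>R f' (1, 0))"
  proof
    fix h :: real
    have "f' (h *\<^sub>R (1, 0)) = h *\<^sub>R f' (1, 0)"
      by (rule linear_scale[OF has_derivative_linear[OF assms]])
    then show "f' (h, 0) = h *\<^sub>R f' (1, 0)" by (simp only: scaleR_Pair real_scaleR_def mult_1_right scaleR_zero_right)
  qed
  ultimately show ?thesis unfolding has_vector_derivative_def by (simp only:)
qed

lemma frechet_derivative_slice:
  "smooth_on (I \<times> S) f \<Longrightarrow> t \<in> I \<Longrightarrow> x \<in> S \<Longrightarrow>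
   frechet_derivative (\<lambda>y. f (t, y)) (at x) v = frechet_derivative f (at (t, x)) (0, v)"
  by (rule fun_cong[OF frechet_derivative_eqI[OF has_derivative_slice[OF smooth_on_has_derivative]]]) auto

lemma smooth_on_slice:
  assumes "open S" "t \<in> I"
  shows "smooth_on (I \<times> S) f \<Longrightarrow> smooth_on S (\<lambda>y. f (t, y))"
proof -
  have "Ck_on k (I \<times> S) f \<Longrightarrow> Ck_on k S (\<lambda>y. f (t, y))" for k
  proof (induction k arbitrary: f)
    case 0
    then have "continuous_on (I \<times> S) f" by simp
    then have "continuous_on S (\<lambda>y. f (t, y))"
      by (rule continuous_on_compose2[OF _ continuous_on_Pair[OF continuous_on_const continuous_on_id]])
         (use assms(2) in auto)
    then show ?case by simp
  next
    case (Suc k)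
    have f: "f differentiable at (t, x)" if "x \<in> S" for x
      using Suc.prems assms(2) that by simp
    show ?case
    proof (rule Ck_on_SucI[OF assms(1) has_derivative_slice[OF has_derivative_frechet[OF f]]])
      show "Ck_on k S (\<lambda>x. frechet_derivative f (at (t, x)) (0, v))" for v
        by (rule Suc.IH) (use Suc.prems in simp)
    qed
  qed
  then show "smooth_on (I \<times> S) f \<Longrightarrow> ?thesis" by (simp add: smooth_on_def)
qed

text \<open>Both second differences \<open>f (x + s u + s v) - f (x + s u) - f (x + s v) + f x\<close> are evaluated
  by the mean value theorem, in either order of the directions.\<close>

lemma second_difference_real:
  fixes f :: "'a::real_normed_vector \<Rightarrow> real"
  assumes "Ck_on 2 (ball x e) f" "0 < s" "s * (norm u + norm v) < e"
  shows "\<exists>y. norm (y - x) \<le> s * (norm u + norm v) \<and>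
     f (x + s *\<^sub>R u + s *\<^sub>R v) - f (x + s *\<^sub>R u) - f (x + s *\<^sub>R v) + f x =
     s * s * frechet_derivative (\<lambda>z. frechet_derivative f (at z) u) (at y) v"
proof -
  let ?D = "\<lambda>z. frechet_derivative f (at z) u"
  have in_ball: "x + a *\<^sub>R u + b *\<^sub>R v \<in> ball x e" "norm (a *\<^sub>R u + b *\<^sub>R v) \<le> s * (norm u + norm v)"
    if "0 \<le> a" "a \<le> s" "0 \<le> b" "b \<le> s" for a b
  proof -
    have "norm (a *\<^sub>R u + b *\<^sub>R v) \<le> a * norm u + b * norm v"
      using that norm_triangle_ineq[of "a *\<^sub>R u" "b *\<^sub>R v"] by simp
    also have "\<dots> \<le> s * (norm u + norm v)"
      using that by (simp add: distrib_left add_mono mult_right_mono)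
    finally show "norm (a *\<^sub>R u + b *\<^sub>R v) \<le> s * (norm u + norm v)" .
    then have "norm (a *\<^sub>R u + b *\<^sub>R v) < e" using assms(3) by linarith
    moreover have "dist x (x + p) = norm p" for p by (simp add: dist_norm)
    ultimately show "x + a *\<^sub>R u + b *\<^sub>R v \<in> ball x e"
      by (simp only: add.assoc mem_ball)
  qed
  have f': "(f has_derivative frechet_derivative f (at z)) (at z)" if "z \<in> ball x e" for z
    using assms(1) that by (simp add: numeral_2_eq_2 has_derivative_frechet)
  have f'': "(?D has_derivative frechet_derivative ?D (at z)) (at z)" if "z \<in> ball x e" for z
    using assms(1) that by (simp add: numeral_2_eq_2 has_derivative_frechet)
  have line: "((\<lambda>a. x + a *\<^sub>R u + b *\<^sub>R v) has_derivative (\<lambda>h. h *\<^sub>R u)) (at a)" for a b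
    by (rule has_derivative_eq_rhs, (rule derivative_intros)+) simp
  have line': "((\<lambda>b. x + a *\<^sub>R u + b *\<^sub>R v) has_derivative (\<lambda>h. h *\<^sub>R v)) (at b)" for a b
    by (rule has_derivative_eq_rhs, (rule derivative_intros)+) simp
  have d1: "((\<lambda>a. f (x + a *\<^sub>R u + b *\<^sub>R v)) has_field_derivative ?D (x + a *\<^sub>R u + b *\<^sub>R v)) (at a)"
    if "0 \<le> a" "a \<le> s" "0 \<le> b" "b \<le> s" for a b
  proof -
    have "((\<lambda>a. f (x + a *\<^sub>R u + b *\<^sub>R v)) has_derivative
        (\<lambda>h. frechet_derivative f (at (x + a *\<^sub>R u + b *\<^sub>R v)) (h *\<^sub>R u))) (at a)"
      by (rule has_derivative_compose[OF line f'[OF in_ball(1)[OF that]]])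
    then show ?thesis
      unfolding has_field_derivative_def
      by (rule has_derivative_eq_rhs)
         (simp add: fun_eq_iff mult.commute linear_scale[OF has_derivative_linear[OF f'[OF in_ball(1)[OF that]]]])
  qed
  have d2: "((\<lambda>b. ?D (x + a *\<^sub>R u + b *\<^sub>R v)) has_field_derivative
      frechet_derivative ?D (at (x + a *\<^sub>R u + b *\<^sub>R v)) v) (at b)"
    if "0 \<le> a" "a \<le> s" "0 \<le> b" "b \<le> s" for a b
  proof -
    have "((\<lambda>b. ?D (x + a *\<^sub>R u + b *\<^sub>R v)) has_derivative
        (\<lambda>h. frechet_derivative ?D (at (x + a *\<^sub>R u + b *\<^sub>R v)) (h *\<^sub>R v))) (at b)"
      by (rule has_derivative_compose[OF line' f''[OF in_ball(1)[OF that]]])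
    then show ?thesis
      unfolding has_field_derivative_def
      by (rule has_derivative_eq_rhs)
         (simp add: fun_eq_iff mult.commute linear_scale[OF has_derivative_linear[OF f''[OF in_ball(1)[OF that]]]])
  qed
  have "\<exists>a>0. a < s \<and> (\<lambda>a. f (x + a *\<^sub>R u + s *\<^sub>R v) - f (x + a *\<^sub>R u + 0 *\<^sub>R v)) s -
      (\<lambda>a. f (x + a *\<^sub>R u + s *\<^sub>R v) - f (x + a *\<^sub>R u + 0 *\<^sub>R v)) 0 =
      (s - 0) * (?D (x + a *\<^sub>R u + s *\<^sub>R v) - ?D (x + a *\<^sub>R u + 0 *\<^sub>R v))"
    using assms(2) by (intro MVT2 DERIV_diff d1) simp_all
  then obtain a where a: "0 < a" "a < s" "f (x + s *\<^sub>R u + s *\<^sub>R v) - f (x + s *\<^sub>R u) - f (x + s *\<^sub>R v) + f x =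
      s * (?D (x + a *\<^sub>R u + s *\<^sub>R v) - ?D (x + a *\<^sub>R u + 0 *\<^sub>R v))"
    by auto
  have "\<exists>b>0. b < s \<and> ?D (x + a *\<^sub>R u + s *\<^sub>R v) - ?D (x + a *\<^sub>R u + 0 *\<^sub>R v) =
      (s - 0) * frechet_derivative ?D (at (x + a *\<^sub>R u + b *\<^sub>R v)) v"
    using assms(2) a(1,2) by (intro MVT2 d2) simp_all
  then obtain b where b: "0 < b" "b < s" "?D (x + a *\<^sub>R u + s *\<^sub>R v) - ?D (x + a *\<^sub>R u + 0 *\<^sub>R v) =
      s * frechet_derivative ?D (at (x + a *\<^sub>R u + b *\<^sub>R v)) v" by auto
  show ?thesis
    using in_ball(2)[of a b] a b
    by (intro exI[of _ "x + a *\<^sub>R u + b *\<^sub>R v"]) (simp add: algebra_simps)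
qed

text \<open>The two evaluations of the same second difference with step \<open>r n\<close> give
  equal values of the two mixed derivatives at points \<open>Y n\<close> and \<open>Z n\<close>.
  Both sequences converge to \<open>x\<close>, where continuity yields the equality.\<close>

lemma symmetric_second_derivative_real:
  fixes f :: "'a::real_normed_vector \<Rightarrow> real"
  assumes "Ck_on 2 S f" "open S" "x \<in> S"
  shows "frechet_derivative (\<lambda>z. frechet_derivative f (at z) u) (at x) v =
         frechet_derivative (\<lambda>z. frechet_derivative f (at z) v) (at x) u"
proof -
  let ?H = "\<lambda>u v y. frechet_derivative (\<lambda>z. frechet_derivative f (at z) u) (at y) v"
  obtain e where e: "0 < e" "ball x e \<subseteq> S"
    using assms(2,3) open_contains_ball by blast
  have C: "Ck_on 2 (ball x e) f" using assms(1) e Ck_on_subset by blast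
  \<comment> \<open>The summand 1 covers \<open>u = v = 0\<close>; the 2, instead of 1, leaves room
    for the strict bound \<open>e / (real n + 1)\<close>, which keeps all points in the ball, also
    for \<open>n = 0\<close>, and forces convergence.\<close>
  define r where "r n = e / ((norm u + norm v + 1) * (real n + 2))" for n
  have pos: "0 < norm u + norm v + 1" using norm_ge_zero[of u] norm_ge_zero[of v] by linarith
  have r: "0 < r n" "r n * (norm u + norm v) < e / (real n + 1)" for n
  proof -
    show "0 < r n" using e pos by (simp add: r_def)
    have "r n * (norm u + norm v) \<le> r n * (norm u + norm v + 1)"
      using \<open>0 < r n\<close> by simp
    also have "\<dots> = e / (real n + 2)" using pos by (simp add: r_def)
    also have "\<dots> < e / (real n + 1)" using e by (simp add: frac_less2)
    finally show "r n * (norm u + norm v) < e / (real n + 1)" .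
  qed
  have "e / (real n + 1) \<le> e" for n using e by (simp add: divide_le_eq)
  then have small: "r n * (norm u + norm v) < e" "r n * (norm v + norm u) < e" for n
    using r(2)[of n] by (simp_all add: add.commute less_le_trans)
  have "\<forall>n. \<exists>y. norm (y - x) \<le> r n * (norm u + norm v) \<and>
     f (x + r n *\<^sub>R u + r n *\<^sub>R v) - f (x + r n *\<^sub>R u) - f (x + r n *\<^sub>R v) + f x = r n * r n * ?H u v y"
    using second_difference_real[OF C r(1) small(1)] by blast
  then obtain Y where Y: "\<And>n. norm (Y n - x) \<le> r n * (norm u + norm v)"
    "\<And>n. f (x + r n *\<^sub>R u + r n *\<^sub>R v) - f (x + r n *\<^sub>R u) - f (x + r n *\<^sub>R v) + f x = r n * r n * ?H u v (Y n)"
    by metis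
  have "\<forall>n. \<exists>y. norm (y - x) \<le> r n * (norm v + norm u) \<and>
     f (x + r n *\<^sub>R v + r n *\<^sub>R u) - f (x + r n *\<^sub>R v) - f (x + r n *\<^sub>R u) + f x = r n * r n * ?H v u y"
    using second_difference_real[OF C r(1) small(2)] by blast
  then obtain Z where Z: "\<And>n. norm (Z n - x) \<le> r n * (norm v + norm u)"
    "\<And>n. f (x + r n *\<^sub>R v + r n *\<^sub>R u) - f (x + r n *\<^sub>R v) - f (x + r n *\<^sub>R u) + f x = r n * r n * ?H v u (Z n)"
    by metis
  have eq: "?H u v (Y n) = ?H v u (Z n)" for n
  proof -
    have "r n * r n * ?H u v (Y n) = r n * r n * ?H v u (Z n)"
      using Y(2)[of n] Z(2)[of n] by (simp only: add.assoc add.commute[of "r n *\<^sub>R v"])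
    then show ?thesis using r(1)[of n] by simp
  qed
  have lim: "W \<longlonglongrightarrow> x" if "\<And>n. norm (W n - x) \<le> r n * (norm u + norm v)" for W
  proof -
    have "(\<lambda>n. e / (real n + 1)) \<longlonglongrightarrow> 0"
      using tendsto_mult[OF tendsto_const LIMSEQ_inverse_real_of_nat, of e]
      by (simp add: divide_inverse add.commute)
    then have "(\<lambda>n. W n - x) \<longlonglongrightarrow> 0"
      by (rule Lim_null_comparison[rotated])
         (use order_trans[OF that less_imp_le[OF r(2)]] in \<open>simp add: always_eventually\<close>)
    then show ?thesis by (simp add: LIM_zero_iff)
  qed
  have "Y \<longlonglongrightarrow> x" "Z \<longlonglongrightarrow> x"
    using lim[OF Y(1)] lim[of Z] Z(1) by (simp_all add: add.commute)
  moreover have "isCont (?H u v) x" "isCont (?H v u) x"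
    using assms by (auto simp: numeral_2_eq_2 continuous_on_eq_continuous_at)
  ultimately have "(\<lambda>n. ?H u v (Y n)) \<longlonglongrightarrow> ?H u v x" "(\<lambda>n. ?H v u (Z n)) \<longlonglongrightarrow> ?H v u x"
    by (auto intro: isCont_tendsto_compose)
  then show ?thesis using eq LIMSEQ_unique by simp
qed

lemma frechet_derivative_linear:
  assumes "bounded_linear L" "f differentiable at x"
  shows "frechet_derivative (\<lambda>y. L (f y)) (at x) v = L (frechet_derivative f (at x) v)"
  using frechet_derivative_eqI[OF bounded_linear.has_derivative[OF assms(1) has_derivative_frechet[OF assms(2)]]]
  by simp

lemma symmetric_second_derivative:
  fixes f :: "'a::real_normed_vector \<Rightarrow> 'b::euclidean_space"
  assumes f: "smooth_on S f" and S: "open S" "x \<in> S"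
  shows "frechet_derivative (\<lambda>z. frechet_derivative f (at z) u) (at x) v =
         frechet_derivative (\<lambda>z. frechet_derivative f (at z) v) (at x) u"
proof (rule euclidean_eqI)
  fix b :: 'b
  have L: "bounded_linear (\<lambda>y. y \<bullet> b)" by (rule bounded_linear_inner_left)
  have *: "frechet_derivative (\<lambda>z. frechet_derivative f (at z) u) (at x) v \<bullet> b =
      frechet_derivative (\<lambda>z. frechet_derivative (\<lambda>y. f y \<bullet> b) (at z) u) (at x) v" for u v
  proof -
    have "frechet_derivative (\<lambda>z. frechet_derivative (\<lambda>y. f y \<bullet> b) (at z) u) (at x) =
        frechet_derivative (\<lambda>z. frechet_derivative f (at z) u \<bullet> b) (at x)"
      by (rule frechet_derivative_cong_open[OF S])
         (simp add: frechet_derivative_linear[OF L] smooth_on_differentiable[OF f])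
    then show ?thesis
      using frechet_derivative_linear[OF L] smooth_on_differentiable[OF smooth_on_frechet[OF f] S(2)] by metis
  qed
  have "Ck_on 2 S (\<lambda>y. f y \<bullet> b)"
    using smooth_on_linear[OF L S(1) f] by (simp add: smooth_on_def)
  from symmetric_second_derivative_real[OF this S]
  show "frechet_derivative (\<lambda>z. frechet_derivative f (at z) u) (at x) v \<bullet> b =
        frechet_derivative (\<lambda>z. frechet_derivative f (at z) v) (at x) u \<bullet> b"
    by (simp add: *)
qed

section \<open>Exterior algebra\<close>

definition contr :: "real^6 \<Rightarrow> form \<Rightarrow> form" where
  "contr v a ws = a (v # ws)"

text \<open>\<open>contr\<close> is the interior product and \<open>twist\<close> the grading
  involution. With the sign carried by an operator on forms, the product rules below mention no
  degrees and hold for inhomogeneous forms.\<close>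

definition twist :: "form \<Rightarrow> form" where
  "twist a ws = (-1) ^ length ws * a ws"

definition hom_form :: "nat \<Rightarrow> form \<Rightarrow> bool" where
  "hom_form k a \<longleftrightarrow> (\<forall>vs. length vs \<noteq> k \<longrightarrow> a vs = 0)"

text \<open>Alternation is asked for adjacent arguments only, the case that passes through the
  recursion over argument lists; \<open>alt_form_repeat\<close> and \<open>alt_form_swap\<close>
  recover distant arguments.\<close>

definition alt_form :: "form \<Rightarrow> bool" where
  "alt_form a \<longleftrightarrow> (\<forall>us ws. linear (\<lambda>v. a (us @ v # ws))) \<and> (\<forall>us v ws. a (us @ v # v # ws) = 0)"

definition one_form :: "(real^6 \<Rightarrow> complex) \<Rightarrow> form" where
  "one_form f vs = (case vs of [v] \<Rightarrow> f v | _ \<Rightarrow> 0)"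

lemma one_form_simps [simp]:
  "one_form f [] = 0" "one_form f [v] = f v" "one_form f (u # v # vs) = 0"
  by (simp_all add: one_form_def)

text \<open>A new argument at position 0 that goes to the right factor forms one inversion with each
  element of \<open>S\<close>, whence the sign; if it goes to the left factor, no inversion is
  added.\<close>

lemma shuffle_sign_Suc:
  assumes "S \<subseteq> {..<n}"
  shows "shuffle_sign (Suc n) (Suc ` S) = (-1) ^ card S * shuffle_sign n S"
    and "shuffle_sign (Suc n) (insert 0 (Suc ` S)) = shuffle_sign n S"
proof -
  let ?P = "{(i, j). i \<in> S \<and> j \<in> {..<n} - S \<and> j < i}"
  have fin: "finite S" "finite ?P"
    using assms finite_subset[of ?P "{..<n} \<times> {..<n}"] by (auto intro: finite_subset)
  have "{(i, j). i \<in> Suc ` S \<and> j \<in> {..<Suc n} - Suc ` S \<and> j < i} =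
      (\<lambda>i. (Suc i, 0)) ` S \<union> map_prod Suc Suc ` ?P" (is "?L = ?R")
  proof
    show "?L \<subseteq> ?R"
    proof (rule subrelI)
      fix i j assume "(i, j) \<in> ?L"
      then obtain i' where "i = Suc i'" "i' \<in> S" "j < Suc n" "j \<notin> Suc ` S" "j < Suc i'" by auto
      then show "(i, j) \<in> ?R" by (cases j) (auto simp: image_iff)
    qed
    show "?R \<subseteq> ?L" using assms by (auto simp: image_iff)
  qed
  moreover have "card ((\<lambda>i. (Suc i, 0::nat)) ` S \<union> map_prod Suc Suc ` ?P) = card S + card ?P"
    using fin by (subst card_Un_disjoint) (auto simp: card_image inj_on_def)
  ultimately show "shuffle_sign (Suc n) (Suc ` S) = (-1) ^ card S * shuffle_sign n S"
    by (simp add: shuffle_sign_def power_add)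
  have "{(i, j). i \<in> insert 0 (Suc ` S) \<and> j \<in> {..<Suc n} - insert 0 (Suc ` S) \<and> j < i} =
      map_prod Suc Suc ` ?P" (is "?L = ?R")
  proof
    show "?L \<subseteq> ?R"
    proof (rule subrelI)
      fix i j assume "(i, j) \<in> ?L"
      then obtain i' j' where "i = Suc i'" "i' \<in> S" "j' < n" "j = Suc j'" "j' \<notin> S" "j' < i'"
        by (cases j) auto
      then show "(i, j) \<in> ?R" by (auto simp: image_iff)
    qed
    show "?R \<subseteq> ?L" using assms by (auto simp: image_iff)
  qed
  moreover have "card (map_prod Suc Suc ` ?P) = card ?P"
    by (rule card_image) (auto simp: inj_on_def)
  ultimately show "shuffle_sign (Suc n) (insert 0 (Suc ` S)) = shuffle_sign n S"
    by (simp add: shuffle_sign_def)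
qed

lemma length_nths_subset:
  assumes "S \<subseteq> {..<length vs}"
  shows "length (nths vs S) = card S"
proof -
  have "{i. i < length vs \<and> i \<in> S} = S" using assms by auto
  then show ?thesis by (simp add: length_nths)
qed

lemma wedge_Nil [simp]: "(a \<and>\<^sub>f b) [] = a [] * b []"
  by (simp add: wedge_def shuffle_sign_def)

text \<open>The shuffles are split by the factor that receives \<open>v\<close>: the interior
  product is an antiderivation. This recursion replaces the sum over shuffles in most of the later
  computations.\<close>

lemma wedge_Cons: "(a \<and>\<^sub>f b) (v # vs) = (contr v a \<and>\<^sub>f b) vs + (twist a \<and>\<^sub>f contr v b) vs"
proof -
  let ?n = "length vs"
  let ?g = "\<lambda>S. shuffle_sign (Suc ?n) S * a (nths (v # vs) S) * b (nths (v # vs) (- S))"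
  have inj: "inj_on ((`) Suc) (Pow {..<?n})" "inj_on (\<lambda>S. insert 0 (Suc ` S)) (Pow {..<?n})"
  proof -
    show "inj_on ((`) Suc) (Pow {..<?n})" by (rule inj_on_image_Pow) simp
    show "inj_on (\<lambda>S. insert 0 (Suc ` S)) (Pow {..<?n})"
    proof (rule inj_onI)
      fix S T :: "nat set" assume "insert 0 (Suc ` S) = insert 0 (Suc ` T)"
      then have "Suc ` S = Suc ` T" by (simp add: insert_ident)
      then show "S = T" by (simp add: inj_image_eq_iff)
    qed
  qed
  have "Pow {..<Suc ?n} = (`) Suc ` Pow {..<?n} \<union> (\<lambda>S. insert 0 (Suc ` S)) ` Pow {..<?n}"
    by (simp only: lessThan_Suc_eq_insert_0 Pow_insert image_Pow_surj[OF refl, symmetric] image_image)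
  moreover have "(`) Suc ` Pow {..<?n} \<inter> (\<lambda>S. insert 0 (Suc ` S)) ` Pow {..<?n} = {}" by auto
  ultimately have "(a \<and>\<^sub>f b) (v # vs) = (\<Sum>S\<in>Pow {..<?n}. ?g (Suc ` S)) + (\<Sum>S\<in>Pow {..<?n}. ?g (insert 0 (Suc ` S)))"
    by (simp add: wedge_def sum.union_disjoint sum.reindex[OF inj(1)] sum.reindex[OF inj(2)])
  also have "(\<Sum>S\<in>Pow {..<?n}. ?g (Suc ` S)) = (twist a \<and>\<^sub>f contr v b) vs"
    unfolding wedge_def
  proof (rule sum.cong[OF refl])
    fix S assume "S \<in> Pow {..<?n}"
    moreover have "{j. Suc j \<in> Suc ` S} = S" "{j. Suc j \<in> - Suc ` S} = - S" by auto
    ultimately show "?g (Suc ` S) = shuffle_sign ?n S * twist a (nths vs S) * contr v b (nths vs (- S))"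
      using shuffle_sign_Suc(1)[of S ?n] length_nths_subset[of S vs]
      by (simp add: nths_Cons contr_def twist_def mult_ac)
  qed
  also have "(\<Sum>S\<in>Pow {..<?n}. ?g (insert 0 (Suc ` S))) = (contr v a \<and>\<^sub>f b) vs"
    unfolding wedge_def
  proof (rule sum.cong[OF refl])
    fix S assume "S \<in> Pow {..<?n}"
    moreover have "{j. Suc j \<in> insert 0 (Suc ` S)} = S" "{j. Suc j \<in> - insert 0 (Suc ` S)} = - S" by auto
    ultimately show "?g (insert 0 (Suc ` S)) = shuffle_sign ?n S * contr v a (nths vs S) * b (nths vs (- S))"
      using shuffle_sign_Suc(2)[of S ?n]
      by (simp add: nths_Cons contr_def mult_ac)
  qed
  finally show ?thesis by simp
qed

lemma contr_wedge: "contr v (a \<and>\<^sub>f b) = (\<lambda>vs. (contr v a \<and>\<^sub>f b) vs + (twist a \<and>\<^sub>f contr v b) vs)"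
  by (simp add: fun_eq_iff contr_def[of v "a \<and>\<^sub>f b"] wedge_Cons)

lemma wedge_add_left: "((\<lambda>vs. a vs + a' vs) \<and>\<^sub>f b) vs = (a \<and>\<^sub>f b) vs + (a' \<and>\<^sub>f b) vs"
  and wedge_add_right: "(a \<and>\<^sub>f (\<lambda>vs. b vs + b' vs)) vs = (a \<and>\<^sub>f b) vs + (a \<and>\<^sub>f b') vs"
  and wedge_scale_left: "((\<lambda>vs. c * a vs) \<and>\<^sub>f b) vs = c * (a \<and>\<^sub>f b) vs"
  and wedge_scale_right: "(a \<and>\<^sub>f (\<lambda>vs. c * b vs)) vs = c * (a \<and>\<^sub>f b) vs"
  by (simp_all add: wedge_def algebra_simps sum.distrib sum_distrib_left)

lemma wedge_zero [simp]: "((\<lambda>vs. 0) \<and>\<^sub>f b) vs = 0" "(a \<and>\<^sub>f (\<lambda>vs. 0)) vs = 0"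
  by (simp_all add: wedge_def)

lemma wedge_minus_left: "((\<lambda>vs. - a vs) \<and>\<^sub>f b) vs = - (a \<and>\<^sub>f b) vs"
  and wedge_minus_right: "(a \<and>\<^sub>f (\<lambda>vs. - b vs)) vs = - (a \<and>\<^sub>f b) vs"
  by (simp_all add: wedge_def sum_negf)

lemma wedge_sum_left: "((\<lambda>vs. \<Sum>i\<in>I. a' i vs) \<and>\<^sub>f b) vs = (\<Sum>i\<in>I. (a' i \<and>\<^sub>f b) vs)"
  and wedge_sum_right: "(a \<and>\<^sub>f (\<lambda>vs. \<Sum>i\<in>I. b' i vs)) vs = (\<Sum>i\<in>I. (a \<and>\<^sub>f b' i) vs)"
  unfolding wedge_def by (simp_all add: sum_distrib_left sum_distrib_right sum.swap[of _ I])

lemma twist_twist [simp]: "twist (twist a) = a"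
  by (simp add: fun_eq_iff twist_def flip: mult.assoc power_add)

lemma contr_twist: "contr v (twist a) = (\<lambda>vs. - twist (contr v a) vs)"
  by (simp add: fun_eq_iff contr_def twist_def)

lemma twist_wedge: "twist (a \<and>\<^sub>f b) = twist a \<and>\<^sub>f twist b"
proof
  fix vs show "twist (a \<and>\<^sub>f b) vs = (twist a \<and>\<^sub>f twist b) vs"
  proof (induction vs arbitrary: a b)
    case (Cons v vs)
    have "(twist a \<and>\<^sub>f twist b) (v # vs) = - (twist (contr v a) \<and>\<^sub>f twist b) vs - (a \<and>\<^sub>f twist (contr v b)) vs"
      by (simp add: wedge_Cons contr_twist wedge_minus_left wedge_minus_right)
    also have "\<dots> = - twist (contr v a \<and>\<^sub>f b) vs - twist (twist a \<and>\<^sub>f contr v b) vs"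
      by (simp add: Cons.IH)
    finally show ?case by (simp add: twist_def[of "_ \<and>\<^sub>f _"] wedge_Cons algebra_simps)
  qed (simp add: twist_def)
qed

text \<open>Both sides satisfy the same recursion in the first argument, so that no combinatorics of
  iterated shuffles enters.\<close>

lemma wedge_assoc: "(a \<and>\<^sub>f b) \<and>\<^sub>f c = a \<and>\<^sub>f (b \<and>\<^sub>f c)"
proof
  fix vs show "((a \<and>\<^sub>f b) \<and>\<^sub>f c) vs = (a \<and>\<^sub>f (b \<and>\<^sub>f c)) vs"
  proof (induction vs arbitrary: a b c)
    case (Cons v vs)
    then show ?case
      by (simp add: wedge_Cons[of "_ \<and>\<^sub>f _"] wedge_Cons[of _ "_ \<and>\<^sub>f _"] contr_wedge twist_wedge
          wedge_add_left wedge_add_right)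
  qed simp
qed

lemma hom_formD: "hom_form k a \<Longrightarrow> length vs \<noteq> k \<Longrightarrow> a vs = 0"
  by (simp add: hom_form_def)

lemma hom_form_one [simp]: "hom_form 1 (one_form f)"
  by (auto simp: hom_form_def one_form_def split: list.splits)

lemma hom_form_one_eq: "hom_form 1 a \<Longrightarrow> a = one_form (\<lambda>v. a [v])"
  by (auto simp: hom_form_def one_form_def fun_eq_iff split: list.splits)

lemma hom_form_wedge:
  assumes "hom_form k a" "hom_form l b"
  shows "hom_form (k + l) (a \<and>\<^sub>f b)"
  unfolding hom_form_def wedge_def
proof (intro allI impI sum.neutral ballI)
  fix vs :: "(real^6) list" and S assume *: "length vs \<noteq> k + l" "S \<in> Pow {..<length vs}"
  have "length (nths vs S) + length (nths vs (- S)) = length vs"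
  proof -
    have "{i. i < length vs \<and> i \<in> S} \<union> {i. i < length vs \<and> i \<notin> S} = {..<length vs}" by auto
    then show ?thesis
      using card_Un_disjoint[of "{i. i < length vs \<and> i \<in> S}" "{i. i < length vs \<and> i \<notin> S}"]
      by (simp add: length_nths disjoint_iff)
  qed
  then have "length (nths vs S) \<noteq> k \<or> length (nths vs (- S)) \<noteq> l" using * by auto
  then show "shuffle_sign (length vs) S * a (nths vs S) * b (nths vs (- S)) = 0"
    using assms by (auto simp: hom_form_def)
qed

lemma twist_one: "twist (one_form f) = one_form (\<lambda>v. - f v)"
  by (auto simp: fun_eq_iff twist_def one_form_def split: list.splits)

text \<open>With a 1-form on the left a shuffle is the choice of one slot. The resulting sum has the
  shape of the one that defines \<open>ext_d\<close>, which links d with the wedge product.\<close>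

lemma wedge_one_eq: "(one_form f \<and>\<^sub>f a) vs =
    (\<Sum>i<length vs. (-1) ^ i * f (vs ! i) * a (take i vs @ drop (Suc i) vs))"
proof (induction vs arbitrary: a f)
  case (Cons v vs)
  have "contr v (one_form f) = (\<lambda>ws. if ws = [] then f v else 0)"
    by (auto simp: fun_eq_iff contr_def one_form_def split: list.splits)
  moreover have "((\<lambda>ws. if ws = [] then f v else 0) \<and>\<^sub>f a) ws = f v * a ws" for ws
  proof (induction ws arbitrary: a)
    case (Cons w ws)
    have "contr w (\<lambda>ws. if ws = [] then f v else 0) = (\<lambda>ws. 0)"
      "twist (\<lambda>ws. if ws = [] then f v else 0) = (\<lambda>ws. if ws = [] then f v else 0)"
      by (auto simp: contr_def twist_def)
    then show ?case by (simp add: wedge_Cons Cons.IH) (simp add: contr_def)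
  qed simp
  ultimately show ?case
    by (simp add: wedge_Cons twist_one Cons.IH sum.lessThan_Suc_shift contr_def del: sum.lessThan_Suc)
qed simp

lemma one_form_wedge_Cons:
  "(one_form f \<and>\<^sub>f a) (v # vs) = f v * a vs - (one_form f \<and>\<^sub>f contr v a) vs"
  by (simp add: wedge_one_eq sum.lessThan_Suc_shift contr_def sum_negf del: sum.lessThan_Suc)

lemma wedge_one_form_Cons:
  "(a \<and>\<^sub>f one_form f) (v # vs) = (contr v a \<and>\<^sub>f one_form f) vs + twist a vs * f v"
proof -
  have "contr v (one_form f) = (\<lambda>ws. if ws = [] then f v else 0)"
    by (auto simp: fun_eq_iff contr_def one_form_def split: list.splits)
  moreover have "(a \<and>\<^sub>f (\<lambda>ws. if ws = [] then f v else 0)) ws = a ws * f v" for a ws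
  proof (induction ws arbitrary: a)
    case (Cons w ws)
    have "contr w (\<lambda>ws. if ws = [] then f v else 0) = (\<lambda>ws. 0)"
      by (auto simp: contr_def)
    then show ?case by (simp add: wedge_Cons Cons.IH) (simp add: contr_def)
  qed simp
  ultimately show ?thesis by (simp add: wedge_Cons)
qed

lemma one_form_wedge_commute: "one_form f \<and>\<^sub>f a = twist a \<and>\<^sub>f one_form f"
proof
  fix vs show "(one_form f \<and>\<^sub>f a) vs = (twist a \<and>\<^sub>f one_form f) vs"
  proof (induction vs arbitrary: a)
    case (Cons v vs)
    then show ?case
      by (simp add: one_form_wedge_Cons wedge_one_form_Cons contr_twist wedge_minus_left)
  qed simp
qed

lemma one_form_anticommute: "(one_form f \<and>\<^sub>f one_form g \<and>\<^sub>f a) vs = - (one_form g \<and>\<^sub>f one_form f \<and>\<^sub>f a) vs"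
proof -
  have "one_form f \<and>\<^sub>f one_form g = (\<lambda>vs. - (one_form g \<and>\<^sub>f one_form f) vs)"
  proof
    fix vs
    have "one_form (\<lambda>v. - g v) = (\<lambda>vs. - one_form g vs)"
      by (auto simp: fun_eq_iff one_form_def split: list.splits)
    then show "(one_form f \<and>\<^sub>f one_form g) vs = - (one_form g \<and>\<^sub>f one_form f) vs"
      by (simp add: one_form_wedge_commute[of f "one_form g"] twist_one wedge_minus_left)
  qed
  then show ?thesis by (simp add: wedge_minus_left flip: wedge_assoc)
qed

lemma alt_formD:
  "alt_form a \<Longrightarrow> linear (\<lambda>v. a (us @ v # ws))"
  "alt_form a \<Longrightarrow> a (us @ v # v # ws) = 0"
  by (simp_all add: alt_form_def)

lemma alt_form_contr: "alt_form a \<Longrightarrow> alt_form (contr v a)"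
  using alt_formD[of a "v # us" for us] by (simp add: alt_form_def contr_def)

lemma linear_const_mult: "linear f \<Longrightarrow> linear (\<lambda>v. c * f v :: complex)"
  by (simp add: linear_iff distrib_left)

lemma alt_form_twist: "alt_form a \<Longrightarrow> alt_form (twist a)"
  by (simp add: alt_form_def twist_def linear_const_mult del: power_Suc)

lemma alt_form_linear_Cons: "alt_form a \<Longrightarrow> linear (\<lambda>v. a (v # ws))"
  using alt_formD(1)[of a "[]"] by simp

lemma alt_form_one: "linear f \<Longrightarrow> alt_form (one_form f)" (is "_ \<Longrightarrow> ?thesis")
proof -
  assume f: "linear f"
  have "linear (\<lambda>v. one_form f (us @ v # ws))" for us ws
  proof (cases "us = [] \<and> ws = []")
    case False
    then have "(\<lambda>v. one_form f (us @ v # ws)) = (\<lambda>v. 0)"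
      by (intro ext hom_formD[OF hom_form_one]) auto
    then show ?thesis by (simp add: linear_zero)
  qed (simp add: f)
  moreover have "one_form f (us @ v # v # ws) = 0" for us v ws
    by (rule hom_formD[OF hom_form_one]) simp
  ultimately show ?thesis by (simp add: alt_form_def)
qed

lemma contr_add: "alt_form a \<Longrightarrow> contr (u + v) a = (\<lambda>ws. contr u a ws + contr v a ws)"
  and contr_scale: "alt_form a \<Longrightarrow> contr (r *\<^sub>R v) a = (\<lambda>ws. complex_of_real r * contr v a ws)"
  by (simp_all add: fun_eq_iff contr_def linear_add[OF alt_form_linear_Cons] linear_scale[OF alt_form_linear_Cons]
      scaleR_conv_of_real[where 'a = complex])

lemma alt_form_wedge:
  assumes "alt_form a" "alt_form b"
  shows "alt_form (a \<and>\<^sub>f b)"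
proof -
  have lin: "linear (\<lambda>v. (a \<and>\<^sub>f b) (us @ v # ws))" if "alt_form a" "alt_form b" for a b us ws
    using that
  proof (induction us arbitrary: a b)
    case Nil
    have "linear (\<lambda>v. (contr v a \<and>\<^sub>f b) ws)" "linear (\<lambda>v. (twist a \<and>\<^sub>f contr v b) ws)"
      by (simp_all add: linear_iff contr_add contr_scale Nil wedge_add_left wedge_add_right
          wedge_scale_left wedge_scale_right scaleR_conv_of_real[where 'a = complex])
    then show ?case by (simp add: wedge_Cons linear_compose_add)
  next
    case (Cons u us)
    then show ?case
      by (simp add: wedge_Cons linear_compose_add alt_form_contr alt_form_twist)
  qed
  have "(a \<and>\<^sub>f b) (us @ v # v # ws) = 0" if "alt_form a" "alt_form b" for a b us v ws
    using that
  proof (induction us arbitrary: a b)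
    case Nil
    have "contr v (contr v a) = (\<lambda>ws. 0)" "contr v (contr v b) = (\<lambda>ws. 0)"
      using alt_formD(2)[OF Nil(1), of "[]"] alt_formD(2)[OF Nil(2), of "[]"]
      by (auto simp: contr_def fun_eq_iff)
    then show ?case by (simp add: wedge_Cons contr_twist wedge_minus_left)
  next
    case (Cons u us)
    then show ?case by (simp add: wedge_Cons alt_form_contr alt_form_twist)
  qed
  then show ?thesis using lin assms by (simp add: alt_form_def)
qed

lemma alt_form_sum: "(\<And>i. i \<in> I \<Longrightarrow> alt_form (a i)) \<Longrightarrow> alt_form (\<lambda>vs. \<Sum>i\<in>I. a i vs)"
  by (simp add: alt_form_def linear_compose_sum)

lemma alt_form_scale: "alt_form a \<Longrightarrow> alt_form (\<lambda>vs. c * a vs)"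
  by (simp add: alt_form_def linear_const_mult)

lemma alt_form_cnj: "alt_form a \<Longrightarrow> alt_form (cnj_form a)"
  by (simp add: alt_form_def cnj_form_def linear_iff)

lemma wedge_cnj: "cnj_form (a \<and>\<^sub>f b) = cnj_form a \<and>\<^sub>f cnj_form b"
  by (simp add: fun_eq_iff cnj_form_def wedge_def shuffle_sign_def)

lemma cnj_one_form: "cnj_form (one_form f) = one_form (\<lambda>v. cnj (f v))"
  by (auto simp: fun_eq_iff cnj_form_def one_form_def split: list.splits)

lemma wedge_map: "(a \<and>\<^sub>f b) (map L vs) = ((\<lambda>vs. a (map L vs)) \<and>\<^sub>f (\<lambda>vs. b (map L vs))) vs"
  by (simp add: wedge_def nths_map)

subsection \<open>The exterior derivative\<close>

definition pderiv_form :: "form_field \<Rightarrow> real^6 \<Rightarrow> real^6 \<Rightarrow> form" where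
  "pderiv_form \<eta> x v vs = frechet_derivative (\<lambda>y. \<eta> y vs) (at x) v"

abbreviation dx :: "6 \<Rightarrow> form" where "dx b \<equiv> one_form (\<lambda>v. complex_of_real (v $ b))"

lemma linear_axis_expansion:
  fixes f :: "real^'n \<Rightarrow> complex"
  assumes "linear f"
  shows "f v = (\<Sum>b\<in>UNIV. complex_of_real (v $ b) * f (axis b 1))"
proof -
  have "f v = f (\<Sum>b\<in>UNIV. v $ b *\<^sub>R axis b 1)"
    by (simp add: basis_expansion[of v, unfolded scalar_mult_eq_scaleR])
  then show ?thesis by (simp add: linear_sum[OF assms] linear_scale[OF assms] scaleR_conv_of_real[where 'a = complex])
qed

text \<open>The direction of each derivative is expanded in the standard basis. In this form the
  Leibniz rule, alternation and d d = 0 become consequences of wedge algebra.\<close>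

lemma ext_d_coord:
  assumes "\<And>vs. (\<lambda>y. \<eta> y vs) differentiable at x"
  shows "ext_d \<eta> x = (\<lambda>vs. \<Sum>b\<in>UNIV. (dx b \<and>\<^sub>f pderiv_form \<eta> x (axis b 1)) vs)"
proof
  fix vs
  have lin: "linear (frechet_derivative (\<lambda>y. \<eta> y ws) (at x))" for ws
    by (rule linear_frechet_derivative[OF assms])
  have "ext_d \<eta> x vs = (\<Sum>i<length vs. \<Sum>b\<in>UNIV. (-1) ^ i * complex_of_real (vs ! i $ b) *
      pderiv_form \<eta> x (axis b 1) (take i vs @ drop (Suc i) vs))"
    unfolding ext_d_def pderiv_form_def
    by (subst linear_axis_expansion[OF lin]) (simp add: sum_distrib_left mult.assoc)
  then show "ext_d \<eta> x vs = (\<Sum>b\<in>UNIV. (dx b \<and>\<^sub>f pderiv_form \<eta> x (axis b 1)) vs)"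
    by (simp add: wedge_one_eq sum.swap[of _ UNIV])
qed

lemma wedge_has_derivative:
  assumes "\<And>vs. ((\<lambda>y. a y vs) has_derivative (\<lambda>h. a' h vs)) (at x)"
    and "\<And>vs. ((\<lambda>y. b y vs) has_derivative (\<lambda>h. b' h vs)) (at x)"
  shows "((\<lambda>y. (a y \<and>\<^sub>f b y) vs) has_derivative (\<lambda>h. (a' h \<and>\<^sub>f b x) vs + (a x \<and>\<^sub>f b' h) vs)) (at x)"
  unfolding wedge_def sum.distrib[symmetric]
proof (rule has_derivative_sum)
  fix S
  show "((\<lambda>y. shuffle_sign (length vs) S * a y (nths vs S) * b y (nths vs (- S))) has_derivative
      (\<lambda>h. shuffle_sign (length vs) S * a' h (nths vs S) * b x (nths vs (- S)) +
           shuffle_sign (length vs) S * a x (nths vs S) * b' h (nths vs (- S)))) (at x)"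
    by (rule has_derivative_eq_rhs[OF has_derivative_mult[OF has_derivative_mult_right[OF assms(1)] assms(2)]])
       (simp add: fun_eq_iff add.commute)
qed

lemma pderiv_form_wedge:
  assumes "\<And>vs. (\<lambda>y. a y vs) differentiable at x" "\<And>vs. (\<lambda>y. b y vs) differentiable at x"
  shows "pderiv_form (\<lambda>y. a y \<and>\<^sub>f b y) x v = (\<lambda>vs. (pderiv_form a x v \<and>\<^sub>f b x) vs + (a x \<and>\<^sub>f pderiv_form b x v) vs)"
proof
  fix vs
  have "((\<lambda>y. (a y \<and>\<^sub>f b y) vs) has_derivative
      (\<lambda>h. (pderiv_form a x h \<and>\<^sub>f b x) vs + (a x \<and>\<^sub>f pderiv_form b x h) vs)) (at x)"
    by (rule wedge_has_derivative; unfold pderiv_form_def; rule has_derivative_frechet[OF assms(1)] has_derivative_frechet[OF assms(2)])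
  then show "pderiv_form (\<lambda>y. a y \<and>\<^sub>f b y) x v vs = (pderiv_form a x v \<and>\<^sub>f b x) vs + (a x \<and>\<^sub>f pderiv_form b x v) vs"
    unfolding pderiv_form_def[of "\<lambda>y. a y \<and>\<^sub>f b y"] by (subst frechet_derivative_eqI) auto
qed

lemma wedge_differentiable:
  assumes "\<And>vs. (\<lambda>y. a y vs) differentiable at x" "\<And>vs. (\<lambda>y. b y vs) differentiable at x"
  shows "(\<lambda>y. (a y \<and>\<^sub>f b y) vs) differentiable at x"
  unfolding differentiable_def
  using wedge_has_derivative[of a "\<lambda>h vs. frechet_derivative (\<lambda>y. a y vs) (at x) h" x b
      "\<lambda>h vs. frechet_derivative (\<lambda>y. b y vs) (at x) h"] assms has_derivative_frechet by blast

lemma ext_d_wedge: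
  assumes "\<And>vs. (\<lambda>y. a y vs) differentiable at x" "\<And>vs. (\<lambda>y. b y vs) differentiable at x"
  shows "ext_d (\<lambda>y. a y \<and>\<^sub>f b y) x vs = (ext_d a x \<and>\<^sub>f b x) vs + (twist (a x) \<and>\<^sub>f ext_d b x) vs"
proof -
  \<comment> \<open>Moving \<open>dx k\<close> past \<open>a x\<close> costs the grading sign; this
    is the origin of \<open>twist\<close> in the Leibniz rule.\<close>
  have "(dx k \<and>\<^sub>f a x \<and>\<^sub>f c) vs = (twist (a x) \<and>\<^sub>f dx k \<and>\<^sub>f c) vs" for k c
    using one_form_wedge_commute by (metis wedge_assoc)
  then show ?thesis
    by (simp add: ext_d_coord assms wedge_differentiable pderiv_form_wedge wedge_add_right sum.distrib
        wedge_sum_left wedge_sum_right wedge_assoc)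
qed

lemma wedge_smooth:
  assumes "open S" "\<And>vs. smooth_on S (\<lambda>y. a y vs)" "\<And>vs. smooth_on S (\<lambda>y. b y vs)"
  shows "smooth_on S (\<lambda>y. (a y \<and>\<^sub>f b y) vs)"
  unfolding wedge_def by (intro smooth_on_sum smooth_on_mult smooth_on_const assms)

lemma ext_d_cong:
  assumes "open S" "x \<in> S" "\<And>y. y \<in> S \<Longrightarrow> \<eta> y = \<theta> y"
  shows "ext_d \<eta> x = ext_d \<theta> x"
  unfolding ext_d_def
  by (intro ext sum.cong refl arg_cong2[where f = "(*)"] fun_cong[OF frechet_derivative_cong_open[OF assms(1,2)]])
     (simp add: assms(3))

lemma ext_d_smooth:
  assumes "open S" "\<And>vs. smooth_on S (\<lambda>y. \<eta> y vs)"
  shows "smooth_on S (\<lambda>y. ext_d \<eta> y vs)"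
  unfolding ext_d_def by (intro smooth_on_sum smooth_on_mult smooth_on_const smooth_on_frechet assms)

lemma ext_d_ext_d:
  assumes S: "open S" "x \<in> S" and \<eta>: "\<And>vs. smooth_on S (\<lambda>y. \<eta> y vs)"
  shows "ext_d (ext_d \<eta>) x vs = 0"
proof -
  let ?P = "\<lambda>b c. pderiv_form (\<lambda>y. pderiv_form \<eta> y (axis b 1)) x (axis c 1)"
  have sm: "smooth_on S (\<lambda>y. pderiv_form \<eta> y v vs)" for v vs
    unfolding pderiv_form_def by (rule smooth_on_frechet[OF \<eta>])
  have d: "(\<lambda>y. pderiv_form \<eta> y v vs) differentiable at x" "(\<lambda>y. (dx b \<and>\<^sub>f pderiv_form \<eta> y v) vs) differentiable at x" for v vs b
    using smooth_on_differentiable[OF sm S(2)]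
      smooth_on_differentiable[OF wedge_smooth[OF S(1) smooth_on_const sm] S(2)] by auto
  have P0: "pderiv_form (\<lambda>y. dx b) x v = (\<lambda>vs. 0)" for b v
    unfolding pderiv_form_def by (simp add: frechet_derivative_eqI[OF has_derivative_const])
  have "ext_d (ext_d \<eta>) x = ext_d (\<lambda>y vs. \<Sum>b\<in>UNIV. (dx b \<and>\<^sub>f pderiv_form \<eta> y (axis b 1)) vs) x"
    by (rule ext_d_cong[OF S]) (simp add: ext_d_coord smooth_on_differentiable[OF \<eta>])
  also have "\<dots> = (\<lambda>vs. \<Sum>c\<in>UNIV. (dx c \<and>\<^sub>f (\<lambda>vs. \<Sum>b\<in>UNIV. (dx b \<and>\<^sub>f ?P b c) vs)) vs)"
  proof -
    have "pderiv_form (\<lambda>y vs. \<Sum>b\<in>UNIV. (dx b \<and>\<^sub>f pderiv_form \<eta> y (axis b 1)) vs) x v =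
        (\<lambda>vs. \<Sum>b\<in>UNIV. (dx b \<and>\<^sub>f pderiv_form (\<lambda>y. pderiv_form \<eta> y (axis b 1)) x v) vs)" for v
    proof
      fix vs
      have "((\<lambda>y. \<Sum>b\<in>UNIV. (dx b \<and>\<^sub>f pderiv_form \<eta> y (axis b 1)) vs) has_derivative
          (\<lambda>h. \<Sum>b\<in>UNIV. frechet_derivative (\<lambda>y. (dx b \<and>\<^sub>f pderiv_form \<eta> y (axis b 1)) vs) (at x) h)) (at x)"
        by (intro has_derivative_sum has_derivative_frechet d)
      from frechet_derivative_eqI[OF this]
      have "pderiv_form (\<lambda>y vs. \<Sum>b\<in>UNIV. (dx b \<and>\<^sub>f pderiv_form \<eta> y (axis b 1)) vs) x v vs =
          (\<Sum>b\<in>UNIV. pderiv_form (\<lambda>y. dx b \<and>\<^sub>f pderiv_form \<eta> y (axis b 1)) x v vs)"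
        by (simp add: pderiv_form_def)
      also have "\<dots> = (\<Sum>b\<in>UNIV. (dx b \<and>\<^sub>f pderiv_form (\<lambda>y. pderiv_form \<eta> y (axis b 1)) x v) vs)"
        by (simp add: pderiv_form_wedge d P0)
      finally show "pderiv_form (\<lambda>y vs. \<Sum>b\<in>UNIV. (dx b \<and>\<^sub>f pderiv_form \<eta> y (axis b 1)) vs) x v vs =
          (\<Sum>b\<in>UNIV. (dx b \<and>\<^sub>f pderiv_form (\<lambda>y. pderiv_form \<eta> y (axis b 1)) x v) vs)" .
    qed
    then show ?thesis by (subst ext_d_coord) (auto intro!: differentiable_sum d)
  qed
  finally have *: "ext_d (ext_d \<eta>) x vs = (\<Sum>c\<in>UNIV. \<Sum>b\<in>UNIV. (dx c \<and>\<^sub>f dx b \<and>\<^sub>f ?P b c) vs)"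
    by (simp add: wedge_sum_right)
  have sym: "?P b c = ?P c b" for b c
    unfolding pderiv_form_def by (rule ext) (rule symmetric_second_derivative[OF \<eta> S])
  \<comment> \<open>The second derivatives are symmetric in \<open>b\<close> and \<open>c\<close>
    while \<open>dx b\<close> and \<open>dx c\<close> anticommute: after renaming the indices the
    sum equals its own negative.\<close>
  have "(\<Sum>c\<in>UNIV. \<Sum>b\<in>UNIV. (dx c \<and>\<^sub>f dx b \<and>\<^sub>f ?P b c) vs) =
      - (\<Sum>c\<in>UNIV. \<Sum>b\<in>UNIV. (dx b \<and>\<^sub>f dx c \<and>\<^sub>f ?P c b) vs)"
    by (subst one_form_anticommute) (simp add: sum_negf sym)
  also have "(\<Sum>c\<in>UNIV. \<Sum>b\<in>UNIV. (dx b \<and>\<^sub>f dx c \<and>\<^sub>f ?P c b) vs) =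
      (\<Sum>c\<in>UNIV. \<Sum>b\<in>UNIV. (dx c \<and>\<^sub>f dx b \<and>\<^sub>f ?P b c) vs)"
    by (rule sum.swap)
  finally show ?thesis using * by simp
qed

lemma pderiv_form_alt:
  assumes "open S" "x \<in> S" "\<And>y. y \<in> S \<Longrightarrow> alt_form (\<eta> y)" "\<And>vs. (\<lambda>y. \<eta> y vs) differentiable at x"
  shows "alt_form (pderiv_form \<eta> x v)"
proof -
  have hd: "((\<lambda>y. \<eta> y vs) has_derivative (\<lambda>h. pderiv_form \<eta> x h vs)) (at x)" for vs
    unfolding pderiv_form_def by (rule has_derivative_frechet[OF assms(4)])
  have "pderiv_form \<eta> x v (us @ (p + q) # ws) = pderiv_form \<eta> x v (us @ p # ws) + pderiv_form \<eta> x v (us @ q # ws)"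
    for us ws p q
  proof -
    have "frechet_derivative (\<lambda>y. \<eta> y (us @ (p + q) # ws)) (at x) =
        frechet_derivative (\<lambda>y. \<eta> y (us @ p # ws) + \<eta> y (us @ q # ws)) (at x)"
      by (rule frechet_derivative_cong_open[OF assms(1,2)]) (simp add: linear_add[OF alt_formD(1)[OF assms(3)]])
    then show ?thesis
      using frechet_derivative_eqI[OF has_derivative_add[OF hd[of "us @ p # ws"] hd[of "us @ q # ws"]]]
      by (simp add: pderiv_form_def)
  qed
  moreover have "pderiv_form \<eta> x v (us @ (c *\<^sub>R p) # ws) = c *\<^sub>R pderiv_form \<eta> x v (us @ p # ws)" for us ws p c
  proof -
    have "frechet_derivative (\<lambda>y. \<eta> y (us @ (c *\<^sub>R p) # ws)) (at x) =
        frechet_derivative (\<lambda>y. c *\<^sub>R \<eta> y (us @ p # ws)) (at x)"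
      by (rule frechet_derivative_cong_open[OF assms(1,2)]) (simp add: linear_scale[OF alt_formD(1)[OF assms(3)]])
    then show ?thesis
      using frechet_derivative_eqI[OF has_derivative_scaleR_right[OF hd[of "us @ p # ws"]]]
      by (simp add: pderiv_form_def)
  qed
  moreover have "pderiv_form \<eta> x v (us @ p # p # ws) = 0" for us ws p
  proof -
    have "frechet_derivative (\<lambda>y. \<eta> y (us @ p # p # ws)) (at x) = frechet_derivative (\<lambda>y. 0) (at x)"
      by (rule frechet_derivative_cong_open[OF assms(1,2)]) (simp add: alt_formD(2)[OF assms(3)])
    then show ?thesis by (simp add: pderiv_form_def frechet_derivative_eqI[OF has_derivative_const])
  qed
  ultimately show ?thesis by (simp add: alt_form_def linear_iff)
qed

lemma ext_d_alt:
  assumes "open S" "x \<in> S" "\<And>y. y \<in> S \<Longrightarrow> alt_form (\<eta> y)" "\<And>vs. (\<lambda>y. \<eta> y vs) differentiable at x"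
  shows "alt_form (ext_d \<eta> x)"
  unfolding ext_d_coord[OF assms(4)]
  by (intro alt_form_sum alt_form_wedge alt_form_one pderiv_form_alt[OF assms(1-3)] assms(4))
     (simp_all add: linear_iff algebra_simps scaleR_conv_of_real[where 'a = complex])

lemma hom_form_ext_d:
  assumes "open S" "x \<in> S" "\<And>y. y \<in> S \<Longrightarrow> hom_form k (\<eta> y)"
  shows "hom_form (Suc k) (ext_d \<eta> x)"
  unfolding hom_form_def ext_d_def
proof (intro allI impI sum.neutral ballI)
  fix vs :: "(real^6) list" and i assume "length vs \<noteq> Suc k" "i \<in> {..<length vs}"
  then have "length (take i vs @ drop (Suc i) vs) \<noteq> k" by auto
  then have "frechet_derivative (\<lambda>y. \<eta> y (take i vs @ drop (Suc i) vs)) (at x) = frechet_derivative (\<lambda>y. 0) (at x)"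
    by (intro frechet_derivative_cong_open[OF assms(1,2)] hom_formD[OF assms(3)])
  then show "(-1) ^ i * frechet_derivative (\<lambda>y. \<eta> y (take i vs @ drop (Suc i) vs)) (at x) (vs ! i) = 0"
    by (simp add: frechet_derivative_eqI[OF has_derivative_const])
qed

section \<open>Forms of top degree\<close>

lemma exhaust_6:
  fixes x :: 6
  shows "x = 1 \<or> x = 2 \<or> x = 3 \<or> x = 4 \<or> x = 5 \<or> x = 6"
proof (induct x)
  case (of_int z)
  then have "z = 0 \<or> z = 1 \<or> z = 2 \<or> z = 3 \<or> z = 4 \<or> z = 5" by fastforce
  then show ?case by auto
qed

lemma UNIV_6: "(UNIV :: 6 set) = {1, 2, 3, 4, 5, 6}"
  using exhaust_6 by auto

lemma sum_6: "sum f (UNIV :: 6 set) = f 1 + f 2 + f 3 + f 4 + f 5 + f 6"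
  unfolding UNIV_6 by (simp add: ac_simps)

lemma forall_6: "(\<forall>i::6. P i) \<longleftrightarrow> P 1 \<and> P 2 \<and> P 3 \<and> P 4 \<and> P 5 \<and> P 6"
proof -
  have "(\<forall>i::6. P i) \<longleftrightarrow> (\<forall>i\<in>UNIV. P i)" by simp
  then show ?thesis unfolding UNIV_6 by simp
qed

lemma vector_6 [simp]:
  fixes a :: "'a::zero"
  shows "(vector [a, b, c, d, e, f] :: 'a^6) $ 1 = a" "(vector [a, b, c, d, e, f] :: 'a^6) $ 2 = b"
    "(vector [a, b, c, d, e, f] :: 'a^6) $ 3 = c" "(vector [a, b, c, d, e, f] :: 'a^6) $ 4 = d"
    "(vector [a, b, c, d, e, f] :: 'a^6) $ 5 = e" "(vector [a, b, c, d, e, f] :: 'a^6) $ 6 = f"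
  unfolding vector_def by simp_all

section \<open>Alternating forms on six vectors and determinants\<close>

lemma alt_form_swap_adjacent:
  assumes "alt_form a"
  shows "a (us @ u # v # ws) = - a (us @ v # u # ws)"
proof -
  note l1 = linear_add[OF alt_formD(1)[OF assms]]
  have l2: "a (us @ x # (y + z) # ws) = a (us @ x # y # ws) + a (us @ x # z # ws)" for x y z
    using l1[of "us @ [x]" y z ws] by simp
  have "a (us @ (u + v) # (u + v) # ws) = 0" by (rule alt_formD(2)[OF assms])
  then have "a (us @ u # u # ws) + a (us @ u # v # ws) + (a (us @ v # u # ws) + a (us @ v # v # ws)) = 0"
    by (simp add: l1 l2)
  then show ?thesis
    by (simp add: alt_formD(2)[OF assms] add_eq_0_iff)
qed

lemma alt_form_repeat:
  assumes "alt_form a"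
  shows "a (us @ v # ms @ v # ws) = 0"
proof (induction ms arbitrary: us)
  case Nil
  then show ?case using alt_formD(2)[OF assms] by simp
next
  case (Cons m ms)
  have "a (us @ v # (m # ms) @ v # ws) = - a ((us @ [m]) @ v # ms @ v # ws)"
    using alt_form_swap_adjacent[OF assms, of us v m "ms @ v # ws"] by simp
  then show ?case using Cons[of "us @ [m]"] by simp
qed

lemma alt_form_swap:
  assumes "alt_form a"
  shows "a (us @ u # ms @ v # ws) = - a (us @ v # ms @ u # ws)"
proof -
  note l1 = linear_add[OF alt_formD(1)[OF assms]]
  have l2: "a (us @ x # ms @ (y + z) # ws) = a (us @ x # ms @ y # ws) + a (us @ x # ms @ z # ws)" for x y z
    using l1[of "us @ x # ms" y z ws] by simp
  have "a (us @ (u + v) # ms @ (u + v) # ws) = 0" by (rule alt_form_repeat[OF assms])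
  then have "a (us @ u # ms @ u # ws) + a (us @ u # ms @ v # ws) +
      (a (us @ v # ms @ u # ws) + a (us @ v # ms @ v # ws)) = 0"
    by (simp only: l1 l2)
  then show ?thesis
    by (simp only: alt_form_repeat[OF assms] add_0_left add_0_right eq_neg_iff_add_eq_0)
qed

lemma alt_form_scale_list:
  assumes "alt_form a"
  shows "a (pre @ map (\<lambda>i. c i *\<^sub>R g i) is) = complex_of_real (prod_list (map c is)) * a (pre @ map g is)"
proof (induction "is" arbitrary: pre)
  case (Cons i "is")
  have "a (pre @ map (\<lambda>i. c i *\<^sub>R g i) (i # is)) =
      complex_of_real (prod_list (map c is)) * a ((pre @ [c i *\<^sub>R g i]) @ map g is)"
    using Cons[of "pre @ [c i *\<^sub>R g i]"] by simp
  also have "a ((pre @ [c i *\<^sub>R g i]) @ map g is) = c i *\<^sub>R a (pre @ map g (i # is))"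
    using linear_scale[OF alt_formD(1)[OF assms], of pre "c i" "g i" "map g is"] by simp
  finally show ?case by (simp add: scaleR_conv_of_real[where 'a = complex])
qed simp

abbreviation coords :: "6 list" where "coords \<equiv> [1, 2, 3, 4, 5, 6]"

lemma coords: "distinct coords" "set coords = UNIV"
  by (simp, simp add: UNIV_6)

lemma coords_split: obtains us ws where "coords = us @ i # ws"
  using split_list[of i coords] coords(2) by blast

lemma coords_split2:
  assumes "m \<noteq> n"
  obtains us ms ws p q where "{p, q} = {m, n}" "coords = us @ p # ms @ q # ws"
    "set us \<inter> {m, n} = {}" "set ms \<inter> {m, n} = {}" "set ws \<inter> {m, n} = {}"
proof -
  obtain us ws where 1: "coords = us @ m # ws" by (rule coords_split)
  have "n \<in> set (us @ m # ws)" unfolding 1[symmetric] coords(2) by simp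
  then have "n \<in> set us \<or> n \<in> set ws" using assms by simp
  then consider xs ys where "us = xs @ n # ys" | xs ys where "ws = xs @ n # ys"
    by (meson split_list)
  then show thesis
  proof cases
    case 1
    then have 2: "coords = xs @ n # ys @ m # ws" using \<open>coords = us @ m # ws\<close> by simp
    have "distinct (xs @ n # ys @ m # ws)" unfolding 2[symmetric] by (rule coords(1))
    then show thesis by (intro that[OF _ 2]) auto
  next
    case 2
    then have 3: "coords = us @ m # xs @ n # ys" using \<open>coords = us @ m # ws\<close> by simp
    have "distinct (us @ m # xs @ n # ys)" unfolding 3[symmetric] by (rule coords(1))
    then show thesis by (intro that[OF _ 3]) auto
  qed
qed

lemma alt_form_swap_coords:
  fixes g :: "6 \<Rightarrow> real^6"
  assumes W: "alt_form W" and "m \<noteq> n"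
  shows "W (map (\<lambda>i. g (Transposition.transpose m n i)) coords) = - W (map g coords)"
proof -
  obtain us ms ws p q where s: "{p, q} = {m, n}" "coords = us @ p # ms @ q # ws"
    "set us \<inter> {m, n} = {}" "set ms \<inter> {m, n} = {}" "set ws \<inter> {m, n} = {}"
    by (rule coords_split2[OF assms(2)])
  have e: "map (\<lambda>i. g (Transposition.transpose m n i)) xs = map g xs" if "set xs \<inter> {m, n} = {}" for xs
    by (rule map_cong[OF refl]) (use that in \<open>auto simp: Transposition.transpose_def\<close>)
  have pq: "Transposition.transpose m n p = q" "Transposition.transpose m n q = p"
    using s(1) by (auto simp: doubleton_eq_iff)
  show ?thesis
    unfolding s(2) map_append list.map e[OF s(3)] e[OF s(4)] e[OF s(5)] pq
    by (rule alt_form_swap[OF W])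
qed

lemma alt_form_add_multiple:
  fixes g :: "6 \<Rightarrow> real^6"
  assumes W: "alt_form W" and "m \<noteq> n"
  shows "W (map (\<lambda>i. if i = m then g m + c *\<^sub>R g n else g i) coords) = W (map g coords)"
proof -
  let ?h = "\<lambda>i. if i = m then g m + c *\<^sub>R g n else g i"
  obtain us ms ws p q where s: "{p, q} = {m, n}" "coords = us @ p # ms @ q # ws"
    "set us \<inter> {m, n} = {}" "set ms \<inter> {m, n} = {}" "set ws \<inter> {m, n} = {}"
    by (rule coords_split2[OF assms(2)])
  have e: "map ?h xs = map g xs" if "set xs \<inter> {m, n} = {}" for xs
    by (rule map_cong[OF refl]) (use that in auto)
  note l = linear_add[OF alt_formD(1)[OF W]] linear_scale[OF alt_formD(1)[OF W]]
  have l': "W (a @ x # b @ (y + r *\<^sub>R z) # d) = W (a @ x # b @ y # d) + r *\<^sub>R W (a @ x # b @ z # d)"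
    for a b d x y z r
    using l(1)[of "a @ x # b"] l(2)[of "a @ x # b"] by simp
  from s(1) consider "p = m" "q = n" | "p = n" "q = m" by (auto simp: doubleton_eq_iff)
  then show ?thesis
  proof cases
    case 1
    then have "?h p = g p + c *\<^sub>R g q" "?h q = g q" using assms(2) by auto
    then show ?thesis
      unfolding s(2) map_append list.map e[OF s(3)] e[OF s(4)] e[OF s(5)]
      by (simp only: l alt_form_repeat[OF W] scaleR_zero_right add_0_right)
  next
    case 2
    then have "?h q = g q + c *\<^sub>R g p" "?h p = g p" using assms(2) by auto
    then show ?thesis
      unfolding s(2) map_append list.map e[OF s(3)] e[OF s(4)] e[OF s(5)]
      by (simp only: l' alt_form_repeat[OF W] scaleR_zero_right add_0_right)
  qed
qed

text \<open>Induction over products of elementary matrices: scalings, transpositions and additions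
  of rows act on the list of rows as multilinearity and alternation prescribe. The claim is made for
  all \<open>B\<close> at once, since a product of matrices is applied with an arbitrary right
  factor.\<close>

lemma alt_form_det_mult:
  assumes W: "alt_form W"
  shows "W (map (\<lambda>i. (A ** B) $ i) coords) = complex_of_real (det A) * W (map (\<lambda>i. B $ i) coords)"
proof -
  define f where "f B = W (map (($) B) coords)" for B :: "real^6^6"
  have row: "(A ** B) $ i = (\<Sum>k\<in>UNIV. A $ i $ k *\<^sub>R B $ k)" for A B :: "real^6^6" and i
    by (simp add: vec_eq_iff matrix_matrix_mult_def)
  have "\<forall>B. f (A ** B) = complex_of_real (det A) * f B"
  proof (induction rule: induct_matrix_elementary)
    case (1 A B)
    then have "f (A ** B ** C) = complex_of_real (det (A ** B)) * f C" for C
      by (simp only: matrix_mul_assoc[symmetric] det_mul of_real_mult mult.assoc)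
    then show ?case by blast
  next
    case (2 A i)
    then have "A $ i $ k = 0" for k by (simp add: row_def vec_eq_iff)
    then have 0: "(A ** B) $ i = 0" for B :: "real^6^6" by (simp add: row)
    obtain us ws where "coords = us @ i # ws" by (rule coords_split)
    then have "f (A ** B) = 0" for B :: "real^6^6"
      using linear_0[OF alt_formD(1)[OF W]] by (simp only: f_def map_append list.map(2) 0)
    moreover have "det A = 0" by (rule det_zero_row(1)[OF 2])
    ultimately show ?case by simp
  next
    case (3 A)
    have "(A ** B) $ i = A $ i $ i *\<^sub>R B $ i" for B :: "real^6^6" and i
    proof -
      have *: "A $ i $ k *\<^sub>R B $ k = (if k = i then A $ i $ i *\<^sub>R B $ i else 0)" for k using 3 by auto
      show ?thesis unfolding row by (rule trans[OF sum.cong[OF refl *]]) simp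
    qed
    then have "(($) (A ** B)) = (\<lambda>i. A $ i $ i *\<^sub>R B $ i)" for B :: "real^6^6" by (rule ext)
    then have "f (A ** B) = W ([] @ map (\<lambda>i. A $ i $ i *\<^sub>R B $ i) coords)" for B
      by (simp only: f_def append_Nil)
    also have "\<dots> B = complex_of_real (prod_list (map (\<lambda>i. A $ i $ i) coords)) * f B" for B
      using alt_form_scale_list[OF W, of "[]" "\<lambda>i. A $ i $ i" "($) B" coords] by (simp only: f_def append_Nil)
    also have "prod_list (map (\<lambda>i. A $ i $ i) coords) = det A"
    proof -
      have "det A = (\<Prod>i\<in>UNIV. A $ i $ i)" by (rule det_diagonal) (rule 3)
      then show ?thesis unfolding UNIV_6 by simp
    qed
    finally show ?case by (rule allI)
  next
    case (4 m n)
    let ?S = "(\<chi> i j. mat 1 $ i $ Transposition.transpose m n j) :: real^6^6"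
    have "det ?S = -1"
      using det_permute_columns[OF permutes_swap_id[of m UNIV n], of "mat 1 :: real^6^6"] 4
      by (simp add: sign_swap_id)
    moreover have "(?S ** B) $ i = B $ Transposition.transpose m n i" for B :: "real^6^6" and i
    proof -
      have *: "?S $ i $ k *\<^sub>R B $ k = (if k = Transposition.transpose m n i then B $ Transposition.transpose m n i else 0)" for k
        by (auto simp: mat_def)
      show ?thesis unfolding row by (rule trans[OF sum.cong[OF refl *]]) simp
    qed
    then have "(($) (?S ** B)) = (\<lambda>i. B $ Transposition.transpose m n i)" for B :: "real^6^6" by (rule ext)
    then have "f (?S ** B) = - f B" for B
      unfolding f_def by (simp only: alt_form_swap_coords[OF W 4, where g = "($) B"])
    ultimately show ?case by simp
  next
    case (5 m n c)
    let ?S = "(\<chi> i j. if i = m \<and> j = n then c else of_bool (i = j)) :: real^6^6"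
    have "?S = (\<chi> k. if k = m then row m (mat 1) + c *s row n (mat 1) else row k (mat 1))"
      using 5 by (auto simp: vec_eq_iff row_def mat_def)
    then have "det ?S = 1" using det_row_operation[OF 5, of "mat 1 :: real^6^6" c] by simp
    moreover have "(?S ** B) $ i = (if i = m then B $ m + c *\<^sub>R B $ n else B $ i)" for B :: "real^6^6" and i
    proof -
      have *: "?S $ i $ k *\<^sub>R B $ k = (if k = i then B $ k else 0) + (if k = n then if i = m then c *\<^sub>R B $ n else 0 else 0)" for k
        using 5 by auto
      show ?thesis unfolding row by (rule trans[OF sum.cong[OF refl *]]) (simp add: sum.distrib)
    qed
    then have "(($) (?S ** B)) = (\<lambda>i. if i = m then B $ m + c *\<^sub>R B $ n else B $ i)" for B :: "real^6^6" by (rule ext)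
    then have "f (?S ** B) = f B" for B
      unfolding f_def by (simp only: alt_form_add_multiple[OF W 5, where g = "($) B"])
    ultimately show ?case by simp
  qed
  then show ?thesis by (simp only: f_def)
qed

abbreviation std_frame :: "(real^6) list" where "std_frame \<equiv> map (\<lambda>i. axis i 1) coords"

lemma alt_form_det:
  assumes "alt_form W"
  shows "W (map (\<lambda>i. A $ i) coords) = complex_of_real (det A) * W std_frame"
proof -
  have "(mat 1 :: real^6^6) $ i = axis i 1" for i
    by (simp add: vec_eq_iff mat_def axis_def)
  then show ?thesis using alt_form_det_mult[OF assms, of A "mat 1"] by (simp del: list.map)
qed

lemma alt_form_det_list:
  assumes "alt_form W"
  shows "W [a, b, c, d, e, f] = complex_of_real (det (vector [a, b, c, d, e, f] :: real^6^6)) * W std_frame"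
  using alt_form_det[OF assms, of "vector [a, b, c, d, e, f]"] by simp

lemma alt_form_det_linear:
  assumes "alt_form W" "linear L"
  shows "W (map L std_frame) = complex_of_real (det (matrix L)) * W std_frame"
proof -
  \<comment> \<open>The images of the basis vectors are columns of \<open>matrix L\<close>, whereas
    \<open>alt_form_det\<close> reads rows.\<close>
  have "transpose (matrix L) $ i = L (axis i 1)" for i
    by (simp add: vec_eq_iff transpose_def matrix_def)
  then show ?thesis using alt_form_det[OF assms(1), of "transpose (matrix L)"] by (simp add: comp_def)
qed

section \<open>Complex coframes of a vector space\<close>

text \<open>The vectors \<open>X j\<close> are real: \<open>X j\<close> and \<open>A *v X j\<close>
  together form a basis of \<open>real^6\<close>, and the complex frame dual to \<open>a\<close>
  consists of the (1,0)-parts of the \<open>X j\<close>.\<close>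

definition dual_frames :: "real^6^6 \<Rightarrow> (3 \<Rightarrow> real^6 \<Rightarrow> complex) \<Rightarrow> (3 \<Rightarrow> real^6) \<Rightarrow> bool" where
  "dual_frames A a X \<longleftrightarrow> (\<forall>i. linear (a i)) \<and> (\<forall>i v. a i (A *v v) = \<i> * a i v) \<and>
     (\<forall>i j. a i (X j) = (if i = j then 1 else 0))"

definition frame_list :: "real^6^6 \<Rightarrow> (3 \<Rightarrow> real^6) \<Rightarrow> (real^6) list" where
  "frame_list A X = [X 1, A *v X 1, X 2, A *v X 2, X 3, A *v X 3]"

definition realification :: "(3 \<Rightarrow> real^6 \<Rightarrow> complex) \<Rightarrow> real^6^6" where
  "realification a = vector [\<chi> b. Re (a 1 (axis b 1)), \<chi> b. Im (a 1 (axis b 1)),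
     \<chi> b. Re (a 2 (axis b 1)), \<chi> b. Im (a 2 (axis b 1)),
     \<chi> b. Re (a 3 (axis b 1)), \<chi> b. Im (a 3 (axis b 1))]"

lemma realification_mult:
  assumes "\<And>i. linear (a i)"
  shows "realification a *v v = vector [Re (a 1 v), Im (a 1 v), Re (a 2 v), Im (a 2 v), Re (a 3 v), Im (a 3 v)]"
  by (simp add: vec_eq_iff forall_6 realification_def matrix_vector_mult_def
      linear_axis_expansion[OF assms, of _ v] mult.commute)

lemma
  assumes "dual_frames A a X"
  shows realification_frame: "realification a ** transpose (vector (frame_list A X)) = mat 1"
    and frame_det_nonzero: "det (vector (frame_list A X) :: real^6^6) \<noteq> 0"
proof -
  have e: "(realification a ** transpose (vector (frame_list A X))) $ i $ j =
      (realification a *v (vector (frame_list A X) $ j)) $ i" for i j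
    by (simp add: matrix_matrix_mult_def matrix_vector_mult_def transpose_def)
  show *: "realification a ** transpose (vector (frame_list A X)) = mat 1"
    unfolding vec_eq_iff e
    using assms by (simp add: forall_6 realification_mult dual_frames_def frame_list_def mat_def)
  then have "det (realification a) * det (transpose (vector (frame_list A X) :: real^6^6)) = 1"
    by (metis det_I det_mul)
  then show "det (vector (frame_list A X) :: real^6^6) \<noteq> 0" by auto
qed

lemma frame_expansion:
  assumes "dual_frames A a X"
  shows "v = (\<Sum>j\<in>UNIV. Re (a j v) *\<^sub>R X j + Im (a j v) *\<^sub>R (A *v X j))"
proof -
  have lin: "linear (a i)" for i using assms by (simp add: dual_frames_def)
  have "transpose (vector (frame_list A X)) ** realification a = mat 1"
    using realification_frame[OF assms] by (rule matrix_left_right_inverse1)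
  then have "v = transpose (vector (frame_list A X)) *v (realification a *v v)"
    by (simp add: matrix_vector_mul_assoc)
  then show ?thesis
    unfolding realification_mult[OF lin]
    by (simp add: vec_eq_iff matrix_vector_mult_def transpose_def sum_6 frame_list_def sum_3 mult.commute add.assoc)
qed

lemma coframe_change:
  assumes "dual_frames A a X" "linear f" "\<And>v. f (A *v v) = \<i> * f v"
  shows "f v = (\<Sum>j\<in>UNIV. f (X j) * a j v)"
proof -
  have "f v = f (\<Sum>j\<in>UNIV. Re (a j v) *\<^sub>R X j + Im (a j v) *\<^sub>R (A *v X j))"
    using frame_expansion[OF assms(1)] by metis
  also have "\<dots> = (\<Sum>j\<in>UNIV. (complex_of_real (Re (a j v)) + complex_of_real (Im (a j v)) * \<i>) * f (X j))"
    by (simp add: linear_sum[OF assms(2)] linear_add[OF assms(2)] linear_scale[OF assms(2)] assms(3)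
        scaleR_conv_of_real[where 'a = complex] algebra_simps)
  also have "\<dots> = (\<Sum>j\<in>UNIV. f (X j) * a j v)"
    by (intro sum.cong refl) (simp add: complex_eq[symmetric] mult.commute)
  finally show ?thesis .
qed

text \<open>A kernel vector \<open>y\<close> of the transposed real matrix encodes complex
  coefficients \<open>k\<close> for which the real part of the sum of \<open>k i * a i v\<close>
  vanishes; as \<open>v\<close> may be replaced by \<open>A *v v\<close>, so does the imaginary
  part. Complex independence thus makes the real matrix invertible, and \<open>X\<close> consists of
  columns 1, 3 and 5 of the inverse.\<close>

lemma independent_dual_frame:
  assumes lin: "\<And>i. linear (a i)" and J: "\<And>i v. a i (A *v v) = \<i> * a i v"
    and indep: "\<And>k. (\<And>v. (\<Sum>i\<in>UNIV. k i * a i v) = 0) \<Longrightarrow> \<forall>i. k i = 0"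
  shows "\<exists>X. dual_frames A a X"
proof -
  let ?R = "realification a"
  have "y = 0" if "transpose ?R *v y = 0" for y
  proof -
    \<comment> \<open>The minus signs make the real part of \<open>k i * a i v\<close> the real
      inner product of two entries of \<open>y\<close> with the real and imaginary parts of
      \<open>a i v\<close>.\<close>
    define k :: "3 \<Rightarrow> complex" where "k i = (if i = 1 then Complex (y $ 1) (- y $ 2)
       else if i = 2 then Complex (y $ 3) (- y $ 4) else Complex (y $ 5) (- y $ 6))" for i
    have re: "Re (\<Sum>i\<in>UNIV. k i * a i v) = y \<bullet> (?R *v v)" for v
      by (simp add: sum_3 k_def realification_mult[OF lin] inner_vec_def sum_6)
    have "y v* ?R = 0" using that by (simp only: transpose_matrix_vector)
    then have re0: "Re (\<Sum>i\<in>UNIV. k i * a i v) = 0" for v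
      unfolding re dot_lmul_matrix[symmetric] by simp
    have "(\<Sum>i\<in>UNIV. k i * a i (A *v v)) = \<i> * (\<Sum>i\<in>UNIV. k i * a i v)" for v
      by (simp add: J sum_distrib_left mult.left_commute)
    then have "Im (\<Sum>i\<in>UNIV. k i * a i v) = 0" for v
      using re0[of "A *v v"] by simp
    then have "(\<Sum>i\<in>UNIV. k i * a i v) = 0" for v
      using re0 complex_eqI by (metis zero_complex.sel)
    then have "\<forall>i. k i = 0" by (rule indep)
    then have "k 1 = 0" "k 2 = 0" "k 3 = 0" by auto
    then show "y = 0" by (simp add: k_def vec_eq_iff forall_6 complex_eq_iff)
  qed
  then obtain B where "B ** transpose ?R = mat 1" using matrix_left_invertible_ker by blast
  then have "?R ** transpose B = mat 1"
    by (metis matrix_transpose_mul transpose_mat transpose_transpose)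
  then have *: "?R *v (transpose B *v y) = y" for y by (simp only: matrix_vector_mul_assoc matrix_vector_mul_lid)
  define X :: "3 \<Rightarrow> real^6" where
    "X j = transpose B *v axis (if j = 1 then 1 else if j = 2 then 3 else 5) 1" for j
  have "vector [Re (a 1 (X j)), Im (a 1 (X j)), Re (a 2 (X j)), Im (a 2 (X j)), Re (a 3 (X j)), Im (a 3 (X j))] =
      (axis (if j = 1 then 1 else if j = 2 then 3 else 5) 1 :: real^6)" for j
    using *[of "axis (if j = 1 then 1 else if j = 2 then 3 else 5) 1"]
    unfolding realification_mult[OF lin] X_def .
  then have "\<forall>i j. a i (X j) = (if i = j then 1 else 0)"
    by (simp add: forall_3 vec_eq_iff forall_6 complex_eq_iff axis_def)
  then show ?thesis using lin J unfolding dual_frames_def by blast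
qed

text \<open>Inverting the matrix of the basis gives real coordinates, on which A acts by the
  standard rotation blocks because A A = -1; each pair of them combines to a complex coordinate on
  which A is multiplication by i.\<close>

lemma frame_dual_coframe:
  assumes A: "A ** A = - mat 1" and D: "det (vector (frame_list A X) :: real^6^6) \<noteq> 0"
  shows "\<exists>a. dual_frames A a X"
proof -
  let ?V = "vector (frame_list A X) :: real^6^6"
  obtain W where W: "?V ** W = mat 1" "W ** ?V = mat 1"
    using D by (metis invertible_det_nz invertible_def)
  define y where "y v = transpose W *v v" for v
  define a :: "3 \<Rightarrow> real^6 \<Rightarrow> complex" where "a i v = (if i = 1 then Complex (y v $ 1) (y v $ 2)
     else if i = 2 then Complex (y v $ 3) (y v $ 4) else Complex (y v $ 5) (y v $ 6))" for i v
  have y: "y (?V $ k) = axis k 1" for k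
  proof -
    have "y (?V $ k) = (?V ** W) $ k"
      by (simp add: y_def vec_eq_iff matrix_vector_mult_def matrix_matrix_mult_def transpose_def mult.commute)
    then show ?thesis by (simp add: W vec_eq_iff mat_def axis_def)
  qed
  have fr: "y (X 1) = axis 1 1" "y (A *v X 1) = axis 2 1" "y (X 2) = axis 3 1"
     "y (A *v X 2) = axis 4 1" "y (X 3) = axis 5 1" "y (A *v X 3) = axis 6 1"
    using y[of 1] y[of 2] y[of 3] y[of 4] y[of 5] y[of 6] by (simp_all add: frame_list_def)
  have AA: "A *v (A *v v) = - v" for v
    by (simp add: matrix_vector_mul_assoc A) (simp add: matrix_vector_mult_def mat_def vec_eq_iff if_distrib[of "\<lambda>x. x * _"] sum_negf cong: if_cong)
  have lin: "y (u + v) = y u + y v" "y (c *\<^sub>R v) = c *\<^sub>R y v" "y (- v) = - y v" "y (u - v) = y u - y v" for u v c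
    by (simp_all only: y_def linear_add[OF matrix_vector_mul_linear] linear_scale[OF matrix_vector_mul_linear]
        linear_neg[OF matrix_vector_mul_linear] linear_diff[OF matrix_vector_mul_linear])
  have yA: "y (A *v v) = vector [- y v $ 2, y v $ 1, - y v $ 4, y v $ 3, - y v $ 6, y v $ 5]" for v
  proof -
    have "v = transpose ?V *v y v"
      unfolding y_def matrix_vector_mul_assoc by (metis W(2) W(1) matrix_transpose_mul matrix_vector_mul_lid transpose_mat)
    then have v: "v = y v $ 1 *\<^sub>R X 1 + y v $ 2 *\<^sub>R (A *v X 1) + y v $ 3 *\<^sub>R X 2 + y v $ 4 *\<^sub>R (A *v X 2) +
        y v $ 5 *\<^sub>R X 3 + y v $ 6 *\<^sub>R (A *v X 3)"
      by (simp add: vec_eq_iff matrix_vector_mult_def transpose_def sum_6 frame_list_def mult.commute)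
    show ?thesis
      by (subst v) (simp add: matrix_vector_right_distrib matrix_vector_mult_scaleR AA lin fr,
          simp add: vec_eq_iff forall_6 axis_def)
  qed
  have "linear (a i)" for i
    by (rule linearI) (simp_all add: a_def lin complex_eq_iff)
  moreover have "a i (A *v v) = \<i> * a i v" for i v
    by (simp add: a_def yA complex_eq_iff)
  moreover have "\<forall>i j. a i (X j) = (if i = j then 1 else 0)"
    by (simp add: forall_3 a_def fr axis_def complex_eq_iff)
  ultimately show ?thesis unfolding dual_frames_def by blast
qed

definition vol_of :: "(3 \<Rightarrow> real^6 \<Rightarrow> complex) \<Rightarrow> form" where
  "vol_of a = one_form (a 1) \<and>\<^sub>f one_form (a 2) \<and>\<^sub>f one_form (a 3)"

definition top_of :: "(3 \<Rightarrow> real^6 \<Rightarrow> complex) \<Rightarrow> form" where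
  "top_of a = vol_of a \<and>\<^sub>f cnj_form (vol_of a)"

lemma cnj_vol_of: "cnj_form (vol_of a) = vol_of (\<lambda>i v. cnj (a i v))"
  by (simp add: vol_of_def wedge_cnj cnj_one_form)

lemma wedge_3_3:
  assumes "hom_form 3 a" "hom_form 3 b"
  shows "(a \<and>\<^sub>f b) [u, v, w, x, y, z] =
     a [u, v, w] * b [x, y, z] - a [u, v, x] * b [w, y, z] + a [u, v, y] * b [w, x, z] - a [u, v, z]
     * b [w, x, y] + a [u, w, x] * b [v, y, z] - a [u, w, y] * b [v, x, z] + a [u, w, z] * b [v, x,
     y] + a [u, x, y] * b [v, w, z] - a [u, x, z] * b [v, w, y] + a [u, y, z] * b [v, w, x] - a [v,
     w, x] * b [u, y, z] + a [v, w, y] * b [u, x, z] - a [v, w, z] * b [u, x, y] - a [v, x, y] * b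
     [u, w, z] + a [v, x, z] * b [u, w, y] - a [v, y, z] * b [u, w, x] + a [w, x, y] * b [u, v, z] -
     a [w, x, z] * b [u, v, y] + a [w, y, z] * b [u, v, x] - a [x, y, z] * b [u, v, w]"
  by (simp only: wedge_Cons wedge_Nil, simp only: contr_def twist_def list.size One_nat_def
      add_0_right add_Suc_right add_0_left power_Suc power_0 mult_1_right,
      simp add: hom_formD[OF assms(1)] hom_formD[OF assms(2)])

lemma vol_of_apply:
  "vol_of a [u, v, w] = a 1 u * a 2 v * a 3 w - a 1 u * a 2 w * a 3 v - a 1 v * a 2 u * a 3 w +
     a 1 v * a 2 w * a 3 u + a 1 w * a 2 u * a 3 v - a 1 w * a 2 v * a 3 u"
  by (simp add: vol_of_def one_form_wedge_Cons contr_def algebra_simps)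

lemma hom_form_vol_of: "hom_form 3 (vol_of a)"
  using hom_form_wedge[OF hom_form_one hom_form_wedge[OF hom_form_one hom_form_one], of "a 1" "a 2" "a 3"]
  by (simp add: vol_of_def numeral_3_eq_3)

text \<open>The value of \<open>vol_of\<close> on three vectors is the determinant of the matrix of
  values, so that the factor comes from multiplicativity of \<open>det\<close>.\<close>

lemma vol_of_change:
  fixes a a' :: "3 \<Rightarrow> real^6 \<Rightarrow> complex"
  assumes "\<And>i v. a' i v = (\<Sum>j\<in>UNIV. g $ i $ j * a j v)"
  shows "vol_of a' vs = det g * vol_of a vs"
proof (cases "length vs = 3")
  case True
  then obtain u v w where vs: "vs = [u, v, w]" by (auto simp: numeral_3_eq_3 length_Suc_conv)
  let ?m = "\<lambda>a. (\<chi> i j. a i (if j = 1 then u else if j = 2 then v else w)) :: complex^3^3"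
  have det: "vol_of a vs = det (?m a)" for a
    by (simp add: vs vol_of_apply det_3)
  have "?m a' = g ** ?m a"
    by (simp add: vec_eq_iff matrix_matrix_mult_def assms)
  then show ?thesis by (simp add: det det_mul)
qed (simp_all add: hom_formD[OF hom_form_vol_of])

lemma top_of_change:
  fixes a a' :: "3 \<Rightarrow> real^6 \<Rightarrow> complex"
  assumes "\<And>i v. a' i v = (\<Sum>j\<in>UNIV. g $ i $ j * a j v)"
  shows "top_of a' vs = det g * cnj (det g) * top_of a vs"
proof -
  have "vol_of a' = (\<lambda>vs. det g * vol_of a vs)" by (rule ext) (rule vol_of_change[OF assms])
  moreover have "cnj_form (\<lambda>vs. c * a vs) = (\<lambda>vs. cnj c * cnj_form a vs)" for c a
    by (simp add: fun_eq_iff cnj_form_def)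
  ultimately show ?thesis
    by (simp add: top_of_def wedge_scale_left wedge_scale_right)
qed

lemma alt_form_vol_of: "(\<And>i. linear (a i)) \<Longrightarrow> alt_form (vol_of a)"
  by (simp add: vol_of_def alt_form_wedge alt_form_one)

lemma alt_form_top_of: "(\<And>i. linear (a i)) \<Longrightarrow> alt_form (top_of a)"
  by (simp add: top_of_def alt_form_wedge alt_form_cnj alt_form_vol_of)

text \<open>Each pair \<open>X j\<close>, \<open>A *v X j\<close> contributes -2 i, and bringing the
  six factors into pairs costs the sign -1. The factor i/8 in \<open>Phi_of\<close> normalises this
  value to 1, so that the integrands are nonnegative multiples of a positive form.\<close>

lemma top_of_frame:
  assumes "dual_frames A a X"
  shows "top_of a (frame_list A X) = - 8 * \<i>"
  using assms unfolding top_of_def cnj_vol_of frame_list_def dual_frames_def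
  by (simp add: wedge_3_3[OF hom_form_vol_of hom_form_vol_of] vol_of_apply)

lemma top_of_std_nonzero:
  assumes "dual_frames A a X"
  shows "top_of a std_frame \<noteq> 0"
  using alt_form_det_list[OF alt_form_top_of, of a "X 1" "A *v X 1" "X 2" "A *v X 2" "X 3" "A *v X 3"]
    top_of_frame[OF assms] assms by (auto simp: frame_list_def dual_frames_def)

lemma alt_form_eq_on_frame:
  assumes "dual_frames A a X" "alt_form V" "alt_form W" "V (frame_list A X) = W (frame_list A X)"
  shows "V std_frame = W std_frame"
  using alt_form_det_list[OF assms(2), of "X 1" "A *v X 1" "X 2" "A *v X 2" "X 3" "A *v X 3"]
    alt_form_det_list[OF assms(3), of "X 1" "A *v X 1" "X 2" "A *v X 2" "X 3" "A *v X 3"]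
    frame_det_nonzero[OF assms(1)] assms(4) by (simp add: frame_list_def)

lemma frame_det_top_of:
  assumes "dual_frames A a X"
  shows "complex_of_real (det (vector (frame_list A X) :: real^6^6)) * top_of a std_frame = - 8 * \<i>"
  using alt_form_det_list[OF alt_form_top_of, of a "X 1" "A *v X 1" "X 2" "A *v X 2" "X 3" "A *v X 3"]
    top_of_frame[OF assms] assms by (simp add: frame_list_def dual_frames_def)

text \<open>Two coframes of the same structure differ by a complex matrix \<open>g\<close>, which
  multiplies the top form by the positive number \<open>(cmod (det g))\<^sup>2\<close>. Hence the
  sign in \<open>orient_sign\<close> is well defined.\<close>

lemma frame_det_sgn:
  assumes "dual_frames A a X" "dual_frames A b Y"
  shows "sgn (det (vector (frame_list A X) :: real^6^6)) = sgn (det (vector (frame_list A Y) :: real^6^6))"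
proof -
  let ?D = "\<lambda>X. det (vector (frame_list A X) :: real^6^6)"
  define g :: "complex^3^3" where "g = (\<chi> i j. b i (X j))"
  have "b i v = (\<Sum>j\<in>UNIV. g $ i $ j * a j v)" for i v
    using coframe_change[OF assms(1), of "b i" v] assms(2) by (simp add: g_def dual_frames_def)
  from top_of_change[OF this] have "top_of b std_frame = complex_of_real ((cmod (det g))\<^sup>2) * top_of a std_frame"
    by (simp add: complex_norm_square[symmetric])
  with frame_det_top_of[OF assms(1)] frame_det_top_of[OF assms(2)]
  have "complex_of_real (?D X) * top_of a std_frame =
      complex_of_real (?D Y * (cmod (det g))\<^sup>2) * top_of a std_frame" by (simp add: mult.assoc)
  then have "?D X = ?D Y * (cmod (det g))\<^sup>2"
    using top_of_std_nonzero[OF assms(1)] by (simp del: of_real_mult add: of_real_eq_iff)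
  then show ?thesis using frame_det_nonzero[OF assms(1)] by (auto simp: sgn_mult)
qed

lemma orient_sign_frame:
  assumes A: "A ** A = - mat 1" and X: "dual_frames A a X"
  shows "orient_sign A = sgn (det (vector (frame_list A X) :: real^6^6))"
  unfolding orient_sign_def Let_def
proof (rule the_equality)
  show "\<exists>u v w. det (vector [u, A *v u, v, A *v v, w, A *v w] :: real^6^6) \<noteq> 0 \<and>
     sgn (det (vector (frame_list A X) :: real^6^6)) = sgn (det (vector [u, A *v u, v, A *v v, w, A *v w] :: real^6^6))"
    using frame_det_nonzero[OF X] unfolding frame_list_def by blast
next
  fix s assume "\<exists>u v w. det (vector [u, A *v u, v, A *v v, w, A *v w] :: real^6^6) \<noteq> 0 \<and>
     s = sgn (det (vector [u, A *v u, v, A *v v, w, A *v w] :: real^6^6))"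
  then obtain u v w where *: "det (vector [u, A *v u, v, A *v v, w, A *v w] :: real^6^6) \<noteq> 0"
     "s = sgn (det (vector [u, A *v u, v, A *v v, w, A *v w] :: real^6^6))" by blast
  define Y :: "3 \<Rightarrow> real^6" where "Y j = (if j = 1 then u else if j = 2 then v else w)" for j
  have Y: "frame_list A Y = [u, A *v u, v, A *v v, w, A *v w]" by (simp add: frame_list_def Y_def)
  then obtain b where "dual_frames A b Y" using frame_dual_coframe[OF A, of Y] * by auto
  then show "s = sgn (det (vector (frame_list A X) :: real^6^6))"
    using frame_det_sgn[OF X] * Y by metis
qed

section \<open>The Nijenhuis matrix at a point\<close>

text \<open>The algebraic symmetries of a Nijenhuis tensor: alternating and conjugate linear in each
  slot. The pointwise algebra refers only to these and therefore applies along a variation as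
  well.\<close>

definition nij_tensor :: "real^6^6 \<Rightarrow> (real^6 \<Rightarrow> real^6 \<Rightarrow> real^6) \<Rightarrow> bool" where
  "nij_tensor A n \<longleftrightarrow> (\<forall>u. linear (n u)) \<and> (\<forall>u v. n v u = - n u v) \<and>
     (\<forall>u v. n u (A *v v) = - (A *v n u v))"

text \<open>With cyclic neighbours of the indices, cofactors of a 3 x 3 matrix are written without
  alternating signs.\<close>

definition succ3 :: "3 \<Rightarrow> 3" where "succ3 j = (if j = 1 then 2 else if j = 2 then 3 else 1)"

definition pred3 :: "3 \<Rightarrow> 3" where "pred3 j = (if j = 1 then 3 else if j = 2 then 1 else 2)"

lemma succ3_simps [simp]: "succ3 1 = 2" "succ3 2 = 3" "succ3 3 = 1"
  and pred3_simps [simp]: "pred3 1 = 3" "pred3 2 = 1" "pred3 3 = 2"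
  by (simp_all add: succ3_def pred3_def)

definition cyc :: "(3 \<Rightarrow> real^6 \<Rightarrow> complex) \<Rightarrow> 3 \<Rightarrow> real^6 \<Rightarrow> real^6 \<Rightarrow> complex" where
  "cyc a j u v = a (succ3 j) u * a (pred3 j) v - a (succ3 j) v * a (pred3 j) u"

text \<open>The \<open>(0,2)\<close>-part of \<open>d\<alpha>\<close> is \<open>\<alpha> \<circ> n / 4\<close>.\<close>

definition nij_mat :: "(3 \<Rightarrow> real^6 \<Rightarrow> complex) \<Rightarrow> (3 \<Rightarrow> real^6) \<Rightarrow> (real^6 \<Rightarrow> real^6 \<Rightarrow> real^6) \<Rightarrow> complex^3^3"
  where "nij_mat a X n = (\<chi> i j. a i (n (X (succ3 j)) (X (pred3 j))) / 4)"

lemma nij_tensorD: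
  assumes "nij_tensor A n"
  shows "linear (n u)" "linear (\<lambda>u. n u v)" "n v u = - n u v" "n u u = 0"
    "n u (A *v v) = - (A *v n u v)" "n (A *v u) v = - (A *v n u v)"
proof -
  show 1: "linear (n u)" "n v u = - n u v" "n u (A *v v) = - (A *v n u v)" for u v
    using assms unfolding nij_tensor_def by blast+
  have "(\<lambda>u. n u v) = (\<lambda>u. - n v u)" using 1(2) by blast
  then show "linear (\<lambda>u. n u v)" using linear_compose_neg[OF 1(1)] by metis
  have "2 *\<^sub>R n u u = 0" using 1(2)[of u u] by (simp add: scaleR_2)
  then show "n u u = 0" by simp
  show "n (A *v u) v = - (A *v n u v)"
  proof -
    have "n (A *v u) v = - n v (A *v u)" by (rule 1(2))
    also have "\<dots> = A *v n v u" by (simp only: 1(3) minus_minus)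
    also have "n v u = - n u v" by (rule 1(2))
    finally show ?thesis by (simp only: linear_neg[OF matrix_vector_mul_linear])
  qed
qed

lemma dual_framesD:
  assumes "dual_frames A a X"
  shows "linear (a i)" "a i (A *v v) = \<i> * a i v" "a i (X j) = (if i = j then 1 else 0)"
  using assms by (auto simp: dual_frames_def)

lemma linear_cnj: "linear f \<Longrightarrow> linear (\<lambda>v. cnj (f v))"
  by (simp add: linear_iff)

lemma antilinear_expansion:
  assumes X: "dual_frames A a X" and "linear f" "\<And>v. f (A *v v) = - \<i> * f v"
  shows "f v = (\<Sum>j\<in>UNIV. f (X j) * cnj (a j v))"
proof -
  have "cnj (f v) = (\<Sum>j\<in>UNIV. cnj (f (X j)) * a j v)"
    by (rule coframe_change[OF X linear_cnj[OF assms(2)]]) (simp add: assms(3))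
  then have "cnj (cnj (f v)) = cnj (\<Sum>j\<in>UNIV. cnj (f (X j)) * a j v)" by simp
  then show ?thesis by simp
qed

text \<open>Being conjugate linear in both slots, \<open>a i (n u v)\<close> is a combination of
  conjugates of products \<open>a k u * a j v\<close>; skewness groups these into the three cyclic
  pairs.\<close>

lemma nij_mat_expand:
  assumes X: "dual_frames A a X" and n: "nij_tensor A n"
  shows "a i (n u v) = 4 * (\<Sum>j\<in>UNIV. nij_mat a X n $ i $ j * cnj (cyc a j u v))"
proof -
  note a = dual_framesD[OF X] and n = nij_tensorD[OF n]
  let ?f = "\<lambda>u v. a i (n u v)"
  have 1: "?f u v = (\<Sum>j\<in>UNIV. ?f u (X j) * cnj (a j v))" for u v
    by (rule antilinear_expansion[OF X linear_compose[OF n(1) a(1), unfolded comp_def]])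
       (simp add: n(5) linear_neg[OF a(1)] a(2))
  have 2: "?f u v = (\<Sum>j\<in>UNIV. ?f (X j) v * cnj (a j u))" for u v
    by (rule antilinear_expansion[OF X linear_compose[OF n(2) a(1), unfolded comp_def]])
       (simp add: n(6) linear_neg[OF a(1)] a(2))
  have f: "?f (X k) (X k) = 0" "?f (X 2) (X 1) = - ?f (X 1) (X 2)" "?f (X 3) (X 2) = - ?f (X 2) (X 3)"
    "?f (X 1) (X 3) = - ?f (X 3) (X 1)" for k
    using n(3)[of "X 2" "X 1"] n(3)[of "X 3" "X 2"] n(3)[of "X 1" "X 3"] n(4)[of "X k"]
    by (simp_all add: linear_neg[OF a(1)] linear_0[OF a(1)])
  have "?f u v = (\<Sum>j\<in>UNIV. (\<Sum>k\<in>UNIV. ?f (X k) (X j) * cnj (a k u)) * cnj (a j v))"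
    by (subst 1, subst 2) simp
  then show ?thesis
    by (simp add: sum_3 f nij_mat_def cyc_def algebra_simps)
qed

lemma cyc_frame:
  assumes "dual_frames A a X"
  shows "cyc a k (X (succ3 j)) (X (pred3 j)) = (if k = j then 1 else 0)"
proof -
  have "\<forall>k j. cyc a k (X (succ3 j)) (X (pred3 j)) = (if k = j then 1 else 0)"
    by (simp add: forall_3 cyc_def dual_framesD(3)[OF assms])
  then show ?thesis by blast
qed

lemma nij_mat_unique:
  assumes X: "dual_frames A a X"
    and "\<And>i u v. a i (n u v) = 4 * (\<Sum>j\<in>UNIV. M $ i $ j * cnj (cyc a j u v))"
  shows "M = nij_mat a X n"
  by (simp add: vec_eq_iff nij_mat_def assms(2) cyc_frame[OF X] if_distrib[of cnj] if_distrib[of "(*) _"] cong: if_cong)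

section \<open>The polarised adjugate, the polarised determinant and the form omega\<close>

lemma adj_pol_entries:
  "adj_pol a b = (\<chi> i j. (a $ succ3 j $ succ3 i * b $ pred3 j $ pred3 i - a $ succ3 j $ pred3 i * b $ pred3 j $ succ3 i
     + b $ succ3 j $ succ3 i * a $ pred3 j $ pred3 i - b $ succ3 j $ pred3 i * a $ pred3 j $ succ3 i) / 2)"
  by (simp add: vec_eq_iff forall_3 adj_pol_def adjugate_def det_3 axis_def) algebra

text \<open>This is the full polarisation of 3 det a = tr(adj(a) a).\<close>

lemma det_pol_adj_pol: "det_pol a b c = (\<Sum>i\<in>UNIV. \<Sum>j\<in>UNIV. adj_pol a b $ i $ j * c $ j $ i) / 3"
proof -
  have "det (a + b + c) - det (a + b) - det (b + c) - det (a + c) + det a + det b + det c =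
     2 * (\<Sum>i\<in>UNIV. \<Sum>j\<in>UNIV. adj_pol a b $ i $ j * c $ j $ i)"
    unfolding adj_pol_entries det_3 sum_3 vec_lambda_beta succ3_simps pred3_simps vector_add_component
    by algebra
  then show ?thesis by (simp add: det_pol_def)
qed

abbreviation Q_mat :: "complex^3^3 \<Rightarrow> complex^3^3" where
  "Q_mat N \<equiv> adj_pol (transpose N) (cnj_mat N)"

abbreviation P_num :: "complex^3^3 \<Rightarrow> complex" where
  "P_num N \<equiv> det_pol (cnj_mat N) (cnj_mat N) (transpose N)"

lemma Q_mat_hermitian: "cnj (Q_mat N $ i $ j) = Q_mat N $ j $ i"
  by (simp add: adj_pol_entries transpose_def cnj_mat_def algebra_simps)

text \<open>The contraction of Q with N itself; through it the cyclic sum of \<omega>(n(u,v),w)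
  becomes a multiple of Im \<psi>.\<close>

lemma cnj_P_num: "cnj (P_num N) = (\<Sum>i\<in>UNIV. \<Sum>j\<in>UNIV. Q_mat N $ i $ j * N $ i $ j) / 3"
  by (simp add: det_pol_adj_pol adj_pol_entries sum_3 transpose_def cnj_mat_def field_simps)

text \<open>The hermitian form whose negative imaginary part is \<open>\<omega>\<close>.\<close>

definition herm :: "complex^3^3 \<Rightarrow> (3 \<Rightarrow> real^6 \<Rightarrow> complex) \<Rightarrow> real^6 \<Rightarrow> real^6 \<Rightarrow> complex" where
  "herm N a u v = (\<Sum>i\<in>UNIV. \<Sum>j\<in>UNIV. Q_mat N $ i $ j * a i u * cnj (a j v))"

lemma herm_cnj: "cnj (herm N a u v) = herm N a v u"
proof -
  have "cnj (herm N a u v) = (\<Sum>i\<in>UNIV. \<Sum>j\<in>UNIV. Q_mat N $ j $ i * a j v * cnj (a i u))"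
    by (simp add: herm_def Q_mat_hermitian algebra_simps)
  then show ?thesis unfolding herm_def by (subst sum.swap)
qed

text \<open>The trace of \<open>A \<circ> n u \<circ> n v\<close>: a formula for \<open>\<omega>\<close> without a choice of coframing.\<close>

definition omega_pt :: "real^6^6 \<Rightarrow> (real^6 \<Rightarrow> real^6 \<Rightarrow> real^6) \<Rightarrow> real^6 \<Rightarrow> real^6 \<Rightarrow> complex" where
  "omega_pt A n u v = complex_of_real (\<Sum>b\<in>UNIV. (A *v n u (n v (axis b 1))) $ b) / 64"

text \<open>In the basis \<open>X j\<close>, \<open>A *v X j\<close> the real part of each diagonal
  entry of the complex matrix is counted twice.\<close>

lemma trace_frame:
  assumes X: "dual_frames A a X" and M: "linear M" "\<And>v. M (A *v v) = A *v M v"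
  shows "(\<Sum>b\<in>UNIV. M (axis b 1) $ b) = 2 * Re (\<Sum>k\<in>UNIV. a k (M (X k)))"
proof -
  note a = dual_framesD[OF X]
  have "M (axis b 1) = (\<Sum>j\<in>UNIV. Re (a j (axis b 1)) *\<^sub>R M (X j) + Im (a j (axis b 1)) *\<^sub>R M (A *v X j))" for b
    by (subst frame_expansion[OF X, of "axis b 1"])
       (simp add: linear_sum[OF M(1)] linear_add[OF M(1)] linear_scale[OF M(1)])
  then have "(\<Sum>b\<in>UNIV. M (axis b 1) $ b) = (\<Sum>b\<in>UNIV. \<Sum>j\<in>UNIV.
      Re (a j (axis b 1)) * M (X j) $ b + Im (a j (axis b 1)) * M (A *v X j) $ b)"
    by (simp add: sum_component)
  also have "\<dots> = (\<Sum>j\<in>UNIV. \<Sum>b\<in>UNIV. Re (a j (axis b 1)) * M (X j) $ b + Im (a j (axis b 1)) * M (A *v X j) $ b)"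
    by (rule sum.swap)
  also have "\<dots> = (\<Sum>j\<in>UNIV. Re (a j (M (X j))) + Im (a j (M (A *v X j))))"
    by (intro sum.cong refl)
       (simp add: sum.distrib linear_axis_expansion[OF a(1), of _ "M _"] mult.commute)
  also have "\<dots> = 2 * Re (\<Sum>k\<in>UNIV. a k (M (X k)))"
    by (simp add: M(2) a(2) sum_distrib_left)
  finally show ?thesis .
qed

text \<open>The constant 64 collects 2 for the real trace, 16 for the two factors 4 in
  \<open>nij_mat_expand\<close>, and 2 for the division in \<open>adj_pol\<close>. The factor A
  turns the real part of the trace into an imaginary part.\<close>

lemma omega_pt_eq:
  assumes X: "dual_frames A a X" and n: "nij_tensor A n"
  shows "omega_pt A n u v = - complex_of_real (Im (herm (nij_mat a X n) a u v))"
proof -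
  let ?N = "nij_mat a X n"
  note a = dual_framesD[OF X] and nD = nij_tensorD[OF n]
  let ?M = "\<lambda>w. A *v n u (n v w)"
  have "linear ?M"
    using linear_compose[OF linear_compose[OF nD(1) nD(1)] matrix_vector_mul_linear] by (simp add: comp_def)
  moreover have "?M (A *v w) = A *v ?M w" for w
    by (simp add: nD(5) linear_neg[OF nD(1)])
  ultimately have "(\<Sum>b\<in>UNIV. ?M (axis b 1) $ b) = 2 * Re (\<Sum>k\<in>UNIV. a k (?M (X k)))"
    by (rule trace_frame[OF X])
  moreover have "(\<Sum>k\<in>UNIV. a k (n u (n v (X k)))) = - 32 * herm ?N a v u"
  proof -
    have "cyc a j v (X k) = a (succ3 j) v * (if pred3 j = k then 1 else 0) - (if succ3 j = k then 1 else 0) * a (pred3 j) v" for j k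
      by (simp add: cyc_def a(3))
    then show ?thesis
      unfolding nij_mat_expand[OF X n, of _ u] cyc_def[of _ _ u] nij_mat_expand[OF X n, of _ v]
      by (simp add: sum_3 herm_def adj_pol_entries transpose_def cnj_mat_def) (simp add: algebra_simps)
  qed
  ultimately have "(\<Sum>b\<in>UNIV. ?M (axis b 1) $ b) = 64 * Im (herm ?N a v u)"
    by (simp add: a(2) flip: sum_distrib_left)
  then show ?thesis
    by (simp add: omega_pt_def herm_cnj[symmetric, of _ _ u v])
qed

definition cyclic_sum :: "(real^6 \<Rightarrow> real^6 \<Rightarrow> complex) \<Rightarrow> (real^6 \<Rightarrow> real^6 \<Rightarrow> real^6) \<Rightarrow>
    real^6 \<Rightarrow> real^6 \<Rightarrow> real^6 \<Rightarrow> complex" where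
  "cyclic_sum w n u v z = w (n u v) z + w (n v z) u + w (n z u) v"

text \<open>The left side is the value on (u,v,w) of the wedge product of a cyclic pair with
  \<open>a j\<close>, in which a factor is repeated unless \<open>j = k\<close>.\<close>

lemma cyc_wedge:
  "cyc a k u v * a j w + cyc a k v w * a j u + cyc a k w u * a j v = (if j = k then vol_of a [u, v, w] else 0)"
proof -
  have "\<forall>j k. cyc a k u v * a j w + cyc a k v w * a j u + cyc a k w u * a j v = (if j = k then vol_of a [u, v, w] else 0)"
    by (simp add: forall_3 cyc_def vol_of_apply algebra_simps)
  then show ?thesis by blast
qed

text \<open>The matrix \<open>M\<close> is kept apart from \<open>N\<close>, because the identity
  serves twice: for n itself and for a type projection of the first variation of n.\<close>

lemma herm_cyclic_sum:
  assumes X: "dual_frames A a X"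
    and m: "\<And>i u v. a i (m u v) = 4 * (\<Sum>j\<in>UNIV. M $ i $ j * cnj (cyc a j u v))"
  shows "cyclic_sum (herm N a) m u v w = 4 * (\<Sum>i\<in>UNIV. \<Sum>j\<in>UNIV. Q_mat N $ i $ j * M $ i $ j) * cnj (vol_of a [u, v, w])"
proof -
  have "cyclic_sum (herm N a) m u v w = 4 * (\<Sum>i\<in>UNIV. \<Sum>j\<in>UNIV. Q_mat N $ i $ j *
      (\<Sum>k\<in>UNIV. M $ i $ k * cnj (cyc a k u v * a j w + cyc a k v w * a j u + cyc a k w u * a j v)))"
    by (simp add: cyclic_sum_def herm_def m sum_3 algebra_simps)
  then show ?thesis
    unfolding cyc_wedge by (simp add: sum_distrib_left sum_distrib_right algebra_simps if_distrib[of cnj] if_distrib[of "(*) _"] cong: if_cong)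
qed

lemma omega_cyclic_sum:
  assumes X: "dual_frames A a X" and n: "nij_tensor A n"
    and m: "\<And>i u v. a i (m u v) = 4 * (\<Sum>j\<in>UNIV. M $ i $ j * cnj (cyc a j u v))"
  shows "cyclic_sum (omega_pt A n) m u v w = 4 * complex_of_real (Im (cnj
     (\<Sum>i\<in>UNIV. \<Sum>j\<in>UNIV. Q_mat (nij_mat a X n) $ i $ j * M $ i $ j) * vol_of a [u, v, w]))"
proof -
  let ?S = "\<Sum>i\<in>UNIV. \<Sum>j\<in>UNIV. Q_mat (nij_mat a X n) $ i $ j * M $ i $ j"
  have "cyclic_sum (omega_pt A n) m u v w =
      - complex_of_real (Im (cyclic_sum (herm (nij_mat a X n) a) m u v w))"
    by (simp add: cyclic_sum_def omega_pt_eq[OF X n])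
  also have "Im (cyclic_sum (herm (nij_mat a X n) a) m u v w) = 4 * Im (cnj (cnj ?S * vol_of a [u, v, w]))"
    unfolding herm_cyclic_sum[OF X m] by simp
  also have "Im (cnj z) = - Im z" for z by simp
  finally show ?thesis by (simp del: Im_sum Re_sum times_complex.sel)
qed

lemma omega_cyclic_sum_psi:
  assumes X: "dual_frames A a X" and n: "nij_tensor A n"
  shows "cyclic_sum (omega_pt A n) n u v w = 12 * complex_of_real (Im (P_num (nij_mat a X n) * vol_of a [u, v, w]))"
proof -
  have "cnj (\<Sum>i\<in>UNIV. \<Sum>j\<in>UNIV. Q_mat (nij_mat a X n) $ i $ j * nij_mat a X n $ i $ j) = 3 * P_num (nij_mat a X n)"
    using arg_cong[OF cnj_P_num, of cnj "nij_mat a X n"] by (simp only: complex_cnj_cnj) (simp add: field_simps)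
  then show ?thesis
    unfolding omega_cyclic_sum[OF X n nij_mat_expand[OF X n]] by (simp add: mult.assoc)
qed

section \<open>Change of coframe\<close>

lemma cyc_change:
  fixes a a' :: "3 \<Rightarrow> real^6 \<Rightarrow> complex"
  assumes "\<And>i v. a' i v = (\<Sum>j\<in>UNIV. g $ i $ j * a j v)"
  shows "cyc a' k u v = (\<Sum>l\<in>UNIV. adjugate g $ l $ k * cyc a l u v)"
proof -
  have "\<forall>k. cyc a' k u v = (\<Sum>l\<in>UNIV. adjugate g $ l $ k * cyc a l u v)"
    by (simp add: forall_3 cyc_def assms sum_3 adjugate_def det_3 axis_def algebra_simps)
  then show ?thesis by blast
qed

lemma det_adjugate:
  assumes "det g \<noteq> 0"
  shows "det (adjugate g) = (det g)\<^sup>2"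
proof -
  have "det (mat (det g) :: complex^3^3) = det g ^ 3"
    by (simp add: det_3 mat_def power3_eq_cube)
  then have "det g * det (adjugate g) = det g ^ 3"
    using adjugate_mult[of g] by (metis det_mul)
  then show ?thesis using assms by (simp add: power2_eq_square power3_eq_cube)
qed

text \<open>The functional \<open>b i (n u v)\<close> is expanded once through \<open>a\<close> and
  once directly; the cyclic pairs of the two coframes are related by the adjugate of
  \<open>g\<close>.\<close>

lemma nij_mat_change:
  assumes X: "dual_frames A a X" and Y: "dual_frames A b Y" and n: "nij_tensor A n"
    and g: "\<And>i v. b i v = (\<Sum>j\<in>UNIV. g $ i $ j * a j v)"
  shows "g ** nij_mat a X n = nij_mat b Y n ** cnj_mat (transpose (adjugate g))"
proof -
  let ?M = "g ** nij_mat a X n" and ?M' = "nij_mat b Y n ** cnj_mat (transpose (adjugate g))"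
  have 1: "b i (n u v) = 4 * (\<Sum>j\<in>UNIV. ?M $ i $ j * cnj (cyc a j u v))" for i u v
    unfolding g nij_mat_expand[OF X n] by (simp add: sum_3 matrix_matrix_mult_def algebra_simps)
  have 2: "b i (n u v) = 4 * (\<Sum>j\<in>UNIV. ?M' $ i $ j * cnj (cyc a j u v))" for i u v
    unfolding nij_mat_expand[OF Y n] cyc_change[OF g]
    by (simp add: sum_3 matrix_matrix_mult_def cnj_mat_def transpose_def algebra_simps)
  have "?M $ i $ j = ?M' $ i $ j" for i j
    using trans[OF 1[symmetric] 2, of i "X (succ3 j)" "X (pred3 j)"]
    by (simp add: cyc_frame[OF X] if_distrib[of cnj] if_distrib[of "(*) _"] cong: if_cong)
  then show ?thesis by (simp add: vec_eq_iff)
qed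

lemma coframe_change_det:
  assumes X: "dual_frames A a X" and Y: "dual_frames A b Y"
    and g: "\<And>i v. b i v = (\<Sum>j\<in>UNIV. g $ i $ j * a j v)"
  shows "det g \<noteq> 0"
proof -
  have "g ** (\<chi> j k. a j (Y k)) = mat 1"
    using dual_framesD(3)[OF Y] by (simp add: vec_eq_iff matrix_matrix_mult_def g[symmetric] mat_def)
  then show ?thesis by (metis det_I det_mul mult_zero_left zero_neq_one)
qed

lemma cnj_mat_det: "det (cnj_mat M) = cnj (det M)"
  by (simp add: det_3 cnj_mat_def)

text \<open>By the transformation law the modulus of the determinant is divided by
  \<open>cmod (det g)\<close>, while the top form is multiplied by the square of this
  number.\<close>

lemma det_nij_top_of:
  assumes X: "dual_frames A a X" and Y: "dual_frames A b Y" and n: "nij_tensor A n"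
  shows "complex_of_real ((cmod (det (nij_mat b Y n)))\<^sup>2) * top_of b vs =
         complex_of_real ((cmod (det (nij_mat a X n)))\<^sup>2) * top_of a vs"
proof -
  define g :: "complex^3^3" where "g = (\<chi> i j. b i (X j))"
  have g: "b i v = (\<Sum>j\<in>UNIV. g $ i $ j * a j v)" for i v
    using coframe_change[OF X, of "b i" v] dual_framesD[OF Y] by (simp add: g_def)
  let ?N = "det (nij_mat a X n)" and ?N' = "det (nij_mat b Y n)"
  have g0: "det g \<noteq> 0" by (rule coframe_change_det[OF X Y g])
  have "det g * ?N = ?N' * cnj (det (adjugate g))"
    using arg_cong[OF nij_mat_change[OF X Y n g], of det] by (simp add: det_mul cnj_mat_det)
  then have "det g * ?N = ?N' * (cnj (det g))\<^sup>2" by (simp add: det_adjugate[OF g0])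
  then have "cmod (det g) * cmod ?N = cmod ?N' * (cmod (det g))\<^sup>2"
    by (metis norm_mult norm_power complex_mod_cnj)
  then have "cmod ?N = cmod ?N' * cmod (det g)"
    using g0 by (simp add: power2_eq_square)
  then show ?thesis
    unfolding top_of_change[OF g] by (simp add: power_mult_distrib complex_norm_square[of "det g", symmetric])
qed

section \<open>Projection of coframes to a nearby complex structure\<close>

text \<open>The (1,0)-part, with respect to \<open>B\<close>, of a coframe that belongs to another
  structure. It is affine in \<open>B\<close> and remains a coframe as long as its matrix of values
  on fixed vectors, \<open>gram\<close>, is invertible.\<close>

definition proj_cof :: "real^6^6 \<Rightarrow> (3 \<Rightarrow> real^6 \<Rightarrow> complex) \<Rightarrow> 3 \<Rightarrow> real^6 \<Rightarrow> complex" where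
  "proj_cof B a i v = (a i v - \<i> * a i (B *v v)) / 2"

definition gram :: "(3 \<Rightarrow> real^6 \<Rightarrow> complex) \<Rightarrow> (3 \<Rightarrow> real^6) \<Rightarrow> complex^3^3" where
  "gram a X = (\<chi> i j. a i (X j))"

lemma complex_structure_square: "B ** B = - mat 1 \<Longrightarrow> B *v (B *v v) = - (v :: real^6)"
  by (simp add: matrix_vector_mul_assoc)
     (simp add: matrix_vector_mult_def mat_def vec_eq_iff if_distrib[of "\<lambda>x. x * _"] sum_negf cong: if_cong)

lemma proj_cof_linear: "linear (a i) \<Longrightarrow> linear (proj_cof B a i)"
  by (rule linearI) (simp_all add: proj_cof_def matrix_vector_right_distrib matrix_vector_mult_scaleR
      linear_add[of "a i"] linear_scale[of "a i"] field_simps scaleR_conv_of_real[where 'a = complex])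

lemma proj_cof_type:
  assumes "B ** B = - mat 1" "linear (a i)"
  shows "proj_cof B a i (B *v v) = \<i> * proj_cof B a i v"
  by (simp add: proj_cof_def complex_structure_square[OF assms(1)] linear_neg[OF assms(2)] field_simps)

lemma proj_cof_dual:
  assumes B: "B ** B = - mat 1" and lin: "\<And>i. linear (a i)" and g: "det (gram (proj_cof B a) X) \<noteq> 0"
  shows "\<exists>Y. dual_frames B (proj_cof B a) Y"
proof (rule independent_dual_frame)
  fix k :: "3 \<Rightarrow> complex"
  assume k: "\<And>v. (\<Sum>i\<in>UNIV. k i * proj_cof B a i v) = 0"
  obtain h where "gram (proj_cof B a) X ** h = mat 1"
    using g invertible_det_nz[of "gram (proj_cof B a) X"] unfolding invertible_def by blast
  then have h: "(\<Sum>j\<in>UNIV. gram (proj_cof B a) X $ i $ j * h $ j $ l) = (if i = l then 1 else 0)" for i l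
    by (simp add: vec_eq_iff matrix_matrix_mult_def mat_def)
  have "k l = (\<Sum>i\<in>UNIV. k i * (\<Sum>j\<in>UNIV. gram (proj_cof B a) X $ i $ j * h $ j $ l))" for l
    by (simp add: h if_distrib[of "(*) _"] cong: if_cong)
  also have "\<dots> l = (\<Sum>j\<in>UNIV. (\<Sum>i\<in>UNIV. k i * proj_cof B a i (X j)) * h $ j $ l)" for l
    by (simp add: sum_3 gram_def algebra_simps)
  finally show "\<forall>i. k i = 0" by (simp add: k)
qed (simp_all add: proj_cof_linear lin proj_cof_type[OF B])

lemma proj_cof_self:
  assumes "dual_frames A a X"
  shows "proj_cof A a = a"
  by (simp add: fun_eq_iff proj_cof_def dual_framesD(2)[OF assms] field_simps)

lemma gram_self: "dual_frames A a X \<Longrightarrow> gram a X = mat 1"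
  by (simp add: vec_eq_iff gram_def mat_def dual_framesD(3))

text \<open>On the vectors \<open>X\<close> the cyclic pairs take the cofactors of
  \<open>gram b X\<close> as values, so that multiplication with this matrix leaves its determinant.
  The dual vectors \<open>Y\<close>, which move with the structure, are thereby eliminated from the
  Nijenhuis matrix.\<close>

lemma nij_mat_gram:
  assumes Y: "dual_frames B b Y" and n: "nij_tensor B n"
  shows "nij_mat b Y n $ i $ l * cnj (det (gram b X)) =
     (\<Sum>j\<in>UNIV. nij_mat b X n $ i $ j * cnj (gram b X $ l $ j))"
proof -
  have cyc: "\<forall>k l. (\<Sum>j\<in>UNIV. cyc b k (X (succ3 j)) (X (pred3 j)) * b l (X j)) = (if k = l then det (gram b X) else 0)"
    by (simp add: forall_3 sum_3 cyc_def gram_def det_3 algebra_simps)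
  have "(\<Sum>j\<in>UNIV. nij_mat b X n $ i $ j * cnj (gram b X $ l $ j)) =
      (\<Sum>k\<in>UNIV. nij_mat b Y n $ i $ k * cnj (\<Sum>j\<in>UNIV. cyc b k (X (succ3 j)) (X (pred3 j)) * b l (X j)))"
    unfolding nij_mat_def[of b X] by (simp add: nij_mat_expand[OF Y n] gram_def sum_3 field_simps)
  then show ?thesis
    by (simp add: cyc if_distrib[of cnj] if_distrib[of "(*) _"] cong: if_cong)
qed

section \<open>The invariant forms of an almost complex structure in coordinates\<close>

definition acs_on :: "(real^6) set \<Rightarrow> field \<Rightarrow> bool" where
  "acs_on V J \<longleftrightarrow> open V \<and> smooth_on V J \<and> (\<forall>x\<in>V. J x ** J x = - mat 1)"

definition Dfield :: "field \<Rightarrow> real^6 \<Rightarrow> real^6 \<Rightarrow> real^6^6" where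
  "Dfield J x w = frechet_derivative J (at x) w"

text \<open>This is \<open>[Ju,Jv] - J[Ju,v] - J[u,Jv] - [u,v]\<close> for constant vector fields \<open>u\<close> and \<open>v\<close>.\<close>

definition nij :: "field \<Rightarrow> real^6 \<Rightarrow> real^6 \<Rightarrow> real^6 \<Rightarrow> real^6" where
  "nij J x u v = Dfield J x (J x *v u) *v v - Dfield J x (J x *v v) *v u
     - J x *v (Dfield J x u *v v) + J x *v (Dfield J x v *v u)"

lemma bounded_bilinear_matrix_vector: "bounded_bilinear ((*v) :: real^6^6 \<Rightarrow> real^6 \<Rightarrow> real^6)"
  unfolding bilinear_conv_bounded_bilinear[symmetric] bilinear_def
  by (auto intro!: linearI simp: matrix_vector_mult_add_rdistrib matrix_vector_right_distrib
      matrix_vector_mult_scaleR scaleR_matrix_vector_assoc)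

lemma bounded_linear_matrix_vector_left: "bounded_linear (\<lambda>A. (A :: real^6^6) *v v)"
  by (rule bounded_bilinear.bounded_linear_left[OF bounded_bilinear_matrix_vector])

lemma acs_onD:
  assumes "acs_on V J"
  shows "open V" "smooth_on V J" "x \<in> V \<Longrightarrow> J x *v (J x *v v) = - v" "x \<in> V \<Longrightarrow> J x ** J x = - mat 1"
    "x \<in> V \<Longrightarrow> (J has_derivative Dfield J x) (at x)"
    "x \<in> V \<Longrightarrow> linear (Dfield J x)"
proof -
  show 1: "open V" "smooth_on V J" "x \<in> V \<Longrightarrow> J x ** J x = - mat 1"
    using assms by (simp_all add: acs_on_def)
  show "x \<in> V \<Longrightarrow> J x *v (J x *v v) = - v"
    by (rule complex_structure_square[OF 1(3)])
  show "x \<in> V \<Longrightarrow> (J has_derivative Dfield J x) (at x)"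
    using smooth_on_has_derivative[OF 1(2)] unfolding Dfield_def .
  then show "x \<in> V \<Longrightarrow> linear (Dfield J x)" by (rule has_derivative_linear)
qed

lemma J_vec_has_derivative:
  assumes "acs_on V J" "x \<in> V"
  shows "((\<lambda>y. J y *v v) has_derivative (\<lambda>h. Dfield J x h *v v)) (at x)"
  by (rule bounded_linear.has_derivative[OF bounded_linear_matrix_vector_left acs_onD(5)[OF assms]])

lemma Dfield_anticommute:
  assumes "acs_on V J" "x \<in> V"
  shows "Dfield J x w *v (J x *v v) = - (J x *v (Dfield J x w *v v))"
proof -
  have "((\<lambda>y. J y *v (J y *v v)) has_derivative
      (\<lambda>h. J x *v (Dfield J x h *v v) + Dfield J x h *v (J x *v v))) (at x)"
    by (rule bounded_bilinear.FDERIV[OF bounded_bilinear_matrix_vector acs_onD(5)[OF assms] J_vec_has_derivative[OF assms]])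
  moreover have "((\<lambda>y. J y *v (J y *v v)) has_derivative (\<lambda>h. 0)) (at x)"
    by (rule has_derivative_transform_within_open[OF has_derivative_const acs_onD(1)[OF assms(1)] assms(2), of "- v"])
       (simp add: acs_onD(3)[OF assms(1)])
  ultimately have "(\<lambda>h. J x *v (Dfield J x h *v v) + Dfield J x h *v (J x *v v)) = (\<lambda>h. 0)"
    by (rule has_derivative_unique)
  from fun_cong[OF this, of w] show ?thesis by (simp only: add_eq_0_iff)
qed

lemma matrix_vector_neg: "(A :: real^6^6) *v (- v) = - (A *v v)" "(- A) *v v = - (A *v v)"
  by (rule linear_neg[OF matrix_vector_mul_linear])
     (rule bounded_bilinear.minus_left[OF bounded_bilinear_matrix_vector])

lemma nij_tensor_nij:
  assumes "acs_on V J" "x \<in> V"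
  shows "nij_tensor (J x) (nij J x)"
proof -
  note D = acs_onD(6)[OF assms]
  note rules = matrix_vector_right_distrib matrix_vector_mult_scaleR matrix_vector_mult_add_rdistrib
    scaleR_matrix_vector_assoc[symmetric] linear_add[OF D] linear_scale[OF D]
  have "linear (nij J x u)" for u
    by (rule linearI) (simp_all add: nij_def rules algebra_simps)
  moreover have "nij J x v u = - nij J x u v" for u v by (simp add: nij_def)
  moreover have "nij J x u (J x *v v) = - (J x *v nij J x u v)" for u v
    by (simp add: nij_def Dfield_anticommute[OF assms] acs_onD(3)[OF assms] linear_neg[OF D]
        matrix_vector_neg matrix_vector_right_distrib matrix_vector_mult_diff_distrib)
  ultimately show ?thesis unfolding nij_tensor_def by blast
qed

subsection \<open>Type components\<close>

lemma type_part_length: "int (length vs) \<noteq> p + q \<Longrightarrow> type_part A p q \<eta> vs = 0"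
  by (simp add: type_part_def)

lemma type_part_zero: "hom_form k \<eta> \<Longrightarrow> p + q \<noteq> int k \<Longrightarrow> type_part A p q \<eta> vs = 0"
  unfolding type_part_def hom_form_def by (auto intro!: sum.neutral)

lemma type_part_neg: "p < 0 \<Longrightarrow> type_part A p q \<eta> vs = 0"
  unfolding type_part_def by (auto intro!: sum.neutral)

lemma lessThan_small: "{..<1::nat} = {0}" "{..<2::nat} = {0, 1}" "{..<3::nat} = {0, 1, 2}"
  by auto

lemma subsets_card:
  "{S. S \<subseteq> {..<n::nat} \<and> int (card S) = p} = {S \<in> Pow {..<n}. int (card S) = p}"
  by auto

lemma type_part_1:
  "type_part A 1 0 \<eta> [v] = (\<eta> [v] - \<i> * \<eta> [A *v v]) / 2"
  "type_part A 0 1 \<eta> [v] = (\<eta> [v] + \<i> * \<eta> [A *v v]) / 2"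
proof -
  have P: "Pow {..<1::nat} = {{}, {0}}" by auto
  have S: "{S. S \<subseteq> {..<1::nat} \<and> int (card S) = 1} = {{0}}" "{S. S \<subseteq> {..<1::nat} \<and> int (card S) = 0} = {{}}"
    unfolding subsets_card P by auto
  show "type_part A 1 0 \<eta> [v] = (\<eta> [v] - \<i> * \<eta> [A *v v]) / 2"
    "type_part A 0 1 \<eta> [v] = (\<eta> [v] + \<i> * \<eta> [A *v v]) / 2"
    using S P by (simp_all add: type_part_def field_simps)
qed

lemma Pow_2: "Pow {..<2::nat} = {{}, {0}, {1}, {0, 1}}"
  unfolding lessThan_small by (auto simp: Pow_insert)

lemma type_part_2:
  "type_part A 2 0 \<eta> [u, v] = (\<eta> [u, v] - \<i> * \<eta> [A *v u, v] - \<i> * \<eta> [u, A *v v] - \<eta> [A *v u, A *v v]) / 4"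
  "type_part A 0 2 \<eta> [u, v] = (\<eta> [u, v] + \<i> * \<eta> [A *v u, v] + \<i> * \<eta> [u, A *v v] - \<eta> [A *v u, A *v v]) / 4"
  "type_part A 1 1 \<eta> [u, v] = (\<eta> [u, v] + \<eta> [A *v u, A *v v]) / 2"
proof -
  have S: "{S. S \<subseteq> {..<2::nat} \<and> int (card S) = 2} = {{0, 1}}" "{S. S \<subseteq> {..<2::nat} \<and> int (card S) = 0} = {{}}"
    "{S. S \<subseteq> {..<2::nat} \<and> int (card S) = 1} = {{0}, {1}}"
    unfolding subsets_card Pow_2 by auto
  have ne: "({0::nat} = {0, Suc 0}) = False" "({Suc 0} = {0::nat, Suc 0}) = False" by auto
  show "type_part A 2 0 \<eta> [u, v] = (\<eta> [u, v] - \<i> * \<eta> [A *v u, v] - \<i> * \<eta> [u, A *v v] - \<eta> [A *v u, A *v v]) / 4"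
    "type_part A 0 2 \<eta> [u, v] = (\<eta> [u, v] + \<i> * \<eta> [A *v u, v] + \<i> * \<eta> [u, A *v v] - \<eta> [A *v u, A *v v]) / 4"
    "type_part A 1 1 \<eta> [u, v] = (\<eta> [u, v] + \<eta> [A *v u, A *v v]) / 2"
    unfolding type_part_def using S Pow_2
    by (simp_all add: numeral_2_eq_2 ne field_simps)
qed

lemma Pow_3: "Pow {..<3::nat} = {{}, {0}, {1}, {0, 1}, {2}, {0, 2}, {1, 2}, {0, 1, 2}}"
  unfolding lessThan_small by (auto simp: Pow_insert)

lemma type_part_12:
  "type_part A 1 2 \<eta> [u, v, w] = (3 * \<eta> [u, v, w] + \<eta> [A *v u, A *v v, w] + \<eta> [A *v u, v, A *v w] + \<eta> [u, A *v v, A *v w]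
     + \<i> * (\<eta> [A *v u, v, w] + \<eta> [u, A *v v, w] + \<eta> [u, v, A *v w] + 3 * \<eta> [A *v u, A *v v, A *v w])) / 8"
proof -
  have S: "{S. S \<subseteq> {..<3::nat} \<and> int (card S) = 1} = {{0}, {1}, {2}}"
    unfolding subsets_card Pow_3 by auto
  have ne: "{0::nat, Suc 0} \<noteq> {0, Suc 0, Suc (Suc 0)}"
    by (rule notI, drule arg_cong[where f = "\<lambda>S. Suc (Suc 0) \<in> S"]) simp
  have ne': "{0::nat, Suc (Suc 0)} \<noteq> {0, Suc 0, Suc (Suc 0)}"
    by (rule notI, drule arg_cong[where f = "\<lambda>S. Suc 0 \<in> S"]) simp
  have ne'': "{Suc 0, Suc (Suc 0)} \<noteq> {0::nat, Suc 0, Suc (Suc 0)}"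
    by (rule notI, drule arg_cong[where f = "\<lambda>S. 0 \<in> S"]) simp
  show ?thesis
    unfolding type_part_def using S Pow_3
    by (simp add: numeral_3_eq_3 numeral_2_eq_2 doubleton_eq_iff ne ne' ne'' field_simps)
qed

subsection \<open>The part of bidegree (-1,2) on a coframing\<close>

text \<open>Forms are functions on lists and not points of a normed space. The product rule for a
  moving argument is obtained by expanding that argument in the standard basis, after which only
  numbers are differentiated.\<close>

lemma slot_has_derivative:
  fixes f :: "'a::real_normed_vector \<Rightarrow> real^6 \<Rightarrow> complex"
  assumes S: "open S" "x \<in> S" and lin: "\<And>y. y \<in> S \<Longrightarrow> linear (f y)"
    and df: "\<And>v. (\<lambda>y. f y v) differentiable at x" and X: "(X has_derivative X') (at x)"
  shows "((\<lambda>y. f y (X y)) has_derivative (\<lambda>h. frechet_derivative (\<lambda>y. f y (X x)) (at x) h + f x (X' h))) (at x)"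
proof -
  have hd: "((\<lambda>y. f y (X y)) has_derivative (\<lambda>h. \<Sum>b\<in>UNIV. complex_of_real (X x $ b) * frechet_derivative (\<lambda>y. f y (axis b 1)) (at x) h
      + complex_of_real (X' h $ b) * f x (axis b 1))) (at x)"
    if X: "(X has_derivative X') (at x)" for X X'
  proof (rule has_derivative_transform_within_open[OF _ S])
    have "((\<lambda>y. complex_of_real (X y $ b)) has_derivative (\<lambda>h. complex_of_real (X' h $ b))) (at x)" for b
      by (rule has_derivative_of_real[OF bounded_linear.has_derivative[OF bounded_linear_vec_nth X]])
    from has_derivative_mult[OF this has_derivative_frechet[OF df]]
    show "((\<lambda>y. \<Sum>b\<in>UNIV. complex_of_real (X y $ b) * f y (axis b 1)) has_derivative
        (\<lambda>h. \<Sum>b\<in>UNIV. complex_of_real (X x $ b) * frechet_derivative (\<lambda>y. f y (axis b 1)) (at x) h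
      + complex_of_real (X' h $ b) * f x (axis b 1))) (at x)"
      by (rule has_derivative_sum)
  qed (rule linear_axis_expansion[OF lin, symmetric])
  have "frechet_derivative (\<lambda>y. f y (X x)) (at x) =
     (\<lambda>h. \<Sum>b\<in>UNIV. complex_of_real (X x $ b) * frechet_derivative (\<lambda>y. f y (axis b 1)) (at x) h)"
    using frechet_derivative_eqI[OF hd[OF has_derivative_const[of "X x"]]] by simp
  moreover have "f x (X' h) = (\<Sum>b\<in>UNIV. complex_of_real (X' h $ b) * f x (axis b 1))" for h
    by (rule linear_axis_expansion[OF lin[OF S(2)]])
  ultimately show ?thesis using hd[OF X] by (simp add: sum.distrib)
qed

text \<open>Differentiating \<open>\<alpha> (J v) = \<i> \<alpha> v\<close>, the derivatives of \<open>\<alpha>\<close> cancel in the (0,2)-part of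
  \<open>d\<alpha>\<close>, which is therefore given by the value of \<open>\<alpha>\<close> on the Nijenhuis tensor.\<close>

lemma type_part_ext_d_one_form:
  assumes J: "acs_on V J" and S: "open S" "S \<subseteq> V" "x \<in> S"
    and lin: "\<And>y. y \<in> S \<Longrightarrow> linear (\<lambda>v. \<eta> y [v])" and type: "\<And>y v. y \<in> S \<Longrightarrow> \<eta> y [J y *v v] = \<i> * \<eta> y [v]"
    and df: "\<And>v. (\<lambda>y. \<eta> y [v]) differentiable at x"
  shows "type_part (J x) 0 2 (ext_d \<eta> x) [u, v] = \<eta> x [nij J x u v] / 4"
proof -
  have x: "x \<in> V" using S by blast
  let ?D = "\<lambda>w v. frechet_derivative (\<lambda>y. \<eta> y [v]) (at x) w"
  note l = lin[OF S(3)]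
  have DJ: "?D w (J x *v v) = \<i> * ?D w v - \<eta> x [Dfield J x w *v v]" for w v
  proof -
    have "((\<lambda>y. \<eta> y [J y *v v]) has_derivative (\<lambda>h. ?D h (J x *v v) + \<eta> x [Dfield J x h *v v])) (at x)"
      by (rule slot_has_derivative[OF S(1,3) lin df J_vec_has_derivative[OF J x]])
    moreover have "((\<lambda>y. \<eta> y [J y *v v]) has_derivative (\<lambda>h. \<i> * ?D h v)) (at x)"
      by (rule has_derivative_transform_within_open[OF has_derivative_mult_right[OF has_derivative_frechet[OF df]] S(1,3)])
         (simp add: type)
    ultimately have "(\<lambda>h. ?D h (J x *v v) + \<eta> x [Dfield J x h *v v]) = (\<lambda>h. \<i> * ?D h v)"
      by (rule has_derivative_unique)
    from fun_cong[OF this, of w] show ?thesis by (simp add: eq_diff_eq)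
  qed
  have ext: "ext_d \<eta> x [u, v] = ?D u v - ?D v u" for u v
    by (simp add: ext_d_def)
  have J\<eta>: "\<eta> x [J x *v w] = \<i> * \<eta> x [w]" for w by (rule type[OF S(3)])
  show ?thesis
    unfolding type_part_2 ext DJ nij_def
    by (simp add: linear_add[OF l] linear_diff[OF l] J\<eta> field_simps)
qed

text \<open>For a form of pure type (a,b) near \<open>x\<close> a single summand of
  \<open>d_part\<close> survives: the other components vanish on an open set, or the target bidegree
  is negative, as happens to the (0,1)-component of a 1-form for \<open>r = -1\<close>.\<close>

lemma d_part_2_form:
  assumes S: "open S" "x \<in> S" and hom: "\<And>y. y \<in> S \<Longrightarrow> hom_form k (\<eta> y)"
    and p: "\<And>p q. p + q = int k \<Longrightarrow> (p, q) \<noteq> (a, b) \<Longrightarrow> p \<in> {0..3} \<Longrightarrow> q \<in> {0..3} \<Longrightarrow>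
      p + r < 0 \<or> (\<forall>y\<in>S. type_part (J y) p q (\<eta> y) = (\<lambda>vs. 0))"
    and ab: "a \<in> {0..3}" "b \<in> {0..3}" "\<And>y. y \<in> S \<Longrightarrow> type_part (J y) a b (\<eta> y) = \<eta> y"
  shows "d_part J r s \<eta> x vs = type_part (J x) (a + r) (b + s) (ext_d \<eta> x) vs"
proof -
  have z: "type_part (J x) (p + r) (q + s) (ext_d (\<lambda>y. type_part (J y) p q (\<eta> y)) x) vs = 0"
    if "p \<in> {0..3}" "q \<in> {0..3}" "(p, q) \<noteq> (a, b)" for p q
  proof (cases "p + r < 0")
    case True
    then show ?thesis by (rule type_part_neg)
  next
    case False
    have "type_part (J y) p q (\<eta> y) = (\<lambda>vs. 0)" if y: "y \<in> S" for y
    proof (cases "p + q = int k")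
      case True
      then show ?thesis using p[OF True \<open>(p, q) \<noteq> (a, b)\<close>] that \<open>p \<in> {0..3}\<close> \<open>q \<in> {0..3}\<close> False by blast
    next
      case False
      then show ?thesis using type_part_zero[OF hom[OF y] False] by blast
    qed
    then have "ext_d (\<lambda>y. type_part (J y) p q (\<eta> y)) x = ext_d (\<lambda>y vs. 0) x"
      by (rule ext_d_cong[OF S])
    also have "\<dots> = (\<lambda>vs. 0)"
      by (simp add: fun_eq_iff ext_d_def frechet_derivative_eqI[OF has_derivative_const])
    finally show ?thesis by (simp add: type_part_def)
  qed
  have "d_part J r s \<eta> x vs = (\<Sum>(p, q)\<in>{0..3} \<times> {0..3}.
      type_part (J x) (p + r) (q + s) (ext_d (\<lambda>y. type_part (J y) p q (\<eta> y)) x) vs)"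
    unfolding d_part_def by (rule sum.cartesian_product)
  also have "\<dots> = (\<Sum>pq\<in>{(a, b)}. case pq of (p, q) \<Rightarrow>
      type_part (J x) (p + r) (q + s) (ext_d (\<lambda>y. type_part (J y) p q (\<eta> y)) x) vs)"
  proof (rule sum.mono_neutral_right)
    show "\<forall>pq\<in>{0..3} \<times> {0..3} - {(a, b)}. (case pq of (p, q) \<Rightarrow>
      type_part (J x) (p + r) (q + s) (ext_d (\<lambda>y. type_part (J y) p q (\<eta> y)) x) vs) = 0"
    proof
      fix pq assume "pq \<in> {0..3::int} \<times> {0..3} - {(a, b)}"
      then show "(case pq of (p, q) \<Rightarrow>
        type_part (J x) (p + r) (q + s) (ext_d (\<lambda>y. type_part (J y) p q (\<eta> y)) x) vs) = 0"
        using z[of "fst pq" "snd pq"] by (cases pq) auto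
    qed
  qed (use ab in auto)
  also have "\<dots> = type_part (J x) (a + r) (b + s) (ext_d (\<lambda>y. type_part (J y) a b (\<eta> y)) x) vs"
    by simp
  also have "ext_d (\<lambda>y. type_part (J y) a b (\<eta> y)) x = ext_d \<eta> x"
    by (rule ext_d_cong[OF S ab(3)])
  finally show ?thesis .
qed

lemma coframingD:
  assumes "coframing J U \<alpha>" "x \<in> U"
  shows "hom_form 1 (\<alpha> i x)" "linear (\<lambda>v. \<alpha> i x [v])" "\<alpha> i x [J x *v v] = \<i> * \<alpha> i x [v]"
    "smooth_on U (\<lambda>x. \<alpha> i x [v])" "open U" "\<alpha> i x = one_form (\<lambda>v. \<alpha> i x [v])"
proof -
  show 1: "hom_form 1 (\<alpha> i x)" "linear (\<lambda>v. \<alpha> i x [v])" "\<alpha> i x [J x *v v] = \<i> * \<alpha> i x [v]"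
    "smooth_on U (\<lambda>x. \<alpha> i x [v])" "open U"
    using assms by (simp_all add: coframing_def hom_form_def)
  show "\<alpha> i x = one_form (\<lambda>v. \<alpha> i x [v])" by (rule hom_form_one_eq[OF 1(1)])
qed

lemma coframing_dual_frame:
  assumes "coframing J U \<alpha>" "x \<in> U"
  shows "\<exists>X. dual_frames (J x) (\<lambda>i v. \<alpha> i x [v]) X"
  by (rule independent_dual_frame) (use assms coframingD[OF assms] in \<open>auto simp: coframing_def\<close>)

lemma type_part_10_one_form:
  assumes "hom_form 1 \<eta>" "\<And>v. \<eta> [A *v v] = \<i> * \<eta> [v]"
  shows "type_part A 1 0 \<eta> = \<eta>"
proof
  fix vs show "type_part A 1 0 \<eta> vs = \<eta> vs"
  proof (cases "length vs = 1")
    case True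
    then obtain v where "vs = [v]" by (auto simp: length_Suc_conv)
    then show ?thesis by (simp add: type_part_1 assms(2))
  next
    case False
    then show ?thesis by (simp add: type_part_length hom_formD[OF assms(1)])
  qed
qed

lemma d_part_coframing:
  assumes J: "acs_on V J" and \<alpha>: "coframing J U \<alpha>" and x: "x \<in> U" "x \<in> V"
  shows "d_part J (-1) 2 (\<alpha> i) x vs = (case vs of [u, v] \<Rightarrow> \<alpha> i x [nij J x u v] / 4 | _ \<Rightarrow> 0)"
proof -
  have S: "open (U \<inter> V)" "x \<in> U \<inter> V" using coframingD(5)[OF \<alpha> x(1)] acs_onD(1)[OF J] x by auto
  have d: "d_part J (-1) 2 (\<alpha> i) x vs = type_part (J x) (1 + - 1) (0 + 2) (ext_d (\<alpha> i) x) vs"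
  proof (rule d_part_2_form[OF S, where k = 1])
    show "type_part (J y) 1 0 (\<alpha> i y) = \<alpha> i y" if "y \<in> U \<inter> V" for y
      using coframingD[OF \<alpha>] that by (intro type_part_10_one_form) auto
  qed (use coframingD[OF \<alpha>] in auto)
  show ?thesis
  proof (cases "length vs = 2")
    case True
    then obtain u v where vs: "vs = [u, v]" by (auto simp: numeral_2_eq_2 length_Suc_conv)
    have "type_part (J x) 0 2 (ext_d (\<alpha> i) x) [u, v] = \<alpha> i x [nij J x u v] / 4"
    proof (rule type_part_ext_d_one_form[OF J S(1) _ S(2)])
      show "(\<lambda>y. \<alpha> i y [v]) differentiable at x" for v
        by (rule smooth_on_differentiable[OF coframingD(4)[OF \<alpha> x(1)] x(1)])
    qed (use coframingD[OF \<alpha>] in auto)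
    then show ?thesis using d by (simp add: vs)
  next
    case False
    then have "d_part J (-1) 2 (\<alpha> i) x vs = 0" by (simp add: d type_part_length)
    then show ?thesis using False by (auto split: list.splits)
  qed
qed

lemma wedge_one_forms: "one_form f \<and>\<^sub>f one_form g = (\<lambda>vs. case vs of [u, v] \<Rightarrow> f u * g v - f v * g u | _ \<Rightarrow> 0)"
proof
  fix vs
  show "(one_form f \<and>\<^sub>f one_form g) vs = (case vs of [u, v] \<Rightarrow> f u * g v - f v * g u | _ \<Rightarrow> 0)"
  proof (cases "length vs = 2")
    case True
    then obtain u v where vs: "vs = [u, v]" by (auto simp: numeral_2_eq_2 length_Suc_conv)
    then show ?thesis by (simp add: one_form_wedge_Cons contr_def)
  next
    case False
    then have "(one_form f \<and>\<^sub>f one_form g) vs = 0"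
      using hom_formD[OF hom_form_wedge[OF hom_form_one hom_form_one]] by simp
    then show ?thesis using False by (auto split: list.splits)
  qed
qed

lemma cyclic_pair_eq:
  assumes "\<And>i. \<alpha> i x = one_form (a i)"
  shows "cnj_form (cyclic_pair \<alpha> x j) = (\<lambda>vs. case vs of [u, v] \<Rightarrow> cnj (cyc a j u v) | _ \<Rightarrow> 0)"
proof -
  have "\<forall>j. cyclic_pair \<alpha> x j = (\<lambda>vs. case vs of [u, v] \<Rightarrow> cyc a j u v | _ \<Rightarrow> 0)"
    by (simp add: forall_3 cyclic_pair_def assms wedge_one_forms cyc_def)
  then show ?thesis by (auto simp: fun_eq_iff cnj_form_def split: list.splits)
qed

text \<open>By \<open>d_part_coframing\<close> the condition under \<open>THE\<close> is an
  expansion of n in the coframe, for which \<open>nij_mat_expand\<close> gives existence and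
  \<open>nij_mat_unique\<close> uniqueness.\<close>

lemma Nij_eq:
  assumes J: "acs_on V J" and \<alpha>: "coframing J U \<alpha>" and x: "x \<in> U" "x \<in> V"
    and X: "dual_frames (J x) (\<lambda>i v. \<alpha> i x [v]) X"
  shows "Nij J \<alpha> x = nij_mat (\<lambda>i v. \<alpha> i x [v]) X (nij J x)"
proof -
  let ?a = "\<lambda>i v. \<alpha> i x [v]"
  note c = cyclic_pair_eq[of \<alpha> x ?a, OF coframingD(6)[OF \<alpha> x(1)]]
  have iff: "(\<forall>i vs. d_part J (-1) 2 (\<alpha> i) x vs = (\<Sum>j\<in>UNIV. N $ i $ j * cnj_form (cyclic_pair \<alpha> x j) vs)) \<longleftrightarrow>
      (\<forall>i u v. ?a i (nij J x u v) = 4 * (\<Sum>j\<in>UNIV. N $ i $ j * cnj (cyc ?a j u v)))" (is "?L \<longleftrightarrow> ?R") for N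
  proof
    assume L: ?L
    show ?R
    proof (intro allI)
      fix i u v
      from L have "d_part J (-1) 2 (\<alpha> i) x [u, v] = (\<Sum>j\<in>UNIV. N $ i $ j * cnj_form (cyclic_pair \<alpha> x j) [u, v])" by blast
      then show "?a i (nij J x u v) = 4 * (\<Sum>j\<in>UNIV. N $ i $ j * cnj (cyc ?a j u v))"
        unfolding d_part_coframing[OF J \<alpha> x] c by (simp add: field_simps)
    qed
  next
    assume R: ?R
    show ?L
      unfolding d_part_coframing[OF J \<alpha> x] c by (auto simp: R split: list.splits)
  qed
  show ?thesis
    unfolding Nij_def iff
  proof (rule the_equality)
    show "\<forall>i u v. ?a i (nij J x u v) = 4 * (\<Sum>j\<in>UNIV. nij_mat ?a X (nij J x) $ i $ j * cnj (cyc ?a j u v))"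
      using nij_mat_expand[OF X nij_tensor_nij[OF J x(2)]] by blast
  next
    fix N assume "\<forall>i u v. ?a i (nij J x u v) = 4 * (\<Sum>j\<in>UNIV. N $ i $ j * cnj (cyc ?a j u v))"
    then show "N = nij_mat ?a X (nij J x)" using nij_mat_unique[OF X] by blast
  qed
qed

subsection \<open>Existence of coframings\<close>

text \<open>Vectors u, v, w are chosen greedily outside the span of the preceding pairs. These spans
  are invariant under A, which keeps each new pair independent of them.\<close>

lemma complex_frame_exists:
  assumes A: "A ** A = - mat 1"
  shows "\<exists>a X. dual_frames A a X"
proof -
  note AA = complex_structure_square[OF A]
  have ex: "\<exists>w. w \<notin> span S" if "finite S" "card S < 6" for S :: "(real^6) set"
  proof (rule ccontr)
    assume "\<not> ?thesis"
    then have "UNIV \<subseteq> span S" by auto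
    from dim_le_card[OF this that(1)] that(2) show False by simp
  qed
  \<comment> \<open>For e = c w + d A w the combination c e - d A e equals (c^2 + d^2) w.\<close>
  have step: "c = 0 \<and> d = 0" if inv: "\<And>s. s \<in> span S \<Longrightarrow> A *v s \<in> span S" and w: "w \<notin> span S"
    and e: "c *\<^sub>R w + d *\<^sub>R (A *v w) \<in> span S" for S c d w
  proof -
    have "c *\<^sub>R (c *\<^sub>R w + d *\<^sub>R (A *v w)) - d *\<^sub>R (A *v (c *\<^sub>R w + d *\<^sub>R (A *v w))) \<in> span S"
      by (intro span_diff span_scale e inv)
    then have "(c * c + d * d) *\<^sub>R w \<in> span S"
      by (simp add: matrix_vector_right_distrib matrix_vector_mult_scaleR AA algebra_simps)
    then have "inverse (c * c + d * d) *\<^sub>R (c * c + d * d) *\<^sub>R w \<in> span S"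
      by (rule span_scale)
    then have "c * c + d * d = 0" using w by (cases "c * c + d * d = 0") simp_all
    then show ?thesis by (simp add: sum_squares_eq_zero_iff)
  qed
  have inv2: "A *v s \<in> span {u, A *v u}" if "s \<in> span {u, A *v u}" for s u
  proof -
    have "s \<in> span {u, A *v u} \<Longrightarrow> A *v s \<in> span {u, A *v u}"
      by (induction rule: span_induct_alt)
         (auto simp: matrix_vector_right_distrib matrix_vector_mult_scaleR AA
           intro!: span_add span_scale span_neg intro: span_base span_zero)
    then show ?thesis using that .
  qed
  have inv4: "A *v s \<in> span {u, A *v u, v, A *v v}" if "s \<in> span {u, A *v u, v, A *v v}" for s u v
  proof -
    have "s \<in> span {u, A *v u, v, A *v v} \<Longrightarrow> A *v s \<in> span {u, A *v u, v, A *v v}"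
      by (induction rule: span_induct_alt)
         (auto simp: matrix_vector_right_distrib matrix_vector_mult_scaleR AA
           intro!: span_add span_scale span_neg intro: span_base span_zero)
    then show ?thesis using that .
  qed
  have "\<exists>u :: real^6. u \<notin> span {}" by (rule ex) simp_all
  then obtain u :: "real^6" where u: "u \<notin> span {}" by blast
  obtain v where v: "v \<notin> span {u, A *v u}"
    using ex[of "{u, A *v u}"] card_insert_le_m1[of 2 "{A *v u}" u] by auto
  have "card {u, A *v u, v, A *v v} \<le> 4"
    by (rule order_trans[OF card_insert_le_m1[of 4] order_refl]; simp)+
       (simp_all add: card_insert_if)
  then obtain w where w: "w \<notin> span {u, A *v u, v, A *v v}"
    using ex[of "{u, A *v u, v, A *v v}"] by auto
  define X :: "3 \<Rightarrow> real^6" where "X j = (if j = 1 then u else if j = 2 then v else w)" for j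
  let ?V = "vector (frame_list A X) :: real^6^6"
  have "\<forall>i. c i = 0" if "(\<Sum>i\<in>UNIV. c i *s row i ?V) = 0" for c :: "6 \<Rightarrow> real"
  proof -
    have "row i ?V = ?V $ i" for i by (simp add: row_def vec_eq_iff)
    then have 0: "c 1 *\<^sub>R u + c 2 *\<^sub>R (A *v u) + (c 3 *\<^sub>R v + c 4 *\<^sub>R (A *v v)) + (c 5 *\<^sub>R w + c 6 *\<^sub>R (A *v w)) = 0"
      using that by (simp add: sum_6 frame_list_def X_def scalar_mult_eq_scaleR add.assoc)
    have "c 1 *\<^sub>R u + c 2 *\<^sub>R (A *v u) + (c 3 *\<^sub>R v + c 4 *\<^sub>R (A *v v)) \<in> span {u, A *v u, v, A *v v}"
      by (intro span_add span_scale span_base) auto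
    then have "- (c 1 *\<^sub>R u + c 2 *\<^sub>R (A *v u) + (c 3 *\<^sub>R v + c 4 *\<^sub>R (A *v v))) \<in> span {u, A *v u, v, A *v v}"
      by (rule span_neg)
    then have "c 5 *\<^sub>R w + c 6 *\<^sub>R (A *v w) \<in> span {u, A *v u, v, A *v v}"
      using 0 by (metis add_eq_0_iff)
    from step[OF inv4 w this] have 56: "c 5 = 0" "c 6 = 0" by auto
    have "c 1 *\<^sub>R u + c 2 *\<^sub>R (A *v u) \<in> span {u, A *v u}"
      by (intro span_add span_scale span_base) auto
    then have "- (c 1 *\<^sub>R u + c 2 *\<^sub>R (A *v u)) \<in> span {u, A *v u}" by (rule span_neg)
    then have "c 3 *\<^sub>R v + c 4 *\<^sub>R (A *v v) \<in> span {u, A *v u}"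
      using 0 56 by (simp add: add_eq_0_iff)
    from step[OF inv2 v this] have 34: "c 3 = 0" "c 4 = 0" by auto
    have "c 1 *\<^sub>R u + c 2 *\<^sub>R (A *v u) \<in> span {}" using 0 56 34 by simp
    from step[OF _ u this] have "c 1 = 0" "c 2 = 0" by auto
    then show ?thesis using 34 56 by (simp add: forall_6)
  qed
  then obtain B where "?V ** B = mat 1" using matrix_right_invertible_independent_rows[of ?V] by blast
  then have "det ?V \<noteq> 0" by (metis det_I det_mul mult_zero_left zero_neq_one)
  from frame_dual_coframe[OF A this] show ?thesis by blast
qed

lemma smooth_on_matrix_vector: "open S \<Longrightarrow> smooth_on S J \<Longrightarrow> smooth_on S (\<lambda>y. (J y :: real^6^6) *v v)"
  by (rule smooth_on_linear[OF bounded_linear_matrix_vector_left])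

lemma linear_bounded: "linear (f :: real^6 \<Rightarrow> complex) \<Longrightarrow> bounded_linear f"
  by (simp add: linear_conv_bounded_linear)

lemma smooth_on_proj_cof:
  assumes "open S" "smooth_on S J" "linear (a i)"
  shows "smooth_on S (\<lambda>y. proj_cof (J y) a i v)"
proof -
  have "smooth_on S (\<lambda>y. (1 / 2) * (a i v - \<i> * a i (J y *v v)))"
    by (intro smooth_on_mult smooth_on_diff smooth_on_const assms(1)
        smooth_on_linear[OF linear_bounded[OF assms(3)]] smooth_on_matrix_vector assms(2))
  then show ?thesis by (simp add: proj_cof_def)
qed

lemma smooth_on_det3:
  assumes "open S" "\<And>i j. smooth_on S (\<lambda>y. M y $ i $ j)"
  shows "smooth_on S (\<lambda>y. det (M y :: complex^3^3))"
  unfolding det_3 by (intro smooth_on_add smooth_on_diff smooth_on_mult assms)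

text \<open>The coframe at \<open>x\<close> is projected to type (1,0) for each \<open>J y\<close>.
  The result is a coframing where the Gram determinant, equal to 1 at \<open>x\<close>, does not
  vanish.\<close>

lemma coframing_exists:
  assumes J: "acs_on V J" "x \<in> V" and X: "dual_frames (J x) a X"
  obtains U \<alpha> where "coframing J U \<alpha>" "x \<in> U" "U \<subseteq> V" "\<And>i y v. \<alpha> i y [v] = proj_cof (J y) a i v"
proof -
  let ?g = "\<lambda>y. det (gram (proj_cof (J y) a) X)"
  define U where "U = {y \<in> V. ?g y \<noteq> 0}"
  define \<alpha> where "\<alpha> i y = one_form (proj_cof (J y) a i)" for i y
  note lin = dual_framesD(1)[OF X]
  have sm: "smooth_on V (\<lambda>y. proj_cof (J y) a i v)" for i v
    by (rule smooth_on_proj_cof[OF acs_onD(1,2)[OF J(1)] lin])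
  have "smooth_on V ?g"
    by (rule smooth_on_det3[OF acs_onD(1)[OF J(1)]]) (simp add: gram_def sm)
  then have "continuous_on V ?g" by (rule smooth_on_continuous)
  then have "open U"
    using continuous_open_preimage[OF _ acs_onD(1)[OF J(1)], of ?g "- {0}"]
    by (simp add: U_def vimage_def Int_def open_Compl)
  have xU: "x \<in> U"
    using J(2) by (simp add: U_def proj_cof_self[OF X] gram_self[OF X])
  have "coframing J U \<alpha>"
    unfolding coframing_def
  proof (intro conjI ballI allI impI)
    show "open U" by fact
    show "smooth_on U (\<lambda>y. \<alpha> i y [v])" for i v
      unfolding \<alpha>_def one_form_simps by (rule smooth_on_subset[OF sm]) (auto simp: U_def)
  next
    fix y i assume y: "y \<in> U"
    then have B: "J y ** J y = - mat 1" using acs_onD(4)[OF J(1)] by (simp add: U_def)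
    show "linear (\<lambda>v. \<alpha> i y [v])" by (simp add: \<alpha>_def proj_cof_linear lin)
    show "\<alpha> i y [J y *v v] = \<i> * \<alpha> i y [v]" for v
      by (simp add: \<alpha>_def proj_cof_type[OF B lin])
    show "\<alpha> i y vs = 0" if "length vs \<noteq> 1" for vs
      unfolding \<alpha>_def by (rule hom_formD[OF hom_form_one that])
  next
    fix y and k :: "3 \<Rightarrow> complex" and j
    assume y: "y \<in> U" and k: "\<forall>v. (\<Sum>i\<in>UNIV. k i * \<alpha> i y [v]) = 0"
    from y have B: "J y ** J y = - mat 1" using acs_onD(4)[OF J(1)] by (simp add: U_def)
    from y have "?g y \<noteq> 0" by (simp add: U_def)
    then obtain Y where Y: "dual_frames (J y) (proj_cof (J y) a) Y" using proj_cof_dual[where a = a, OF B lin] by blast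
    have "(\<Sum>i\<in>UNIV. k i * \<alpha> i y [Y j]) = k j"
      by (simp add: \<alpha>_def dual_framesD(3)[OF Y] if_distrib[of "(*) _"] cong: if_cong)
    then show "k j = 0" using k by simp
  qed
  then show thesis by (rule that[OF _ xU]) (auto simp: U_def \<alpha>_def)
qed

subsection \<open>The invariant forms\<close>

text \<open>Independence of the coframing enters as the hypothesis that \<open>E\<close> always
  takes the value \<open>\<eta>\<close>; that there is a coframing at all is
  \<open>coframing_exists\<close>.\<close>

lemma invariant_form_eq:
  assumes J: "acs_on V J" "x \<in> V"
    and E: "\<And>U \<alpha> X. coframing J U \<alpha> \<Longrightarrow> x \<in> U \<Longrightarrow> dual_frames (J x) (\<lambda>i v. \<alpha> i x [v]) X \<Longrightarrow> E J \<alpha> x = \<eta>"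
  shows "invariant_form E J x = \<eta>"
  unfolding invariant_form_def
proof (rule the_equality)
  obtain a X where aX: "dual_frames (J x) a X" using complex_frame_exists[OF acs_onD(4)[OF J]] by blast
  obtain U \<alpha> where U: "coframing J U \<alpha>" "x \<in> U" by (rule coframing_exists[OF J aX])
  then show "\<exists>U \<alpha>. coframing J U \<alpha> \<and> x \<in> U \<and> \<eta> = E J \<alpha> x"
    using coframing_dual_frame[OF U] E by metis
next
  fix \<theta> assume "\<exists>U \<alpha>. coframing J U \<alpha> \<and> x \<in> U \<and> \<theta> = E J \<alpha> x"
  then show "\<theta> = \<eta>" using coframing_dual_frame E by metis
qed

definition two_form :: "(real^6 \<Rightarrow> real^6 \<Rightarrow> complex) \<Rightarrow> form" where
  "two_form w vs = (case vs of [u, v] \<Rightarrow> w u v | _ \<Rightarrow> 0)"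

lemma two_form_simps [simp]: "two_form w [u, v] = w u v"
  by (simp add: two_form_def)

lemma hom_form_two_form: "hom_form 2 (two_form w)"
  by (auto simp: hom_form_def two_form_def split: list.splits)

lemma omega_eq:
  assumes J: "acs_on V J" "x \<in> V"
  shows "omega J x = two_form (omega_pt (J x) (nij J x))"
  unfolding omega_def
proof (rule invariant_form_eq[OF J])
  fix U \<alpha> X assume U: "coframing J U \<alpha>" "x \<in> U" and X: "dual_frames (J x) (\<lambda>i v. \<alpha> i x [v]) X"
  let ?a = "\<lambda>i v. \<alpha> i x [v]" and ?N = "Nij J \<alpha> x"
  note N = Nij_eq[OF J(1) U J(2) X]
  have w: "\<alpha> i x \<and>\<^sub>f cnj_form (\<alpha> j x) = (\<lambda>vs. case vs of [u, v] \<Rightarrow> ?a i u * cnj (?a j v) - ?a i v * cnj (?a j u) | _ \<Rightarrow> 0)" for i j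
    by (subst (1 2) coframingD(6)[OF U]) (simp only: cnj_one_form wedge_one_forms)
  have "omega_of J \<alpha> x [u, v] = omega_pt (J x) (nij J x) u v" for u v
  proof -
    have "omega_of J \<alpha> x [u, v] = \<i> / 2 * (herm ?N ?a u v - herm ?N ?a v u)"
      by (simp add: omega_of_def w herm_def sum_subtractf algebra_simps)
    also have "\<dots> = - complex_of_real (Im (herm ?N ?a u v))"
      unfolding herm_cnj[symmetric, of _ _ v u] by (simp add: complex_eq_iff)
    finally show ?thesis unfolding N omega_pt_eq[OF X nij_tensor_nij[OF J]] .
  qed
  moreover have "omega_of J \<alpha> x vs = 0" if "length vs \<noteq> 2" for vs
  proof -
    have "(case vs of [u, v] \<Rightarrow> F u v | _ \<Rightarrow> 0) = (0 :: complex)" for F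
      using that by (auto split: list.splits)
    then show ?thesis by (simp only: omega_of_def w mult_zero_right sum.neutral_const)
  qed
  ultimately show "omega_of J \<alpha> x = two_form (omega_pt (J x) (nij J x))"
    by (auto simp: fun_eq_iff two_form_def split: list.splits)
qed

lemma vol_30_eq:
  assumes "coframing J U \<alpha>" "x \<in> U"
  shows "vol_30 \<alpha> x = vol_of (\<lambda>i v. \<alpha> i x [v])"
  unfolding vol_30_def vol_of_def by (simp flip: coframingD(6)[OF assms])

text \<open>The real part of \<open>P vol\<close> is recovered from its imaginary part by inserting \<open>J\<close>.\<close>

lemma P_vol_eq:
  assumes X: "dual_frames A a X" and n: "nij_tensor A n"
  shows "P_num (nij_mat a X n) * vol_of a [u, v, w] =
    (cyclic_sum (omega_pt A n) n (A *v u) v w + \<i> * cyclic_sum (omega_pt A n) n u v w) / 12"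
proof -
  have "vol_of a [A *v u, v, w] = \<i> * vol_of a [u, v, w]"
    by (simp add: vol_of_apply dual_framesD(2)[OF X] algebra_simps)
  then show ?thesis
    unfolding omega_cyclic_sum_psi[OF X n] by (simp add: complex_eq_iff)
qed

text \<open>The right-hand side of \<open>P_vol_eq\<close> does not mention the coframe.\<close>

lemma P_vol_invariant:
  assumes X: "dual_frames A a X" and Y: "dual_frames A b Y" and n: "nij_tensor A n"
  shows "P_num (nij_mat a X n) * vol_of a vs = P_num (nij_mat b Y n) * vol_of b vs"
proof (cases "length vs = 3")
  case True
  then obtain u v w where vs: "vs = [u, v, w]" by (auto simp: numeral_3_eq_3 length_Suc_conv)
  show ?thesis unfolding vs P_vol_eq[OF X n] P_vol_eq[OF Y n] ..
qed (simp_all add: hom_formD[OF hom_form_vol_of])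

lemma psi_eq:
  assumes J: "acs_on V J" "x \<in> V" and X: "dual_frames (J x) a X"
  shows "psi J x = (\<lambda>vs. P_num (nij_mat a X (nij J x)) * vol_of a vs)"
  unfolding psi_def
proof (rule invariant_form_eq[OF J])
  fix U \<alpha> Y assume U: "coframing J U \<alpha>" "x \<in> U" and Y: "dual_frames (J x) (\<lambda>i v. \<alpha> i x [v]) Y"
  show "psi_of J \<alpha> x = (\<lambda>vs. P_num (nij_mat a X (nij J x)) * vol_of a vs)"
    unfolding psi_of_def vol_30_eq[OF U] Nij_eq[OF J(1) U J(2) Y]
    by (rule ext) (rule P_vol_invariant[OF Y X nij_tensor_nij[OF J]])
qed

lemma Phi_eq:
  assumes J: "acs_on V J" "x \<in> V" and X: "dual_frames (J x) a X"
  shows "Phi J x vs = \<i> / 8 * complex_of_real ((cmod (det (nij_mat a X (nij J x))))\<^sup>2) * top_of a vs"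
proof -
  have "Phi J x = (\<lambda>vs. \<i> / 8 * (complex_of_real ((cmod (det (nij_mat a X (nij J x))))\<^sup>2) * top_of a vs))"
    unfolding Phi_def
  proof (rule invariant_form_eq[OF J])
    fix U \<alpha> Y assume U: "coframing J U \<alpha>" "x \<in> U" and Y: "dual_frames (J x) (\<lambda>i v. \<alpha> i x [v]) Y"
    let ?a = "\<lambda>i v. \<alpha> i x [v]"
    have "\<alpha> 1 x \<and>\<^sub>f \<alpha> 2 x \<and>\<^sub>f \<alpha> 3 x \<and>\<^sub>f cnj_form (\<alpha> 1 x) \<and>\<^sub>f cnj_form (\<alpha> 2 x) \<and>\<^sub>f cnj_form (\<alpha> 3 x) = top_of ?a"
      unfolding top_of_def vol_of_def wedge_cnj wedge_assoc by (simp flip: coframingD(6)[OF U])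
    then show "Phi_of J \<alpha> x = (\<lambda>vs. \<i> / 8 * (complex_of_real ((cmod (det (nij_mat a X (nij J x))))\<^sup>2) * top_of a vs))"
      unfolding Phi_of_def Nij_eq[OF J(1) U J(2) Y]
      by (simp only: mult.assoc det_nij_top_of[OF X Y nij_tensor_nij[OF J]])
  qed
  then show ?thesis by (simp only: mult.assoc)
qed

lemma F_form_eq:
  assumes J: "acs_on V J" "x \<in> V" and X: "dual_frames (J x) a X"
  shows "F_form c1 c2 J x vs = \<i> / 8 * complex_of_real (c1 * (cmod (det (nij_mat a X (nij J x))))\<^sup>2 +
     c2 * (cmod (P_num (nij_mat a X (nij J x))))\<^sup>2) * top_of a vs"
proof -
  let ?P = "P_num (nij_mat a X (nij J x))"
  have "cnj_form (\<lambda>vs. ?P * vol_of a vs) = (\<lambda>vs. cnj ?P * cnj_form (vol_of a) vs)"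
    by (simp add: fun_eq_iff cnj_form_def)
  then have "(psi J x \<and>\<^sub>f cnj_form (psi J x)) vs = complex_of_real ((cmod ?P)\<^sup>2) * top_of a vs"
    unfolding psi_eq[OF J X]
    by (simp only: wedge_scale_left wedge_scale_right top_of_def complex_norm_square mult.assoc)
  then show ?thesis
    unfolding F_form_def Phi_eq[OF J X] by (simp add: algebra_simps)
qed

section \<open>Differential identities for forms on an almost complex manifold\<close>

definition form_on :: "(real^6) set \<Rightarrow> nat \<Rightarrow> form_field \<Rightarrow> bool" where
  "form_on V k \<eta> \<longleftrightarrow> (\<forall>y\<in>V. alt_form (\<eta> y) \<and> hom_form k (\<eta> y)) \<and> (\<forall>vs. smooth_on V (\<lambda>y. \<eta> y vs))"

lemma form_onD:
  assumes "form_on V k \<eta>"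
  shows "y \<in> V \<Longrightarrow> alt_form (\<eta> y)" "y \<in> V \<Longrightarrow> hom_form k (\<eta> y)" "smooth_on V (\<lambda>y. \<eta> y vs)"
    "y \<in> V \<Longrightarrow> (\<lambda>y. \<eta> y vs) differentiable at y"
proof -
  show 1: "y \<in> V \<Longrightarrow> alt_form (\<eta> y)" "y \<in> V \<Longrightarrow> hom_form k (\<eta> y)" "smooth_on V (\<lambda>y. \<eta> y vs)" for vs
    using assms by (simp_all add: form_on_def)
  show "y \<in> V \<Longrightarrow> (\<lambda>y. \<eta> y vs) differentiable at y"
    by (rule smooth_on_differentiable[OF 1(3)])
qed

lemma form_on_ext_d:
  assumes "open V" "form_on V k \<eta>"
  shows "form_on V (Suc k) (ext_d \<eta>)"
  unfolding form_on_def
proof (intro conjI ballI allI)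
  fix y assume y: "y \<in> V"
  show "alt_form (ext_d \<eta> y)"
    by (rule ext_d_alt[OF assms(1) y form_onD(1)[OF assms(2)] form_onD(4)[OF assms(2) y]])
  show "hom_form (Suc k) (ext_d \<eta> y)"
    by (rule hom_form_ext_d[OF assms(1) y form_onD(2)[OF assms(2)]])
next
  show "smooth_on V (\<lambda>y. ext_d \<eta> y vs)" for vs
    by (rule ext_d_smooth[OF assms(1) form_onD(3)[OF assms(2)]])
qed

lemma alt_form_2:
  assumes "alt_form a"
  shows "a [u + u', v] = a [u, v] + a [u', v]" "a [u - u', v] = a [u, v] - a [u', v]" "a [- u, v] = - a [u, v]"
    "a [u, v + v'] = a [u, v] + a [u, v']" "a [u, v - v'] = a [u, v] - a [u, v']" "a [u, - v] = - a [u, v]"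
    "a [v, u] = - a [u, v]"
proof -
  note l = alt_formD(1)[OF assms, of "[]" "[v]", simplified] and r = alt_formD(1)[OF assms, of "[u]" "[]", simplified]
  show "a [u + u', v] = a [u, v] + a [u', v]" by (rule linear_add[OF l])
  show "a [u - u', v] = a [u, v] - a [u', v]" by (rule linear_diff[OF l])
  show "a [- u, v] = - a [u, v]" by (rule linear_neg[OF l])
  show "a [u, v + v'] = a [u, v] + a [u, v']" by (rule linear_add[OF r])
  show "a [u, v - v'] = a [u, v] - a [u, v']" by (rule linear_diff[OF r])
  show "a [u, - v] = - a [u, v]" by (rule linear_neg[OF r])
  show "a [v, u] = - a [u, v]" using alt_form_swap_adjacent[OF assms, of "[]" v u "[]"] by simp
qed

lemma alt_form_3:
  assumes "alt_form a"
  shows "a [u + u', v, w] = a [u, v, w] + a [u', v, w]" "a [u - u', v, w] = a [u, v, w] - a [u', v, w]"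
    "a [- u, v, w] = - a [u, v, w]" "a [u, - v, w] = - a [u, v, w]" "a [u, v, - w] = - a [u, v, w]"
    "a [v, u, w] = - a [u, v, w]" "a [u, w, v] = - a [u, v, w]" "a [u, u, w] = 0" "a [u, v, v] = 0" "a [u, v, u] = 0"
proof -
  note l = alt_formD(1)[OF assms, of "[]" "[v, w]", simplified]
  show "a [u + u', v, w] = a [u, v, w] + a [u', v, w]" by (rule linear_add[OF l])
  show "a [u - u', v, w] = a [u, v, w] - a [u', v, w]" by (rule linear_diff[OF l])
  show "a [- u, v, w] = - a [u, v, w]" by (rule linear_neg[OF l])
  show "a [u, - v, w] = - a [u, v, w]" by (rule linear_neg[OF alt_formD(1)[OF assms, of "[u]" "[w]", simplified]])
  show "a [u, v, - w] = - a [u, v, w]" by (rule linear_neg[OF alt_formD(1)[OF assms, of "[u, v]" "[]", simplified]])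
  show "a [v, u, w] = - a [u, v, w]" using alt_form_swap_adjacent[OF assms, of "[]" v u "[w]"] by simp
  show "a [u, w, v] = - a [u, v, w]" using alt_form_swap_adjacent[OF assms, of "[u]" w v "[]"] by simp
  show "a [u, u, w] = 0" using alt_formD(2)[OF assms, of "[]" u "[w]"] by simp
  show "a [u, v, v] = 0" using alt_formD(2)[OF assms, of "[u]" v "[]"] by simp
  show "a [u, v, u] = 0" using alt_form_repeat[OF assms, of "[]" u "[v]" "[]"] by simp
qed

lemma ext_d_2_form:
  assumes "open V" "form_on V 2 \<eta>" "x \<in> V"
  shows "ext_d \<eta> x [u, v, w] = pderiv_form \<eta> x u [v, w] + pderiv_form \<eta> x v [w, u] + pderiv_form \<eta> x w [u, v]"
proof -
  have "alt_form (pderiv_form \<eta> x v)"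
    by (rule pderiv_form_alt[OF assms(1,3) form_onD(1)[OF assms(2)] form_onD(4)[OF assms(2,3)]])
  from alt_form_2(7)[OF this, of u w] show ?thesis
    by (simp add: ext_d_def numeral_2_eq_2 power2_eq_square flip: pderiv_form_def)
qed

lemma ext_d_3_form:
  assumes "open V" "form_on V 3 \<eta>" "x \<in> V"
  shows "ext_d \<eta> x [u, v, w, z] = pderiv_form \<eta> x u [v, w, z] - pderiv_form \<eta> x v [u, w, z]
     + pderiv_form \<eta> x w [z, u, v] - pderiv_form \<eta> x z [w, u, v]"
proof -
  have *: "alt_form (pderiv_form \<eta> x h)" for h
    by (rule pderiv_form_alt[OF assms(1,3) form_onD(1)[OF assms(2)] form_onD(4)[OF assms(2,3)]])
  have "pderiv_form \<eta> x w [z, u, v] = pderiv_form \<eta> x w [u, v, z]"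
    using alt_form_3(6)[OF *, of w u z v] alt_form_3(7)[OF *, of w u v z] by simp
  moreover have "pderiv_form \<eta> x z [w, u, v] = pderiv_form \<eta> x z [u, v, w]"
    using alt_form_3(6)[OF *, of z u w v] alt_form_3(7)[OF *, of z u v w] by simp
  moreover have "ext_d \<eta> x [u, v, w, z] = pderiv_form \<eta> x u [v, w, z] - pderiv_form \<eta> x v [u, w, z]
     + pderiv_form \<eta> x w [u, v, z] - pderiv_form \<eta> x z [u, v, w]"
    by (simp add: ext_d_def numeral_3_eq_3 numeral_2_eq_2 flip: pderiv_form_def)
  ultimately show ?thesis by simp
qed

lemma pderiv_form_linear:
  assumes "form_on V k \<eta>" "x \<in> V"
  shows "linear (\<lambda>h. pderiv_form \<eta> x h vs)"
  unfolding pderiv_form_def by (rule linear_frechet_derivative[OF form_onD(4)[OF assms]])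

lemma slot_derivative:
  assumes V: "open V" "x \<in> V" and \<eta>: "form_on V k \<eta>" and B: "smooth_on V B"
  shows "((\<lambda>y. \<eta> y (us @ (B y *v v) # ws)) has_derivative
    (\<lambda>h. pderiv_form \<eta> x h (us @ (B x *v v) # ws) + \<eta> x (us @ (Dfield B x h *v v) # ws))) (at x)"
  unfolding pderiv_form_def
proof (rule slot_has_derivative[OF V])
  show "linear (\<lambda>v. \<eta> y (us @ v # ws))" if "y \<in> V" for y
    by (rule alt_formD(1)[OF form_onD(1)[OF \<eta> that]])
  show "(\<lambda>y. \<eta> y (us @ v # ws)) differentiable at x" for v by (rule form_onD(4)[OF \<eta> V(2)])
  show "((\<lambda>y. B y *v v) has_derivative (\<lambda>h. Dfield B x h *v v)) (at x)"
    unfolding Dfield_def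
    by (rule bounded_linear.has_derivative[OF bounded_linear_matrix_vector_left smooth_on_has_derivative[OF B V(2)]])
qed

lemma derivative_eq_on_open:
  assumes "(f has_derivative f') (at x)" "(g has_derivative g') (at x)" "open V" "x \<in> V" "\<And>y. y \<in> V \<Longrightarrow> f y = g y"
  shows "f' h = g' h"
  using has_derivative_unique[OF has_derivative_transform_within_open[OF assms(1,3,4,5)] assms(2)] by metis

text \<open>Smooth forms of type (1,1), with the type expressed in real terms.\<close>

definition skew_2 :: "(real^6) set \<Rightarrow> field \<Rightarrow> form_field \<Rightarrow> bool" where
  "skew_2 V J \<eta> \<longleftrightarrow> form_on V 2 \<eta> \<and> (\<forall>y\<in>V. \<forall>u v. \<eta> y [J y *v u, v] = - \<eta> y [u, J y *v v])"

lemma skew_2D: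
  assumes "skew_2 V J \<eta>"
  shows "form_on V 2 \<eta>" "y \<in> V \<Longrightarrow> \<eta> y [J y *v u, v] = - \<eta> y [u, J y *v v]"
  using assms by (simp_all add: skew_2_def)

lemma skew_2_derivative:
  assumes J: "acs_on V J" and \<eta>: "skew_2 V J \<eta>" and x: "x \<in> V"
  shows "pderiv_form \<eta> x h [J x *v u, v] + pderiv_form \<eta> x h [u, J x *v v] =
    - \<eta> x [Dfield J x h *v u, v] - \<eta> x [u, Dfield J x h *v v]"
proof -
  note V = acs_onD(1)[OF J]
  have "pderiv_form \<eta> x h [J x *v u, v] + \<eta> x [Dfield J x h *v u, v] =
      - (pderiv_form \<eta> x h [u, J x *v v] + \<eta> x [u, Dfield J x h *v v])"
    by (rule derivative_eq_on_open[OF slot_derivative[OF V x skew_2D(1)[OF \<eta>] acs_onD(2)[OF J], of "[]", simplified]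
          has_derivative_minus[OF slot_derivative[OF V x skew_2D(1)[OF \<eta>] acs_onD(2)[OF J], of "[u]" v "[]", simplified]] V x])
       (rule skew_2D(2)[OF \<eta>])
  then show ?thesis by algebra
qed

text \<open>Four times the \<open>(3,0)+(0,3)\<close>-part.\<close>

definition E_part :: "real^6^6 \<Rightarrow> (real^6 \<Rightarrow> real^6 \<Rightarrow> real^6 \<Rightarrow> complex) \<Rightarrow> real^6 \<Rightarrow> real^6 \<Rightarrow> real^6 \<Rightarrow> complex" where
  "E_part A m u v w = m u v w - m (A *v u) (A *v v) w - m u (A *v v) (A *v w) - m (A *v u) v (A *v w)"

abbreviation tri :: "form \<Rightarrow> real^6 \<Rightarrow> real^6 \<Rightarrow> real^6 \<Rightarrow> complex" where
  "tri a u v w \<equiv> a [u, v, w]"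

abbreviation bi :: "form \<Rightarrow> real^6 \<Rightarrow> real^6 \<Rightarrow> complex" where
  "bi a u v \<equiv> a [u, v]"

text \<open>On forms of type (1,1) the (3,0)+(0,3)-part of d is of order zero: differentiated
  skewness trades the derivatives of \<open>\<eta>\<close> for derivatives of J, and these assemble
  to n.\<close>

lemma E_ext_d_skew:
  assumes J: "acs_on V J" and \<eta>: "skew_2 V J \<eta>" and x: "x \<in> V"
  shows "E_part (J x) (tri (ext_d \<eta> x)) u v w = cyclic_sum (bi (\<eta> x)) (nij J x) u v w"
proof -
  note V = acs_onD(1)[OF J] and f = skew_2D(1)[OF \<eta>]
  note a = alt_form_2[OF form_onD(1)[OF f x]]
  have pa: "alt_form (pderiv_form \<eta> x h)" for h
    by (rule pderiv_form_alt[OF V x form_onD(1)[OF f] form_onD(4)[OF f x]])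
  note p = alt_form_2[OF pa]
  let ?D = "pderiv_form \<eta> x" and ?e = "\<eta> x"
  \<comment> \<open>One half of the skew expression n(u,v) = X u v - X v u. Collecting terms by the
    direction of differentiation leaves three cyclic copies of \<open>block\<close>.\<close>
  define X where "X u v = Dfield J x (J x *v u) *v v - J x *v (Dfield J x u *v v)" for u v
  have block: "?D u [v, w] - ?D u [J x *v v, J x *v w] - ?D (J x *v u) [J x *v v, w] - ?D (J x *v u) [v, J x *v w] =
      ?e [X u v, w] + ?e [v, X u w]" for u v w
  proof -
    have 1: "?D u [J x *v v, J x *v w] = ?D u [v, w] + ?e [v, J x *v (Dfield J x u *v w)] + ?e [J x *v (Dfield J x u *v v), w]"
      using skew_2_derivative[OF J \<eta> x, of u v "J x *v w"]
      by (simp add: acs_onD(3)[OF J x] p(6) a(6) Dfield_anticommute[OF J x] skew_2D(2)[OF \<eta> x] algebra_simps)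
    show ?thesis
      using skew_2_derivative[OF J \<eta> x, of "J x *v u" v w]
      unfolding 1 X_def a(2) a(5) by algebra
  qed
  have n: "nij J x u v = X u v - X v u" for u v by (simp add: nij_def X_def)
  have "E_part (J x) (tri (ext_d \<eta> x)) u v w =
      (?e [X u v, w] + ?e [v, X u w]) + (?e [X v w, u] + ?e [w, X v u]) + (?e [X w u, v] + ?e [u, X w v])"
    unfolding block[symmetric] E_part_def ext_d_2_form[OF V f x] by (simp add: algebra_simps)
  also have "\<dots> = cyclic_sum (bi ?e) (nij J x) u v w"
    unfolding cyclic_sum_def n a(2) using a(7)[of "X u w" v] a(7)[of "X v u" w] a(7)[of "X w v" u]
    by (simp add: algebra_simps)
  finally show ?thesis .
qed

text \<open>No components of type \<open>(2,1)\<close> and \<open>(1,2)\<close>.\<close>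

definition typed_3 :: "real^6^6 \<Rightarrow> form \<Rightarrow> bool" where
  "typed_3 A b \<longleftrightarrow> (\<forall>u v w. b [A *v u, v, w] = b [u, v, A *v w] \<and> b [u, A *v v, w] = b [u, v, A *v w])"

lemma typed_3D:
  assumes "typed_3 A b"
  shows "b [A *v u, v, w] = b [u, v, A *v w]" "b [u, A *v v, w] = b [u, v, A *v w]"
  using assms by (auto simp: typed_3_def)

lemma E_part_typed:
  assumes "typed_3 A b" "A ** A = - mat 1" "alt_form b"
  shows "E_part A (tri b) u v w = 4 * b [u, v, w]"
  by (simp add: E_part_def typed_3D[OF assms(1)] complex_structure_square[OF assms(2)] alt_form_3(3-5)[OF assms(3)])

text \<open>The projection of \<open>d\<beta> = 0\<close> to bidegree \<open>(2,2)\<close>, in real form.\<close>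

lemma ext_d_typed_3:
  assumes J: "acs_on V J" and b: "form_on V 3 \<beta>" and ty: "\<And>y. y \<in> V \<Longrightarrow> typed_3 (J y) (\<beta> y)" and x: "x \<in> V"
    and closed: "\<And>u v w z. ext_d \<beta> x [u, v, w, z] = 0"
  shows "\<beta> x [nij J x u v, w, z] + \<beta> x [nij J x w z, u, v] = 0"
proof -
  note V = acs_onD(1)[OF J] and sm = acs_onD(2)[OF J]
  note a = alt_form_3[OF form_onD(1)[OF b x]]
  have pa: "alt_form (pderiv_form \<beta> x h)" for h
    by (rule pderiv_form_alt[OF V x form_onD(1)[OF b] form_onD(4)[OF b x]])
  note p = alt_form_3[OF pa]
  let ?D = "pderiv_form \<beta> x" and ?b = "\<beta> x" and ?J = "\<lambda>u. J x *v u" and ?DJ = "\<lambda>h u. Dfield J x h *v u"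
  have Dm: "?D (- h) vs = - ?D h vs" for h vs by (rule linear_neg[OF pderiv_form_linear[OF b x]])
  note JJ = acs_onD(3)[OF J x] and DJ = Dfield_anticommute[OF J x] and t = typed_3D[OF ty[OF x]]
  note s1 = slot_derivative[OF V x b sm, of "[]", simplified]
  note s2 = slot_derivative[OF V x b sm, of "[u]" for u, simplified]
  note s3 = slot_derivative[OF V x b sm, of "[u, v]" _ "[]" for u v, simplified]
  have 1: "?D h [?J v, w, z] = ?D h [v, w, ?J z] + ?b [v, w, ?DJ h z] - ?b [?DJ h v, w, z]" for h v w z
    using derivative_eq_on_open[OF s1[of v "[w, z]"] s3[of v w z] V x typed_3D(1)[OF ty], of h]
    by (simp add: algebra_simps)
  have 2: "?D h [v, ?J w, z] = ?D h [v, w, ?J z] + ?b [v, w, ?DJ h z] - ?b [v, ?DJ h w, z]" for h v w z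
    using derivative_eq_on_open[OF s2[of v w "[z]"] s3[of v w z] V x typed_3D(2)[OF ty], of h]
    by (simp add: algebra_simps)
  define X where "X u v = ?DJ (?J u) v - ?J (?DJ u v)" for u v
  have block: "?D u [v, w, z] - ?D u [v, ?J w, ?J z] + ?D u [?J v, ?J w, z] + ?D u [?J v, w, ?J z]
      - ?D (?J u) [?J v, w, z] + ?D (?J u) [v, ?J w, z] + ?D (?J u) [v, w, ?J z] + ?D (?J u) [?J v, ?J w, ?J z]
      = 2 * ?b [X u v, w, z]" for u v w z
    by (simp add: 1 2 X_def a(2-5) JJ p(3-5) DJ t)
  have n: "nij J x u v = X u v - X v u" for u v by (simp add: nij_def X_def)
  let ?d = "\<lambda>u v w z. ext_d \<beta> x [u, v, w, z]"
  \<comment> \<open>These signs select arguments with u, v of one type and w, z of the opposite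
    type: there all eight summands agree, and for every other distribution of types they
    cancel.\<close>
  have "?d u v w z - ?d (?J u) (?J v) w z - ?d u v (?J w) (?J z) + ?d (?J u) v (?J w) z + ?d (?J u) v w (?J z)
      + ?d u (?J v) (?J w) z + ?d u (?J v) w (?J z) + ?d (?J u) (?J v) (?J w) (?J z)
     = 2 * ?b [X u v, w, z] - 2 * ?b [X v u, w, z] + 2 * ?b [X w z, u, v] - 2 * ?b [X z w, u, v]"
    unfolding block[symmetric] ext_d_3_form[OF V b x] by (simp add: algebra_simps)
  then have "2 * (?b [nij J x u v, w, z] + ?b [nij J x w z, u, v]) = 0"
    unfolding closed n a(2) by (simp add: algebra_simps)
  then show ?thesis unfolding mult_eq_0_iff by simp
qed

subsection \<open>The linearised identity\<close>

definition contr_sum :: "real^6^6 \<Rightarrow> form \<Rightarrow> form" where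
  "contr_sum s e = two_form (\<lambda>u v. e [s *v u, v] + e [u, s *v v])"

text \<open>The linearisation of \<open>nij\<close> at J in the direction s.\<close>

definition nij_dot :: "field \<Rightarrow> field \<Rightarrow> real^6 \<Rightarrow> real^6 \<Rightarrow> real^6 \<Rightarrow> real^6" where
  "nij_dot J s x u v =
     (Dfield s x (J x *v u) *v v + Dfield J x (s x *v u) *v v - s x *v (Dfield J x u *v v) - J x *v (Dfield s x u *v v)) -
     (Dfield s x (J x *v v) *v u + Dfield J x (s x *v v) *v u - s x *v (Dfield J x v *v u) - J x *v (Dfield s x v *v u))"

text \<open>The linearised condition J^2 = -1: s exchanges the types (1,0) and (0,1) of
  vectors.\<close>

definition acs_tangent :: "(real^6) set \<Rightarrow> field \<Rightarrow> field \<Rightarrow> bool" where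
  "acs_tangent V J s \<longleftrightarrow> smooth_on V s \<and> (\<forall>y\<in>V. \<forall>v. s y *v (J y *v v) = - (J y *v (s y *v v)))"

lemma acs_tangentD:
  assumes "acs_tangent V J s"
  shows "smooth_on V s" "y \<in> V \<Longrightarrow> s y *v (J y *v v) = - (J y *v (s y *v v))"
  using assms by (simp_all add: acs_tangent_def)

lemma acs_tangent_derivative:
  assumes J: "acs_on V J" and s: "acs_tangent V J s" and x: "x \<in> V"
  shows "Dfield s x h *v (J x *v v) + J x *v (Dfield s x h *v v) =
    - (s x *v (Dfield J x h *v v)) - Dfield J x h *v (s x *v v)"
proof -
  note V = acs_onD(1)[OF J]
  have ds: "(s has_derivative Dfield s x) (at x)"
    unfolding Dfield_def by (rule smooth_on_has_derivative[OF acs_tangentD(1)[OF s] x, unfolded eta_contract_eq])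
  have dsv: "((\<lambda>y. s y *v v) has_derivative (\<lambda>h. Dfield s x h *v v)) (at x)"
    by (rule bounded_linear.has_derivative[OF bounded_linear_matrix_vector_left ds])
  have "s x *v (Dfield J x h *v v) + Dfield s x h *v (J x *v v) =
      - (J x *v (Dfield s x h *v v) + Dfield J x h *v (s x *v v))"
    by (rule derivative_eq_on_open[OF
          bounded_bilinear.FDERIV[OF bounded_bilinear_matrix_vector ds J_vec_has_derivative[OF J x]]
          has_derivative_minus[OF bounded_bilinear.FDERIV[OF bounded_bilinear_matrix_vector acs_onD(5)[OF J x] dsv]] V x])
       (rule acs_tangentD(2)[OF s])
  then have "s x *v (Dfield J x h *v v) + Dfield s x h *v (J x *v v) +
      (J x *v (Dfield s x h *v v) + Dfield J x h *v (s x *v v)) = 0" by simp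
  then show ?thesis by (simp add: eq_diff_eq eq_neg_iff_add_eq_0 ac_simps)
qed

lemma alt_form_two_form:
  assumes "\<And>v. linear (\<lambda>u. f u v)" "\<And>u. linear (\<lambda>v. f u v)" "\<And>u. f u u = 0"
  shows "alt_form (two_form f)"
proof -
  have "linear (\<lambda>v. two_form f (us @ v # ws))" for us ws
  proof (cases "length (us @ ws) = 1")
    case True
    then consider z where "us = []" "ws = [z]" | z where "us = [z]" "ws = []"
      by (cases us; cases ws) auto
    then show ?thesis using assms(1,2) by cases simp_all
  next
    case False
    then have "two_form f (us @ v # ws) = 0" for v
      by (intro hom_formD[OF hom_form_two_form]) auto
    then show ?thesis by (simp add: linear_zero)
  qed
  moreover have "two_form f (us @ v # v # ws) = 0" for us v ws
  proof (cases "us = [] \<and> ws = []")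
    case False
    then show ?thesis by (intro hom_formD[OF hom_form_two_form]) auto
  qed (simp add: assms(3))
  ultimately show ?thesis by (simp add: alt_form_def)
qed

lemma form_on_contr_sum:
  assumes V: "open V" and e: "form_on V 2 \<eta>" and s: "smooth_on V s"
  shows "form_on V 2 (\<lambda>y. contr_sum (s y) (\<eta> y))"
  unfolding form_on_def
proof (intro conjI ballI allI)
  fix y assume "y \<in> V"
  note a = form_onD(1)[OF e this]
  show "alt_form (contr_sum (s y) (\<eta> y))"
    unfolding contr_sum_def
  proof (rule alt_form_two_form)
    note l = alt_formD(1)[OF a, of "[]" "[v]" for v, simplified] and r = alt_formD(1)[OF a, of "[u]" "[]" for u, simplified]
    show "linear (\<lambda>u. \<eta> y [s y *v u, v] + \<eta> y [u, s y *v v])" for v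
      by (rule linearI) (simp_all add: matrix_vector_right_distrib matrix_vector_mult_scaleR
          linear_add[OF l] linear_scale[OF l] algebra_simps)
    show "linear (\<lambda>v. \<eta> y [s y *v u, v] + \<eta> y [u, s y *v v])" for u
      by (rule linearI) (simp_all add: matrix_vector_right_distrib matrix_vector_mult_scaleR
          linear_add[OF r] linear_scale[OF r] algebra_simps)
    show "\<eta> y [s y *v u, u] + \<eta> y [u, s y *v u] = 0" for u
      using alt_form_2(7)[OF a, of u "s y *v u"] by simp
  qed
  show "hom_form 2 (contr_sum (s y) (\<eta> y))" by (simp add: contr_sum_def hom_form_two_form)
next
  fix vs
  have sm: "smooth_on V (\<lambda>y. complex_of_real ((s y *v u) $ b))" for u b
    by (rule smooth_on_linear[OF bounded_linear_compose[OF bounded_linear_of_real bounded_linear_vec_nth] V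
          smooth_on_matrix_vector[OF V s]])
  show "smooth_on V (\<lambda>y. contr_sum (s y) (\<eta> y) vs)"
  proof (cases "length vs = 2")
    case True
    then obtain u v where vs: "vs = [u, v]" by (auto simp: numeral_2_eq_2 length_Suc_conv)
    have "contr_sum (s y) (\<eta> y) vs = (\<Sum>b\<in>UNIV. complex_of_real ((s y *v u) $ b) * \<eta> y [axis b 1, v]) +
       (\<Sum>b\<in>UNIV. complex_of_real ((s y *v v) $ b) * \<eta> y [u, axis b 1])" if "y \<in> V" for y
      using linear_axis_expansion[OF alt_formD(1)[OF form_onD(1)[OF e that], of "[]" "[v]"], of "s y *v u"]
        linear_axis_expansion[OF alt_formD(1)[OF form_onD(1)[OF e that], of "[u]" "[]"], of "s y *v v"]
      by (simp add: contr_sum_def vs)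
    then show ?thesis
      by (subst smooth_on_cong[OF V]) (auto intro!: smooth_on_add smooth_on_sum smooth_on_mult V sm form_onD(3)[OF e])
  next
    case False
    then have "contr_sum (s y) (\<eta> y) vs = 0" for y
      unfolding contr_sum_def by (rule hom_formD[OF hom_form_two_form])
    then show ?thesis by (simp add: smooth_on_const)
  qed
qed

lemma pderiv_contr_sum:
  assumes V: "open V" "x \<in> V" and e: "form_on V 2 \<eta>" and s: "smooth_on V s"
  shows "pderiv_form (\<lambda>y. contr_sum (s y) (\<eta> y)) x h [u, v] =
    pderiv_form \<eta> x h [s x *v u, v] + \<eta> x [Dfield s x h *v u, v] +
    (pderiv_form \<eta> x h [u, s x *v v] + \<eta> x [u, Dfield s x h *v v])"
proof -
  have "(\<lambda>y. contr_sum (s y) (\<eta> y) [u, v]) = (\<lambda>y. \<eta> y [s y *v u, v] + \<eta> y [u, s y *v v])"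
    by (simp add: contr_sum_def)
  then show ?thesis
    using frechet_derivative_eqI[OF has_derivative_add[OF
        slot_derivative[OF V e s, of "[]" u "[v]"] slot_derivative[OF V e s, of "[u]" v "[]"]]]
    by (simp add: pderiv_form_def[of "\<lambda>y. contr_sum (s y) (\<eta> y)"])
qed

text \<open>This linearises \<open>E_ext_d_skew\<close>. The derivatives of s enter through d\<tau>,
  and those of \<open>\<eta>\<close> combine to d\<eta> with one s and one J inserted; as d\<eta>
  has no (2,1)- and (1,2)-components, the projection kills the latter.\<close>

lemma E_nij_dot:
  assumes J: "acs_on V J" and s: "acs_tangent V J s" and \<eta>: "skew_2 V J \<eta>" and x: "x \<in> V"
    and ty: "typed_3 (J x) (ext_d \<eta> x)"
  shows "E_part (J x) (cyclic_sum (bi (\<eta> x)) (nij_dot J s x)) (J x *v u) v w =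
    - 2 * E_part (J x) (tri (ext_d (\<lambda>y. contr_sum (s y) (\<eta> y)) x)) u v w"
proof -
  note V = acs_onD(1)[OF J] and f = skew_2D(1)[OF \<eta>]
  note a = alt_form_2[OF form_onD(1)[OF f x]]
  have pa: "alt_form (pderiv_form \<eta> x h)" for h
    by (rule pderiv_form_alt[OF V x form_onD(1)[OF f] form_onD(4)[OF f x]])
  note p = alt_form_2[OF pa]
  define \<tau> where "\<tau> y = contr_sum (s y) (\<eta> y)" for y
  have ft: "form_on V 2 \<tau>" unfolding \<tau>_def by (rule form_on_contr_sum[OF V f acs_tangentD(1)[OF s]])
  let ?D = "pderiv_form \<eta> x" and ?e = "\<eta> x" and ?T = "pderiv_form \<tau> x" and ?t = "\<tau> x"
  let ?J = "\<lambda>u. J x *v u" and ?DJ = "\<lambda>h u. Dfield J x h *v u" and ?s = "\<lambda>u. s x *v u" and ?Ds = "\<lambda>h u. Dfield s x h *v u"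
  have Ta: "alt_form (?T h)" for h
    by (rule pderiv_form_alt[OF V x form_onD(1)[OF ft] form_onD(4)[OF ft x]])
  note T = alt_form_2[OF Ta] and ta = alt_form_2[OF form_onD(1)[OF ft x]]
  have t: "?t [u, v] = ?e [?s u, v] + ?e [u, ?s v]" for u v by (simp add: \<tau>_def contr_sum_def)
  have Tt: "?T h [u, v] = ?D h [?s u, v] + ?e [?Ds h u, v] + (?D h [u, ?s v] + ?e [u, ?Ds h v])" for h u v
    unfolding \<tau>_def by (rule pderiv_contr_sum[OF V x f acs_tangentD(1)[OF s]])
  note JJ = acs_onD(3)[OF J x] and sJ = acs_tangentD(2)[OF s x] and sk = skew_2D(2)[OF \<eta> x]
  define X where "X u v = ?Ds (?J u) v + ?DJ (?s u) v - ?s (?DJ u v) - ?J (?Ds u v)" for u v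
  \<comment> \<open>The share of the linearised expression that \<tau> accounts for. Each derivative
    of \<open>\<eta>\<close> that remains in \<open>block\<close> contains s once and J once, as the
    expansion of d\<eta> in \<open>LT\<close> requires.\<close>
  define T' where "T' u v w = ?t [?DJ u v, w] - ?T u [v, ?J w] - ?T (?J u) [v, w]" for u v w
  have block: "?e [X u v, w] + ?e [v, X u w] + T' u v w =
     - ?D u [?s v, ?J w] - ?D u [?J v, ?s w] - ?D (?s u) [?J v, w] - ?D (?J u) [?s v, w]
     - ?D (?s u) [v, ?J w] - ?D (?J u) [v, ?s w]" for u v w
  proof -
    have 1: "?e [v, ?Ds u (?J w)] + ?e [v, ?J (?Ds u w)] = - ?e [v, ?s (?DJ u w)] - ?e [v, ?DJ u (?s w)]"
      using arg_cong[OF acs_tangent_derivative[OF J s x, of u w], of "\<lambda>z. ?e [v, z]"] by (simp add: a(4-6))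
    have 2: "?D u [?J v, ?s w] + ?D u [v, ?J (?s w)] = - ?e [?DJ u v, ?s w] - ?e [v, ?DJ u (?s w)]"
      by (rule skew_2_derivative[OF J \<eta> x])
    have 3: "?D (?s u) [?J v, w] + ?D (?s u) [v, ?J w] = - ?e [?DJ (?s u) v, w] - ?e [v, ?DJ (?s u) w]"
      by (rule skew_2_derivative[OF J \<eta> x])
    have 4: "?e [?J (?Ds u v), w] = - ?e [?Ds u v, ?J w]" by (rule sk)
    show ?thesis
      unfolding T'_def Tt t X_def sJ p(6) a(1) a(2) a(4) a(5) using 1 2 3 4 by algebra
  qed
  define L where "L u v w = ?e [X u v, w] + ?e [v, X u w] + (?e [X v w, u] + ?e [w, X v u]) + (?e [X w u, v] + ?e [u, X w v])" for u v w
  have L: "cyclic_sum (bi ?e) (nij_dot J s x) u v w = L u v w" for u v w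
  proof -
    have n: "nij_dot J s x u v = X u v - X v u" for u v by (simp add: nij_dot_def X_def)
    show ?thesis
      unfolding cyclic_sum_def n a(2) L_def using a(7)[of "X u w" v] a(7)[of "X v u" w] a(7)[of "X w v" u]
      by (simp add: algebra_simps)
  qed
  let ?b = "ext_d \<eta> x"
  have b_alt: "alt_form ?b" by (rule ext_d_alt[OF V x form_onD(1)[OF f] form_onD(4)[OF f x]])
  note b = alt_form_3[OF b_alt] and bt = typed_3D[OF ty]
  have LT: "L u v w = - (T' u v w + T' v w u + T' w u v)
      - 2 * (?b [u, v, ?J (?s w)] + ?b [u, ?s v, ?J w] + ?b [?s u, v, ?J w])" for u v w
  proof -
    have "L u v w + (T' u v w + T' v w u + T' w u v) = - (?b [?s u, ?J v, w] + ?b [?J u, ?s v, w] +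
        ?b [u, ?s v, ?J w] + ?b [u, ?J v, ?s w] + ?b [?s u, v, ?J w] + ?b [?J u, v, ?s w])"
      unfolding L_def ext_d_2_form[OF V f x] using block[of u v w] block[of v w u] block[of w u v] by algebra
    then show ?thesis unfolding bt by algebra
  qed
  have "E_part (J x) L (?J u) v w = - 2 * E_part (J x) (tri (ext_d \<tau> x)) u v w" for u v w
  proof -
    \<comment> \<open>In terms of types: \<tau> has type (2,0)+(0,2), because \<open>\<eta>\<close>
      has type (1,1) and s exchanges the types of vectors.\<close>
    have tt: "?t [?J u, v] = ?t [u, ?J v]" for u v
      by (simp add: t sJ sk a(3) a(6))
    have Tm: "?T (- h) vs = - ?T h vs" for h vs by (rule linear_neg[OF pderiv_form_linear[OF ft x]])
    note DJ = Dfield_anticommute[OF J x]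
    have DJm: "?DJ (- h) v = - ?DJ h v" for h v
      by (simp add: linear_neg[OF acs_onD(6)[OF J x]] matrix_vector_neg)
    have T2: "T' (?J u) v w + T' u (?J v) w + T' u v (?J w) - T' (?J u) (?J v) (?J w) =
       2 * (?T u [v, w] - ?T u [?J v, ?J w] - ?T (?J u) [v, ?J w] - ?T (?J u) [?J v, w])" for u v w
      unfolding T'_def by (simp add: JJ Tm T(1-6) ta(1-6) DJ tt DJm algebra_simps)
    have T'm: "T' (- u) v w = - T' u v w" "T' u (- v) w = - T' u v w" "T' u v (- w) = - T' u v w" for u v w
      unfolding T'_def by (simp_all add: Tm T(1-6) ta(1-6) DJm matrix_vector_neg)
    have Lm: "L (- u) v w = - L u v w" for u v w
      unfolding LT by (simp add: T'm b(3-5) matrix_vector_neg)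
    define m where "m u v w = ?b [u, v, ?J (?s w)] + ?b [u, ?s v, ?J w] + ?b [?s u, v, ?J w]" for u v w
    \<comment> \<open>J moves freely between the slots of d\<eta> and anticommutes with s, so that
      the projected terms cancel.\<close>
    have m: "m (?J u) v w + m u (?J v) w + m u v (?J w) - m (?J u) (?J v) (?J w) = 0"
      unfolding m_def by (simp add: bt JJ sJ b(3-5) matrix_vector_neg)
    have "E_part (J x) L (?J u) v w = L (?J u) v w + L u (?J v) w + L u v (?J w) - L (?J u) (?J v) (?J w)"
      by (simp add: E_part_def JJ Lm)
    also have "\<dots> = - 2 * E_part (J x) (tri (ext_d \<tau> x)) u v w"
      unfolding E_part_def LT m_def[symmetric] ext_d_2_form[OF V ft x]
      using T2[of u v w] T2[of v w u] T2[of w u v] m by algebra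
    finally show ?thesis .
  qed
  moreover have "cyclic_sum (bi ?e) (nij_dot J s x) = L" by (intro ext) (rule L)
  moreover have "\<tau> = (\<lambda>y. contr_sum (s y) (\<eta> y))" by (intro ext) (simp only: \<tau>_def)
  ultimately show ?thesis by (simp only:)
qed

section \<open>Structures with \<open>\<bar>\<partial>\<omega> = 0\<close>\<close>

lemma smooth_on_mv:
  "open S \<Longrightarrow> smooth_on S A \<Longrightarrow> smooth_on S Z \<Longrightarrow> smooth_on S (\<lambda>y. (A y :: real^6^6) *v Z y)"
  by (rule smooth_on_bilinear[OF bounded_bilinear_matrix_vector])

lemma vec_axis_sum: "(v :: real^6) = (\<Sum>b\<in>UNIV. v $ b *\<^sub>R axis b 1)"
  by (simp add: basis_expansion[of v, unfolded scalar_mult_eq_scaleR])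

lemma smooth_on_vec_nth: "open S \<Longrightarrow> smooth_on S Z \<Longrightarrow> smooth_on S (\<lambda>y. (Z y :: real^6) $ b)"
  by (rule smooth_on_linear[OF bounded_linear_vec_nth])

lemma smooth_on_Dfield:
  assumes J: "acs_on V J" and Z: "smooth_on V Z"
  shows "smooth_on V (\<lambda>y. Dfield J y (Z y))"
proof -
  note V = acs_onD(1)[OF J]
  have "Dfield J y (Z y) = (\<Sum>b\<in>UNIV. Z y $ b *\<^sub>R Dfield J y (axis b 1))" if "y \<in> V" for y
    by (subst vec_axis_sum[of "Z y"]) (simp add: linear_sum[OF acs_onD(6)[OF J that]] linear_scale[OF acs_onD(6)[OF J that]])
  moreover have "smooth_on V (\<lambda>y. \<Sum>b\<in>UNIV. Z y $ b *\<^sub>R Dfield J y (axis b 1))"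
    unfolding Dfield_def
    by (intro smooth_on_sum smooth_on_scaleR V smooth_on_vec_nth Z smooth_on_frechet acs_onD(2)[OF J])
  ultimately show ?thesis by (subst smooth_on_cong[OF V])
qed

lemma smooth_on_nij:
  assumes J: "acs_on V J" and Z: "smooth_on V Z" "smooth_on V Y"
  shows "smooth_on V (\<lambda>y. nij J y (Z y) (Y y))"
  unfolding nij_def
  by (intro smooth_on_add smooth_on_diff acs_onD(1)[OF J] smooth_on_mv smooth_on_Dfield[OF J] acs_onD(2)[OF J] Z)

definition omega_field :: "field \<Rightarrow> form_field" where
  "omega_field J y = two_form (omega_pt (J y) (nij J y))"

lemma omega_pt_linear:
  assumes X: "dual_frames A a X" and n: "nij_tensor A n"
  shows "linear (\<lambda>u. omega_pt A n u v)" "linear (\<lambda>v. omega_pt A n u v)" "omega_pt A n u u = 0"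
    "omega_pt A n (A *v u) v = - omega_pt A n u (A *v v)"
proof -
  note a = dual_framesD[OF X]
  let ?h = "herm (nij_mat a X n) a"
  have "linear (\<lambda>u. ?h u v)" "linear (\<lambda>v. ?h u v)" for u v
    by (rule linearI; simp add: herm_def linear_add[OF a(1)] linear_scale[OF a(1)] algebra_simps sum.distrib
        sum_distrib_left scaleR_conv_of_real[where 'a = complex])+
  then show "linear (\<lambda>u. omega_pt A n u v)" "linear (\<lambda>v. omega_pt A n u v)"
    unfolding omega_pt_eq[OF X n]
    by (simp_all add: linear_iff scaleR_conv_of_real[where 'a = complex])
  have "?h u u = cnj (?h u u)" by (simp add: herm_cnj)
  then have "Im (?h u u) = 0" by (metis complex_cnj_cancel_iff cnj.sel(2) neg_equal_zero)
  then show "omega_pt A n u u = 0" by (simp add: omega_pt_eq[OF X n])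
  have "?h (A *v u) v = \<i> * ?h u v" "?h u (A *v v) = - \<i> * ?h u v"
    by (simp_all add: herm_def a(2) sum_distrib_left algebra_simps sum_negf)
  then show "omega_pt A n (A *v u) v = - omega_pt A n u (A *v v)"
    by (simp add: omega_pt_eq[OF X n])
qed

lemma acs_dual_frame:
  assumes "acs_on V J" "x \<in> V"
  obtains a X where "dual_frames (J x) a X"
  using complex_frame_exists[OF acs_onD(4)[OF assms]] by blast

text \<open>Smoothness is visible from the trace formula, a polynomial in J and its first
  derivatives; the algebraic properties are checked in a frame at each point separately.\<close>

lemma skew_2_omega_field:
  assumes J: "acs_on V J"
  shows "skew_2 V J (omega_field J)"
  unfolding skew_2_def form_on_def
proof (intro conjI ballI allI)
  fix y assume y: "y \<in> V"
  obtain a X where X: "dual_frames (J y) a X" by (rule acs_dual_frame[OF J y])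
  note l = omega_pt_linear[OF X nij_tensor_nij[OF J y]]
  show "alt_form (omega_field J y)"
    unfolding omega_field_def by (rule alt_form_two_form) (rule l)+
  show "hom_form 2 (omega_field J y)" by (simp add: omega_field_def hom_form_two_form)
  show "bi (omega_field J y) (J y *v u) v = - bi (omega_field J y) u (J y *v v)" for u v
    by (simp add: omega_field_def l(4))
next
  fix vs
  note V = acs_onD(1)[OF J]
  show "smooth_on V (\<lambda>y. omega_field J y vs)"
  proof (cases "length vs = 2")
    case True
    then obtain u v where vs: "vs = [u, v]" by (auto simp: numeral_2_eq_2 length_Suc_conv)
    have "smooth_on V (\<lambda>y. \<Sum>b\<in>UNIV. (J y *v nij J y u (nij J y v (axis b 1))) $ b)"
      by (intro smooth_on_sum V smooth_on_vec_nth smooth_on_mv acs_onD(2)[OF J] smooth_on_nij[OF J] smooth_on_const)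
    then have "smooth_on V (\<lambda>y. (1 / 64) * complex_of_real (\<Sum>b\<in>UNIV. (J y *v nij J y u (nij J y v (axis b 1))) $ b))"
      by (intro smooth_on_mult smooth_on_const V smooth_on_linear[OF bounded_linear_of_real])
    then show ?thesis by (simp add: vs omega_field_def omega_pt_def)
  next
    case False
    then have "omega_field J y vs = 0" for y
      unfolding omega_field_def by (rule hom_formD[OF hom_form_two_form])
    then show ?thesis by (simp add: smooth_on_const)
  qed
qed

lemma omega_field_real: "Im (omega_field J y vs) = 0"
  by (simp add: omega_field_def two_form_def omega_pt_def split: list.splits)

lemma ext_d_real:
  assumes "open V" "x \<in> V" "\<And>y vs. y \<in> V \<Longrightarrow> Im (\<eta> y vs) = 0" "\<And>vs. (\<lambda>y. \<eta> y vs) differentiable at x"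
  shows "Im (ext_d \<eta> x vs) = 0"
proof -
  have "Im (frechet_derivative (\<lambda>y. \<eta> y vs) (at x) h) = 0" for vs h
  proof -
    have "Im (frechet_derivative (\<lambda>y. \<eta> y vs) (at x) h) = frechet_derivative (\<lambda>y. Im (\<eta> y vs)) (at x) h"
      by (rule frechet_derivative_linear[OF bounded_linear_Im assms(4), symmetric])
    also have "frechet_derivative (\<lambda>y. Im (\<eta> y vs)) (at x) = frechet_derivative (\<lambda>y. 0) (at x)"
      by (rule frechet_derivative_cong_open[OF assms(1,2,3)])
    finally show ?thesis by (simp add: frechet_derivative_eqI[OF has_derivative_const])
  qed
  moreover have "Im ((-1) ^ i * z) = 0" if "Im z = 0" for i :: nat and z
    using that by (cases "even i") auto
  ultimately show ?thesis unfolding ext_d_def Im_sum by (intro sum.neutral ballI) blast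
qed

lemma omega_field_eq: "acs_on V J \<Longrightarrow> x \<in> V \<Longrightarrow> omega J x = omega_field J x"
  unfolding omega_field_def by (rule omega_eq)

text \<open>As \<omega> has type (1,1), only the bidegree (1,2) is left of the sum over
  types.\<close>

lemma del_bar_omega:
  assumes J: "acs_on V J" and x: "x \<in> V"
  shows "del_bar J (omega J) x vs = type_part (J x) 1 2 (ext_d (omega_field J) x) vs"
proof -
  note V = acs_onD(1)[OF J] and sk = skew_2_omega_field[OF J]
  note f = skew_2D(1)[OF sk]
  have w: "type_part (J y) p q (omega J y) vs = (if (p, q) = (1, 1) then omega J y vs else 0)"
    if "(p, q) \<in> {(2, 0), (1, 1), (0, 2)}" "y \<in> V" for p q y vs
  proof (cases "length vs = 2")
    case True
    then obtain u v where vs: "vs = [u, v]" by (auto simp: numeral_2_eq_2 length_Suc_conv)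
    note a = alt_form_2[OF form_onD(1)[OF f that(2)]]
    show ?thesis
      using that(1) unfolding omega_field_eq[OF J that(2)] vs
      by (auto simp: type_part_2 skew_2D(2)[OF sk that(2)] acs_onD(3)[OF J that(2)] a(3) a(6))
  next
    case False
    then have "type_part (J y) p q (omega J y) vs = 0" using that(1) by (intro type_part_length) auto
    moreover have "omega J y vs = 0"
      unfolding omega_field_eq[OF J that(2)] by (rule hom_formD[OF form_onD(2)[OF f that(2)] False])
    ultimately show ?thesis by simp
  qed
  have "del_bar J (omega J) x vs = type_part (J x) (1 + 0) (1 + 1) (ext_d (omega J) x) vs"
  proof (rule d_part_2_form[OF V x, where k = 2])
    show "hom_form 2 (omega J y)" if "y \<in> V" for y
      unfolding omega_field_eq[OF J that] by (rule form_onD(2)[OF f that])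
    show "type_part (J y) 1 1 (omega J y) = omega J y" if "y \<in> V" for y
      using w[of 1 1, OF _ that] by (simp add: fun_eq_iff)
    show "p + 0 < 0 \<or> (\<forall>y\<in>V. type_part (J y) p q (omega J y) = (\<lambda>vs. 0))"
      if "p + q = int 2" "(p, q) \<noteq> (1, 1)" "p \<in> {0..3}" "q \<in> {0..3}" for p q
    proof -
      have "(p, q) \<in> {(2, 0), (1, 1), (0, 2)}" using that by auto
      then show ?thesis using w that(2) by (auto simp: fun_eq_iff)
    qed
  qed auto
  also have "ext_d (omega J) x = ext_d (omega_field J) x"
    by (rule ext_d_cong[OF V x omega_field_eq[OF J]])
  finally show ?thesis by simp
qed

section \<open>The differential of omega under the hypothesis on its (1,2)-part\<close>

definition beta :: "field \<Rightarrow> form_field" where "beta J = ext_d (omega_field J)"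

lemma form_on_beta: "acs_on V J \<Longrightarrow> form_on V 3 (beta J)"
  using form_on_ext_d[OF acs_onD(1) skew_2D(1)[OF skew_2_omega_field]]
  by (simp add: beta_def numeral_3_eq_3 numeral_2_eq_2)

text \<open>Since \<beta> is real, vanishing of the (1,2)-part includes the (2,1)-part. The real
  part of the equation, with J inserted in one slot at a time, gives three linear relations between
  the values with a single J, and these force the values to be equal.\<close>

lemma typed_3_beta:
  assumes J: "acs_on V J" and x: "x \<in> V" and 0: "del_bar J (omega J) x = (\<lambda>vs. 0)"
  shows "typed_3 (J x) (beta J x)"
proof -
  note V = acs_onD(1)[OF J] and f = skew_2D(1)[OF skew_2_omega_field[OF J]]
  note b = alt_form_3[OF form_onD(1)[OF form_on_beta[OF J] x]]
  have Im: "Im (beta J x vs) = 0" for vs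
    unfolding beta_def by (rule ext_d_real[OF V x omega_field_real form_onD(4)[OF f x]])
  let ?J = "\<lambda>u. J x *v u"
  have R: "3 * Re (beta J x [u, v, w]) + Re (beta J x [?J u, ?J v, w]) + Re (beta J x [?J u, v, ?J w])
      + Re (beta J x [u, ?J v, ?J w]) = 0" for u v w
  proof -
    have "type_part (J x) 1 2 (beta J x) [u, v, w] = 0"
      using fun_cong[OF 0, of "[u, v, w]"] unfolding del_bar_omega[OF J x] beta_def .
    from arg_cong[OF this, of Re] show ?thesis
      unfolding type_part_12 by (simp add: Im)
  qed
  note JJ = acs_onD(3)[OF J x]
  have R1: "3 * Re (beta J x [?J u, v, w]) - Re (beta J x [u, ?J v, w]) - Re (beta J x [u, v, ?J w])
      + Re (beta J x [?J u, ?J v, ?J w]) = 0" for u v w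
    using R[of "?J u" v w] by (simp add: JJ b(3-5))
  have R2: "3 * Re (beta J x [u, ?J v, w]) - Re (beta J x [?J u, v, w]) - Re (beta J x [u, v, ?J w])
      + Re (beta J x [?J u, ?J v, ?J w]) = 0" for u v w
    using R[of u "?J v" w] by (simp add: JJ b(3-5))
  have R3: "3 * Re (beta J x [u, v, ?J w]) - Re (beta J x [?J u, v, w]) - Re (beta J x [u, ?J v, w])
      + Re (beta J x [?J u, ?J v, ?J w]) = 0" for u v w
    using R[of u v "?J w"] by (simp add: JJ b(3-5))
  have "Re (beta J x [?J u, v, w]) = Re (beta J x [u, v, ?J w])" "Re (beta J x [u, ?J v, w]) = Re (beta J x [u, v, ?J w])" for u v w
    using R1[of u v w] R2[of u v w] R3[of u v w] by linarith+
  then show ?thesis by (simp add: typed_3_def complex_eq_iff Im)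
qed

lemma beta_eq:
  assumes J: "acs_on V J" and x: "x \<in> V" and ty: "typed_3 (J x) (beta J x)" and X: "dual_frames (J x) a X"
  shows "beta J x [u, v, w] = 3 * complex_of_real (Im (P_num (nij_mat a X (nij J x)) * vol_of a [u, v, w]))"
proof -
  have "4 * beta J x [u, v, w] = E_part (J x) (tri (beta J x)) u v w"
    using E_part_typed[OF ty acs_onD(4)[OF J x] form_onD(1)[OF form_on_beta[OF J] x]] by simp
  also have "\<dots> = cyclic_sum (bi (omega_field J x)) (nij J x) u v w"
    unfolding beta_def by (rule E_ext_d_skew[OF J skew_2_omega_field[OF J] x])
  also have "\<dots> = 12 * complex_of_real (Im (P_num (nij_mat a X (nij J x)) * vol_of a [u, v, w]))"
    unfolding omega_cyclic_sum_psi[OF X nij_tensor_nij[OF J x], symmetric] by (simp add: omega_field_def cyclic_sum_def)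
  finally have *: "4 * beta J x [u, v, w] = 12 * complex_of_real (Im (P_num (nij_mat a X (nij J x)) * vol_of a [u, v, w]))" .
  have "b = 3 * z" if "4 * b = 12 * z" for b z :: complex using that by simp
  from this[OF *] show ?thesis .
qed

text \<open>On two cyclic pairs of frame vectors the (2,2)-identity compares the entries (i,j) and
  (j,i) of P N, because the vol form contracted with the i-th pair is \<open>a i\<close>. The
  identity as it stands gives the imaginary parts, and with J inserted in one vector the real
  parts.\<close>

lemma P_nij_hermitian:
  assumes J: "acs_on V J" and ty: "\<And>y. y \<in> V \<Longrightarrow> typed_3 (J y) (beta J y)" and x: "x \<in> V"
    and X: "dual_frames (J x) a X"
  defines "N \<equiv> nij_mat a X (nij J x)"
  shows "cnj (P_num N * N $ i $ j) = P_num N * N $ j $ i"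
proof -
  note V = acs_onD(1)[OF J] and n = nij_tensorD[OF nij_tensor_nij[OF J x]]
  note b = alt_form_3[OF form_onD(1)[OF form_on_beta[OF J] x]]
  let ?p = "\<lambda>j. X (succ3 j)" and ?q = "\<lambda>j. X (pred3 j)" and ?n = "nij J x" and ?J = "\<lambda>u. J x *v u"
  have closed: "ext_d (beta J) x [u, v, w, z] = 0" for u v w z
    unfolding beta_def by (rule ext_d_ext_d[OF V x form_onD(3)[OF skew_2D(1)[OF skew_2_omega_field[OF J]]]])
  have sym: "beta J x [?n u v, w, z] + beta J x [?n w z, u, v] = 0" for u v w z
    by (rule ext_d_typed_3[OF J form_on_beta[OF J] ty x closed])
  have vol: "vol_of a [z, ?p i, ?q i] = a i z" for z i
  proof -
    have "\<forall>i. vol_of a [z, ?p i, ?q i] = a i z"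
      by (simp add: forall_3 vol_of_apply dual_framesD(3)[OF X])
    then show ?thesis by blast
  qed
  have Nij: "a i (?n (?p j) (?q j)) = 4 * N $ i $ j" for i j by (simp add: N_def nij_mat_def)
  have bN: "beta J x [?n (?p j) (?q j), ?p i, ?q i] = 12 * complex_of_real (Im (P_num N * N $ i $ j))" for i j
    unfolding beta_eq[OF J x ty[OF x] X] vol Nij by (simp add: N_def[symmetric])
  have bJN: "beta J x [?J (?n (?p j) (?q j)), ?p i, ?q i] = 12 * complex_of_real (Re (P_num N * N $ i $ j))" for i j
    unfolding beta_eq[OF J x ty[OF x] X] vol dual_framesD(2)[OF X] Nij by (simp add: N_def[symmetric])
  have "Im (P_num N * N $ i $ j) = - Im (P_num N * N $ j $ i)"
  proof -
    have "12 * complex_of_real (Im (P_num N * N $ i $ j) + Im (P_num N * N $ j $ i)) = 0"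
      using sym[of "?p j" "?q j" "?p i" "?q i"] unfolding bN by (simp only: of_real_add distrib_left)
    then have "Im (P_num N * N $ i $ j) + Im (P_num N * N $ j $ i) = 0"
      by (simp only: mult_eq_0_iff of_real_eq_0_iff) simp
    then show ?thesis by linarith
  qed
  moreover have "Re (P_num N * N $ i $ j) = Re (P_num N * N $ j $ i)"
  proof -
    have "beta J x [?n (?J (?p j)) (?q j), ?p i, ?q i] + beta J x [?n (?p i) (?q i), ?J (?p j), ?q j] = 0"
      by (rule sym)
    then have "beta J x [?J (?n (?p j) (?q j)), ?p i, ?q i] = beta J x [?J (?n (?p i) (?q i)), ?p j, ?q j]"
      unfolding n(6) b(3) typed_3D[OF ty[OF x]] by (simp add: add_eq_0_iff)
    then have "12 * complex_of_real (Re (P_num N * N $ i $ j) - Re (P_num N * N $ j $ i)) = 0"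
      unfolding bJN by (simp only: of_real_diff right_diff_distrib) simp
    then have "Re (P_num N * N $ i $ j) - Re (P_num N * N $ j $ i) = 0"
      by (simp only: mult_eq_0_iff of_real_eq_0_iff) simp
    then show ?thesis by linarith
  qed
  ultimately show ?thesis by (simp only: complex_eq_iff cnj.sel) simp
qed

lemma real_type_local:
  assumes J: "acs_on V J" and ty: "\<And>y. y \<in> V \<Longrightarrow> typed_3 (J y) (beta J y)" and x: "x \<in> V"
    and X: "dual_frames (J x) a X" and psi: "psi J x \<noteq> (\<lambda>vs. 0)"
  shows "\<exists>s H. (\<forall>i j. H $ i $ j = cnj (H $ j $ i)) \<and> nij_mat a X (nij J x) = (\<chi> i j. s * H $ i $ j)"
proof -
  let ?N = "nij_mat a X (nij J x)"
  have P: "P_num ?N \<noteq> 0" using psi unfolding psi_eq[OF J x X] by auto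
  define H :: "complex^3^3" where "H = (\<chi> i j. P_num ?N * ?N $ i $ j)"
  have "\<forall>i j. H $ i $ j = cnj (H $ j $ i)"
    using P_nij_hermitian[OF J ty x X] by (simp only: H_def vec_lambda_beta) simp
  moreover have "?N = (\<chi> i j. inverse (P_num ?N) * H $ i $ j)"
    using P by (simp add: vec_eq_iff H_def)
  ultimately show ?thesis by blast
qed

section \<open>First variation of the integrand at a point\<close>

text \<open>The Nijenhuis matrix of the coframe \<open>proj_cof B a\<close>, written with vectors \<open>X\<close> that need not be
  dual to it, so that they can be kept fixed while \<open>B\<close> varies.\<close>

definition N_proj :: "real^6^6 \<Rightarrow> (real^6 \<Rightarrow> real^6 \<Rightarrow> real^6) \<Rightarrow> (3 \<Rightarrow> real^6 \<Rightarrow> complex) \<Rightarrow> (3 \<Rightarrow> real^6) \<Rightarrow> complex^3^3" where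
  "N_proj B n a X = (\<chi> i l. (\<Sum>j\<in>UNIV. nij_mat (proj_cof B a) X n $ i $ j * cnj (gram (proj_cof B a) X $ l $ j))
     / cnj (det (gram (proj_cof B a) X)))"

text \<open>The integrand on the standard frame, computed in the projected coframe. Squared moduli
  are written as products with the conjugate, so that the product rule applies.\<close>

definition F_val :: "real \<Rightarrow> real \<Rightarrow> real^6^6 \<Rightarrow> (real^6 \<Rightarrow> real^6 \<Rightarrow> real^6) \<Rightarrow> (3 \<Rightarrow> real^6 \<Rightarrow> complex) \<Rightarrow> (3 \<Rightarrow> real^6) \<Rightarrow> complex" where
  "F_val c1 c2 B n a X = \<i> / 8 * (complex_of_real c1 * (det (N_proj B n a X) * cnj (det (N_proj B n a X))) +
     complex_of_real c2 * (P_num (N_proj B n a X) * cnj (P_num (N_proj B n a X)))) * top_of (proj_cof B a) std_frame"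

lemma N_proj_eq:
  assumes Y: "dual_frames B (proj_cof B a) Y" and n: "nij_tensor B n" and g: "det (gram (proj_cof B a) X) \<noteq> 0"
  shows "N_proj B n a X = nij_mat (proj_cof B a) Y n"
  by (simp add: N_proj_def vec_eq_iff nij_mat_gram[OF Y n, of _ _ X, symmetric] g)

lemma F_form_proj:
  assumes J: "acs_on V J" "x \<in> V" and lin: "\<And>i. linear (a i)" and g: "det (gram (proj_cof (J x) a) X) \<noteq> 0"
  shows "F_form c1 c2 J x std_frame = F_val c1 c2 (J x) (nij J x) a X"
proof -
  obtain Y where Y: "dual_frames (J x) (proj_cof (J x) a) Y"
    using proj_cof_dual[where a = a, OF acs_onD(4)[OF J] lin g] by blast
  show ?thesis
    unfolding F_form_eq[OF J Y] F_val_def N_proj_eq[OF Y nij_tensor_nij[OF J] g]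
    by (simp only: of_real_add of_real_mult complex_norm_square mult.assoc)
qed

subsection \<open>Algebra for Nijenhuis tensors of real type\<close>

lemma adjugate_entries:
  "adjugate a $ i $ j = a $ succ3 j $ succ3 i * a $ pred3 j $ pred3 i - a $ succ3 j $ pred3 i * a $ pred3 j $ succ3 i"
  unfolding adj_pol_same[symmetric] adj_pol_entries by (simp add: field_simps)

text \<open>For N = s H with H Hermitian every term is a multiple of the adjugate of the transpose
  of H: the adjugate of the transpose of N carries s^2, Q carries |s|^2, and the scalars are det N =
  s^3 det H and P = cnj(s)^2 s det H with det H real. These two identities are what makes the two
  differentials agree.\<close>

lemma real_type_adjugate:
  assumes H: "\<And>i j. cnj (H $ i $ j) = H $ j $ i" and N: "N = (\<chi> i j. s * H $ i $ j)"
  shows "cnj (det N) * adjugate (transpose N) $ i $ j = P_num N * Q_mat N $ i $ j"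
    and "P_num N * adjugate (transpose N) $ j $ i = cnj (P_num N * Q_mat N $ i $ j)"
proof -
  have h: "cnj (H $ i $ j) = H $ j $ i" for i j by (rule H)
  have adj: "adjugate (transpose N) $ i $ j = s\<^sup>2 * adjugate (transpose H) $ i $ j" for i j
    by (simp add: N adjugate_entries transpose_def power2_eq_square algebra_simps)
  have Q: "Q_mat N $ i $ j = s * cnj s * adjugate (transpose H) $ i $ j" for i j
    by (simp add: N adjugate_entries adj_pol_entries transpose_def cnj_mat_def h field_simps)
  have det: "cnj (det N) = cnj s ^ 3 * det H"
    by (simp add: N det_3 h power3_eq_cube algebra_simps)
  have detH: "cnj (det H) = det H" by (simp add: det_3 h algebra_simps)
  have P: "P_num N = (cnj s)\<^sup>2 * s * det H"
  proof -
    have 1: "cnj_mat N = (\<chi> i j. cnj s * transpose H $ i $ j)" "transpose N = (\<chi> i j. s * transpose H $ i $ j)"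
      by (simp_all add: N cnj_mat_def transpose_def vec_eq_iff h)
    have 2: "det_pol a (\<chi> i j. z * b $ i $ j) c = z * det_pol a b c" for a b c z
      by (subst det_pol_commute(1), subst det_pol_scale, subst det_pol_commute(1), rule refl)
    have 3: "det_pol a b (\<chi> i j. z * c $ i $ j) = z * det_pol a b c" for a b c z
      by (subst det_pol_commute(2), subst 2, subst det_pol_commute(2), rule refl)
    show ?thesis
      unfolding 1 det_pol_scale 2 3 det_pol_same by (simp add: power2_eq_square)
  qed
  show "cnj (det N) * adjugate (transpose N) $ i $ j = P_num N * Q_mat N $ i $ j"
    unfolding adj Q det P by (simp add: power2_eq_square power3_eq_cube)
  have "cnj (P_num N) = s\<^sup>2 * cnj s * det H"
    unfolding P by (simp add: detH)
  then show "P_num N * adjugate (transpose N) $ j $ i = cnj (P_num N * Q_mat N $ i $ j)"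
    unfolding complex_cnj_mult Q_mat_hermitian unfolding adj Q P by (simp add: power2_eq_square detH)
qed

subsection \<open>Derivatives of the invariants\<close>

lemma det_has_vector_derivative:
  assumes "\<And>i j. ((\<lambda>t. N t $ i $ j) has_vector_derivative N' $ i $ j) (at t0)"
  shows "((\<lambda>t. det (N t :: complex^3^3)) has_vector_derivative
    (\<Sum>i\<in>UNIV. \<Sum>j\<in>UNIV. adjugate (transpose (N t0)) $ i $ j * N' $ i $ j)) (at t0)"
  unfolding det_3[of "N _"]
  by (rule has_vector_derivative_eq_rhs,
      (rule has_vector_derivative_add has_vector_derivative_diff has_vector_derivative_mult assms)+)
     (simp add: sum_3 adjugate_entries transpose_def algebra_simps)

text \<open>The conjugate of P is a trilinear form with N in two slots and the conjugate of N in
  one; hence the weights 2 and 1 and the division by 3.\<close>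

lemma cnj_P_has_vector_derivative:
  assumes "\<And>i j. ((\<lambda>t. N t $ i $ j) has_vector_derivative N' $ i $ j) (at t0)"
  shows "((\<lambda>t. cnj (P_num (N t))) has_vector_derivative
    (2 * (\<Sum>i\<in>UNIV. \<Sum>j\<in>UNIV. Q_mat (N t0) $ i $ j * N' $ i $ j) +
     (\<Sum>i\<in>UNIV. \<Sum>j\<in>UNIV. adjugate (transpose (N t0)) $ j $ i * cnj (N' $ i $ j))) / 3) (at t0)"
proof -
  define Z where "Z M = (\<Sum>i\<in>UNIV. \<Sum>j\<in>UNIV. adjugate (transpose M) $ j $ i * cnj (M $ i $ j))" for M :: "complex^3^3"
  have Z: "cnj (P_num M) = Z M / 3" for M
    by (simp add: det_pol_adj_pol Z_def adj_pol_same adjugate_entries sum_3 transpose_def cnj_mat_def)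
       (simp add: algebra_simps)
  have adj: "((\<lambda>t. adjugate (transpose (N t)) $ j $ i) has_vector_derivative
       2 * adj_pol (transpose (N t0)) (transpose N') $ j $ i) (at t0)" for i j
    unfolding adj_pol_same[symmetric] adj_pol_entries transpose_def vec_lambda_beta
    by (rule has_vector_derivative_eq_rhs,
      (rule has_vector_derivative_divide has_vector_derivative_add has_vector_derivative_diff has_vector_derivative_mult assms)+)
      (simp add: field_simps)
  have "((\<lambda>t. Z (N t)) has_vector_derivative
     (\<Sum>i\<in>UNIV. \<Sum>j\<in>UNIV. adjugate (transpose (N t0)) $ j $ i * cnj (N' $ i $ j) +
        2 * adj_pol (transpose (N t0)) (transpose N') $ j $ i * cnj (N t0 $ i $ j))) (at t0)"
    unfolding Z_def
    by (intro has_vector_derivative_sum has_vector_derivative_mult adj has_vector_derivative_cnj assms)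
  then have "((\<lambda>t. Z (N t) / 3) has_vector_derivative
     (\<Sum>i\<in>UNIV. \<Sum>j\<in>UNIV. adjugate (transpose (N t0)) $ j $ i * cnj (N' $ i $ j) +
        2 * adj_pol (transpose (N t0)) (transpose N') $ j $ i * cnj (N t0 $ i $ j)) / 3) (at t0)"
    by (rule has_vector_derivative_divide)
  moreover have "(\<Sum>i\<in>UNIV. \<Sum>j\<in>UNIV. adj_pol (transpose (N t0)) (transpose N') $ j $ i * cnj (N t0 $ i $ j)) =
     (\<Sum>i\<in>UNIV. \<Sum>j\<in>UNIV. Q_mat (N t0) $ i $ j * N' $ i $ j)"
    by (simp add: adj_pol_entries sum_3 transpose_def cnj_mat_def) (simp add: field_simps)
  ultimately show ?thesis
    unfolding Z by (simp add: sum.distrib sum_distrib_left[symmetric] mult.assoc add.commute)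
qed

lemma three_one_forms:
  "(one_form f \<and>\<^sub>f one_form g \<and>\<^sub>f one_form h) [u, v, w] =
   f u * g v * h w - f u * g w * h v - f v * g u * h w + f v * g w * h u + f w * g u * h v - f w * g v * h u"
  by (simp add: one_form_wedge_Cons contr_def algebra_simps)

lemma hom_form_three: "hom_form 3 (one_form f \<and>\<^sub>f one_form g \<and>\<^sub>f one_form h)"
  using hom_form_wedge[OF hom_form_one hom_form_wedge[OF hom_form_one hom_form_one], of f g h]
  by (simp add: numeral_3_eq_3)

text \<open>A first-order change of the coframe by (0,1)-forms does not change \<open>\<alpha> \<and> \<alpha>\<bar>\<close> in top degree.\<close>

lemma top_of_derivative_zero:
  assumes X: "dual_frames A a X" and lin: "\<And>t i. linear (c t i)" and c0: "c t0 = a"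
    and c': "\<And>i v. ((\<lambda>t. c t i v) has_vector_derivative c' i v) (at t0)"
    and type: "\<And>i v. c' i (A *v v) = - \<i> * c' i v"
  shows "((\<lambda>t. top_of (c t) std_frame) has_vector_derivative 0) (at t0)"
proof -
  have one: "((\<lambda>t. one_form (c t i) vs) has_derivative (\<lambda>h. h *\<^sub>R one_form (c' i) vs)) (at t0)" for i vs
    using c'[of i] by (cases vs rule: remdups_adj.cases) (simp_all add: has_vector_derivative_def)
  define v1 where "v1 vs = (one_form (c' 1) \<and>\<^sub>f one_form (a 2) \<and>\<^sub>f one_form (a 3)) vs +
     ((one_form (a 1) \<and>\<^sub>f one_form (c' 2) \<and>\<^sub>f one_form (a 3)) vs + (one_form (a 1) \<and>\<^sub>f one_form (a 2) \<and>\<^sub>f one_form (c' 3)) vs)" for vs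
  have sc: "((\<lambda>vs. h *\<^sub>R p vs) \<and>\<^sub>f q) vs = h *\<^sub>R (p \<and>\<^sub>f q) vs" "(p \<and>\<^sub>f (\<lambda>vs. h *\<^sub>R q vs)) vs = h *\<^sub>R (p \<and>\<^sub>f q) vs" for h p q vs
    by (simp_all add: scaleR_conv_of_real[where 'a = complex] wedge_scale_left wedge_scale_right)
  have vol: "((\<lambda>t. vol_of (c t) vs) has_derivative (\<lambda>h. h *\<^sub>R v1 vs)) (at t0)" for vs
    unfolding vol_of_def
    by (rule has_derivative_eq_rhs[OF wedge_has_derivative[OF one wedge_has_derivative[OF one one]]])
       (simp add: fun_eq_iff sc c0 v1_def wedge_add_right scaleR_add_right flip: scaleR_add_right)
  have cvol: "((\<lambda>t. cnj_form (vol_of (c t)) vs) has_derivative (\<lambda>h. h *\<^sub>R cnj_form v1 vs)) (at t0)" for vs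
    unfolding cnj_form_def
    by (rule has_derivative_eq_rhs[OF bounded_linear.has_derivative[OF bounded_linear_cnj vol]]) simp
  define T where "T vs = (v1 \<and>\<^sub>f cnj_form (vol_of a)) vs + (vol_of a \<and>\<^sub>f cnj_form v1) vs" for vs
  have top: "((\<lambda>t. top_of (c t) vs) has_vector_derivative T vs) (at t0)" for vs
    unfolding top_of_def has_vector_derivative_def
    by (rule has_derivative_eq_rhs[OF wedge_has_derivative[OF vol cvol]])
       (simp add: fun_eq_iff sc c0 T_def scaleR_add_right)
  have hom: "hom_form 3 v1" "hom_form 3 (cnj_form v1)" "hom_form 3 (cnj_form (vol_of a))"
    using hom_form_three hom_form_vol_of by (simp_all add: hom_form_def v1_def cnj_form_def)
  have "T (frame_list A X) = 0"
    unfolding T_def frame_list_def wedge_3_3[OF hom(1,3)] wedge_3_3[OF hom_form_vol_of hom(2)]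
    by (simp add: cnj_form_def vol_of_apply v1_def three_one_forms dual_framesD(2,3)[OF X] type) (simp add: algebra_simps)
  then have "((\<lambda>t. top_of (c t) (frame_list A X)) has_vector_derivative 0) (at t0)"
    using top[of "frame_list A X"] by simp
  moreover have "top_of (c t) (frame_list A X) = complex_of_real (det (vector (frame_list A X) :: real^6^6)) * top_of (c t) std_frame" for t
    unfolding frame_list_def by (rule alt_form_det_list[OF alt_form_top_of[OF lin]])
  ultimately have "((\<lambda>t. inverse (complex_of_real (det (vector (frame_list A X) :: real^6^6))) *
      (complex_of_real (det (vector (frame_list A X) :: real^6^6)) * top_of (c t) std_frame)) has_vector_derivative
      inverse (complex_of_real (det (vector (frame_list A X) :: real^6^6))) * 0) (at t0)"
    by (intro has_vector_derivative_mult_right) simp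
  moreover have "(\<lambda>t. inverse z * (z * f t)) = f" if "z \<noteq> 0" for z and f :: "real \<Rightarrow> complex"
    using that by (simp add: fun_eq_iff)
  then have "(\<lambda>t. inverse (complex_of_real (det (vector (frame_list A X) :: real^6^6))) *
      (complex_of_real (det (vector (frame_list A X) :: real^6^6)) * top_of (c t) std_frame)) = (\<lambda>t. top_of (c t) std_frame)"
    using frame_det_nonzero[OF X] by (simp only: of_real_eq_0_iff not_False_eq_True)
  ultimately show ?thesis by (simp only: mult_zero_right)
qed

lemma proj_cof_has_vector_derivative:
  assumes lin: "linear (a i)" and B': "(B has_vector_derivative s) (at t0)"
  shows "((\<lambda>t. proj_cof (B t) a i v) has_vector_derivative - (\<i> / 2) * a i (s *v v)) (at t0)"
proof -
  have bl: "bounded_linear (\<lambda>B :: real^6^6. a i (B *v v))"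
    by (rule bounded_linear_compose[OF linear_bounded[OF lin] bounded_linear_matrix_vector_left])
  have "((\<lambda>t. (1 / 2) * (a i v - \<i> * a i (B t *v v))) has_vector_derivative (1 / 2) * (0 - \<i> * a i (s *v v))) (at t0)"
    by (intro has_vector_derivative_mult_right has_vector_derivative_diff has_vector_derivative_const
        bounded_linear.has_vector_derivative[OF bl B'])
  then show ?thesis by (simp add: proj_cof_def)
qed

lemma gram_differentiable:
  assumes lin: "\<And>i. linear (a i)" and B': "(B has_vector_derivative s) (at t0)"
  shows "(\<lambda>t. det (gram (proj_cof (B t) a) X)) differentiable (at t0)"
  unfolding det_3 gram_def vec_lambda_beta
  by (intro differentiable_add differentiable_diff differentiable_mult
      differentiableI_vector[OF proj_cof_has_vector_derivative[where a = a, OF lin B']])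

lemma gram_eventually:
  assumes lin: "\<And>i. linear (a i)" and B': "(B has_vector_derivative s) (at t0)"
    and g0: "det (gram (proj_cof (B t0) a) X) \<noteq> 0"
  shows "\<forall>\<^sub>F t in nhds t0. det (gram (proj_cof (B t) a) X) \<noteq> 0"
proof -
  have "isCont (\<lambda>t. det (gram (proj_cof (B t) a) X)) t0"
    by (rule differentiable_imp_continuous_within[OF gram_differentiable[where a = a, OF lin B']])
  then show ?thesis
    using g0 by (simp add: isCont_def tendsto_imp_eventually_ne eventually_nhds_conv_at)
qed

text \<open>The witness \<open>q\<close> contracts Q with the variation of the Nijenhuis matrix in
  the projected coframe. It occurs in both claims: real type reduces both squared moduli to the real
  part of P q, while the \<open>E_part\<close> keeps exactly that component of \<open>n'\<close>
  which the variation of the matrix records. The top form contributes nothing by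
  \<open>top_of_derivative_zero\<close>.\<close>

lemma F_val_derivative:
  assumes X: "dual_frames A a X" and n0: "nij_tensor A (n 0)" and B0: "B 0 = A"
    and B': "(B has_vector_derivative s) (at 0)" and s: "\<And>v. s *v (A *v v) = - (A *v (s *v v))"
    and n': "\<And>u v. ((\<lambda>t. n t u v) has_vector_derivative n' u v) (at 0)"
    and ev: "\<forall>\<^sub>F t in nhds 0. B t ** B t = - mat 1 \<and> nij_tensor (B t) (n t)"
    and H: "\<And>i j. cnj (H $ i $ j) = H $ j $ i" and N: "nij_mat a X (n 0) = (\<chi> i j. s0 * H $ i $ j)"
  defines "N0 \<equiv> nij_mat a X (n 0)"
  shows "\<exists>q. ((\<lambda>t. F_val c1 c2 (B t) (n t) a X) has_vector_derivative
      \<i> / 8 * complex_of_real (2 * (c1 + c2) * Re (P_num N0 * q)) * top_of a std_frame) (at 0) \<and>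
    (\<forall>u v w. E_part A (cyclic_sum (omega_pt A (n 0)) n') u v w = 16 * complex_of_real (Im (cnj q * vol_of a [u, v, w])))"
proof -
  note a = dual_framesD[OF X] and nD = nij_tensorD[OF n0]
  let ?c = "\<lambda>t. proj_cof (B t) a" and ?N = "\<lambda>t. N_proj (B t) (n t) a X" and ?g = "\<lambda>t. gram (proj_cof (B t) a) X"
  have c0: "?c 0 = a" by (simp add: B0 proj_cof_self[OF X])
  have lin: "linear (?c t i)" for t i by (rule proj_cof_linear[OF a(1)])
  have AA: "A ** A = - mat 1" using eventually_nhds_x_imp_x[OF ev] B0 by simp
  note AAv = complex_structure_square[OF AA]
  define a' where "a' i v = - (\<i> / 2) * a i (s *v v)" for i v
  have c': "((\<lambda>t. ?c t i v) has_vector_derivative a' i v) (at 0)" for i v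
    unfolding a'_def by (rule proj_cof_has_vector_derivative[OF a(1) B'])
  have a'_type: "a' i (A *v v) = - \<i> * a' i v" for i v
    by (simp add: a'_def s linear_neg[OF a(1)] a(2))
  have a'_neg: "a' i (- z) = - a' i z" for i z
    by (simp add: a'_def matrix_vector_neg linear_neg[OF a(1)])
  have cn': "((\<lambda>t. ?c t i (n t u v)) has_vector_derivative a' i (n 0 u v) + a i (n' u v)) (at 0)" for i u v
  proof -
    have "((\<lambda>t. B t *v n t u v) has_vector_derivative B 0 *v n' u v + s *v n 0 u v) (at 0)"
      by (rule bounded_bilinear.has_vector_derivative[OF bounded_bilinear_matrix_vector B' n'])
    then have "((\<lambda>t. (1 / 2) * (a i (n t u v) - \<i> * a i (B t *v n t u v))) has_vector_derivative
        (1 / 2) * (a i (n' u v) - \<i> * a i (B 0 *v n' u v + s *v n 0 u v))) (at 0)"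
      by (intro has_vector_derivative_mult_right has_vector_derivative_diff
          bounded_linear.has_vector_derivative[OF linear_bounded[OF a(1)]] n')
    then show ?thesis by (simp add: proj_cof_def a'_def B0 linear_add[OF a(1)] a(2) field_simps)
  qed
  have dc: "(\<lambda>t. ?c t i v) differentiable (at 0)" for i v by (rule differentiableI_vector[OF c'])
  have dcj: "(\<lambda>t. cnj (f t)) differentiable (at 0)" if "f differentiable (at 0)" for f :: "real \<Rightarrow> complex"
    using that by (simp add: differentiable_cnj_iff)
  have dg: "(\<lambda>t. det (?g t)) differentiable (at 0)"
    by (rule gram_differentiable[where a = a, OF a(1) B'])
  have g0: "det (?g 0) \<noteq> 0" by (simp add: c0 gram_self[OF X])
  have evg: "\<forall>\<^sub>F t in nhds 0. det (?g t) \<noteq> 0"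
    by (rule gram_eventually[where a = a, OF a(1) B' g0])
  \<comment> \<open>The frame dual to the projected coframe moves with t. Differentiability comes
    from \<open>N_proj\<close>, a quotient of expressions with the fixed vectors \<open>X\<close>
    and denominator 1 at t = 0.\<close>
  define N' :: "complex^3^3" where "N' = (\<chi> i j. vector_derivative (\<lambda>t. ?N t $ i $ j) (at 0))"
  have N': "((\<lambda>t. ?N t $ i $ j) has_vector_derivative N' $ i $ j) (at 0)" for i j
  proof -
    have "(\<lambda>t. ?N t $ i $ j) differentiable (at 0)"
      unfolding N_proj_def nij_mat_def gram_def[of _ X] vec_lambda_beta
      using g0 dg
      by (intro differentiable_divide differentiable_sum differentiable_mult dcj dc differentiableI_vector[OF cn']
          differentiable_const finite_class.finite_UNIV ballI) (simp_all add: gram_def)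
    then show ?thesis by (simp add: N'_def vector_derivative_works)
  qed
  have N00: "?N 0 = N0"
    using N_proj_eq[of A a X "n 0" X] by (simp add: B0 c0 proj_cof_self[OF X] X n0 gram_self[OF X] N0_def)
  have cyc': "((\<lambda>t. cyc (?c t) j u v) has_vector_derivative
     (a (succ3 j) u * a' (pred3 j) v + a' (succ3 j) u * a (pred3 j) v) -
     (a (succ3 j) v * a' (pred3 j) u + a' (succ3 j) v * a (pred3 j) u)) (at 0)" for j u v
    unfolding cyc_def
    by (rule has_vector_derivative_eq_rhs[OF has_vector_derivative_diff[OF
          has_vector_derivative_mult[OF c' c'] has_vector_derivative_mult[OF c' c']]]) (simp add: c0)
  define k where "k j u v = (a (succ3 j) u * a' (pred3 j) v + a' (succ3 j) u * a (pred3 j) v) -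
     (a (succ3 j) v * a' (pred3 j) u + a' (succ3 j) v * a (pred3 j) u)" for j u v
  \<comment> \<open>The expansion of n in the moving coframe, differentiated at 0. It ties
    \<open>n'\<close> to \<open>N'\<close> up to terms that stem from the motion of the
    coframe.\<close>
  have id: "a' i (n 0 u v) + a i (n' u v) = 4 * (\<Sum>j\<in>UNIV. N0 $ i $ j * cnj (k j u v) + N' $ i $ j * cnj (cyc a j u v))" for i u v
  proof -
    have "((\<lambda>t. 4 * (\<Sum>j\<in>UNIV. ?N t $ i $ j * cnj (cyc (?c t) j u v))) has_vector_derivative
       4 * (\<Sum>j\<in>UNIV. ?N 0 $ i $ j * cnj (k j u v) + N' $ i $ j * cnj (cyc (?c 0) j u v))) (at 0)"
      unfolding k_def
      by (intro has_vector_derivative_mult_right has_vector_derivative_sum has_vector_derivative_mult N' has_vector_derivative_cnj cyc')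
    moreover have "\<forall>\<^sub>F t in nhds 0. ?c t i (n t u v) = 4 * (\<Sum>j\<in>UNIV. ?N t $ i $ j * cnj (cyc (?c t) j u v))"
      using ev evg
    proof eventually_elim
      case (elim t)
      then obtain Y where Y: "dual_frames (B t) (?c t) Y"
        using proj_cof_dual[where a = a, OF _ a(1)] by blast
      show ?case
        using nij_mat_expand[OF Y, of "n t" i u v] N_proj_eq[OF Y, of "n t" X] elim by simp
    qed
    ultimately have "((\<lambda>t. ?c t i (n t u v)) has_vector_derivative
       4 * (\<Sum>j\<in>UNIV. ?N 0 $ i $ j * cnj (k j u v) + N' $ i $ j * cnj (cyc (?c 0) j u v))) (at 0)"
      using eventually_nhds_x_imp_x
      by (subst has_vector_derivative_cong_ev[where g = "\<lambda>t. 4 * (\<Sum>j\<in>UNIV. ?N t $ i $ j * cnj (cyc (?c t) j u v))"]) auto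
    from vector_derivative_unique_at[OF cn' this] show ?thesis by (simp only: N00 c0)
  qed
  \<comment> \<open>Four times the part of \<open>n'\<close> that is conjugate linear in both slots.
    The terms from the motion of the coframe have other types and drop out, which leaves the matrix
    4 \<open>N'\<close>.\<close>
  define m where "m u v = n' u v - n' (A *v u) (A *v v) + A *v n' u (A *v v) + A *v n' (A *v u) v" for u v
  have m: "a i (m u v) = 4 * (\<Sum>j\<in>UNIV. (\<chi> i j. 4 * N' $ i $ j) $ i $ j * cnj (cyc a j u v))" for i u v
  proof -
    have i: "a i (n' u v) = 4 * (\<Sum>j\<in>UNIV. N0 $ i $ j * cnj (k j u v) + N' $ i $ j * cnj (cyc a j u v)) - a' i (n 0 u v)" for u v
      using id[of i u v] by (simp only: eq_diff_eq add.commute)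
    show ?thesis
      by (simp add: m_def linear_add[OF a(1)] linear_diff[OF a(1)] a(2) i)
         (simp add: nD(5,6) k_def cyc_def a(2) a'_type a'_neg AAv matrix_vector_neg sum_3 algebra_simps)
  qed
  define q where "q = (\<Sum>i\<in>UNIV. \<Sum>j\<in>UNIV. Q_mat N0 $ i $ j * N' $ i $ j)"
  have E: "E_part A (cyclic_sum (omega_pt A (n 0)) n') u v w = 16 * complex_of_real (Im (cnj q * vol_of a [u, v, w]))" for u v w
  proof -
    note o = omega_pt_linear[OF X n0]
    have oA: "omega_pt A (n 0) z (A *v w) = - omega_pt A (n 0) (A *v z) w" for z w by (simp add: o(4))
    have "E_part A (cyclic_sum (omega_pt A (n 0)) n') u v w = cyclic_sum (omega_pt A (n 0)) m u v w"
      by (simp add: E_part_def cyclic_sum_def m_def oA linear_add[OF o(1)] linear_diff[OF o(1)])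
    also have "\<dots> = 4 * complex_of_real (Im (cnj (4 * q) * vol_of a [u, v, w]))"
      unfolding omega_cyclic_sum[OF X n0 m] by (simp only: q_def N0_def sum_distrib_left vec_lambda_beta mult.left_commute)
    also have "cnj (4 * q) * vol_of a [u, v, w] = 4 * (cnj q * vol_of a [u, v, w])" by simp
    also have "Im (4 * z) = 4 * Im z" for z by simp
    finally show ?thesis by (simp only: of_real_mult) simp
  qed
  let ?P = "P_num N0"
  let ?R = "\<lambda>t. complex_of_real c1 * (det (?N t) * cnj (det (?N t))) + complex_of_real c2 * (P_num (?N t) * cnj (P_num (?N t)))"
  define d where "d = (\<Sum>i\<in>UNIV. \<Sum>j\<in>UNIV. adjugate (transpose N0) $ i $ j * N' $ i $ j)"
  define r where "r = (2 * q + (\<Sum>i\<in>UNIV. \<Sum>j\<in>UNIV. adjugate (transpose N0) $ j $ i * cnj (N' $ i $ j))) / 3"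
  have d': "((\<lambda>t. det (?N t)) has_vector_derivative d) (at 0)"
    using det_has_vector_derivative[OF N'] by (simp only: N00 d_def)
  have r': "((\<lambda>t. cnj (P_num (?N t))) has_vector_derivative r) (at 0)"
    using cnj_P_has_vector_derivative[OF N'] by (simp only: N00 r_def q_def)
  have r'': "((\<lambda>t. P_num (?N t)) has_vector_derivative cnj r) (at 0)"
    using has_vector_derivative_cnj[OF r'] by simp
  have R': "(?R has_vector_derivative complex_of_real c1 * (det N0 * cnj d + d * cnj (det N0)) +
      complex_of_real c2 * (?P * r + cnj r * cnj ?P)) (at 0)"
    unfolding N00[symmetric]
    by (intro has_vector_derivative_add has_vector_derivative_mult_right has_vector_derivative_mult d' r' r'' has_vector_derivative_cnj)
  note rt = real_type_adjugate[OF H N[folded N0_def]]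
  have dd: "d * cnj (det N0) = ?P * q"
    unfolding d_def q_def sum_distrib_left sum_distrib_right
    by (intro sum.cong refl) (simp only: mult.assoc[symmetric] rt(1)[symmetric], simp only: mult_ac)
  \<comment> \<open>The slots of cnj P that contain N contribute 2/3 of P q and the conjugate slot
    1/3 of its conjugate, so that P r has the same real part as P q, the quantity found in
    \<open>dd\<close> for the determinant.\<close>
  have rr: "?P * r = 2 / 3 * (?P * q) + 1 / 3 * cnj (?P * q)"
  proof -
    have "?P * (\<Sum>i\<in>UNIV. \<Sum>j\<in>UNIV. adjugate (transpose N0) $ j $ i * cnj (N' $ i $ j)) =
        (\<Sum>i\<in>UNIV. \<Sum>j\<in>UNIV. cnj (?P * Q_mat N0 $ i $ j) * cnj (N' $ i $ j))"
      unfolding sum_distrib_left rt(2)[symmetric] by (simp only: mult.assoc)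
    also have "\<dots> = cnj (?P * q)"
      unfolding q_def sum_distrib_left cnj_sum by (simp only: mult.assoc complex_cnj_mult)
    finally show ?thesis unfolding r_def by (simp only: distrib_left add_divide_distrib times_divide_eq_right) simp
  qed
  have "complex_of_real c1 * (det N0 * cnj d + d * cnj (det N0)) + complex_of_real c2 * (?P * r + cnj r * cnj ?P) =
      complex_of_real (2 * (c1 + c2) * Re (?P * q))"
  proof -
    have 1: "det N0 * cnj d = cnj (?P * q)" using arg_cong[OF dd, of cnj] by (simp add: mult.commute)
    have 2: "cnj r * cnj ?P = 2 / 3 * cnj (?P * q) + 1 / 3 * (?P * q)" using arg_cong[OF rr, of cnj] by (simp add: mult.commute)
    have "complex_of_real c1 * (cnj z + z) + complex_of_real c2 * (2 / 3 * z + 1 / 3 * cnj z + (2 / 3 * cnj z + 1 / 3 * z)) =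
      complex_of_real (2 * (c1 + c2) * Re z)" for z
      by (simp add: complex_eq_iff algebra_simps)
    then show ?thesis unfolding dd rr 1 2 .
  qed
  with R' have R'': "(?R has_vector_derivative complex_of_real (2 * (c1 + c2) * Re (?P * q))) (at 0)" by (simp only:)
  have "((\<lambda>t. \<i> / 8 * ?R t * top_of (?c t) std_frame) has_vector_derivative
     \<i> / 8 * ?R 0 * 0 + \<i> / 8 * complex_of_real (2 * (c1 + c2) * Re (?P * q)) * top_of (?c 0) std_frame) (at 0)"
    by (intro has_vector_derivative_mult has_vector_derivative_mult_right R'' top_of_derivative_zero[OF X lin c0 c' a'_type])
  then have "((\<lambda>t. F_val c1 c2 (B t) (n t) a X) has_vector_derivative
      \<i> / 8 * complex_of_real (2 * (c1 + c2) * Re (?P * q)) * top_of a std_frame) (at 0)"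
    by (simp only: F_val_def c0 mult_zero_right add_0_left)
  with E show ?thesis by blast
qed

section \<open>Variations in a chart\<close>

definition chart_variation :: "(real^6) set \<Rightarrow> real \<Rightarrow> (real \<Rightarrow> field) \<Rightarrow> bool" where
  "chart_variation V \<epsilon> Jt \<longleftrightarrow> open V \<and> 0 < \<epsilon> \<and> smooth_on ({-\<epsilon><..<\<epsilon>} \<times> V) (\<lambda>z. Jt (fst z) (snd z)) \<and>
     (\<forall>t\<in>{-\<epsilon><..<\<epsilon>}. \<forall>x\<in>V. Jt t x ** Jt t x = - mat 1)"

text \<open>Differentiation takes place jointly in (t,x): smoothness in x is then immediate, and the
  exchange with derivatives in x is symmetry of second derivatives.\<close>

definition velocity :: "(real \<Rightarrow> field) \<Rightarrow> field" where
  "velocity Jt x = frechet_derivative (\<lambda>z. Jt (fst z) (snd z)) (at (0, x)) (1, 0)"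

lemma chart_variationD:
  assumes "chart_variation V \<epsilon> Jt"
  shows "open V" "0 < \<epsilon>" "0 \<in> {-\<epsilon><..<\<epsilon>}" "open ({-\<epsilon><..<\<epsilon>} \<times> V)"
    "smooth_on ({-\<epsilon><..<\<epsilon>} \<times> V) (\<lambda>z. Jt (fst z) (snd z))"
    "t \<in> {-\<epsilon><..<\<epsilon>} \<Longrightarrow> acs_on V (Jt t)"
proof -
  show 1: "open V" "0 < \<epsilon>" "0 \<in> {-\<epsilon><..<\<epsilon>}" "open ({-\<epsilon><..<\<epsilon>} \<times> V)"
    "smooth_on ({-\<epsilon><..<\<epsilon>} \<times> V) (\<lambda>z. Jt (fst z) (snd z))"
    using assms by (simp_all add: chart_variation_def open_Times)
  show "t \<in> {-\<epsilon><..<\<epsilon>} \<Longrightarrow> acs_on V (Jt t)"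
    using smooth_on_slice[OF 1(1) _ 1(5), of t] assms unfolding acs_on_def chart_variation_def by simp
qed

lemma Dfield_slice:
  assumes "chart_variation V \<epsilon> Jt" "t \<in> {-\<epsilon><..<\<epsilon>}" "x \<in> V"
  shows "Dfield (Jt t) x w = frechet_derivative (\<lambda>z. Jt (fst z) (snd z)) (at (t, x)) (0, w)"
  using frechet_derivative_slice[OF chart_variationD(5)[OF assms(1)] assms(2,3), of w]
  by (simp add: Dfield_def)

lemma Jt_has_vector_derivative:
  assumes "chart_variation V \<epsilon> Jt" "x \<in> V"
  shows "((\<lambda>t. Jt t x) has_vector_derivative velocity Jt x) (at 0)"
  using has_vector_derivative_slice[OF smooth_on_has_derivative[OF chart_variationD(5)[OF assms(1)]], of 0 x]
    chart_variationD(3)[OF assms(1)] assms(2) by (simp add: velocity_def)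

lemma smooth_velocity:
  assumes "chart_variation V \<epsilon> Jt"
  shows "smooth_on V (velocity Jt)"
  using smooth_on_slice[OF chart_variationD(1,3)[OF assms] smooth_on_frechet[OF chart_variationD(5)[OF assms]], of "(1, 0)"]
  unfolding velocity_def[abs_def] .

text \<open>Exchange of the derivatives in \<open>t\<close> and in the base.\<close>

lemma Dfield_has_vector_derivative:
  assumes "chart_variation V \<epsilon> Jt" "x \<in> V"
  shows "((\<lambda>t. Dfield (Jt t) x w) has_vector_derivative Dfield (velocity Jt) x w) (at 0)"
proof -
  note sm = chart_variationD(5)[OF assms(1)] and O = chart_variationD(4)[OF assms(1)]
  have z: "(0, x) \<in> {-\<epsilon><..<\<epsilon>} \<times> V" using chart_variationD(3)[OF assms(1)] assms(2) by simp
  let ?G = "\<lambda>z. Jt (fst z) (snd z)"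
  have "((\<lambda>t. frechet_derivative ?G (at (t, x)) (0, w)) has_vector_derivative
      frechet_derivative (\<lambda>z. frechet_derivative ?G (at z) (0, w)) (at (0, x)) (1, 0)) (at 0)"
    by (rule has_vector_derivative_slice[OF smooth_on_has_derivative[OF smooth_on_frechet[OF sm] z]])
  also have "frechet_derivative (\<lambda>z. frechet_derivative ?G (at z) (0, w)) (at (0, x)) (1, 0) =
      frechet_derivative (\<lambda>z. frechet_derivative ?G (at z) (1, 0)) (at (0, x)) (0, w)"
    by (rule symmetric_second_derivative[OF sm O z])
  also have "\<dots> = Dfield (velocity Jt) x w"
    unfolding Dfield_def velocity_def[abs_def]
    by (rule frechet_derivative_slice[OF smooth_on_frechet[OF sm], symmetric]) (use z in auto)
  finally have "((\<lambda>t. frechet_derivative ?G (at (t, x)) (0, w)) has_vector_derivative Dfield (velocity Jt) x w) (at 0)" .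
  then show ?thesis
    by (rule has_vector_derivative_transform_within_open[of _ _ _ "{-\<epsilon><..<\<epsilon>}"])
       (use chart_variationD(3)[OF assms(1)] Dfield_slice[OF assms(1) _ assms(2)] in auto)
qed

lemma has_vector_derivative_mv:
  assumes "(B has_vector_derivative B') (at t)" "(Z has_vector_derivative Z') (at t)"
  shows "((\<lambda>t. (B t :: real^6^6) *v Z t) has_vector_derivative B t *v Z' + B' *v Z t) (at t)"
  by (rule bounded_bilinear.has_vector_derivative[OF bounded_bilinear_matrix_vector assms])

lemma Dfield_var_has_vector_derivative:
  assumes C: "chart_variation V \<epsilon> Jt" "x \<in> V" and Z: "(Z has_vector_derivative Z') (at 0)"
  shows "((\<lambda>t. Dfield (Jt t) x (Z t)) has_vector_derivative Dfield (Jt 0) x Z' + Dfield (velocity Jt) x (Z 0)) (at 0)"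
proof -
  have ex: "L v = (\<Sum>b\<in>UNIV. v $ b *\<^sub>R L (axis b 1))" if "linear L" for L :: "real^6 \<Rightarrow> real^6^6" and v
    by (subst vec_axis_sum[of v]) (simp add: linear_sum[OF that] linear_scale[OF that])
  have lin: "linear (Dfield (Jt t) x)" if "t \<in> {-\<epsilon><..<\<epsilon>}" for t
    by (rule acs_onD(6)[OF chart_variationD(6)[OF C(1) that] C(2)])
  have linv: "linear (Dfield (velocity Jt) x)"
    unfolding Dfield_def by (rule linear_frechet_derivative[OF smooth_on_differentiable[OF smooth_velocity[OF C(1)] C(2)], unfolded eta_contract_eq])
  have "((\<lambda>t. \<Sum>b\<in>UNIV. Z t $ b *\<^sub>R Dfield (Jt t) x (axis b 1)) has_vector_derivative
      (\<Sum>b\<in>UNIV. Z 0 $ b *\<^sub>R Dfield (velocity Jt) x (axis b 1) + Z' $ b *\<^sub>R Dfield (Jt 0) x (axis b 1))) (at 0)"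
    by (intro has_vector_derivative_sum bounded_bilinear.has_vector_derivative[OF bounded_bilinear_scaleR]
        bounded_linear.has_vector_derivative[OF bounded_linear_vec_nth Z] Dfield_has_vector_derivative[OF C])
  also have "(\<Sum>b\<in>UNIV. Z 0 $ b *\<^sub>R Dfield (velocity Jt) x (axis b 1) + Z' $ b *\<^sub>R Dfield (Jt 0) x (axis b 1)) =
      Dfield (Jt 0) x Z' + Dfield (velocity Jt) x (Z 0)"
    using ex[OF linv, of "Z 0"] ex[OF lin[OF chart_variationD(3)[OF C(1)]], of Z'] by (simp add: sum.distrib)
  finally show ?thesis
    by (rule has_vector_derivative_transform_within_open[of _ _ _ "{-\<epsilon><..<\<epsilon>}"])
       (use chart_variationD(3)[OF C(1)] in \<open>auto intro!: ex[OF lin, symmetric]\<close>)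
qed

lemma nij_has_vector_derivative:
  assumes C: "chart_variation V \<epsilon> Jt" "x \<in> V"
  shows "((\<lambda>t. nij (Jt t) x u v) has_vector_derivative nij_dot (Jt 0) (velocity Jt) x u v) (at 0)"
proof -
  have Jv: "((\<lambda>t. Jt t x *v u) has_vector_derivative velocity Jt x *v u) (at 0)" for u
    by (rule bounded_linear.has_vector_derivative[OF bounded_linear_matrix_vector_left Jt_has_vector_derivative[OF C]])
  have mv: "((\<lambda>t. (B t :: real^6^6) *v v) has_vector_derivative B' *v v) (at 0)" if "(B has_vector_derivative B') (at 0)" for B B' v
    by (rule bounded_linear.has_vector_derivative[OF bounded_linear_matrix_vector_left that])
  show ?thesis
    unfolding nij_def
    by (rule has_vector_derivative_eq_rhs[OF has_vector_derivative_add[OF has_vector_derivative_diff[OF has_vector_derivative_diff[OF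
          mv[OF Dfield_var_has_vector_derivative[OF C Jv]] mv[OF Dfield_var_has_vector_derivative[OF C Jv]]]
          has_vector_derivative_mv[OF Jt_has_vector_derivative[OF C] mv[OF Dfield_has_vector_derivative[OF C]]]]
          has_vector_derivative_mv[OF Jt_has_vector_derivative[OF C] mv[OF Dfield_has_vector_derivative[OF C]]]]])
       (simp add: nij_dot_def matrix_vector_mult_add_rdistrib algebra_simps)
qed

lemma acs_tangent_velocity:
  assumes C: "chart_variation V \<epsilon> Jt"
  shows "acs_tangent V (Jt 0) (velocity Jt)"
  unfolding acs_tangent_def
proof (intro conjI ballI allI)
  show "smooth_on V (velocity Jt)" by (rule smooth_velocity[OF C])
  fix y v assume y: "y \<in> V"
  have Jv: "((\<lambda>t. Jt t y *v v) has_vector_derivative velocity Jt y *v v) (at 0)"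
    by (rule bounded_linear.has_vector_derivative[OF bounded_linear_matrix_vector_left Jt_has_vector_derivative[OF C y]])
  have "((\<lambda>t. Jt t y *v (Jt t y *v v)) has_vector_derivative
      Jt 0 y *v (velocity Jt y *v v) + velocity Jt y *v (Jt 0 y *v v)) (at 0)"
    by (rule has_vector_derivative_mv[OF Jt_has_vector_derivative[OF C y] Jv])
  moreover have "((\<lambda>t. Jt t y *v (Jt t y *v v)) has_vector_derivative 0) (at 0)"
    by (rule has_vector_derivative_transform_within_open[OF has_vector_derivative_const[of "- v"], of "{-\<epsilon><..<\<epsilon>}"])
       (use chart_variationD(3)[OF C] acs_onD(3)[OF chart_variationD(6)[OF C] y] in auto)
  ultimately have "Jt 0 y *v (velocity Jt y *v v) + velocity Jt y *v (Jt 0 y *v v) = 0"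
    by (rule vector_derivative_unique_at)
  then show "velocity Jt y *v (Jt 0 y *v v) = - (Jt 0 y *v (velocity Jt y *v v))"
    by (simp only: add_eq_0_iff)
qed

definition tau :: "(real \<Rightarrow> field) \<Rightarrow> form_field" where
  "tau Jt y = contr_sum (velocity Jt y) (omega_field (Jt 0) y)"

lemma form_on_tau:
  assumes "chart_variation V \<epsilon> Jt"
  shows "form_on V 2 (tau Jt)"
  unfolding tau_def[abs_def]
  by (rule form_on_contr_sum[OF chart_variationD(1)[OF assms]
        skew_2D(1)[OF skew_2_omega_field[OF chart_variationD(6)[OF assms chart_variationD(3)[OF assms]]]] smooth_velocity[OF assms]])

text \<open>The first variation of the integrand is exact up to the closed form \<open>d\<omega>\<close>.\<close>

lemma F_form_variation:
  assumes C: "chart_variation V \<epsilon> Jt" and x: "x \<in> V"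
    and ty: "\<And>y. y \<in> V \<Longrightarrow> typed_3 (Jt 0 y) (beta (Jt 0) y)" and psi: "psi (Jt 0) x \<noteq> (\<lambda>vs. 0)"
  shows "((\<lambda>t. F_form c1 c2 (Jt t) x std_frame) has_vector_derivative
     - complex_of_real (c1 + c2) / 12 * (ext_d (tau Jt) x \<and>\<^sub>f beta (Jt 0) x) std_frame) (at 0)"
proof -
  let ?J = "Jt 0" and ?s = "velocity Jt"
  note I0 = chart_variationD(3)[OF C] and V = chart_variationD(1)[OF C]
  note J = chart_variationD(6)[OF C I0]
  obtain a X where X: "dual_frames (?J x) a X" by (rule acs_dual_frame[OF J x])
  note a = dual_framesD[OF X]
  obtain s0 H where H: "\<forall>i j. H $ i $ j = cnj (H $ j $ i)" "nij_mat a X (nij ?J x) = (\<chi> i j. s0 * H $ i $ j)"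
    using real_type_local[OF J ty x X psi] by blast
  have H': "cnj (H $ i $ j) = H $ j $ i" for i j by (rule H(1)[rule_format, symmetric])
  let ?N = "nij_mat a X (nij ?J x)"
  have "\<forall>\<^sub>F t in nhds 0. t \<in> {-\<epsilon><..<\<epsilon>}" by (rule eventually_nhds_in_open[OF open_greaterThanLessThan I0])
  then have ev: "\<forall>\<^sub>F t in nhds 0. Jt t x ** Jt t x = - mat 1 \<and> nij_tensor (Jt t x) (nij (Jt t) x)"
    by eventually_elim (use acs_onD(4)[OF chart_variationD(6)[OF C] x] nij_tensor_nij[OF chart_variationD(6)[OF C] x] in blast)
  obtain q where q: "((\<lambda>t. F_val c1 c2 (Jt t x) (nij (Jt t) x) a X) has_vector_derivative
      \<i> / 8 * complex_of_real (2 * (c1 + c2) * Re (P_num ?N * q)) * top_of a std_frame) (at 0)"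
    "\<And>u v w. E_part (?J x) (cyclic_sum (omega_pt (?J x) (nij ?J x)) (nij_dot ?J ?s x)) u v w =
      16 * complex_of_real (Im (cnj q * vol_of a [u, v, w]))"
    using F_val_derivative[where a = a and X = X and A = "?J x" and B = "\<lambda>t. Jt t x" and n = "\<lambda>t. nij (Jt t) x"
        and s = "?s x" and n' = "nij_dot ?J ?s x" and ?c1.0 = c1 and ?c2.0 = c2, OF X nij_tensor_nij[OF J x] refl
        Jt_has_vector_derivative[OF C x] acs_tangentD(2)[OF acs_tangent_velocity[OF C] x] nij_has_vector_derivative[OF C x] ev H' H(2)]
    by blast
  have F': "((\<lambda>t. F_form c1 c2 (Jt t) x std_frame) has_vector_derivative
      \<i> / 8 * complex_of_real (2 * (c1 + c2) * Re (P_num ?N * q)) * top_of a std_frame) (at 0)"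
  proof -
    have g: "\<forall>\<^sub>F t in nhds 0. det (gram (proj_cof (Jt t x) a) X) \<noteq> 0"
      by (rule gram_eventually[where a = a, OF a(1) Jt_has_vector_derivative[OF C x]])
         (simp add: proj_cof_self[OF X] gram_self[OF X])
    have "\<forall>\<^sub>F t in nhds 0. F_form c1 c2 (Jt t) x std_frame = F_val c1 c2 (Jt t x) (nij (Jt t) x) a X"
      using g \<open>\<forall>\<^sub>F t in nhds 0. t \<in> {-\<epsilon><..<\<epsilon>}\<close>
      by eventually_elim (rule F_form_proj[where a = a, OF chart_variationD(6)[OF C] x a(1)])
    then show ?thesis
      using q(1) eventually_nhds_x_imp_x by (subst has_vector_derivative_cong_ev) auto
  qed
  \<comment> \<open>Both are top forms, hence may be compared on one frame. There \<open>W1\<close>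
    is 2 (c1 + c2) Re(P q), since i/8 times -8 i is 1, and d\<tau> \<and> \<beta> is -24 Re(P q);
    this is the origin of -1/12.\<close>
  define W1 where "W1 vs = \<i> / 8 * complex_of_real (2 * (c1 + c2) * Re (P_num ?N * q)) * top_of a vs" for vs
  define W2 where "W2 vs = - complex_of_real (c1 + c2) / 12 * (ext_d (tau Jt) x \<and>\<^sub>f beta ?J x) vs" for vs
  note ft = form_on_ext_d[OF V form_on_tau[OF C]] and fb = form_on_beta[OF J]
  have E: "E_part (?J x) (tri (ext_d (tau Jt) x)) u v w = - 8 * complex_of_real (Re (cnj q * vol_of a [u, v, w]))" for u v w
  proof -
    have c: "cyclic_sum (bi (omega_field ?J x)) m = cyclic_sum (omega_pt (?J x) (nij ?J x)) m" for m
      by (simp add: fun_eq_iff cyclic_sum_def omega_field_def)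
    have "vol_of a [?J x *v u, v, w] = \<i> * vol_of a [u, v, w]"
      by (simp add: vol_of_apply a(2) algebra_simps)
    then have "Im (cnj q * vol_of a [?J x *v u, v, w]) = Re (cnj q * vol_of a [u, v, w])"
      by (simp only: mult.left_commute[of _ \<i>]) simp
    then have "- 2 * E_part (?J x) (tri (ext_d (tau Jt) x)) u v w = 16 * complex_of_real (Re (cnj q * vol_of a [u, v, w]))"
      using E_nij_dot[OF J acs_tangent_velocity[OF C] skew_2_omega_field[OF J] x ty[OF x, unfolded beta_def], of u v w]
      unfolding c q(2) tau_def[abs_def] by (simp only:)
    moreover have "e = - 8 * z" if "- 2 * e = 16 * z" for e z :: complex using that by algebra
    ultimately show ?thesis by blast
  qed
  have "W1 std_frame = W2 std_frame"
  proof (rule alt_form_eq_on_frame[OF X])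
    show "alt_form W1" unfolding W1_def by (intro alt_form_scale alt_form_top_of a(1))
    show "alt_form W2" unfolding W2_def
      by (intro alt_form_scale alt_form_wedge form_onD(1)[OF ft x] form_onD(1)[OF fb x])
    have ht: "hom_form 3 (ext_d (tau Jt) x)" using form_onD(2)[OF ft x] by (simp add: numeral_3_eq_3 numeral_2_eq_2)
    note hb = form_onD(2)[OF fb x]
    let ?P = "P_num ?N"
    \<comment> \<open>As \<beta> has type (3,0)+(0,3), the twenty terms of the wedge product combine
      into the \<open>E_part\<close> of d\<tau> on X 1, X 2, X 3, which is governed by Re q, and the
      one with J inserted in the first slot, governed by Im q.\<close>
    have e: "ext_d (tau Jt) x [X 1, X 2, X 3] - ext_d (tau Jt) x [?J x *v X 1, ?J x *v X 2, X 3]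
       - ext_d (tau Jt) x [X 1, ?J x *v X 2, ?J x *v X 3] - ext_d (tau Jt) x [?J x *v X 1, X 2, ?J x *v X 3] =
       - 8 * complex_of_real (Re q)"
      using E[of "X 1" "X 2" "X 3"] by (simp add: E_part_def vol_of_apply a(3))
    have e': "ext_d (tau Jt) x [?J x *v X 1, X 2, X 3] + ext_d (tau Jt) x [X 1, ?J x *v X 2, X 3]
       - ext_d (tau Jt) x [?J x *v X 1, ?J x *v X 2, ?J x *v X 3] + ext_d (tau Jt) x [X 1, X 2, ?J x *v X 3] =
       - 8 * complex_of_real (Im q)"
      using E[of "?J x *v X 1" "X 2" "X 3"]
      by (simp add: E_part_def vol_of_apply a(2,3) acs_onD(3)[OF J x] alt_form_3(3)[OF form_onD(1)[OF ft x]])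
    have bv: "beta ?J x [u, v, w] = 3 * complex_of_real (Im (?P * vol_of a [u, v, w]))" for u v w
      by (rule beta_eq[OF J x ty[OF x] X])
    have "(ext_d (tau Jt) x \<and>\<^sub>f beta ?J x) (frame_list (?J x) X) =
        3 * complex_of_real (Re ?P) * (- 8 * complex_of_real (Re q)) - 3 * complex_of_real (Im ?P) * (- 8 * complex_of_real (Im q))"
      unfolding e[symmetric] e'[symmetric] frame_list_def wedge_3_3[OF ht hb] bv
      by (simp add: vol_of_apply a(2,3)) (simp add: algebra_simps)
    then have "(ext_d (tau Jt) x \<and>\<^sub>f beta ?J x) (frame_list (?J x) X) = - 24 * complex_of_real (Re (?P * q))"
      by (simp add: algebra_simps)
    moreover have "\<i> / 8 * complex_of_real (2 * c * r) * (- 8 * \<i>) = - complex_of_real c / 12 * (- 24 * complex_of_real r)" for c r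
      by (simp add: complex_eq_iff)
    ultimately show "W1 (frame_list (?J x) X) = W2 (frame_list (?J x) X)"
      unfolding W1_def W2_def top_of_frame[OF X] by (simp only:)
  qed
  then show ?thesis using F' unfolding W1_def W2_def by (simp only:)
qed


subsection \<open>Smoothness of the integrand\<close>

lemma smooth_on_det_pol:
  assumes "open S" "\<And>i j. smooth_on S (\<lambda>y. a y $ i $ j)" "\<And>i j. smooth_on S (\<lambda>y. b y $ i $ j)"
    "\<And>i j. smooth_on S (\<lambda>y. c y $ i $ j)"
  shows "smooth_on S (\<lambda>y. det_pol (a y) (b y) (c y))"
proof -
  have "smooth_on S (\<lambda>y. (1 / 6) * (det (a y + b y + c y) - det (a y + b y) - det (b y + c y) - det (a y + c y)
                + det (a y) + det (b y) + det (c y)))"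
    by (intro smooth_on_mult smooth_on_const smooth_on_add smooth_on_diff smooth_on_det3 assms(1))
       (simp_all add: smooth_on_add assms)
  then show ?thesis by (simp add: det_pol_def)
qed

lemma smooth_on_F_val:
  assumes S: "open S" and G: "smooth_on S G" and n: "\<And>u v. smooth_on S (\<lambda>z. n z u v)"
    and lin: "\<And>i. linear (a i)" and g: "\<And>z. z \<in> S \<Longrightarrow> det (gram (proj_cof (G z) a) X) \<noteq> 0"
  shows "smooth_on S (\<lambda>z. F_val c1 c2 (G z) (n z) a X)"
proof -
  have pc: "smooth_on S (\<lambda>z. proj_cof (G z) a i (w z))" if "smooth_on S w" for i w
  proof -
    have "smooth_on S (\<lambda>z. (1 / 2) * (a i (w z) - \<i> * a i (G z *v w z)))"
      by (intro smooth_on_mult smooth_on_diff smooth_on_const S smooth_on_linear[OF linear_bounded[OF lin]]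
          smooth_on_mv that G)
    then show ?thesis by (simp add: proj_cof_def)
  qed
  have pc0: "smooth_on S (\<lambda>z. proj_cof (G z) a i v)" for i v by (rule pc[OF smooth_on_const])
  have det: "smooth_on S (\<lambda>z. det (gram (proj_cof (G z) a) X))"
    by (rule smooth_on_det3[OF S]) (simp add: gram_def pc0)
  have gr: "smooth_on S (\<lambda>z. gram (proj_cof (G z) a) X $ i $ j)" for i j by (simp add: gram_def pc0)
  have N: "smooth_on S (\<lambda>z. N_proj (G z) (n z) a X $ i $ l)" for i l
    unfolding N_proj_def nij_mat_def vec_lambda_beta divide_inverse
    by (intro smooth_on_mult smooth_on_sum smooth_on_const S pc n smooth_on_cnj gr smooth_on_inverse det) (simp add: g)
  have detN: "smooth_on S (\<lambda>z. det (N_proj (G z) (n z) a X))" by (rule smooth_on_det3[OF S N])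
  have P: "smooth_on S (\<lambda>z. P_num (N_proj (G z) (n z) a X))"
    by (rule smooth_on_det_pol[OF S]) (simp_all add: cnj_mat_def transpose_def smooth_on_cnj[OF S] N)
  have one: "smooth_on S (\<lambda>z. one_form (proj_cof (G z) a i) vs)" for i vs
    by (cases vs rule: remdups_adj.cases) (simp_all add: smooth_on_const pc0)
  have vol: "smooth_on S (\<lambda>z. vol_of (proj_cof (G z) a) vs)" for vs
    unfolding vol_of_def by (intro wedge_smooth S one)
  have top: "smooth_on S (\<lambda>z. top_of (proj_cof (G z) a) vs)" for vs
    unfolding top_of_def by (intro wedge_smooth S vol) (simp add: cnj_form_def smooth_on_cnj[OF S vol])
  show ?thesis
    unfolding F_val_def by (intro smooth_on_mult smooth_on_add smooth_on_const S smooth_on_cnj detN P top)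
qed

text \<open>Near a given point of the product, a coframe of the structure there is projected to all
  neighbouring structures; in it the integrand is the explicit expression
  \<open>F_val\<close>.\<close>

lemma smooth_on_F_form:
  assumes C: "chart_variation V \<epsilon> Jt"
  shows "smooth_on ({-\<epsilon><..<\<epsilon>} \<times> V) (\<lambda>z. F_form c1 c2 (Jt (fst z)) (snd z) std_frame)"
proof (rule smooth_on_local)
  let ?S = "{-\<epsilon><..<\<epsilon>} \<times> V"
  let ?G = "\<lambda>z. Jt (fst z) (snd z)"
  note S = chart_variationD(4)[OF C] and G = chart_variationD(5)[OF C]
  fix z0 assume "z0 \<in> ?S"
  then have z0: "fst z0 \<in> {-\<epsilon><..<\<epsilon>}" "snd z0 \<in> V" by auto
  note J0 = chart_variationD(6)[OF C z0(1)]
  obtain a X where X: "dual_frames (?G z0) a X" by (rule acs_dual_frame[OF J0 z0(2)])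
  note lin = dual_framesD(1)[OF X]
  have Dvar: "smooth_on ?S (\<lambda>z. Dfield (Jt (fst z)) (snd z) (W z))" if W: "smooth_on ?S W" for W
  proof -
    have "Dfield (Jt (fst z)) (snd z) (W z) = (\<Sum>b\<in>UNIV. W z $ b *\<^sub>R frechet_derivative ?G (at z) (0, axis b 1))"
      if "z \<in> ?S" for z
    proof -
      have z: "fst z \<in> {-\<epsilon><..<\<epsilon>}" "snd z \<in> V" using that by auto
      have l: "linear (Dfield (Jt (fst z)) (snd z))" by (rule acs_onD(6)[OF chart_variationD(6)[OF C z(1)] z(2)])
      have "Dfield (Jt (fst z)) (snd z) (W z) = (\<Sum>b\<in>UNIV. W z $ b *\<^sub>R Dfield (Jt (fst z)) (snd z) (axis b 1))"
        by (subst vec_axis_sum[of "W z"]) (simp only: linear_sum[OF l] linear_scale[OF l])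
      then show ?thesis by (simp only: Dfield_slice[OF C z] prod.collapse)
    qed
    moreover have "smooth_on ?S (\<lambda>z. \<Sum>b\<in>UNIV. W z $ b *\<^sub>R frechet_derivative ?G (at z) (0, axis b 1))"
      by (intro smooth_on_sum smooth_on_scaleR S smooth_on_vec_nth W smooth_on_frechet G)
    ultimately show ?thesis by (subst smooth_on_cong[OF S])
  qed
  have n: "smooth_on ?S (\<lambda>z. nij (Jt (fst z)) (snd z) u v)" for u v
    unfolding nij_def
    by (intro smooth_on_add smooth_on_diff S smooth_on_mv Dvar G smooth_on_const)
  define T where "T = ?S \<inter> (\<lambda>z. det (gram (proj_cof (?G z) a) X)) -` (- {0})"
  have "smooth_on ?S (\<lambda>z. det (gram (proj_cof (?G z) a) X))"
    by (rule smooth_on_det3[OF S]) (simp add: gram_def smooth_on_proj_cof[OF S G lin])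
  then have T: "open T"
    unfolding T_def by (intro continuous_open_preimage smooth_on_continuous S) auto
  have "smooth_on T (\<lambda>z. F_val c1 c2 (?G z) (nij (Jt (fst z)) (snd z)) a X)"
    by (rule smooth_on_F_val[where a = a, OF T _ _ lin])
       (auto intro: smooth_on_subset[OF G] smooth_on_subset[OF n] simp: T_def)
  moreover have "F_form c1 c2 (Jt (fst z)) (snd z) std_frame = F_val c1 c2 (?G z) (nij (Jt (fst z)) (snd z)) a X" if "z \<in> T" for z
  proof -
    have z: "fst z \<in> {-\<epsilon><..<\<epsilon>}" "snd z \<in> V" "det (gram (proj_cof (?G z) a) X) \<noteq> 0"
      using that unfolding T_def by auto
    show ?thesis by (rule F_form_proj[where a = a, OF chart_variationD(6)[OF C z(1)] z(2) lin z(3)])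
  qed
  ultimately have "smooth_on T (\<lambda>z. F_form c1 c2 (Jt (fst z)) (snd z) std_frame)"
    by (subst smooth_on_cong[OF T])
  moreover have "?S \<inter> T = T" by (auto simp: T_def)
  moreover have "z0 \<in> T"
    using \<open>z0 \<in> ?S\<close> unfolding T_def by (auto simp: proj_cof_self[OF X] gram_self[OF X])
  ultimately show "\<exists>T. open T \<and> z0 \<in> T \<and> smooth_on (?S \<inter> T) (\<lambda>z. F_form c1 c2 (Jt (fst z)) (snd z) std_frame)"
    using T by (intro exI[of _ T]) simp
qed

section \<open>Naturality under changes of coordinates\<close>

text \<open>Pseudoholomorphic local diffeomorphisms; between spaces of equal dimension, injectivity
  of the differential is invertibility.\<close>

definition acs_map :: "(real^6) set \<Rightarrow> field \<Rightarrow> (real^6) set \<Rightarrow> field \<Rightarrow> (real^6 \<Rightarrow> real^6) \<Rightarrow> bool" where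
  "acs_map V J W K f \<longleftrightarrow> acs_on V J \<and> acs_on W K \<and> smooth_on V f \<and> f ` V \<subseteq> W \<and>
     (\<forall>x\<in>V. inj (frechet_derivative f (at x))) \<and>
     (\<forall>x\<in>V. \<forall>v. frechet_derivative f (at x) (J x *v v) = K (f x) *v frechet_derivative f (at x) v)"

lemma acs_mapD:
  assumes "acs_map V J W K f"
  shows "acs_on V J" "acs_on W K" "smooth_on V f" "x \<in> V \<Longrightarrow> f x \<in> W"
    "x \<in> V \<Longrightarrow> inj (frechet_derivative f (at x))" "x \<in> V \<Longrightarrow> linear (frechet_derivative f (at x))"
    "x \<in> V \<Longrightarrow> (f has_derivative frechet_derivative f (at x)) (at x)"
    "x \<in> V \<Longrightarrow> frechet_derivative f (at x) (J x *v v) = K (f x) *v frechet_derivative f (at x) v"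
proof -
  show 1: "acs_on V J" "acs_on W K" "smooth_on V f" "x \<in> V \<Longrightarrow> f x \<in> W"
    "x \<in> V \<Longrightarrow> inj (frechet_derivative f (at x))"
    "x \<in> V \<Longrightarrow> frechet_derivative f (at x) (J x *v v) = K (f x) *v frechet_derivative f (at x) v"
    using assms by (auto simp: acs_map_def)
  show "x \<in> V \<Longrightarrow> (f has_derivative frechet_derivative f (at x)) (at x)"
    by (rule smooth_on_has_derivative[OF 1(3)])
  then show "x \<in> V \<Longrightarrow> linear (frechet_derivative f (at x))" by (rule has_derivative_linear)
qed

text \<open>The second derivatives of the coordinate change cancel by symmetry.\<close>

lemma nij_natural:
  assumes m: "acs_map V J W K f" and x: "x \<in> V"
  defines "L \<equiv> frechet_derivative f (at x)"
  shows "L (nij J x u v) = nij K (f x) (L u) (L v)"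
proof -
  note D = acs_mapD[OF m] and V = acs_onD(1)[OF acs_mapD(1)[OF m]]
  note lin = D(6)[OF x, folded L_def] and LJ = D(8)[OF x, folded L_def]
  define D2 where "D2 h v = frechet_derivative (\<lambda>y. frechet_derivative f (at y) v) (at x) h" for h v
  have sym: "D2 h v = D2 v h" for h v
    unfolding D2_def by (rule symmetric_second_derivative[OF D(3) V x])
  have d: "((\<lambda>y. frechet_derivative f (at y) v) has_derivative (\<lambda>h. D2 h v)) (at x)" for v
    unfolding D2_def by (rule smooth_on_has_derivative[OF smooth_on_frechet[OF D(3)] x])
  have ex: "F w = (\<Sum>b\<in>UNIV. w $ b *\<^sub>R F (axis b 1))" if "linear F" for F :: "real^6 \<Rightarrow> real^6" and w
    by (subst vec_axis_sum[of w]) (simp only: linear_sum[OF that] linear_scale[OF that])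
  have linD2: "linear (\<lambda>v. D2 h v)" for h
    unfolding sym[of h] using has_derivative_linear[OF d] .
  have lhs: "((\<lambda>y. frechet_derivative f (at y) (J y *v v)) has_derivative
      (\<lambda>h. L (Dfield J x h *v v) + D2 h (J x *v v))) (at x)" for v
  proof -
    have "((\<lambda>y. \<Sum>b\<in>UNIV. (J y *v v) $ b *\<^sub>R frechet_derivative f (at y) (axis b 1)) has_derivative
      (\<lambda>h. \<Sum>b\<in>UNIV. (J x *v v) $ b *\<^sub>R D2 h (axis b 1) + (Dfield J x h *v v) $ b *\<^sub>R L (axis b 1))) (at x)"
      unfolding L_def
      by (intro has_derivative_sum has_derivative_scaleR d
          bounded_linear.has_derivative[OF bounded_linear_vec_nth J_vec_has_derivative[OF D(1) x]])
    also have "(\<lambda>h. \<Sum>b\<in>UNIV. (J x *v v) $ b *\<^sub>R D2 h (axis b 1) + (Dfield J x h *v v) $ b *\<^sub>R L (axis b 1)) =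
        (\<lambda>h. L (Dfield J x h *v v) + D2 h (J x *v v))"
      unfolding sum.distrib ex[OF lin, of "Dfield J x _ *v v"] ex[OF linD2, of _ "J x *v v"] by (simp add: add.commute)
    finally show ?thesis
      by (rule has_derivative_transform_within_open[OF _ V x]) (rule ex[OF D(6), symmetric])
  qed
  have rhs: "((\<lambda>y. K (f y) *v frechet_derivative f (at y) v) has_derivative
      (\<lambda>h. K (f x) *v D2 h v + Dfield K (f x) (L h) *v L v)) (at x)" for v
    unfolding L_def
    by (rule bounded_bilinear.FDERIV[OF bounded_bilinear_matrix_vector
          has_derivative_compose[OF D(7)[OF x] acs_onD(5)[OF D(2) D(4)[OF x]]] d])
  have key: "L (Dfield J x h *v v) = K (f x) *v D2 h v + Dfield K (f x) (L h) *v L v - D2 h (J x *v v)" for h v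
  proof -
    have "(\<lambda>h. L (Dfield J x h *v v) + D2 h (J x *v v)) = (\<lambda>h. K (f x) *v D2 h v + Dfield K (f x) (L h) *v L v)"
      by (rule has_derivative_unique[OF has_derivative_transform_within_open[OF lhs V x] rhs]) (rule D(8))
    from fun_cong[OF this, of h] show ?thesis by (simp add: eq_diff_eq)
  qed
  have KK: "K (f x) *v (K (f x) *v w) = - w" for w by (rule acs_onD(3)[OF D(2) D(4)[OF x]])
  show ?thesis
    unfolding nij_def
    by (simp add: linear_add[OF lin] linear_diff[OF lin] LJ key matrix_vector_right_distrib matrix_vector_mult_diff_distrib KK
        sym[of "J x *v u"] sym[of "J x *v v" u] sym[of v u])
qed

lemma inverse_map:
  assumes m: "acs_map V J W K f" and x: "x \<in> V"
  obtains M where "linear M" "\<And>v. M (frechet_derivative f (at x) v) = v" "\<And>v. frechet_derivative f (at x) (M v) = v"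
proof -
  note lin = acs_mapD(6)[OF m x] and inj = acs_mapD(5)[OF m x]
  obtain M where M: "linear M" "M \<circ> frechet_derivative f (at x) = id"
    using linear_injective_left_inverse[OF lin inj] by blast
  have "frechet_derivative f (at x) \<circ> M = id"
    using linear_inverse_left[OF lin M(1)] M(2) by blast
  then show thesis using M by (intro that[of M]) (simp_all add: pointfree_idE)
qed

lemma dual_frames_map:
  assumes X: "dual_frames A a X" and M: "linear M" "\<And>v. M (L v) = v" and LA: "\<And>v. M (B *v v) = A *v M v"
  shows "dual_frames B (\<lambda>i v. a i (M v)) (\<lambda>i. L (X i))"
  unfolding dual_frames_def
  using linear_compose[OF M(1) dual_framesD(1)[OF X], unfolded comp_def]
  by (simp add: LA dual_framesD(2,3)[OF X] M(2))

lemma one_form_map: "(\<lambda>vs. one_form f (map L vs)) = one_form (\<lambda>v. f (L v))"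
proof
  fix vs show "one_form f (map L vs) = one_form (\<lambda>v. f (L v)) vs"
    by (cases vs rule: remdups_adj.cases) simp_all
qed

lemma vol_of_map: "vol_of a (map L vs) = vol_of (\<lambda>i v. a i (L v)) vs"
  by (simp add: vol_of_def wedge_map one_form_map)

lemma top_of_map: "top_of a (map L vs) = top_of (\<lambda>i v. a i (L v)) vs"
proof -
  have "(\<lambda>vs. vol_of b (map L vs)) = vol_of (\<lambda>i v. b i (L v))" for b
    by (rule ext) (rule vol_of_map)
  then show ?thesis by (simp add: top_of_def wedge_map cnj_vol_of)
qed

text \<open>The frame is pushed forward and the coframe pulled back along the inverse differential.
  As n is natural the Nijenhuis matrices coincide, and every invariant written with coframe and
  matrix becomes natural.\<close>

lemma transported_frame:
  assumes m: "acs_map V J W K f" and x: "x \<in> V" and X: "dual_frames (J x) a X"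
  defines "L \<equiv> frechet_derivative f (at x)"
  obtains b where "dual_frames (K (f x)) b (\<lambda>i. L (X i))" "\<forall>i v. b i (L v) = a i v"
    "nij_mat b (\<lambda>i. L (X i)) (nij K (f x)) = nij_mat a X (nij J x)"
proof -
  obtain M where M: "linear M" "\<And>v. M (L v) = v" "\<And>v. L (M v) = v"
    unfolding L_def by (rule inverse_map[OF m x]) blast
  have "M (K (f x) *v v) = J x *v M v" for v
  proof -
    have "K (f x) *v v = L (J x *v M v)"
      using acs_mapD(8)[OF m x, of "M v"] by (simp add: L_def[symmetric] M(3))
    then show ?thesis by (simp add: M(2))
  qed
  from dual_frames_map[OF X M(1,2) this]
  have "dual_frames (K (f x)) (\<lambda>i v. a i (M v)) (\<lambda>i. L (X i))" .
  moreover have "nij_mat (\<lambda>i v. a i (M v)) (\<lambda>i. L (X i)) (nij K (f x)) = nij_mat a X (nij J x)"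
    unfolding nij_mat_def L_def nij_natural[OF m x, symmetric] unfolding L_def[symmetric] M(2) ..
  ultimately show thesis by (intro that[of "\<lambda>i v. a i (M v)"]) (simp_all add: M(2))
qed

lemma F_form_natural:
  assumes m: "acs_map V J W K f" and x: "x \<in> V"
  shows "F_form c1 c2 J x std_frame =
    complex_of_real (det (matrix (frechet_derivative f (at x)))) * F_form c1 c2 K (f x) std_frame"
proof -
  let ?L = "frechet_derivative f (at x)"
  note D = acs_mapD[OF m]
  obtain a X where X: "dual_frames (J x) a X" by (rule acs_dual_frame[OF D(1) x])
  obtain b where b: "dual_frames (K (f x)) b (\<lambda>i. ?L (X i))" "\<forall>i v. b i (?L v) = a i v"
    "nij_mat b (\<lambda>i. ?L (X i)) (nij K (f x)) = nij_mat a X (nij J x)"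
    by (rule transported_frame[OF m x X])
  have "top_of a std_frame = top_of b (map ?L std_frame)"
    unfolding top_of_map b(2)[rule_format] ..
  also have "\<dots> = complex_of_real (det (matrix ?L)) * top_of b std_frame"
    by (rule alt_form_det_linear[OF alt_form_top_of[OF dual_framesD(1)[OF b(1)]] D(6)[OF x]])
  finally show ?thesis
    unfolding F_form_eq[OF D(1) x X] F_form_eq[OF D(2) D(4)[OF x] b(1)] b(3) by simp
qed

lemma det_matrix_rows:
  assumes "linear L"
  shows "det (vector [L a, L b, L c, L d, L e, L f] :: real^6^6) = det (matrix L) * det (vector [a, b, c, d, e, f] :: real^6^6)"
proof -
  have L: "matrix L *v w = L w" for w
    by (rule matrix_works) (rule assms[unfolded linear_matrix_vector_mul_eq[symmetric]])
  have "(vector [L a, L b, L c, L d, L e, L f] :: real^6^6) = vector [a, b, c, d, e, f] ** transpose (matrix L)"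
  proof -
    have "(vector [a, b, c, d, e, f] ** transpose (matrix L)) $ i = matrix L *v (vector [a, b, c, d, e, f] :: real^6^6) $ i" for i
      by (simp add: vec_eq_iff matrix_matrix_mult_def matrix_vector_mult_def transpose_def mult.commute)
    then show ?thesis
      by (simp add: vec_eq_iff[of "vector _ :: real^6^6"] forall_6 L)
  qed
  then show ?thesis by (simp add: det_mul)
qed

lemma orient_sign_natural:
  assumes m: "acs_map V J W K f" and x: "x \<in> V"
  shows "orient_sign (K (f x)) = sgn (det (matrix (frechet_derivative f (at x)))) * orient_sign (J x)"
proof -
  let ?L = "frechet_derivative f (at x)"
  note D = acs_mapD[OF m]
  obtain a X where X: "dual_frames (J x) a X" by (rule acs_dual_frame[OF D(1) x])
  obtain b where b: "dual_frames (K (f x)) b (\<lambda>i. ?L (X i))" by (rule transported_frame[OF m x X])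
  have "frame_list (K (f x)) (\<lambda>i. ?L (X i)) = map ?L (frame_list (J x) X)"
    by (simp add: frame_list_def D(8)[OF x])
  then show ?thesis
    unfolding orient_sign_frame[OF acs_onD(4)[OF D(1) x] X] orient_sign_frame[OF acs_onD(4)[OF D(2) D(4)[OF x]] b]
    by (simp add: frame_list_def det_matrix_rows[OF D(6)[OF x]] sgn_mult)
qed

lemma omega_natural:
  assumes m: "acs_map V J W K f" and x: "x \<in> V"
  shows "omega_field J x [u, v] = omega_field K (f x) [frechet_derivative f (at x) u, frechet_derivative f (at x) v]"
proof -
  let ?L = "frechet_derivative f (at x)"
  note D = acs_mapD[OF m]
  obtain a X where X: "dual_frames (J x) a X" by (rule acs_dual_frame[OF D(1) x])
  obtain b where b: "dual_frames (K (f x)) b (\<lambda>i. ?L (X i))" "\<forall>i v. b i (?L v) = a i v"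
    "nij_mat b (\<lambda>i. ?L (X i)) (nij K (f x)) = nij_mat a X (nij J x)"
    by (rule transported_frame[OF m x X])
  show ?thesis
    unfolding omega_field_def two_form_simps omega_pt_eq[OF X nij_tensor_nij[OF D(1) x]]
      omega_pt_eq[OF b(1) nij_tensor_nij[OF D(2) D(4)[OF x]]] b(3) by (simp add: herm_def b(2)[rule_format])
qed

text \<open>Naturality is read off from the pointwise formula \<open>beta_eq\<close> rather than
  from that of the exterior derivative; this is the purpose of the \<open>typed_3\<close>
  hypotheses.\<close>

lemma beta_natural:
  assumes m: "acs_map V J W K f" and x: "x \<in> V"
    and ty: "typed_3 (J x) (beta J x)" "typed_3 (K (f x)) (beta K (f x))"
  shows "beta J x vs = beta K (f x) (map (frechet_derivative f (at x)) vs)"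
proof (cases "length vs = 3")
  case True
  then obtain u v w where vs: "vs = [u, v, w]" by (auto simp: numeral_3_eq_3 length_Suc_conv)
  let ?L = "frechet_derivative f (at x)"
  note D = acs_mapD[OF m]
  obtain a X where X: "dual_frames (J x) a X" by (rule acs_dual_frame[OF D(1) x])
  obtain b where b: "dual_frames (K (f x)) b (\<lambda>i. ?L (X i))" "\<forall>i v. b i (?L v) = a i v"
    "nij_mat b (\<lambda>i. ?L (X i)) (nij K (f x)) = nij_mat a X (nij J x)"
    by (rule transported_frame[OF m x X])
  have "beta K (f x) [?L u, ?L v, ?L w] = beta J x [u, v, w]"
    unfolding beta_eq[OF D(1) x ty(1) X] beta_eq[OF D(2) D(4)[OF x] ty(2) b(1)] b(3) by (simp add: vol_of_apply b(2)[rule_format])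
  then show ?thesis by (simp add: vs)
next
  case False
  note D = acs_mapD[OF m]
  show ?thesis
    using False hom_formD[OF form_onD(2)[OF form_on_beta[OF D(1)] x]]
      hom_formD[OF form_onD(2)[OF form_on_beta[OF D(2)] D(4)[OF x]]] by simp
qed

text \<open>Differentiating the intertwining of \<open>Jt t\<close> and \<open>Kt t\<close> at t = 0
  shows that the differential of \<open>f\<close> relates the two velocities.\<close>

lemma tau_natural:
  assumes m: "acs_map V (Jt 0) W (Kt 0) f" and x: "x \<in> V"
    and J: "((\<lambda>t. Jt t x) has_vector_derivative velocity Jt x) (at 0)"
    and K: "((\<lambda>t. Kt t (f x)) has_vector_derivative velocity Kt (f x)) (at 0)"
    and nat: "\<forall>\<^sub>F t in nhds 0. \<forall>v. frechet_derivative f (at x) (Jt t x *v v) = Kt t (f x) *v frechet_derivative f (at x) v"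
  shows "tau Jt x vs = tau Kt (f x) (map (frechet_derivative f (at x)) vs)"
proof -
  let ?L = "frechet_derivative f (at x)"
  note D = acs_mapD[OF m]
  have s: "?L (velocity Jt x *v v) = velocity Kt (f x) *v ?L v" for v
  proof -
    have "((\<lambda>t. ?L (Jt t x *v v)) has_vector_derivative ?L (velocity Jt x *v v)) (at 0)"
      by (intro bounded_linear.has_vector_derivative[OF has_derivative_bounded_linear[OF D(7)[OF x]]]
          bounded_linear.has_vector_derivative[OF bounded_linear_matrix_vector_left] J)
    moreover have "((\<lambda>t. Kt t (f x) *v ?L v) has_vector_derivative velocity Kt (f x) *v ?L v) (at 0)"
      by (rule bounded_linear.has_vector_derivative[OF bounded_linear_matrix_vector_left K])
    moreover have "\<forall>\<^sub>F t in nhds 0. ?L (Jt t x *v v) = Kt t (f x) *v ?L v"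
      using nat by eventually_elim blast
    ultimately have "((\<lambda>t. ?L (Jt t x *v v)) has_vector_derivative velocity Kt (f x) *v ?L v) (at 0)"
      using eventually_nhds_x_imp_x by (subst has_vector_derivative_cong_ev) auto
    with \<open>((\<lambda>t. ?L (Jt t x *v v)) has_vector_derivative ?L (velocity Jt x *v v)) (at 0)\<close>
    show ?thesis by (rule vector_derivative_unique_at)
  qed
  show ?thesis
  proof (cases "length vs = 2")
    case True
    then obtain u v where vs: "vs = [u, v]" by (auto simp: numeral_2_eq_2 length_Suc_conv)
    show ?thesis
      by (simp add: vs tau_def contr_sum_def omega_natural[OF m x] s)
  next
    case False
    then show ?thesis by (simp add: tau_def contr_sum_def hom_formD[OF hom_form_two_form])
  qed
qed

section \<open>Integration on a manifold\<close>

text \<open>\<open>T\<close> identifies complex numbers with vectors in \<open>real^2\<close>, where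
  the theorem on absolutely integrable functions applies; integrability of both sides returns the
  result to Bochner integrals.\<close>

lemma change_of_variables_complex:
  fixes f :: "real^6 \<Rightarrow> complex" and \<phi> :: "real^6 \<Rightarrow> real^6"
  assumes S: "S \<in> sets borel" and der: "\<And>x. x \<in> S \<Longrightarrow> (\<phi> has_derivative \<phi>' x) (at x)" and inj: "inj_on \<phi> S"
    and int: "set_integrable lborel S (\<lambda>x. \<bar>det (matrix (\<phi>' x))\<bar> *\<^sub>R f (\<phi> x))" "set_integrable lborel (\<phi> ` S) f"
  shows "(LINT x:S|lborel. \<bar>det (matrix (\<phi>' x))\<bar> *\<^sub>R f (\<phi> x)) = (LINT y:\<phi> ` S|lborel. f y)"
proof -
  define T :: "complex \<Rightarrow> real^2" where "T z = (\<chi> i. if i = 1 then Re z else Im z)" for z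
  have T: "bounded_linear T"
    unfolding linear_conv_bounded_linear[symmetric] by (rule linearI) (simp_all add: T_def vec_eq_iff)
  have injT: "T y = T z \<Longrightarrow> y = z" for y z
    by (simp add: T_def vec_eq_iff forall_2 complex_eq_iff)
  note T_scale = linear_scale[OF bounded_linear.linear[OF T]]
  have TI: "set_integrable lborel X (\<lambda>x. T (h x))" "(LINT x:X|lborel. T (h x)) = T (LINT x:X|lborel. h x)"
    if "set_integrable lborel X h" for X and h :: "real^6 \<Rightarrow> complex"
    using integrable_bounded_linear[OF T that[unfolded set_integrable_def]]
      integral_bounded_linear[OF T that[unfolded set_integrable_def]]
    by (simp_all add: set_integrable_def set_lebesgue_integral_def T_scale)
  have abs: "h absolutely_integrable_on X" if "set_integrable lborel X h" for X and h :: "real^6 \<Rightarrow> real^2"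
    using that unfolding set_integrable_def by (subst integrable_completion) auto
  let ?D = "\<lambda>x. \<bar>det (matrix (\<phi>' x))\<bar> *\<^sub>R T (f (\<phi> x))"
  have "T (LINT x:S|lborel. \<bar>det (matrix (\<phi>' x))\<bar> *\<^sub>R f (\<phi> x)) = integral S ?D"
    using TI[OF int(1)] set_borel_integral_eq_integral(2)[OF TI(1)[OF int(1)]] by (simp add: T_scale)
  also have "\<dots> = integral (\<phi> ` S) (\<lambda>y. T (f y))"
  proof -
    have "S \<in> sets lebesgue" using S by simp
    from has_absolute_integral_change_of_variables[OF this has_derivative_at_withinI[OF der] inj, where f = "\<lambda>y. T (f y)"]
      abs[OF TI(1)[OF int(2)]]
    show ?thesis by blast
  qed
  also have "\<dots> = T (LINT y:\<phi> ` S|lborel. f y)"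
    using TI(2)[OF int(2)] set_borel_integral_eq_integral(2)[OF TI(1)[OF int(2)]] by simp
  finally show ?thesis by (rule injT)
qed

section \<open>Charts, transition maps and densities\<close>

lemma atlasD:
  assumes "smooth_atlas A" "c \<in> A"
  shows "open (chart_dom c)" "open (chart_img c)" "continuous_on (chart_dom c) (chart_map c)"
    "continuous_on (chart_img c) (chart_inv c)" "inj_on (chart_map c) (chart_dom c)"
    "p \<in> chart_dom c \<Longrightarrow> chart_inv c (chart_map c p) = p"
proof -
  have h: "homeomorphism (chart_dom c) (chart_img c) (chart_map c) (chart_inv c)"
    using assms by (auto simp: smooth_atlas_def)
  show "open (chart_dom c)" "open (chart_img c)" using assms by (auto simp: smooth_atlas_def)
  show "continuous_on (chart_dom c) (chart_map c)" "continuous_on (chart_img c) (chart_inv c)"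
    using h by (simp_all add: homeomorphism_def)
  show "inj_on (chart_map c) (chart_dom c)"
    by (rule inj_on_inverseI) (rule homeomorphism_apply1[OF h])
  then show "p \<in> chart_dom c \<Longrightarrow> chart_inv c (chart_map c p) = p" by simp
qed

lemma open_chart_image:
  assumes "smooth_atlas A" "c \<in> A" "open G"
  shows "open (chart_map c ` (chart_dom c \<inter> G))"
proof -
  note D = atlasD[OF assms(1,2)]
  have "chart_map c ` (chart_dom c \<inter> G) = chart_inv c -` G \<inter> chart_img c"
    using D(6) by (auto 0 3)
  then show ?thesis using iffD1[OF continuous_on_open_vimage[OF D(2)] D(4)] assms(3) by simp
qed

lemma borel_chart_image:
  assumes "smooth_atlas A" "c \<in> A" "B \<in> sets borel" "B \<subseteq> chart_dom c"
  shows "chart_map c ` B \<in> sets borel"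
proof -
  note D = atlasD[OF assms(1,2)]
  have "chart_map c ` B = chart_inv c -` B \<inter> chart_img c"
    using D(6) assms(4) by (auto 0 3)
  also have "\<dots> = chart_inv c -` B \<inter> space (restrict_space borel (chart_img c))"
    by (simp add: space_restrict_space)
  also have "\<dots> \<in> sets (restrict_space borel (chart_img c))"
    by (rule measurable_sets[OF borel_measurable_continuous_on_restrict[OF D(4)] assms(3)])
  finally show ?thesis using D(2) by (subst (asm) sets_restrict_space_iff) auto
qed

lemma overlap_transition:
  assumes "smooth_atlas A" "c \<in> A" "d \<in> A" "p \<in> chart_dom c" "p \<in> chart_dom d"
  shows "open (overlap c d)" "chart_map c p \<in> overlap c d" "transition c d (chart_map c p) = chart_map d p"
    "smooth_on (overlap c d) (transition c d)"
    "(transition c d has_derivative frechet_derivative (transition c d) (at (chart_map c p))) (at (chart_map c p))"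
    "inj (frechet_derivative (transition c d) (at (chart_map c p)))"
proof -
  have op: "open (overlap c d)" if "c \<in> A" "d \<in> A" for c d
    using open_chart_image[OF assms(1) that(1) atlasD(1)[OF assms(1) that(2)]] .
  have sm: "smooth_on (overlap c d) (transition c d)" if "c \<in> A" "d \<in> A" for c d
    using assms(1) that by (auto simp: smooth_atlas_def)
  have inv: "chart_inv c (chart_map c q) = q" if "q \<in> chart_dom c" "c \<in> A" for c q
    using atlasD(6)[OF assms(1) that(2,1)] .
  show 1: "open (overlap c d)" "smooth_on (overlap c d) (transition c d)"
    using op sm assms(2,3) by blast+
  show x: "chart_map c p \<in> overlap c d" using assms(4,5) by blast
  show y: "transition c d (chart_map c p) = chart_map d p" using inv[OF assms(4,2)] by simp
  show d: "(transition c d has_derivative frechet_derivative (transition c d) (at (chart_map c p))) (at (chart_map c p))"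
    by (rule smooth_on_has_derivative[OF 1(2) x])
  have e: "(transition d c has_derivative frechet_derivative (transition d c) (at (chart_map d p))) (at (transition c d (chart_map c p)))"
    unfolding y using assms(4,5) by (intro smooth_on_has_derivative[OF sm[OF assms(3,2)]]) blast
  have "((\<lambda>x. x) has_derivative
      (\<lambda>v. frechet_derivative (transition d c) (at (chart_map d p)) (frechet_derivative (transition c d) (at (chart_map c p)) v))) (at (chart_map c p))"
    by (rule has_derivative_transform_within_open[OF has_derivative_compose[OF d e] 1(1) x])
       (auto simp: inv assms(2,3))
  from has_derivative_unique[OF this has_derivative_ident]
  have "frechet_derivative (transition d c) (at (chart_map d p)) (frechet_derivative (transition c d) (at (chart_map c p)) v) = v" for v
    by (rule fun_cong)
  then show "inj (frechet_derivative (transition c d) (at (chart_map c p)))" by (rule inj_on_inverseI)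
qed

text \<open>Transformation with the absolute value of the Jacobian makes integrals independent of
  charts without orienting them. Both clauses refer to K only, because the cut-off functions below
  are continuous just near K.\<close>

definition chart_density :: "'m::{t2_space,second_countable_topology} chart set \<Rightarrow> 'm set \<Rightarrow> ('m chart \<Rightarrow> real^6 \<Rightarrow> complex) \<Rightarrow> bool" where
  "chart_density A K g \<longleftrightarrow>
     (\<forall>c\<in>A. continuous_on (chart_map c ` (chart_dom c \<inter> K)) (g c)) \<and>
     (\<forall>c\<in>A. \<forall>d\<in>A. \<forall>p\<in>chart_dom c \<inter> chart_dom d \<inter> K. g c (chart_map c p) =
        \<bar>det (matrix (frechet_derivative (transition c d) (at (chart_map c p))))\<bar> *\<^sub>R g d (chart_map d p))"

lemma chart_densityD:
  assumes "chart_density A K g" "c \<in> A"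
  shows "continuous_on (chart_map c ` (chart_dom c \<inter> K)) (g c)"
    "d \<in> A \<Longrightarrow> p \<in> chart_dom c \<Longrightarrow> p \<in> chart_dom d \<Longrightarrow> p \<in> K \<Longrightarrow> g c (chart_map c p) =
        \<bar>det (matrix (frechet_derivative (transition c d) (at (chart_map c p))))\<bar> *\<^sub>R g d (chart_map d p)"
  using assms unfolding chart_density_def by blast+

text \<open>The closure of \<open>B\<close> is a compact subset of the chart domain, on whose image
  \<open>g c\<close> is continuous; this is what the condition on closures of pieces is for.\<close>

lemma density_integrable:
  assumes A: "smooth_atlas A" and g: "chart_density A K g" and c: "c \<in> A" and K: "compact K"
    and B: "B \<in> sets borel" "B \<subseteq> K" "closure B \<subseteq> chart_dom c"
  shows "set_integrable lborel (chart_map c ` B) (g c)"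
proof -
  note D = atlasD[OF A c]
  have cl: "closure B \<subseteq> K" by (rule closure_minimal[OF B(2) compact_imp_closed[OF K]])
  then have "compact (closure B)"
    using compact_Int_closed[OF K closed_closure, of B] by (simp add: inf_absorb2)
  then have cm: "compact (chart_map c ` closure B)"
    by (rule compact_continuous_image[OF continuous_on_subset[OF D(3) B(3)]])
  have "continuous_on (chart_map c ` closure B) (g c)"
    using g c cl B(3) by (auto simp: chart_density_def intro: continuous_on_subset)
  then have "set_integrable lborel (chart_map c ` closure B) (g c)"
    unfolding set_integrable_def by (rule borel_integrable_compact[OF cm])
  then show ?thesis
    by (rule set_integrable_subset)
       (use borel_chart_image[OF A c B(1)] B(3) closure_subset[of B] in auto)
qed

lemma density_change_chart:
  assumes A: "smooth_atlas A" and g: "chart_density A K g" and c: "c \<in> A" "d \<in> A" and K: "compact K"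
    and B: "B \<in> sets borel" "B \<subseteq> K" "closure B \<subseteq> chart_dom c" "closure B \<subseteq> chart_dom d"
  shows "(LINT x:chart_map c ` B|lborel. g c x) = (LINT x:chart_map d ` B|lborel. g d x)"
proof -
  have dom: "p \<in> chart_dom c" "p \<in> chart_dom d" "p \<in> K" if "p \<in> B" for p
    using that B(2-4) closure_subset[of B] by auto
  let ?\<phi> = "transition c d"
  let ?h = "\<lambda>x. \<bar>det (matrix (frechet_derivative ?\<phi> (at x)))\<bar> *\<^sub>R g d (?\<phi> x)"
  have h: "g c x = ?h x" if x: "x \<in> chart_map c ` B" for x
  proof -
    obtain p where p: "p \<in> B" "x = chart_map c p" using x by blast
    show ?thesis
      unfolding p(2) overlap_transition(3)[OF A c dom(1,2)[OF p(1)]]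
      by (rule chart_densityD(2)[OF g c dom[OF p(1)]])
  qed
  have Bm: "chart_map c ` B \<in> sets borel" using dom by (intro borel_chart_image[OF A c(1) B(1)]) auto
  have img: "?\<phi> ` chart_map c ` B = chart_map d ` B"
    unfolding image_image by (intro image_cong refl) (rule overlap_transition(3)[OF A c dom(1,2)])
  have "(LINT x:chart_map c ` B|lborel. g c x) = (LINT x:chart_map c ` B|lborel. ?h x)"
    using h Bm by (intro set_lebesgue_integral_cong) auto
  also have "\<dots> = (LINT x:?\<phi> ` chart_map c ` B|lborel. g d x)"
  proof (rule change_of_variables_complex[OF Bm])
    fix x assume "x \<in> chart_map c ` B"
    then show "(?\<phi> has_derivative frechet_derivative ?\<phi> (at x)) (at x)"
      using overlap_transition(5)[OF A c dom(1,2)] by blast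
  next
    show "inj_on ?\<phi> (chart_map c ` B)"
    proof (rule inj_onI)
      fix x y assume xy: "x \<in> chart_map c ` B" "y \<in> chart_map c ` B" "?\<phi> x = ?\<phi> y"
      then obtain p q where pq: "p \<in> B" "q \<in> B" "x = chart_map c p" "y = chart_map c q" by blast
      have "chart_map d p = chart_map d q"
        using xy(3) unfolding pq overlap_transition(3)[OF A c dom(1,2)[OF pq(1)]]
          overlap_transition(3)[OF A c dom(1,2)[OF pq(2)]] .
      then show "x = y" using inj_onD[OF atlasD(5)[OF A c(2)]] dom(2) pq by blast
    qed
  next
    show "set_integrable lborel (chart_map c ` B) ?h"
      using density_integrable[OF A g c(1) K B(1-3)] h
      by (subst set_integrable_cong[OF refl refl h[symmetric]]) auto
    show "set_integrable lborel (?\<phi> ` chart_map c ` B) (g d)"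
      unfolding img by (rule density_integrable[OF A g c(2) K B(1,2,4)])
  qed
  finally show ?thesis unfolding img .
qed

text \<open>Part of K may stay uncovered, so that a density supported in one chart can be integrated
  over a single piece.\<close>

definition chart_pieces :: "'m::{t2_space,second_countable_topology} chart set \<Rightarrow> 'm set \<Rightarrow> 'm chart set \<Rightarrow> ('m chart \<Rightarrow> 'm set) \<Rightarrow> bool" where
  "chart_pieces A K C B \<longleftrightarrow> finite C \<and> C \<subseteq> A \<and> disjoint_family_on B C \<and>
     (\<forall>c\<in>C. B c \<subseteq> K \<and> B c \<in> sets borel \<and> closure (B c) \<subseteq> chart_dom c)"

lemma chart_piecesD:
  assumes "chart_pieces A K C B"
  shows "finite C" "C \<subseteq> A" "disjoint_family_on B C" "c \<in> C \<Longrightarrow> c \<in> A" "c \<in> C \<Longrightarrow> B c \<subseteq> K"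
    "c \<in> C \<Longrightarrow> B c \<in> sets borel" "c \<in> C \<Longrightarrow> closure (B c) \<subseteq> chart_dom c" "c \<in> C \<Longrightarrow> B c \<subseteq> chart_dom c"
  using assms closure_subset[of "B c"] by (auto simp: chart_pieces_def)

lemma integral_refine:
  assumes A: "smooth_atlas A" and g: "chart_density A K g" and K: "compact K"
    and B: "chart_pieces A K C B" and B': "chart_pieces A K C' B'" and c: "c \<in> C"
    and 0: "\<And>p. p \<in> B c \<Longrightarrow> p \<notin> (\<Union>d\<in>C'. B' d) \<Longrightarrow> g c (chart_map c p) = 0"
  shows "(LINT x:chart_map c ` B c|lborel. g c x) = (\<Sum>d\<in>C'. LINT x:chart_map c ` (B c \<inter> B' d)|lborel. g c x)"
proof -
  note D = chart_piecesD[OF B] and D' = chart_piecesD[OF B']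
  let ?f = "chart_map c"
  have inj: "inj_on ?f (chart_dom c)" by (rule atlasD(5)[OF A D(4)[OF c]])
  have sub: "B c \<inter> X \<subseteq> K" "closure (B c \<inter> X) \<subseteq> chart_dom c" "B c \<inter> X \<subseteq> chart_dom c" for X
    using D(5,7,8)[OF c] closure_mono[of "B c \<inter> X" "B c"] by auto
  have int: "set_integrable lborel (?f ` (B c \<inter> X)) (g c)" "?f ` (B c \<inter> X) \<in> sets borel" if "X \<in> sets borel" for X
    using that D(6)[OF c] by (auto intro!: density_integrable[OF A g D(4)[OF c] K _ sub(1,2)] borel_chart_image[OF A D(4)[OF c] _ sub(3)])
  have U: "(\<Union>d\<in>C'. B' d) \<in> sets borel" using D'(1,6) by auto
  have "(LINT x:?f ` B c|lborel. g c x) = (LINT x:?f ` (B c \<inter> (\<Union>d\<in>C'. B' d))|lborel. g c x)"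
    unfolding set_lebesgue_integral_def
  proof (rule Bochner_Integration.integral_cong[OF refl])
    fix x
    show "indicat_real (?f ` B c) x *\<^sub>R g c x = indicat_real (?f ` (B c \<inter> (\<Union>d\<in>C'. B' d))) x *\<^sub>R g c x"
      using 0 by (auto simp: indicator_def)
  qed
  also have "?f ` (B c \<inter> (\<Union>d\<in>C'. B' d)) = (\<Union>d\<in>C'. ?f ` (B c \<inter> B' d))" by blast
  also have "(LINT x:(\<Union>d\<in>C'. ?f ` (B c \<inter> B' d))|lborel. g c x) = (\<Sum>d\<in>C'. LINT x:?f ` (B c \<inter> B' d)|lborel. g c x)"
  proof (rule set_integral_finite_Union[OF D'(1)])
    show "disjoint_family_on (\<lambda>d. ?f ` (B c \<inter> B' d)) C'"
      unfolding disjoint_family_on_def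
    proof (intro ballI impI)
      fix d e assume "d \<in> C'" "e \<in> C'" "d \<noteq> e"
      then have "B' d \<inter> B' e = {}" using D'(3) by (auto simp: disjoint_family_on_def)
      then show "?f ` (B c \<inter> B' d) \<inter> ?f ` (B c \<inter> B' e) = {}"
        by (subst inj_on_image_Int[OF inj sub(3) sub(3), symmetric]) blast
    qed
  qed (use int D'(6) in auto)
  finally show ?thesis .
qed

text \<open>Both families are refined to the pairwise intersections, on which the chart can be
  changed; where only one family is present, the density vanishes.\<close>

lemma integral_pieces_unique:
  assumes A: "smooth_atlas A" and g: "chart_density A K g" and K: "compact K"
    and B: "chart_pieces A K C B" and B': "chart_pieces A K C' B'"
    and 0: "\<And>c p. c \<in> C \<Longrightarrow> p \<in> B c \<Longrightarrow> p \<notin> (\<Union>d\<in>C'. B' d) \<Longrightarrow> g c (chart_map c p) = 0"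
      "\<And>d p. d \<in> C' \<Longrightarrow> p \<in> B' d \<Longrightarrow> p \<notin> (\<Union>c\<in>C. B c) \<Longrightarrow> g d (chart_map d p) = 0"
  shows "(\<Sum>c\<in>C. LINT x:chart_map c ` B c|lborel. g c x) = (\<Sum>d\<in>C'. LINT x:chart_map d ` B' d|lborel. g d x)"
proof -
  note D = chart_piecesD[OF B] and D' = chart_piecesD[OF B']
  have "(\<Sum>c\<in>C. LINT x:chart_map c ` B c|lborel. g c x) =
      (\<Sum>c\<in>C. \<Sum>d\<in>C'. LINT x:chart_map c ` (B c \<inter> B' d)|lborel. g c x)"
    by (intro sum.cong refl integral_refine[OF A g K B B'] 0)
  also have "\<dots> = (\<Sum>d\<in>C'. \<Sum>c\<in>C. LINT x:chart_map c ` (B c \<inter> B' d)|lborel. g c x)" by (rule sum.swap)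
  also have "\<dots> = (\<Sum>d\<in>C'. \<Sum>c\<in>C. LINT x:chart_map d ` (B' d \<inter> B c)|lborel. g d x)"
  proof (intro sum.cong refl)
    fix c d assume cd: "c \<in> C" "d \<in> C'"
    show "(LINT x:chart_map c ` (B c \<inter> B' d)|lborel. g c x) = (LINT x:chart_map d ` (B' d \<inter> B c)|lborel. g d x)"
      unfolding Int_commute[of "B' d"]
      using D(5-7)[OF cd(1)] D'(5-7)[OF cd(2)] closure_mono[of "B c \<inter> B' d" "B c"] closure_mono[of "B c \<inter> B' d" "B' d"]
      by (intro density_change_chart[OF A g D(4)[OF cd(1)] D'(4)[OF cd(2)] K]) auto
  qed
  also have "\<dots> = (\<Sum>d\<in>C'. LINT x:chart_map d ` B' d|lborel. g d x)"
    by (intro sum.cong refl integral_refine[OF A g K B' B, symmetric] 0)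
  finally show ?thesis .
qed

lemma disjoint_refinement:
  assumes "finite C" "\<And>c. c \<in> C \<Longrightarrow> U c \<in> sets borel" "K \<in> sets borel"
  shows "\<exists>B. disjoint_family_on B C \<and> (\<Union>c\<in>C. B c) = K \<inter> (\<Union>c\<in>C. U c) \<and> (\<forall>c\<in>C. B c \<in> sets borel \<and> B c \<subseteq> U c)"
  using assms(1,2)
proof (induction C)
  case empty
  then show ?case by (auto simp: disjoint_family_on_def)
next
  case (insert c C)
  obtain B where B: "disjoint_family_on B C" "(\<Union>c\<in>C. B c) = K \<inter> (\<Union>c\<in>C. U c)" "\<forall>c\<in>C. B c \<in> sets borel \<and> B c \<subseteq> U c"
    using insert.IH insert.prems by auto
  let ?B = "B(c := (K \<inter> U c) - (\<Union>c\<in>C. U c))"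
  have eq: "?B d = B d" if "d \<in> C" for d using insert.hyps(2) that by auto
  have new: "?B c = K \<inter> U c - (\<Union>c\<in>C. U c)" by simp
  have U: "(\<Union>c\<in>C. U c) \<in> sets borel" using insert.hyps(1) insert.prems by auto
  have "disjoint_family_on ?B C"
    using B(1) eq by (simp add: disjoint_family_on_def)
  moreover have "?B c \<inter> ?B d = {}" if "d \<in> C" for d
    unfolding eq[OF that] new using B(3) that by blast
  ultimately have "disjoint_family_on ?B (insert c C)"
    using disjoint_family_on_insert[OF insert.hyps(2), of ?B] by blast
  moreover have "(\<Union>d\<in>insert c C. ?B d) = K \<inter> (\<Union>d\<in>insert c C. U d)"
  proof -
    have "(\<Union>d\<in>insert c C. ?B d) = ?B c \<union> (\<Union>d\<in>C. ?B d)" by (rule UN_insert)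
    also have "(\<Union>d\<in>C. ?B d) = (\<Union>d\<in>C. B d)" by (rule SUP_cong[OF refl eq])
    finally show ?thesis unfolding new B(2) by blast
  qed
  moreover have "?B d \<in> sets borel \<and> ?B d \<subseteq> U d" if "d \<in> insert c C" for d
  proof (cases "d = c")
    case True
    then show ?thesis unfolding new using U assms(3) insert.prems by auto
  next
    case False
    then show ?thesis using that eq B(3) by auto
  qed
  ultimately have "disjoint_family_on ?B (insert c C) \<and> (\<Union>d\<in>insert c C. ?B d) = K \<inter> (\<Union>d\<in>insert c C. U d) \<and>
      (\<forall>d\<in>insert c C. ?B d \<in> sets borel \<and> ?B d \<subseteq> U d)" by blast
  then show ?case by (rule exI[of _ ?B])
qed

lemma chart_pieces_exist:
  fixes A :: "'m::{t2_space,second_countable_topology} chart set"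
  assumes A: "smooth_atlas A" and K: "compact K" and P: "finite P" "K \<subseteq> (\<Union>p\<in>P. G p)"
    and G: "\<And>p. p \<in> P \<Longrightarrow> open (G p) \<and> ch p \<in> A \<and> closure (G p) \<subseteq> chart_dom (ch p)"
  obtains C B where "chart_pieces A K C B" "(\<Union>c\<in>C. B c) = K"
proof -
  let ?C = "ch ` P"
  \<comment> \<open>Several points may have selected the same chart, whereas pieces are indexed by
    charts; their neighbourhoods are therefore united.\<close>
  define U where "U c = (\<Union>p\<in>{p\<in>P. ch p = c}. G p)" for c
  have Ub: "U c \<in> sets borel" for c
    unfolding U_def using G by (intro borel_open open_UN) auto
  then obtain B where B: "disjoint_family_on B ?C" "(\<Union>c\<in>?C. B c) = K \<inter> (\<Union>c\<in>?C. U c)"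
      "\<forall>c\<in>?C. B c \<in> sets borel \<and> B c \<subseteq> U c"
    using disjoint_refinement[where U = U, OF finite_imageI[OF P(1), of ch] Ub borel_closed[OF compact_imp_closed[OF K]]]
    by (elim exE conjE)
  have un: "(\<Union>c\<in>?C. U c) = (\<Union>p\<in>P. G p)" by (auto simp: U_def)
  have cl: "closure (U c) \<subseteq> chart_dom c" if "c \<in> ?C" for c
  proof -
    have "closure (U c) \<subseteq> (\<Union>p\<in>{p\<in>P. ch p = c}. closure (G p))"
      unfolding U_def using P(1) closure_subset by (intro closure_minimal closed_UN ballI closed_closure) fastforce+
    then show ?thesis using G by auto
  qed
  have "closure (B c) \<subseteq> chart_dom c" "B c \<subseteq> K" "c \<in> A" if "c \<in> ?C" for c
    using closure_mono[of "B c" "U c"] cl[OF that] B(2,3) that G by auto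
  then have "chart_pieces A K ?C B"
    using B(1,3) P(1) G unfolding chart_pieces_def by (intro conjI ballI finite_imageI image_subsetI) auto
  then show thesis using that B(2) P(2) un by (simp add: inf_absorb1)
qed

lemma form_integral_eq:
  fixes A :: "'m::{t2_space,second_countable_topology} chart set"
  assumes A: "smooth_atlas A" and K: "compact K"
    and g: "chart_density A K (\<lambda>c x. of_real (orient_sign (J c x)) * \<theta> c x std_frame)"
    and B: "chart_pieces A K C B" "(\<Union>c\<in>C. B c) = K"
  shows "form_integral A J K \<theta> =
    (\<Sum>c\<in>C. LINT x:chart_map c ` B c|lborel. of_real (orient_sign (J c x)) * \<theta> c x std_frame)"
  unfolding form_integral_def
proof (rule the_equality)
  note D = chart_piecesD[OF B(1)]
  show "\<exists>C' B'. finite C' \<and> C' \<subseteq> A \<and> disjoint_family_on B' C' \<and> (\<Union>c\<in>C'. B' c) = K \<and>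
      (\<forall>c\<in>C'. B' c \<in> sets borel \<and> closure (B' c) \<subseteq> chart_dom c) \<and>
     (\<Sum>c\<in>C. LINT x:chart_map c ` B c|lborel. of_real (orient_sign (J c x)) * \<theta> c x std_frame) =
     (\<Sum>c\<in>C'. LINT x:chart_map c ` B' c|lborel. of_real (orient_sign (J c x)) * \<theta> c x std_frame)"
    by (rule exI[of _ C], rule exI[of _ B]) (simp add: D B(2))
  show "I = (\<Sum>c\<in>C. LINT x:chart_map c ` B c|lborel. of_real (orient_sign (J c x)) * \<theta> c x std_frame)"
    if "\<exists>C B. finite C \<and> C \<subseteq> A \<and> disjoint_family_on B C \<and> (\<Union>c\<in>C. B c) = K \<and>
      (\<forall>c\<in>C. B c \<in> sets borel \<and> closure (B c) \<subseteq> chart_dom c) \<and>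
     I = (\<Sum>c\<in>C. LINT x:chart_map c ` B c|lborel. of_real (orient_sign (J c x)) * \<theta> c x std_frame)" for I
  proof -
    from that obtain C' B' where h: "finite C'" "C' \<subseteq> A" "disjoint_family_on B' C'" "(\<Union>c\<in>C'. B' c) = K"
      "\<forall>c\<in>C'. B' c \<in> sets borel \<and> closure (B' c) \<subseteq> chart_dom c"
      "I = (\<Sum>c\<in>C'. LINT x:chart_map c ` B' c|lborel. of_real (orient_sign (J c x)) * \<theta> c x std_frame)"
      by blast
    have "chart_pieces A K C' B'" using h(1-5) unfolding chart_pieces_def by blast
    from integral_pieces_unique[OF A g K this B(1)] show ?thesis
      unfolding h(6) using B(2) h(4) by (auto simp: chart_piecesD[OF B(1)] chart_piecesD)
  qed
qed

section \<open>Derivatives of integrals and Stokes' theorem\<close>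

text \<open>Difference quotients can be tested along sequences, as dominated convergence
  requires.\<close>

lemma has_vector_derivative_iff_quotient:
  "(f has_vector_derivative D) (at 0) \<longleftrightarrow> ((\<lambda>t. (f t - f 0) /\<^sub>R t) \<longlongrightarrow> D) (at 0)"
proof -
  have "norm (f t - f 0 - t *\<^sub>R D) / norm t = norm ((f t - f 0) /\<^sub>R t - D)" if "t \<noteq> 0" for t
  proof -
    have "(f t - f 0) /\<^sub>R t - D = (f t - f 0 - t *\<^sub>R D) /\<^sub>R t" using that by (simp add: scaleR_diff_right)
    then show ?thesis by (simp add: divide_inverse mult.commute)
  qed
  then have "((\<lambda>t. norm (f t - f 0 - t *\<^sub>R D) / norm t) \<longlongrightarrow> 0) (at 0) \<longleftrightarrow>
      ((\<lambda>t. norm ((f t - f 0) /\<^sub>R t - D)) \<longlongrightarrow> 0) (at 0)"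
    by (intro tendsto_cong) (auto simp: eventually_at_filter)
  then show ?thesis
    unfolding has_vector_derivative_def has_derivative_at
    by (simp add: bounded_linear_scaleR_left tendsto_norm_zero_iff LIM_zero_iff)
qed

text \<open>Dominated convergence of the difference quotients: the derivative in t is required at 0
  only, and a Lipschitz bound at 0 serves as majorant.\<close>

lemma integral_has_vector_derivative:
  fixes f :: "real \<Rightarrow> 'a \<Rightarrow> 'b::{banach, second_countable_topology}"
  assumes \<delta>: "0 < \<delta>" and int: "\<And>t. \<bar>t\<bar> < \<delta> \<Longrightarrow> integrable M (f t)"
    and f': "\<And>x. x \<in> space M \<Longrightarrow> ((\<lambda>t. f t x) has_vector_derivative f' x) (at 0)"
    and bd: "\<And>t x. \<bar>t\<bar> < \<delta> \<Longrightarrow> x \<in> space M \<Longrightarrow> norm (f t x - f 0 x) \<le> \<bar>t\<bar> * w x" and w: "integrable M w"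
  shows "((\<lambda>t. integral\<^sup>L M (f t)) has_vector_derivative integral\<^sup>L M f') (at 0)"
  unfolding has_vector_derivative_iff_quotient tendsto_at_iff_sequentially
proof (intro allI impI)
  fix X :: "nat \<Rightarrow> real" assume X: "\<forall>i. X i \<in> UNIV - {0}" "X \<longlonglongrightarrow> 0"
  \<comment> \<open>The finitely many terms out of range are replaced by the admissible nonzero
    value \<delta>/2, so that every quotient is dominated while the limit is unchanged.\<close>
  define Y where "Y i = (if \<bar>X i\<bar> < \<delta> then X i else \<delta> / 2)" for i
  have Y: "Y i \<noteq> 0" "\<bar>Y i\<bar> < \<delta>" for i using X(1)[rule_format, of i] \<delta> by (simp_all add: Y_def)
  have "\<forall>\<^sub>F i in sequentially. \<bar>X i\<bar> < \<delta>"
    using order_tendstoD(2)[OF tendsto_rabs_zero[OF X(2)] \<delta>] .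
  then have YX: "\<forall>\<^sub>F i in sequentially. Y i = X i" by eventually_elim (simp add: Y_def)
  have Y0: "Y \<longlonglongrightarrow> 0" by (rule iffD2[OF tendsto_cong[OF YX] X(2)])
  let ?q = "\<lambda>i x. (f (Y i) x - f 0 x) /\<^sub>R Y i"
  have lim: "(\<lambda>i. ?q i x) \<longlonglongrightarrow> f' x" if "x \<in> space M" for x
    using f'[OF that, unfolded has_vector_derivative_iff_quotient tendsto_at_iff_sequentially, rule_format, of Y] Y(1) Y0
    by (simp add: comp_def)
  have qm: "integrable M (?q i)" for i using int[OF Y(2)] int[of 0] \<delta> by auto
  have "(\<lambda>i. integral\<^sup>L M (?q i)) \<longlonglongrightarrow> integral\<^sup>L M f'"
  proof (rule integral_dominated_convergence[OF _ _ w])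
    show "f' \<in> borel_measurable M"
      by (rule borel_measurable_LIMSEQ_metric[OF borel_measurable_integrable[OF qm] lim])
    show "?q i \<in> borel_measurable M" for i by (rule borel_measurable_integrable[OF qm])
    show "AE x in M. (\<lambda>i. ?q i x) \<longlonglongrightarrow> f' x" using lim by (rule AE_I2)
    show "AE x in M. norm (?q i x) \<le> w x" for i
    proof (rule AE_I2)
      fix x assume "x \<in> space M"
      from bd[OF Y(2) this, of i] have "norm (f (Y i) x - f 0 x) / \<bar>Y i\<bar> \<le> w x"
        using Y(1)[of i] by (simp add: divide_le_eq mult.commute)
      then show "norm (?q i x) \<le> w x" by (simp add: divide_inverse mult.commute)
    qed
  qed
  moreover have "integral\<^sup>L M (?q i) = (integral\<^sup>L M (f (Y i)) - integral\<^sup>L M (f 0)) /\<^sub>R Y i" for i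
    using Bochner_Integration.integral_diff[OF int[OF Y(2)] int[of 0]] \<delta> by simp
  ultimately have "(\<lambda>i. (integral\<^sup>L M (f (Y i)) - integral\<^sup>L M (f 0)) /\<^sub>R Y i) \<longlonglongrightarrow> integral\<^sup>L M f'" by (simp only:)
  moreover have "\<forall>\<^sub>F i in sequentially. (integral\<^sup>L M (f (Y i)) - integral\<^sup>L M (f 0)) /\<^sub>R Y i =
      ((\<lambda>t. (integral\<^sup>L M (f t) - integral\<^sup>L M (f 0)) /\<^sub>R t) \<circ> X) i"
    using YX by eventually_elim simp
  ultimately show "((\<lambda>t. (integral\<^sup>L M (f t) - integral\<^sup>L M (f 0)) /\<^sub>R t) \<circ> X) \<longlonglongrightarrow> integral\<^sup>L M f'"
    by (subst (asm) tendsto_cong)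
qed

lemma real_vector_mean_value:
  fixes g :: "real \<Rightarrow> 'b::real_normed_vector"
  assumes "convex S" "0 \<in> S" "t \<in> S"
    and "\<And>s. s \<in> S \<Longrightarrow> (g has_vector_derivative g' s) (at s)" "\<And>s. s \<in> S \<Longrightarrow> norm (g' s) \<le> M"
  shows "norm (g t - g 0) \<le> \<bar>t\<bar> * M"
proof -
  have "norm (g t - g 0) \<le> M * norm (t - 0)"
  proof (rule differentiable_bound[OF assms(1) _ _ assms(3,2)])
    fix s assume s: "s \<in> S"
    show "(g has_derivative (\<lambda>h. h *\<^sub>R g' s)) (at s within S)"
      using has_vector_derivative_at_within[OF assms(4)[OF s]] by (simp add: has_vector_derivative_def)
    show "onorm (\<lambda>h. h *\<^sub>R g' s) \<le> M"
      by (rule onorm_le) (use mult_right_mono[OF assms(5)[OF s] abs_ge_zero] in \<open>simp add: mult.commute\<close>)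
  qed
  then show ?thesis by (simp add: mult.commute)
qed

lemma set_integral_has_vector_derivative:
  fixes f :: "real \<Rightarrow> 'a::euclidean_space \<Rightarrow> complex"
  assumes sm: "smooth_on ({-\<epsilon><..<\<epsilon>} \<times> V) (\<lambda>z. f (fst z) (snd z))" and \<epsilon>: "0 < \<epsilon>"
    and Q: "compact Q" "Q \<subseteq> V" and S: "S \<in> sets borel" "S \<subseteq> Q"
    and f': "\<And>x. x \<in> S \<Longrightarrow> ((\<lambda>t. f t x) has_vector_derivative f' x) (at 0)"
  shows "((\<lambda>t. LINT x:S|lborel. f t x) has_vector_derivative (LINT x:S|lborel. f' x)) (at 0)"
proof -
  \<comment> \<open>Half of the interval, closed, lies inside the domain; on its compact product
    with \<open>Q\<close> the time derivative is bounded.\<close>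
  let ?I = "{-\<epsilon>/2..\<epsilon>/2}" and ?F = "\<lambda>z. f (fst z) (snd z)"
  let ?D = "\<lambda>z. frechet_derivative ?F (at z) (1, 0)"
  have sub: "?I \<times> Q \<subseteq> {-\<epsilon><..<\<epsilon>} \<times> V" using Q(2) \<epsilon> by auto
  have "compact (?D ` (?I \<times> Q))"
    by (intro compact_continuous_image compact_Times Q(1) compact_Icc
        continuous_on_subset[OF smooth_on_continuous[OF smooth_on_frechet[OF sm]] sub])
  from compact_imp_bounded[OF this] obtain M where "\<forall>y\<in>?D ` (?I \<times> Q). norm y \<le> M"
    unfolding bounded_iff by (rule exE)
  then have M: "norm (?D z) \<le> M" if "z \<in> ?I \<times> Q" for z using that by (rule bspec[OF _ imageI])
  have d: "((\<lambda>t. f t x) has_vector_derivative ?D (s, x)) (at s)" if "s \<in> ?I" "x \<in> Q" for s x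
    using has_vector_derivative_slice[OF smooth_on_has_derivative[OF sm, of "(s, x)"]] subsetD[OF sub, of "(s, x)"] that by simp
  have "continuous_on Q (f t)" if "t \<in> ?I" for t
  proof -
    have "continuous_on Q (?F \<circ> (\<lambda>x. (t, x)))"
      by (rule continuous_on_compose[OF continuous_on_Pair[OF continuous_on_const continuous_on_id]])
         (rule continuous_on_subset[OF smooth_on_continuous[OF sm]], use that Q(2) \<epsilon> in auto)
    then show ?thesis by (simp add: comp_def)
  qed
  then have int: "integrable lborel (\<lambda>x. indicator S x *\<^sub>R f t x)" if "t \<in> ?I" for t
    using set_integrable_subset[OF borel_integrable_compact[OF Q(1), folded set_integrable_def] _ S(2)] S(1) that
    by (auto simp: set_integrable_def)
  show ?thesis
    unfolding set_lebesgue_integral_def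
  proof (rule integral_has_vector_derivative[where \<delta> = "\<epsilon> / 2" and w = "\<lambda>x. indicat_real Q x *\<^sub>R M"])
    show "integrable lborel (\<lambda>x. indicat_real Q x *\<^sub>R M)"
      by (rule borel_integrable_compact[OF Q(1) continuous_on_const])
  next
    show "integrable lborel (\<lambda>x. indicat_real S x *\<^sub>R f t x)" if "\<bar>t\<bar> < \<epsilon> / 2" for t
      by (rule int) (use that in auto)
  next
    fix x
    show "((\<lambda>t. indicat_real S x *\<^sub>R f t x) has_vector_derivative indicat_real S x *\<^sub>R f' x) (at 0)"
      by (cases "x \<in> S") (simp_all add: f')
    fix t assume t: "\<bar>t\<bar> < \<epsilon> / 2"
    show "norm (indicat_real S x *\<^sub>R f t x - indicat_real S x *\<^sub>R f 0 x) \<le> \<bar>t\<bar> * (indicat_real Q x *\<^sub>R M)"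
    proof (cases "x \<in> S")
      case True
      then have x: "x \<in> Q" using S(2) by blast
      have "norm (f t x - f 0 x) \<le> \<bar>t\<bar> * M"
        by (rule real_vector_mean_value[where S = ?I, OF convex_real_interval(5) _ _ d[OF _ x]])
           (use t \<epsilon> M x in auto)
      then show ?thesis using True x by simp
    next
      case False
      moreover have "0 \<le> M" if "x \<in> Q" by (rule order_trans[OF norm_ge_zero M[of "(0, x)"]]) (use that \<epsilon> in simp)
      ultimately show ?thesis by (cases "x \<in> Q") simp_all
    qed
  qed (use \<epsilon> in auto)
qed

text \<open>The integral of a translate does not depend on the translation.\<close>

lemma integral_directional_derivative:
  fixes h :: "'a::euclidean_space \<Rightarrow> complex"
  assumes h': "\<And>x. (h has_derivative h' x) (at x)" and cont: "continuous_on UNIV (\<lambda>x. h' x v)"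
    and Q: "compact Q" and 0: "\<And>x. x \<notin> Q \<Longrightarrow> h x = 0"
  shows "integral\<^sup>L lborel (\<lambda>x. h' x v) = 0"
proof -
  have conth: "continuous_on UNIV h"
    using h' by (intro has_derivative_continuous_on) (auto intro: has_derivative_at_withinI)
  have int0: "integrable lborel h"
  proof -
    have "(\<lambda>x. indicator Q x *\<^sub>R h x) = h" using 0 by (auto simp: indicator_def)
    then show ?thesis using borel_integrable_compact[OF Q continuous_on_subset[OF conth subset_UNIV]] by simp
  qed
  have out: "h' x v = 0" if "x \<notin> Q" for x
  proof -
    have "(h has_derivative (\<lambda>_. 0)) (at x)"
      by (rule has_derivative_transform_within_open[OF has_derivative_const[of 0] open_Compl[OF compact_imp_closed[OF Q]]])
         (use that 0 in auto)
    from has_derivative_unique[OF h' this] show ?thesis by simp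
  qed
  obtain M0 where M0: "norm (h' x v) \<le> M0" if "x \<in> Q" for x
    using compact_imp_bounded[OF compact_continuous_image[OF continuous_on_subset[OF cont subset_UNIV] Q]]
    unfolding bounded_iff by blast
  define M where "M = max M0 0"
  have M: "norm (h' x v) \<le> M" "0 \<le> M" for x
    using M0[of x] out[of x] by (cases "x \<in> Q"; simp add: M_def)+
  obtain R where R: "\<And>x. x \<in> Q \<Longrightarrow> norm x \<le> R"
    using compact_imp_bounded[OF Q] unfolding bounded_iff by blast
  let ?f = "\<lambda>t x. h (t *\<^sub>R v + x)"
  have d: "((\<lambda>t. ?f t x) has_vector_derivative h' (s *\<^sub>R v + x) v) (at s)" for s x
  proof -
    have "((\<lambda>t. t *\<^sub>R v + x) has_derivative (\<lambda>r. r *\<^sub>R v)) (at s)"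
      by (auto intro!: derivative_eq_intros)
    from has_derivative_compose[OF this h'] show ?thesis
      by (simp add: has_vector_derivative_def linear_scale[OF has_derivative_linear[OF h']])
  qed
  have tr: "integrable lborel (?f t)" "integral\<^sup>L lborel (?f t) = integral\<^sup>L lborel h" for t
  proof -
    have m: "(+) (t *\<^sub>R v) \<in> measurable lborel borel" by simp
    have hm: "h \<in> borel_measurable borel" using conth by (rule borel_measurable_continuous_onI)
    show "integrable lborel (?f t)"
      using integrable_distr_eq[OF m hm] int0 by (simp add: lborel_distr_plus)
    show "integral\<^sup>L lborel (?f t) = integral\<^sup>L lborel h"
      using integral_distr[OF m hm] by (simp add: lborel_distr_plus)
  qed
  have "((\<lambda>t. integral\<^sup>L lborel (?f t)) has_vector_derivative integral\<^sup>L lborel (\<lambda>x. h' x v)) (at 0)"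
  \<comment> \<open>For |t| < 1 every translate vanishes outside the ball of radius
    \<open>R + norm v\<close>, on which the constant \<open>M\<close> is a majorant.\<close>
  proof (rule integral_has_vector_derivative[where \<delta> = 1 and w = "\<lambda>x. indicat_real (cball 0 (R + norm v)) x *\<^sub>R M"])
    show "((\<lambda>t. ?f t x) has_vector_derivative h' x v) (at 0)" for x using d[of x 0] by simp
    show "integrable lborel (\<lambda>x. indicat_real (cball 0 (R + norm v)) x *\<^sub>R M)"
      by (rule borel_integrable_compact[OF compact_cball continuous_on_const])
    fix t x assume t: "\<bar>t\<bar> < (1::real)"
    show "norm (?f t x - ?f 0 x) \<le> \<bar>t\<bar> * (indicat_real (cball 0 (R + norm v)) x *\<^sub>R M)"
    proof (cases "x \<in> cball 0 (R + norm v)")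
      case True
      have "norm (?f t x - ?f 0 x) \<le> \<bar>t\<bar> * M"
        by (rule real_vector_mean_value[where S = UNIV, OF convex_UNIV _ _ d M(1)]) simp_all
      then show ?thesis using True by simp
    next
      case False
      then have x: "norm x > R + norm v" by simp
      have "norm (t *\<^sub>R v) \<le> norm v" using t by (simp add: mult_left_le_one_le)
      then have "norm (t *\<^sub>R v + x) > R" using x norm_triangle_ineq2[of x "- (t *\<^sub>R v)"] by (simp add: add.commute)
      moreover have "norm x > R" using x norm_ge_zero[of v] by linarith
      ultimately have "t *\<^sub>R v + x \<notin> Q" "x \<notin> Q" using R by force+
      then show ?thesis using 0 False by simp
    qed
  qed (use tr in auto)
  then have "((\<lambda>t. integral\<^sup>L lborel h) has_vector_derivative integral\<^sup>L lborel (\<lambda>x. h' x v)) (at (0::real))"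
    unfolding tr(2) .
  from vector_derivative_unique_at[OF this has_vector_derivative_const] show ?thesis .
qed

section \<open>Stokes' theorem for compact support in a chart\<close>

lemma ext_d_scale:
  assumes \<kappa>: "(\<kappa> has_derivative \<kappa>') (at x)" and \<theta>: "\<And>vs. (\<lambda>y. \<theta> y vs) differentiable at x"
  shows "ext_d (\<lambda>y vs. \<kappa> y * \<theta> y vs) x vs = (one_form \<kappa>' \<and>\<^sub>f \<theta> x) vs + \<kappa> x * ext_d \<theta> x vs"
proof -
  have "frechet_derivative (\<lambda>y. \<kappa> y * \<theta> y ws) (at x) v = \<kappa> x * frechet_derivative (\<lambda>y. \<theta> y ws) (at x) v + \<kappa>' v * \<theta> x ws" for ws v
    by (simp add: frechet_derivative_eqI[OF has_derivative_mult[OF \<kappa> has_derivative_frechet[OF \<theta>]]])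
  then show ?thesis
    by (simp add: ext_d_def wedge_one_eq algebra_simps sum.distrib sum_distrib_left)
qed

text \<open>The open set \<open>V\<close> and the complement of the compact set \<open>R\<close>
  cover the space, and on the second the extension is 0.\<close>

lemma Ck_on_compact_extension:
  fixes h :: "'a::euclidean_space \<Rightarrow> complex"
  assumes V: "open V" and h: "Ck_on k V h" and R: "compact R" "R \<subseteq> V" and 0: "\<And>x. x \<in> V - R \<Longrightarrow> h x = 0"
  shows "Ck_on k UNIV (\<lambda>x. if x \<in> V then h x else 0)"
proof (rule Ck_on_local)
  fix x :: 'a
  show "\<exists>T. open T \<and> x \<in> T \<and> Ck_on k (UNIV \<inter> T) (\<lambda>x. if x \<in> V then h x else 0)"
  proof (cases "x \<in> V")
    case True
    have "Ck_on k V (\<lambda>x. if x \<in> V then h x else 0)"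
      using h by (subst Ck_on_cong[OF V, where g = h]) auto
    then show ?thesis using True V by (intro exI[of _ V]) simp
  next
    case False
    have op: "open (- R)" using R(1) by (simp add: compact_imp_closed open_Compl)
    have "Ck_on k (- R) (\<lambda>x. if x \<in> V then h x else 0)"
      by (subst Ck_on_cong[OF op, where g = "\<lambda>x. 0"]) (use 0 in \<open>auto simp: Ck_on_const\<close>)
    then show ?thesis using False op R(2) by (intro exI[of _ "- R"]) auto
  qed
qed

text \<open>On \<open>R\<close> the integrand is d of the product, which extends by 0 to the whole
  space. Each term of d is then a directional derivative of a compactly supported C^1 function and
  integrates to 0.\<close>

lemma stokes_compact:
  assumes V: "open V" and \<kappa>: "Ck_on 1 V \<kappa>" and \<theta>: "\<And>vs. Ck_on 1 V (\<lambda>y. \<theta> y vs)"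
    and R: "compact R" "R \<subseteq> V" and 0: "\<And>x vs. x \<in> V - R \<Longrightarrow> \<kappa> x * \<theta> x vs = 0"
  shows "(LINT x:R|lborel. (one_form (frechet_derivative \<kappa> (at x)) \<and>\<^sub>f \<theta> x) us + \<kappa> x * ext_d \<theta> x us) = 0"
proof -
  let ?h = "\<lambda>vs x. if x \<in> V then \<kappa> x * \<theta> x vs else 0"
  have C: "Ck_on 1 UNIV (?h vs)" for vs
    by (rule Ck_on_compact_extension[OF V bounded_bilinear.Ck_on[OF bounded_bilinear_mult V \<kappa> \<theta>] R 0])
  have d: "(?h vs has_derivative frechet_derivative (?h vs) (at x)) (at x)" for vs x
    using Ck_on_has_derivative[OF C[of vs, unfolded One_nat_def]] by blast
  have ct: "continuous_on UNIV (\<lambda>x. frechet_derivative (?h vs) (at x) v)" for vs v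
    using C[of vs] by (simp add: One_nat_def)
  have out: "?h vs x = 0" if "x \<notin> R" for vs x using 0[of x vs] that by auto
  have out': "frechet_derivative (?h vs) (at x) v = 0" if "x \<notin> R" for vs x v
  proof -
    have "(?h vs has_derivative (\<lambda>_. 0)) (at x)"
      by (rule has_derivative_transform_within_open[OF has_derivative_const[of 0] open_Compl[OF compact_imp_closed[OF R(1)]]])
         (use that out in auto)
    from has_derivative_unique[OF d this] show ?thesis by simp
  qed
  have int: "integrable lborel (\<lambda>x. frechet_derivative (?h vs) (at x) v)" for vs v
  proof -
    have "(\<lambda>x. indicator R x *\<^sub>R frechet_derivative (?h vs) (at x) v) = (\<lambda>x. frechet_derivative (?h vs) (at x) v)"
      using out' by (auto simp: indicator_def)
    with borel_integrable_compact[OF R(1) continuous_on_subset[OF ct[of vs v] subset_UNIV]] show ?thesis by (simp only:)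
  qed
  have zero: "integral\<^sup>L lborel (\<lambda>x. frechet_derivative (?h vs) (at x) v) = 0" for vs v
    by (rule integral_directional_derivative[OF d ct R(1) out])
  have dif: "\<kappa> differentiable at x" "(\<lambda>y. \<theta> y vs) differentiable at x" if "x \<in> V" for x vs
    using \<kappa> \<theta> that by (simp_all add: One_nat_def)
  have "(one_form (frechet_derivative \<kappa> (at x)) \<and>\<^sub>f \<theta> x) us + \<kappa> x * ext_d \<theta> x us = ext_d (\<lambda>y vs. ?h vs y) x us"
    if "x \<in> R" for x
  proof -
    have x: "x \<in> V" using that R(2) by blast
    have "ext_d (\<lambda>y vs. ?h vs y) x = ext_d (\<lambda>y vs. \<kappa> y * \<theta> y vs) x"
      by (rule ext_d_cong[OF V x]) auto
    then show ?thesis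
      by (simp add: ext_d_scale[OF has_derivative_frechet[OF dif(1)[OF x]] dif(2)[OF x]])
  qed
  then have "(LINT x:R|lborel. (one_form (frechet_derivative \<kappa> (at x)) \<and>\<^sub>f \<theta> x) us + \<kappa> x * ext_d \<theta> x us) =
      (LINT x:R|lborel. ext_d (\<lambda>y vs. ?h vs y) x us)"
    using borel_closed[OF compact_imp_closed[OF R(1)]] by (intro set_lebesgue_integral_cong) auto
  also have "\<dots> = integral\<^sup>L lborel (\<lambda>x. ext_d (\<lambda>y vs. ?h vs y) x us)"
    unfolding set_lebesgue_integral_def
    by (intro Bochner_Integration.integral_cong refl) (auto simp: indicator_def ext_d_def out')
  also have "\<dots> = (\<Sum>i<length us. (-1) ^ i * integral\<^sup>L lborel (\<lambda>x. frechet_derivative (?h (take i us @ drop (Suc i) us)) (at x) (us ! i)))"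
    unfolding ext_d_def using int by simp
  also have "\<dots> = 0" unfolding zero by simp
  finally show ?thesis .
qed


section \<open>The orientation sign as a function of the point\<close>

lemma frame_signs_agree:
  assumes A: "A ** A = - mat 1" and X: "det (vector (frame_list A X) :: real^6^6) \<noteq> 0"
  shows "orient_sign A = sgn (det (vector (frame_list A X) :: real^6^6))"
  using orient_sign_frame[OF A] frame_dual_coframe[OF A X] by blast

text \<open>For fixed vectors \<open>X j\<close> the determinant of the frame \<open>X j\<close>,
  \<open>J y *v X j\<close> is continuous in y and keeps its sign near \<open>x\<close>.\<close>

lemma orient_sign_locally_constant:
  assumes J: "acs_on V J" and x: "x \<in> V"
  shows "\<exists>T. open T \<and> x \<in> T \<and> (\<forall>y\<in>V \<inter> T. orient_sign (J y) = orient_sign (J x))"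
proof -
  obtain a X where X: "dual_frames (J x) a X" by (rule acs_dual_frame[OF J x])
  let ?D = "\<lambda>y. det (vector (frame_list (J y) X) :: real^6^6)"
  have "smooth_on V (\<lambda>y. J y *v X i)" for i
    by (rule smooth_on_mv[OF acs_onD(1,2)[OF J] smooth_on_const])
  then have "continuous_on V (\<lambda>y. (J y *v X i) $ k)" for i k
    by (intro smooth_on_continuous smooth_on_vec_nth acs_onD(1)[OF J])
  then have "\<forall>i. continuous_on V (\<lambda>y. (vector (frame_list (J y) X) :: real^6^6) $ i $ k)" for k
    by (simp add: forall_6 vector_6 frame_list_def continuous_on_const)
  then have "continuous_on V ?D"
    unfolding det_def by (intro continuous_on_sum continuous_on_mult continuous_on_const continuous_on_prod) simp
  then have c: "isCont ?D x" using acs_onD(1)[OF J] x by (simp add: continuous_on_eq_continuous_at)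
  have "\<exists>T. open T \<and> x \<in> T \<and> (\<forall>y\<in>T. ?D y \<noteq> 0 \<and> sgn (?D y) = sgn (?D x))"
  proof (cases "?D x > 0")
    case True
    then have "\<forall>\<^sub>F y in nhds x. ?D y > 0"
      using c unfolding isCont_def by (simp add: order_tendstoD(1) eventually_nhds_conv_at)
    then show ?thesis using True unfolding eventually_nhds by (metis less_irrefl sgn_pos)
  next
    case False
    then have D: "?D x < 0" using frame_det_nonzero[OF X] by linarith
    then have "\<forall>\<^sub>F y in nhds x. ?D y < 0"
      using c unfolding isCont_def by (simp add: order_tendstoD(2) eventually_nhds_conv_at)
    then show ?thesis using D unfolding eventually_nhds by (metis less_irrefl sgn_neg)
  qed
  then obtain T where T: "open T" "x \<in> T" "\<And>y. y \<in> T \<Longrightarrow> ?D y \<noteq> 0" "\<And>y. y \<in> T \<Longrightarrow> sgn (?D y) = sgn (?D x)" by blast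
  have "orient_sign (J y) = orient_sign (J x)" if "y \<in> V" "y \<in> T" for y
    using frame_signs_agree[OF acs_onD(4)[OF J that(1)] T(3)[OF that(2)]]
      frame_signs_agree[OF acs_onD(4)[OF J x] T(3)[OF T(2)]] T(4)[OF that(2)] by simp
  then show ?thesis using T(1,2) by blast
qed

lemma smooth_on_locally_constant:
  assumes "open S" "\<And>x. x \<in> S \<Longrightarrow> \<exists>T. open T \<and> x \<in> T \<and> (\<forall>y\<in>S \<inter> T. f y = f x)"
  shows "smooth_on S f"
proof (rule smooth_on_local)
  fix x assume "x \<in> S"
  then obtain T where T: "open T" "x \<in> T" "\<forall>y\<in>S \<inter> T. f y = f x" using assms(2) by blast
  have "smooth_on (S \<inter> T) f"
    by (subst smooth_on_cong[OF open_Int[OF assms(1) T(1)], where g = "\<lambda>y. f x"]) (use T(3) in \<open>auto simp: smooth_on_const\<close>)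
  then show "\<exists>T. open T \<and> x \<in> T \<and> smooth_on (S \<inter> T) f" using T by blast
qed

lemma smooth_on_orient_sign:
  assumes "acs_on V J"
  shows "smooth_on V (\<lambda>x. orient_sign (J x))"
  by (rule smooth_on_locally_constant[OF acs_onD(1)[OF assms] orient_sign_locally_constant[OF assms]])

section \<open>Partitions of unity\<close>

lemma square_pos_part_derivative:
  "((\<lambda>s. (max 0 s)\<^sup>2) has_derivative (\<lambda>h. h * (2 * max 0 s))) (at (s :: real))"
proof -
  consider "s > 0" | "s < 0" | "s = 0" by linarith
  then show ?thesis
  proof cases
    case 1
    have "((\<lambda>s. s\<^sup>2) has_derivative (\<lambda>h. h * (2 * max 0 s))) (at s)"
      using 1 by (auto intro!: derivative_eq_intros)
    then show ?thesis
      by (rule has_derivative_transform_within_open[OF _ open_greaterThan[of 0]]) (use 1 in auto)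
  next
    case 2
    have "((\<lambda>s. 0) has_derivative (\<lambda>h. h * (2 * max 0 s))) (at s)" using 2 by simp
    then show ?thesis
      by (rule has_derivative_transform_within_open[OF _ open_lessThan[of 0]]) (use 2 in auto)
  next
    case 3
    have "((\<lambda>h. norm ((max 0 h)\<^sup>2) / norm h) \<longlongrightarrow> 0) (at (0 :: real))"
    proof (rule tendsto_sandwich[of "\<lambda>h. 0" _ _ "\<lambda>h. \<bar>h\<bar>"])
      show "\<forall>\<^sub>F h in at (0 :: real). norm ((max 0 h)\<^sup>2) / norm h \<le> \<bar>h\<bar>"
        by (rule always_eventually) (auto simp: max_def power2_eq_square)
      show "((\<lambda>h. \<bar>h\<bar>) \<longlongrightarrow> 0) (at (0 :: real))" by (rule tendsto_rabs_zero) simp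
    qed simp_all
    then show ?thesis unfolding 3 has_derivative_at by simp
  qed
qed

lemma C1_square_pos_part:
  fixes u :: "'a::real_normed_vector \<Rightarrow> real"
  assumes "open S" "Ck_on 1 S u"
  shows "Ck_on 1 S (\<lambda>x. (max 0 (u x))\<^sup>2)"
  unfolding One_nat_def
proof (rule Ck_on_SucI[OF assms(1)])
  fix x assume "x \<in> S"
  from has_derivative_compose[OF Ck_on_has_derivative[OF assms(2)[unfolded One_nat_def] this] square_pos_part_derivative]
  show "((\<lambda>x. (max 0 (u x))\<^sup>2) has_derivative (\<lambda>h. frechet_derivative u (at x) h * (2 * max 0 (u x)))) (at x)" .
next
  fix v
  show "Ck_on 0 S (\<lambda>x. frechet_derivative u (at x) v * (2 * max 0 (u x)))"
    using assms(2) Ck_on_continuous[OF assms(2)] by (simp add: continuous_intros)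
qed

text \<open>The square of a positive part is of class C^1, which suffices because cut-off functions
  are differentiated only once.\<close>

definition chart_bump :: "'m::{t2_space,second_countable_topology} chart \<Rightarrow> real^6 \<Rightarrow> real \<Rightarrow> 'm \<Rightarrow> real" where
  "chart_bump c y r q = (if q \<in> chart_dom c then (max 0 (r\<^sup>2 - (chart_map c q - y) \<bullet> (chart_map c q - y)))\<^sup>2 else 0)"

lemma chart_bump_pos:
  assumes "0 < r" "q \<in> chart_dom c"
  shows "chart_bump c y r q > 0 \<longleftrightarrow> chart_map c q \<in> ball y r"
proof -
  have "(chart_map c q - y) \<bullet> (chart_map c q - y) < r\<^sup>2 \<longleftrightarrow> dist y (chart_map c q) < r"
    unfolding power2_norm_eq_inner[symmetric] dist_norm norm_minus_commute[of y "chart_map c q"]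
    using power_strict_mono[of "norm (chart_map c q - y)" r 2] power_less_imp_less_base[of "norm (chart_map c q - y)" 2 r] assms(1)
    by auto
  then show ?thesis using assms(2) by (auto simp: chart_bump_def max_def)
qed

text \<open>Two kinds of open sets cover the chart image: the overlap with \<open>c\<close>, where
  the bump is explicit, and the part outside the inverse image \<open>?Z\<close> of the closed ball,
  where it is 0. That \<open>?Z\<close> is closed uses the Hausdorff property.\<close>

lemma chart_bump_C1:
  fixes A :: "'m::{t2_space,second_countable_topology} chart set"
  assumes A: "smooth_atlas A" and c: "c \<in> A" "d \<in> A" and r: "0 < r" "cball y r \<subseteq> chart_img c"
  shows "Ck_on 1 (chart_img d) (\<lambda>x. chart_bump c y r (chart_inv d x))"
proof (rule Ck_on_local)
  note D = atlasD[OF A c(1)] and E = atlasD[OF A c(2)]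
  let ?Z = "chart_inv c ` cball y r"
  have Z: "closed ?Z"
    by (intro compact_imp_closed compact_continuous_image continuous_on_subset[OF D(4) r(2)]) simp
  fix x assume "x \<in> chart_img d"
  then obtain q where q: "q \<in> chart_dom d" "x = chart_map d q" by blast
  show "\<exists>T. open T \<and> x \<in> T \<and> Ck_on 1 (chart_img d \<inter> T) (\<lambda>x. chart_bump c y r (chart_inv d x))"
  proof (cases "q \<in> chart_dom c")
    case True
    note o = overlap_transition[OF A c(2,1) q(1) True]
    let ?u = "\<lambda>x. r\<^sup>2 - (transition d c x - y) \<bullet> (transition d c x - y)"
    have "smooth_on (overlap d c) ?u"
      by (intro smooth_on_diff[OF o(1)] smooth_on_const smooth_on_bilinear[OF bounded_bilinear_inner o(1)] o(4))
    then have "Ck_on 1 (overlap d c) (\<lambda>x. (max 0 (?u x))\<^sup>2)"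
      by (intro C1_square_pos_part o(1)) (simp only: smooth_on_def)
    then have "Ck_on 1 (overlap d c) (\<lambda>x. chart_bump c y r (chart_inv d x))"
      by (subst Ck_on_cong[OF o(1), where g = "\<lambda>x. (max 0 (?u x))\<^sup>2"]) (auto simp: chart_bump_def E(6))
    moreover have "chart_img d \<inter> overlap d c = overlap d c" by blast
    ultimately show ?thesis using o(1,2) unfolding q(2) by (intro exI[of _ "overlap d c"]) (simp only: simp_thms)
  next
    case False
    let ?T = "chart_map d ` (chart_dom d \<inter> - ?Z)"
    have T: "open ?T" by (rule open_chart_image[OF A c(2) open_Compl[OF Z]])
    have "Z' \<in> chart_dom c" if "Z' \<in> ?Z" for Z' using that r(2) D(6) by auto
    then have x: "x \<in> ?T" using False q by blast
    have "Ck_on 1 ?T (\<lambda>x. chart_bump c y r (chart_inv d x))"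
    proof (subst Ck_on_cong[OF T, where g = "\<lambda>x. 0"])
      fix x assume "x \<in> ?T"
      then obtain p where p: "p \<in> chart_dom d" "p \<notin> ?Z" "x = chart_map d p" by blast
      have "chart_map c p \<notin> cball y r" if "p \<in> chart_dom c"
        using p(2) imageI[of "chart_map c p" "cball y r" "chart_inv c"] D(6)[OF that] by auto
      then have "\<not> chart_bump c y r p > 0" using chart_bump_pos[OF r(1), of p c y] by (auto simp: chart_bump_def)
      then show "chart_bump c y r (chart_inv d x) = 0" unfolding p(3) E(6)[OF p(1)] by (auto simp: chart_bump_def)
    qed (rule Ck_on_const)
    moreover have "chart_img d \<inter> ?T = ?T" by blast
    ultimately show ?thesis using T x by (intro exI[of _ ?T]) (simp only: simp_thms)
  qed
qed

lemma Ck_on_sum: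
  "open S \<Longrightarrow> (\<And>i. i \<in> I \<Longrightarrow> Ck_on k S (f i)) \<Longrightarrow> Ck_on k S (\<lambda>x. \<Sum>i\<in>I. f i x)"
  by (induction I rule: infinite_finite_induct) (auto simp: Ck_on_const Ck_on_add)

text \<open>The bumps are divided by their sum, which is positive exactly where some bump is. The
  functions add up to 1 on an open neighbourhood of K and not merely on K, so that this relation can
  be differentiated.\<close>

lemma partition_of_unity:
  fixes A :: "'m::{t2_space,second_countable_topology} chart set"
  assumes A: "smooth_atlas A" and K: "compact K"
  obtains P :: "'m set" and ch G Z \<rho> where "finite P" "K \<subseteq> (\<Union>p\<in>P. G p)"
    "\<And>p. p \<in> P \<Longrightarrow> ch p \<in> A" "\<And>p. p \<in> P \<Longrightarrow> open (G p)" "\<And>p. p \<in> P \<Longrightarrow> G p \<subseteq> Z p"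
    "\<And>p. p \<in> P \<Longrightarrow> compact (Z p)" "\<And>p. p \<in> P \<Longrightarrow> Z p \<subseteq> chart_dom (ch p)"
    "\<And>p q. p \<in> P \<Longrightarrow> q \<notin> Z p \<Longrightarrow> \<rho> p q = (0::real)" "\<And>q. q \<in> (\<Union>p\<in>P. G p) \<Longrightarrow> (\<Sum>p\<in>P. \<rho> p q) = 1"
    "\<And>p c. p \<in> P \<Longrightarrow> c \<in> A \<Longrightarrow> Ck_on 1 (chart_map c ` (chart_dom c \<inter> (\<Union>p\<in>P. G p))) (\<lambda>x. \<rho> p (chart_inv c x))"
proof -
  have "\<exists>c r. c \<in> A \<and> p \<in> chart_dom c \<and> 0 < r \<and> cball (chart_map c p) r \<subseteq> chart_img c" for p
  proof -
    have "p \<in> (\<Union>c\<in>A. chart_dom c)" using A by (simp add: smooth_atlas_def)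
    then obtain c where c: "c \<in> A" "p \<in> chart_dom c" by blast
    then obtain r where "0 < r" "cball (chart_map c p) r \<subseteq> chart_img c"
      using open_contains_cball[of "chart_img c"] atlasD(2)[OF A c(1)] by blast
    then show ?thesis using c by blast
  qed
  then obtain ch r where ch: "\<And>p. ch p \<in> A" "\<And>p. p \<in> chart_dom (ch p)" and r: "\<And>p. 0 < r p"
      "\<And>p. cball (chart_map (ch p) p) (r p) \<subseteq> chart_img (ch p)" by metis
  define b where "b p = chart_bump (ch p) (chart_map (ch p) p) (r p)" for p
  define Z where "Z p = chart_inv (ch p) ` cball (chart_map (ch p) p) (r p)" for p
  define G where "G p = {q. b p q > 0}" for p
  note D = atlasD[OF A ch(1)]
  have Zdom: "Z p \<subseteq> chart_dom (ch p)" for p using r(2)[of p] D(6)[of _ p] by (auto simp: Z_def)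
  have Zc: "compact (Z p)" for p
    unfolding Z_def by (intro compact_continuous_image continuous_on_subset[OF D(4) r(2)] compact_cball)
  have b0: "b p q \<ge> 0" for p q by (simp add: b_def chart_bump_def)
  have bpos: "b p q > 0 \<longleftrightarrow> q \<in> chart_dom (ch p) \<and> chart_map (ch p) q \<in> ball (chart_map (ch p) p) (r p)" for p q
    using chart_bump_pos[OF r(1), of q "ch p"] by (cases "q \<in> chart_dom (ch p)") (simp_all add: b_def chart_bump_def)
  have OZ: "G p \<subseteq> Z p" for p
  proof
    fix q assume "q \<in> G p"
    then have q: "q \<in> chart_dom (ch p)" "chart_map (ch p) q \<in> cball (chart_map (ch p) p) (r p)"
      by (simp_all add: G_def bpos)
    then show "q \<in> Z p" unfolding Z_def using D(6)[OF q(1)] by force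
  qed
  have Oo: "open (G p)" for p
  proof -
    have "G p = chart_map (ch p) -` ball (chart_map (ch p) p) (r p) \<inter> chart_dom (ch p)"
      by (auto simp: G_def bpos)
    then show ?thesis using iffD1[OF continuous_on_open_vimage[OF D(1)] D(3)] by simp
  qed
  have self: "p \<in> G p" for p using ch(2) r(1) by (simp add: G_def bpos)
  obtain P where P: "finite P" "K \<subseteq> (\<Union>p\<in>P. G p)"
    by (rule compactE_image[OF K, of UNIV G]) (use Oo self in blast)+
  define S where "S q = (\<Sum>p\<in>P. b p q)" for q
  have S: "S q > 0" if "q \<in> (\<Union>p\<in>P. G p)" for q
  proof -
    from that obtain p where "p \<in> P" "b p q > 0" by (auto simp: G_def)
    then show ?thesis unfolding S_def using P(1) b0 by (intro sum_pos2)
  qed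
  define \<rho> where "\<rho> p q = b p q * inverse (S q)" for p q
  let ?N = "\<Union>p\<in>P. G p"
  show thesis
  proof (rule that[of P G ch Z \<rho>])
    show "finite P" "K \<subseteq> ?N" by fact+
    show "ch p \<in> A" "open (G p)" "G p \<subseteq> Z p" "compact (Z p)" "Z p \<subseteq> chart_dom (ch p)" for p by fact+
    show "\<rho> p q = 0" if "q \<notin> Z p" for p q
      using that OZ[of p] b0[of p q] by (force simp: \<rho>_def G_def)
    show "(\<Sum>p\<in>P. \<rho> p q) = 1" if "q \<in> ?N" for q
      using S[OF that] by (simp add: \<rho>_def sum_distrib_right[symmetric] S_def[symmetric])
    fix p c assume c: "c \<in> A"
    let ?V = "chart_map c ` (chart_dom c \<inter> ?N)"
    have V: "open ?V" by (rule open_chart_image[OF A c]) (use Oo in auto)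
    have bC: "Ck_on 1 ?V (\<lambda>x. b p (chart_inv c x))" for p
      unfolding b_def by (rule Ck_on_subset[OF chart_bump_C1[OF A ch(1) c r(1) r(2)]]) blast
    have "Ck_on 1 ?V (\<lambda>x. S (chart_inv c x))"
      unfolding S_def by (rule Ck_on_sum[OF V bC])
    moreover have "S (chart_inv c x) \<noteq> 0" if "x \<in> ?V" for x
      using that S atlasD(6)[OF A c] by fastforce
    ultimately show "Ck_on 1 ?V (\<lambda>x. \<rho> p (chart_inv c x))"
      unfolding \<rho>_def by (intro bounded_bilinear.Ck_on[OF bounded_bilinear_mult V] bC Ck_on_inverse V)
  qed
qed

section \<open>The first variation\<close>

lemma nij_cong:
  assumes "open V" "x \<in> V" "\<And>y. y \<in> V \<Longrightarrow> J y = K y"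
  shows "nij J x = nij K x"
proof -
  have "Dfield J x = Dfield K x"
    unfolding Dfield_def[abs_def] using frechet_derivative_cong_open[OF assms] by simp
  then show ?thesis using assms(2,3) by (simp add: nij_def fun_eq_iff)
qed

lemma beta_cong:
  assumes "open V" "x \<in> V" "\<And>y. y \<in> V \<Longrightarrow> J y = K y"
  shows "beta J x = beta K x"
  unfolding beta_def
proof (rule ext_d_cong[OF assms(1,2)])
  fix y assume "y \<in> V"
  then show "omega_field J y = omega_field K y"
    using nij_cong[OF assms(1) _ assms(3)] assms(3) by (simp add: omega_field_def)
qed

lemma psi_cong:
  assumes "acs_on V J" "acs_on V K" "x \<in> V" "\<And>y. y \<in> V \<Longrightarrow> J y = K y"
  shows "psi J x = psi K x"
proof -
  obtain a X where X: "dual_frames (J x) a X" by (rule acs_dual_frame[OF assms(1,3)])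
  then have Y: "dual_frames (K x) a X" using assms(3,4) by simp
  show ?thesis
    using nij_cong[where J = J and K = K, OF acs_onD(1)[OF assms(1)] assms(3,4)]
    by (simp add: psi_eq[OF assms(1,3) X] psi_eq[OF assms(2,3) Y])
qed

lemma almost_complex_acs_on:
  assumes "smooth_atlas A" "almost_complex A J" "c \<in> A"
  shows "acs_on (chart_img c) (J c)"
  using assms atlasD(2)[OF assms(1,3)] by (simp add: acs_on_def almost_complex_def)

lemma acs_map_transition:
  fixes A :: "'m::{t2_space,second_countable_topology} chart set"
  assumes A: "smooth_atlas A" and J: "almost_complex A J" and c: "c \<in> A" "d \<in> A"
  shows "acs_map (overlap c d) (J c) (chart_img d) (J d) (transition c d)"
proof -
  have o: "open (overlap c d)" by (rule open_chart_image[OF A c(1) atlasD(1)[OF A c(2)]])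
  have sub: "overlap c d \<subseteq> chart_img c" by blast
  have "acs_on (overlap c d) (J c)"
    using almost_complex_acs_on[OF A J c(1)] o sub smooth_on_subset[OF _ sub] by (auto simp: acs_on_def)
  moreover have "transition c d x \<in> chart_img d" "inj (frechet_derivative (transition c d) (at x))"
    if x: "x \<in> overlap c d" for x
  proof -
    obtain p where p: "p \<in> chart_dom c" "p \<in> chart_dom d" "x = chart_map c p" using x by blast
    show "transition c d x \<in> chart_img d" "inj (frechet_derivative (transition c d) (at x))"
      unfolding p(3) using overlap_transition(3,6)[OF A c p(1,2)] p(2) by (simp_all only: imageI)
  qed
  moreover have "smooth_on (overlap c d) (transition c d)" using A c by (auto simp: smooth_atlas_def)
  moreover have "\<forall>x\<in>overlap c d. \<forall>v. frechet_derivative (transition c d) (at x) (J c x *v v) =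
        J d (transition c d x) *v frechet_derivative (transition c d) (at x) v"
    using J c unfolding almost_complex_def by blast
  ultimately show ?thesis
    unfolding acs_map_def using almost_complex_acs_on[OF A J c(2)] by blast
qed

text \<open>The orientation sign changes by the sign of the Jacobian and thereby turns a 6-form,
  which transforms with the determinant itself, into a density.\<close>

lemma oriented_density:
  fixes A :: "'m::{t2_space,second_countable_topology} chart set"
  assumes A: "smooth_atlas A" and J: "almost_complex A J"
    and cont: "\<And>c. c \<in> A \<Longrightarrow> continuous_on (chart_map c ` (chart_dom c \<inter> K)) (h c)"
    and nat: "\<And>c d p. c \<in> A \<Longrightarrow> d \<in> A \<Longrightarrow> p \<in> chart_dom c \<Longrightarrow> p \<in> chart_dom d \<Longrightarrow> p \<in> K \<Longrightarrow> h c (chart_map c p) =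
      complex_of_real (det (matrix (frechet_derivative (transition c d) (at (chart_map c p))))) * h d (chart_map d p)"
  shows "chart_density A K (\<lambda>c x. complex_of_real (orient_sign (J c x)) * h c x)"
  unfolding chart_density_def
proof (intro conjI ballI)
  fix c assume c: "c \<in> A"
  have "continuous_on (chart_map c ` (chart_dom c \<inter> K)) (\<lambda>x. orient_sign (J c x))"
    by (rule continuous_on_subset[OF smooth_on_continuous[OF smooth_on_orient_sign[OF almost_complex_acs_on[OF A J c]]]]) blast
  then show "continuous_on (chart_map c ` (chart_dom c \<inter> K)) (\<lambda>x. complex_of_real (orient_sign (J c x)) * h c x)"
    by (intro continuous_on_mult continuous_on_of_real cont c)
  fix d p assume d: "d \<in> A" and p: "p \<in> chart_dom c \<inter> chart_dom d \<inter> K"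
  then have p': "p \<in> chart_dom c" "p \<in> chart_dom d" "p \<in> K" by auto
  note o = overlap_transition[OF A c d p'(1,2)]
  let ?D = "det (matrix (frechet_derivative (transition c d) (at (chart_map c p))))"
  have s: "orient_sign (J d (chart_map d p)) = sgn ?D * orient_sign (J c (chart_map c p))"
    using orient_sign_natural[OF acs_map_transition[OF A J c d] o(2)] unfolding o(3) .
  have "complex_of_real (orient_sign (J c (chart_map c p))) * (complex_of_real ?D * z) =
     \<bar>?D\<bar> *\<^sub>R (complex_of_real (sgn ?D * orient_sign (J c (chart_map c p))) * z)" for z
  proof -
    have "?D = \<bar>?D\<bar> * sgn ?D" by (simp add: abs_mult_sgn)
    from arg_cong[OF this, of complex_of_real]
    have "complex_of_real ?D = complex_of_real \<bar>?D\<bar> * complex_of_real (sgn ?D)" unfolding of_real_mult .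
    then show ?thesis by (simp only: scaleR_conv_of_real[where 'a = complex] of_real_mult mult_ac)
  qed
  then show "complex_of_real (orient_sign (J c (chart_map c p))) * h c (chart_map c p) =
      \<bar>?D\<bar> *\<^sub>R (complex_of_real (orient_sign (J d (chart_map d p))) * h d (chart_map d p))"
    unfolding nat[OF c d p'] s .
qed

lemma wedge_continuous:
  assumes "\<And>vs. continuous_on S (\<lambda>x. a x vs)" "\<And>vs. continuous_on S (\<lambda>x. b x vs)"
  shows "continuous_on S (\<lambda>x. (a x \<and>\<^sub>f b x) vs)"
  unfolding wedge_def by (intro continuous_on_sum continuous_on_mult continuous_on_const assms)

lemma set_integral_sum_finite:
  fixes f :: "'i \<Rightarrow> 'a \<Rightarrow> 'b::{banach, second_countable_topology}"
  assumes "\<And>i. i \<in> I \<Longrightarrow> set_integrable M S (f i)"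
  shows "(LINT x:S|M. (\<Sum>i\<in>I. f i x)) = (\<Sum>i\<in>I. LINT x:S|M. f i x)"
  using assms unfolding set_integrable_def set_lebesgue_integral_def
  by (simp add: scaleR_sum_right Bochner_Integration.integral_sum)

lemma orient_sign_has_derivative:
  assumes "acs_on V J" "x \<in> V"
  shows "((\<lambda>y. orient_sign (J y)) has_derivative (\<lambda>_. 0)) (at x)"
proof -
  obtain T where T: "open T" "x \<in> T" "\<forall>y\<in>V \<inter> T. orient_sign (J y) = orient_sign (J x)"
    using orient_sign_locally_constant[OF assms] by blast
  show ?thesis
    by (rule has_derivative_transform_within_open[OF has_derivative_const[of "orient_sign (J x)"] open_Int[OF acs_onD(1)[OF assms(1)] T(1)]])
       (use T(2) assms(2) in simp, rule T(3)[rule_format, symmetric])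
qed

text \<open>The condition \<open>typed\<close> is the shape in which the hypothesis on the
  (1,2)-part of d\<omega> is applied.\<close>

locale acs_variation =
  fixes A :: "'m::{t2_space,second_countable_topology} chart set" and J :: "'m chart \<Rightarrow> field"
    and \<epsilon> :: real and K :: "'m set" and Jt :: "real \<Rightarrow> 'm chart \<Rightarrow> field" and c1 c2 :: real
  assumes atlas: "smooth_atlas A" and acs: "almost_complex A J" and var: "variation A J \<epsilon> K Jt"
    and typed: "\<And>c x. c \<in> A \<Longrightarrow> x \<in> chart_img c \<Longrightarrow> typed_3 (J c x) (beta (J c) x)"
    and psi: "\<And>c x. c \<in> A \<Longrightarrow> x \<in> chart_img c \<Longrightarrow> psi (J c) x \<noteq> (\<lambda>vs. 0)"
begin

lemma eps: "0 < \<epsilon>" and K: "compact K" and acs_t: "\<bar>t\<bar> < \<epsilon> \<Longrightarrow> almost_complex A (Jt t)"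
  and J0: "c \<in> A \<Longrightarrow> x \<in> chart_img c \<Longrightarrow> Jt 0 c x = J c x"
  and off_K: "\<bar>t\<bar> < \<epsilon> \<Longrightarrow> c \<in> A \<Longrightarrow> p \<in> chart_dom c \<Longrightarrow> p \<notin> K \<Longrightarrow> Jt t c (chart_map c p) = J c (chart_map c p)"
  using var unfolding variation_def by (auto simp: abs_less_iff minus_less_iff)

lemma chart_var: "c \<in> A \<Longrightarrow> chart_variation (chart_img c) \<epsilon> (\<lambda>t. Jt t c)"
  using var atlasD(2)[OF atlas] unfolding variation_def chart_variation_def almost_complex_def by (simp add: split_def)

lemma acs_c: "c \<in> A \<Longrightarrow> acs_on (chart_img c) (J c)"
  by (rule almost_complex_acs_on[OF atlas acs])

lemma acs_0: "c \<in> A \<Longrightarrow> acs_on (chart_img c) (Jt 0 c)"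
  using almost_complex_acs_on[OF atlas acs_t[of 0]] eps by simp

text \<open>\<open>J c\<close> and \<open>Jt 0 c\<close> agree on the chart image only; it is open,
  and \<beta> at a point depends just on the germ of the structure.\<close>

lemma typed_0: "c \<in> A \<Longrightarrow> x \<in> chart_img c \<Longrightarrow> typed_3 (Jt 0 c x) (beta (Jt 0 c) x)"
  using typed[of c x] beta_cong[OF acs_onD(1)[OF acs_c], of c x "Jt 0 c"] J0 by simp

lemma psi_0: "c \<in> A \<Longrightarrow> x \<in> chart_img c \<Longrightarrow> psi (Jt 0 c) x \<noteq> (\<lambda>vs. 0)"
  using psi[of c x] psi_cong[of "chart_img c" "Jt 0 c" "J c" x] acs_0 acs_c J0 by simp

abbreviation \<tau> where "\<tau> c \<equiv> tau (\<lambda>t. Jt t c)"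
abbreviation \<beta> where "\<beta> c \<equiv> beta (Jt 0 c)"
abbreviation \<sigma> where "\<sigma> c x \<equiv> complex_of_real (orient_sign (J c x))"
abbreviation \<kappa> where "\<kappa> \<equiv> - complex_of_real (c1 + c2) / 12"

definition rate :: "'m chart \<Rightarrow> real^6 \<Rightarrow> complex" where
  "rate c x = \<kappa> * (ext_d (\<tau> c) x \<and>\<^sub>f \<beta> c x) std_frame"

lemma form_on_\<tau>: "c \<in> A \<Longrightarrow> form_on (chart_img c) 2 (\<tau> c)"
  by (rule form_on_tau[OF chart_var])

lemma form_on_\<beta>: "c \<in> A \<Longrightarrow> form_on (chart_img c) 3 (\<beta> c)"
  by (rule form_on_beta[OF acs_0])

lemma F_form_rate:
  "c \<in> A \<Longrightarrow> x \<in> chart_img c \<Longrightarrow> ((\<lambda>t. F_form c1 c2 (Jt t c) x std_frame) has_vector_derivative rate c x) (at 0)"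
  unfolding rate_def by (rule F_form_variation[where Jt = "\<lambda>t. Jt t c", OF chart_var _ typed_0 psi_0])

context
  fixes c d :: "'m chart" and p :: 'm
  assumes c: "c \<in> A" and d: "d \<in> A" and p: "p \<in> chart_dom c" "p \<in> chart_dom d"
begin

abbreviation (input) "L \<equiv> frechet_derivative (transition c d) (at (chart_map c p))"

lemma F_form_transition:
  assumes "\<bar>t\<bar> < \<epsilon>"
  shows "F_form c1 c2 (Jt t c) (chart_map c p) std_frame = complex_of_real (det (matrix L)) * F_form c1 c2 (Jt t d) (chart_map d p) std_frame"
  using F_form_natural[OF acs_map_transition[OF atlas acs_t[OF assms] c d] overlap_transition(2)[OF atlas c d p]]
  unfolding overlap_transition(3)[OF atlas c d p] .

text \<open>The transformation law of the integrand is differentiated in t; this takes the place of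
  naturality of d\<tau>.\<close>

lemma rate_transition: "rate c (chart_map c p) = complex_of_real (det (matrix L)) * rate d (chart_map d p)"
proof -
  have "((\<lambda>t. complex_of_real (det (matrix L)) * F_form c1 c2 (Jt t d) (chart_map d p) std_frame) has_vector_derivative
      complex_of_real (det (matrix L)) * rate d (chart_map d p)) (at 0)"
    using p by (intro has_vector_derivative_mult_right F_form_rate d) auto
  then have "((\<lambda>t. F_form c1 c2 (Jt t c) (chart_map c p) std_frame) has_vector_derivative
      complex_of_real (det (matrix L)) * rate d (chart_map d p)) (at 0)"
    by (rule has_vector_derivative_transform_within_open[where S = "{-\<epsilon><..<\<epsilon>}"])
       (use eps F_form_transition in \<open>auto simp: abs_less_iff minus_less_iff\<close>)
  moreover have "((\<lambda>t. F_form c1 c2 (Jt t c) (chart_map c p) std_frame) has_vector_derivative rate c (chart_map c p)) (at 0)"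
    using p by (intro F_form_rate c) auto
  ultimately show ?thesis by (rule vector_derivative_unique_at[rotated])
qed

lemma \<beta>_transition: "\<beta> c (chart_map c p) vs = \<beta> d (chart_map d p) (map L vs)"
proof -
  have m: "acs_map (overlap c d) (Jt 0 c) (chart_img d) (Jt 0 d) (transition c d)"
    using acs_map_transition[OF atlas acs_t[of 0] c d] eps by simp
  note o = overlap_transition[OF atlas c d p]
  show ?thesis
    using beta_natural[OF m o(2), unfolded o(3), OF typed_0[OF c] typed_0[OF d]] p by simp
qed

lemma \<tau>_transition: "\<tau> c (chart_map c p) vs = \<tau> d (chart_map d p) (map L vs)"
proof -
  have m: "acs_map (overlap c d) (Jt t c) (chart_img d) (Jt t d) (transition c d)" if "\<bar>t\<bar> < \<epsilon>" for t
    by (rule acs_map_transition[OF atlas acs_t[OF that] c d])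
  note o = overlap_transition[OF atlas c d p]
  have "\<forall>\<^sub>F t in nhds 0. \<forall>v. L (Jt t c (chart_map c p) *v v) = Jt t d (chart_map d p) *v L v"
    unfolding eventually_nhds
  proof (intro exI[of _ "{-\<epsilon><..<\<epsilon>}"] conjI ballI allI)
    fix t v assume "t \<in> {-\<epsilon><..<\<epsilon>}"
    then have "\<bar>t\<bar> < \<epsilon>" by auto
    from acs_mapD(8)[OF m[OF this] o(2)]
    show "L (Jt t c (chart_map c p) *v v) = Jt t d (chart_map d p) *v L v" unfolding o(3) .
  qed (use eps in auto)
  then show ?thesis
    using tau_natural[where Jt = "\<lambda>t. Jt t c" and Kt = "\<lambda>t. Jt t d", OF m[of 0] o(2), unfolded o(3),
        OF _ Jt_has_vector_derivative[OF chart_var[OF c]] Jt_has_vector_derivative[OF chart_var[OF d]]] eps p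
    by simp
qed

end

text \<open>Off K the structures do not depend on t, so that the velocity and with it \<tau>
  vanish.\<close>

lemma \<tau>_off_K:
  assumes c: "c \<in> A" and p: "p \<in> chart_dom c" "p \<notin> K"
  shows "\<tau> c (chart_map c p) vs = 0"
proof -
  have x: "chart_map c p \<in> chart_img c" using p by blast
  have "((\<lambda>t. Jt t c (chart_map c p)) has_vector_derivative 0) (at 0)"
    by (rule has_vector_derivative_transform_within_open[OF has_vector_derivative_const[of "J c (chart_map c p)"], where S = "{-\<epsilon><..<\<epsilon>}"])
       (use off_K[OF _ c p] eps in \<open>auto simp: abs_less_iff minus_less_iff\<close>)
  then have v: "velocity (\<lambda>t. Jt t c) (chart_map c p) = 0"
    by (rule vector_derivative_unique_at[OF Jt_has_vector_derivative[OF chart_var[OF c] x]])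
  have "alt_form (omega_field (Jt 0 c) (chart_map c p))"
    by (rule form_onD(1)[OF skew_2D(1)[OF skew_2_omega_field[OF acs_0[OF c]]] x])
  note l = linear_0[OF alt_formD(1)[OF this]]
  have "omega_field (Jt 0 c) (chart_map c p) [0, v] = 0" "omega_field (Jt 0 c) (chart_map c p) [v, 0] = 0" for v
    using l[of "[]" "[v]"] l[of "[v]" "[]"] by simp_all
  then show ?thesis by (simp add: tau_def contr_sum_def v two_form_def split: list.splits)
qed

lemma F_density: "\<bar>t\<bar> < \<epsilon> \<Longrightarrow> chart_density A K (\<lambda>c x. \<sigma> c x * F_form c1 c2 (Jt t c) x std_frame)"
proof (rule oriented_density[OF atlas acs _ F_form_transition])
  fix c assume t: "\<bar>t\<bar> < \<epsilon>" and c: "c \<in> A"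
  have "smooth_on (chart_img c) (\<lambda>x. F_form c1 c2 (Jt t c) x std_frame)"
    using smooth_on_slice[OF atlasD(2)[OF atlas c] _ smooth_on_F_form[OF chart_var[OF c]], of t] t by (simp add: abs_less_iff minus_less_iff)
  then show "continuous_on (chart_map c ` (chart_dom c \<inter> K)) (\<lambda>x. F_form c1 c2 (Jt t c) x std_frame)"
    by (rule continuous_on_subset[OF smooth_on_continuous]) blast
qed

lemma smooth_rate: "c \<in> A \<Longrightarrow> smooth_on (chart_img c) (rate c)"
  unfolding rate_def[abs_def]
  by (intro smooth_on_mult smooth_on_const wedge_smooth ext_d_smooth atlasD(2)[OF atlas] form_onD(3)[OF form_on_\<tau>] form_onD(3)[OF form_on_\<beta>])

text \<open>One decomposition of K serves all t, since neither the pieces nor the orientation sign,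
  which is that of J, depend on t; each summand is then differentiated under the integral.\<close>

lemma form_integral_derivative:
  assumes B: "chart_pieces A K C B" "(\<Union>c\<in>C. B c) = K"
  shows "((\<lambda>t. form_integral A J K (\<lambda>c. F_form c1 c2 (Jt t c))) has_vector_derivative
    (\<Sum>c\<in>C. LINT x:chart_map c ` B c|lborel. \<sigma> c x * rate c x)) (at 0)"
proof -
  note D = chart_piecesD[OF B(1)]
  have "((\<lambda>t. LINT x:chart_map c ` B c|lborel. \<sigma> c x * F_form c1 c2 (Jt t c) x std_frame) has_vector_derivative
      (LINT x:chart_map c ` B c|lborel. \<sigma> c x * rate c x)) (at 0)" if c: "c \<in> C" for c
  proof (rule set_integral_has_vector_derivative[OF _ eps])
    note E = atlasD[OF atlas D(4)[OF c]] and cv = chart_var[OF D(4)[OF c]]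
    let ?S = "{-\<epsilon><..<\<epsilon>} \<times> chart_img c"
    have S: "open ?S" by (rule chart_variationD(4)[OF cv])
    have "smooth_on ?S (\<lambda>z. \<sigma> c (snd z))"
    proof (rule smooth_on_locally_constant[OF S])
      fix z assume "z \<in> ?S"
      then have "snd z \<in> chart_img c" by auto
      from orient_sign_locally_constant[OF acs_c[OF D(4)[OF c]] this] obtain T where
        "open T" "snd z \<in> T" "\<forall>y\<in>chart_img c \<inter> T. orient_sign (J c y) = orient_sign (J c (snd z))" by blast
      then show "\<exists>T. open T \<and> z \<in> T \<and> (\<forall>y\<in>?S \<inter> T. \<sigma> c (snd y) = \<sigma> c (snd z))"
        by (intro exI[of _ "UNIV \<times> T"]) (auto simp: open_Times mem_Times_iff)
    qed
    then show "smooth_on ?S (\<lambda>z. \<sigma> c (snd z) * F_form c1 c2 (Jt (fst z) c) (snd z) std_frame)"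
      by (intro smooth_on_mult S smooth_on_F_form[OF cv])
    have "closure (B c) \<subseteq> K" by (rule closure_minimal[OF D(5)[OF c] compact_imp_closed[OF K]])
    then have "compact (closure (B c))" using compact_Int_closed[OF K closed_closure, of "B c"] by (simp add: inf_absorb2)
    then show "compact (chart_map c ` closure (B c))"
      by (rule compact_continuous_image[OF continuous_on_subset[OF E(3) D(7)[OF c]]])
    show "chart_map c ` closure (B c) \<subseteq> chart_img c" by (rule image_mono[OF D(7)[OF c]])
    show "chart_map c ` B c \<in> sets borel" by (rule borel_chart_image[OF atlas D(4)[OF c] D(6)[OF c] D(8)[OF c]])
    show "chart_map c ` B c \<subseteq> chart_map c ` closure (B c)" by (rule image_mono[OF closure_subset])
    fix x assume "x \<in> chart_map c ` B c"
    then have "x \<in> chart_img c" using D(8)[OF c] by blast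
    then show "((\<lambda>t. \<sigma> c x * F_form c1 c2 (Jt t c) x std_frame) has_vector_derivative \<sigma> c x * rate c x) (at 0)"
      by (intro has_vector_derivative_mult_right F_form_rate D(4)[OF c])
  qed
  then have d: "((\<lambda>t. \<Sum>c\<in>C. LINT x:chart_map c ` B c|lborel. \<sigma> c x * F_form c1 c2 (Jt t c) x std_frame) has_vector_derivative
    (\<Sum>c\<in>C. LINT x:chart_map c ` B c|lborel. \<sigma> c x * rate c x)) (at 0)"
    by (intro has_vector_derivative_sum)
  have e: "(\<Sum>c\<in>C. LINT x:chart_map c ` B c|lborel. \<sigma> c x * F_form c1 c2 (Jt t c) x std_frame) =
      form_integral A J K (\<lambda>c. F_form c1 c2 (Jt t c))" if "t \<in> {-\<epsilon><..<\<epsilon>}" for t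
    by (rule form_integral_eq[where \<theta> = "\<lambda>c. F_form c1 c2 (Jt t c)", OF atlas K F_density B, symmetric]) (use that in auto)
  show ?thesis
    by (rule has_vector_derivative_transform_within_open[where S = "{-\<epsilon><..<\<epsilon>}", OF d _ _ e]) (use eps in auto)
qed

text \<open>A partition of unity on a neighbourhood of \<open>K\<close> reduces Stokes' theorem to the charts: the
  differentials of the cut-off functions add up to \<open>0\<close>.\<close>

context
  fixes P :: "'m set" and G :: "'m \<Rightarrow> 'm set" and ch :: "'m \<Rightarrow> 'm chart" and Z :: "'m \<Rightarrow> 'm set" and \<rho> :: "'m \<Rightarrow> 'm \<Rightarrow> real"
  assumes finP: "finite P" and KP: "K \<subseteq> (\<Union>p\<in>P. G p)" and ch: "\<And>p. p \<in> P \<Longrightarrow> ch p \<in> A"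
    and G: "\<And>p. p \<in> P \<Longrightarrow> open (G p)" and OZ: "\<And>p. p \<in> P \<Longrightarrow> G p \<subseteq> Z p"
    and Z: "\<And>p. p \<in> P \<Longrightarrow> compact (Z p)" "\<And>p. p \<in> P \<Longrightarrow> Z p \<subseteq> chart_dom (ch p)"
    and \<rho>0: "\<And>p q. p \<in> P \<Longrightarrow> q \<notin> Z p \<Longrightarrow> \<rho> p q = 0"
    and \<rho>1: "\<And>q. q \<in> (\<Union>p\<in>P. G p) \<Longrightarrow> (\<Sum>p\<in>P. \<rho> p q) = 1"
    and \<rho>C1: "\<And>p c. p \<in> P \<Longrightarrow> c \<in> A \<Longrightarrow> Ck_on 1 (chart_map c ` (chart_dom c \<inter> (\<Union>p\<in>P. G p))) (\<lambda>x. \<rho> p (chart_inv c x))"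
begin

abbreviation (input) "N \<equiv> \<Union>p\<in>P. G p"
abbreviation (input) "V c \<equiv> chart_map c ` (chart_dom c \<inter> N)"

definition d\<rho> :: "'m \<Rightarrow> 'm chart \<Rightarrow> real^6 \<Rightarrow> real^6 \<Rightarrow> real" where
  "d\<rho> p c x = frechet_derivative (\<lambda>y. \<rho> p (chart_inv c y)) (at x)"

text \<open>The error term d\<rho> \<and> \<tau> \<and> \<beta> of the cut-off, with the same
  constant as \<open>rate\<close>.\<close>

definition cut :: "'m \<Rightarrow> 'm chart \<Rightarrow> real^6 \<Rightarrow> complex" where
  "cut p c x = \<kappa> * (one_form (\<lambda>v. complex_of_real (d\<rho> p c x v)) \<and>\<^sub>f \<tau> c x \<and>\<^sub>f \<beta> c x) std_frame"

lemma V: "c \<in> A \<Longrightarrow> open (V c)" "V c \<subseteq> chart_img c" "chart_map c ` (chart_dom c \<inter> K) \<subseteq> V c"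
  using KP G by (auto intro!: open_chart_image[OF atlas])

lemma d\<rho>: "p \<in> P \<Longrightarrow> c \<in> A \<Longrightarrow> x \<in> V c \<Longrightarrow> ((\<lambda>y. \<rho> p (chart_inv c y)) has_derivative d\<rho> p c x) (at x)"
  unfolding d\<rho>_def by (rule Ck_on_has_derivative[OF \<rho>C1[unfolded One_nat_def]])

lemma d\<rho>_transition:
  assumes c: "c \<in> A" "d \<in> A" and q: "q \<in> chart_dom c" "q \<in> chart_dom d" "q \<in> N" and p: "p \<in> P"
  shows "d\<rho> p c (chart_map c q) v = d\<rho> p d (chart_map d q) (frechet_derivative (transition c d) (at (chart_map c q)) v)"
proof -
  note o = overlap_transition[OF atlas c q(1,2)]
  have x: "chart_map c q \<in> V c" "chart_map d q \<in> V d" using q by blast+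
  have "((\<lambda>y. \<rho> p (chart_inv d y)) has_derivative d\<rho> p d (chart_map d q)) (at (transition c d (chart_map c q)))"
    unfolding o(3) by (rule d\<rho>[OF p c(2) x(2)])
  from has_derivative_compose[OF o(5) this]
  have "((\<lambda>y. \<rho> p (chart_inv c y)) has_derivative (\<lambda>v. d\<rho> p d (chart_map d q)
      (frechet_derivative (transition c d) (at (chart_map c q)) v))) (at (chart_map c q))"
    by (rule has_derivative_transform_within_open[OF _ o(1,2)]) (auto simp: atlasD(6)[OF atlas c(1)] atlasD(6)[OF atlas c(2)])
  from fun_cong[OF has_derivative_unique[OF d\<rho>[OF p c(1) x(1)] this]] show ?thesis .
qed

lemma cut_density:
  assumes p: "p \<in> P"
  shows "chart_density A K (\<lambda>c x. \<sigma> c x * cut p c x)"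
proof (rule oriented_density[OF atlas acs])
  fix c assume c: "c \<in> A"
  have "continuous_on (V c) (\<lambda>x. d\<rho> p c x v)" for v
    using \<rho>C1[OF p c] by (simp add: One_nat_def d\<rho>_def)
  then have "continuous_on (V c) (\<lambda>x. one_form (\<lambda>v. complex_of_real (d\<rho> p c x v)) vs)" for vs
    by (cases vs rule: remdups_adj.cases) (simp_all add: continuous_on_const continuous_on_of_real)
  then have "continuous_on (V c) (cut p c)"
    unfolding cut_def[abs_def]
    by (intro continuous_on_mult continuous_on_const wedge_continuous
        continuous_on_subset[OF smooth_on_continuous[OF form_onD(3)[OF form_on_\<tau>[OF c]]] V(2)]
        continuous_on_subset[OF smooth_on_continuous[OF form_onD(3)[OF form_on_\<beta>[OF c]]] V(2)])
  then show "continuous_on (chart_map c ` (chart_dom c \<inter> K)) (cut p c)"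
    by (rule continuous_on_subset[OF _ V(3)])
next
  fix c d q assume c: "c \<in> A" "d \<in> A" and q: "q \<in> chart_dom c" "q \<in> chart_dom d" "q \<in> K"
  let ?L = "frechet_derivative (transition c d) (at (chart_map c q))" and ?x = "chart_map c q" and ?y = "chart_map d q"
  let ?f = "\<lambda>v. complex_of_real (d\<rho> p d ?y v)"
  have qN: "q \<in> N" using q(3) KP by blast
  have y: "?y \<in> V d" "?y \<in> chart_img d" using q(2) qN by blast+
  have "(one_form (\<lambda>v. complex_of_real (d\<rho> p c ?x v)) \<and>\<^sub>f \<tau> c ?x \<and>\<^sub>f \<beta> c ?x) std_frame =
      (one_form ?f \<and>\<^sub>f \<tau> d ?y \<and>\<^sub>f \<beta> d ?y) (map ?L std_frame)"
    unfolding wedge_map one_form_map d\<rho>_transition[OF c q(1,2) qN p] \<tau>_transition[OF c q(1,2)] \<beta>_transition[OF c q(1,2)]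
    by (simp add: wedge_def)
  also have "\<dots> = complex_of_real (det (matrix ?L)) * (one_form ?f \<and>\<^sub>f \<tau> d ?y \<and>\<^sub>f \<beta> d ?y) std_frame"
  proof (rule alt_form_det_linear)
    have "linear ?f"
      using bounded_linear_compose[OF bounded_linear_of_real has_derivative_bounded_linear[OF d\<rho>[OF p c(2) y(1)]]]
      by (rule bounded_linear.linear)
    then show "alt_form (one_form ?f \<and>\<^sub>f \<tau> d ?y \<and>\<^sub>f \<beta> d ?y)"
      by (intro alt_form_wedge alt_form_one form_onD(1)[OF form_on_\<tau>[OF c(2)] y(2)] form_onD(1)[OF form_on_\<beta>[OF c(2)] y(2)])
    show "linear ?L" by (rule has_derivative_linear[OF overlap_transition(5)[OF atlas c q(1,2)]])
  qed
  finally show "cut p c ?x = complex_of_real (det (matrix ?L)) * cut p d ?y" by (simp add: cut_def)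
qed

lemma scaled_rate_density:
  assumes p: "p \<in> P"
  shows "chart_density A K (\<lambda>c x. \<sigma> c x * (complex_of_real (\<rho> p (chart_inv c x)) * rate c x))"
proof (rule oriented_density[OF atlas acs])
  fix c assume c: "c \<in> A"
  show "continuous_on (chart_map c ` (chart_dom c \<inter> K)) (\<lambda>x. complex_of_real (\<rho> p (chart_inv c x)) * rate c x)"
    by (intro continuous_on_mult continuous_on_of_real continuous_on_subset[OF Ck_on_continuous[OF \<rho>C1[OF p c]] V(3)]
        continuous_on_subset[OF smooth_on_continuous[OF smooth_rate[OF c]] order_trans[OF V(3) V(2)]])
next
  fix c d q assume c: "c \<in> A" "d \<in> A" and q: "q \<in> chart_dom c" "q \<in> chart_dom d" "q \<in> K"
  show "complex_of_real (\<rho> p (chart_inv c (chart_map c q))) * rate c (chart_map c q) =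
      complex_of_real (det (matrix (frechet_derivative (transition c d) (at (chart_map c q))))) *
      (complex_of_real (\<rho> p (chart_inv d (chart_map d q))) * rate d (chart_map d q))"
    unfolding atlasD(6)[OF atlas c(1) q(1)] atlasD(6)[OF atlas c(2) q(2)] rate_transition[OF c q(1,2)] by simp
qed

lemma support_pieces:
  assumes p: "p \<in> P"
  shows "chart_pieces A K {ch p} (\<lambda>_. Z p \<inter> K)"
proof -
  have "closed (Z p \<inter> K)" using Z(1)[OF p] K by (simp add: compact_imp_closed closed_Int)
  then show ?thesis using Z(2)[OF p] ch[OF p] by (auto simp: chart_pieces_def disjoint_family_on_def closure_closed)
qed

text \<open>The product of \<rho> with \<tau> \<and> \<beta> is supported in the compact set
  \<open>Z p \<inter> K\<close>: the cut-off confines it to \<open>Z p\<close>, and the variation to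
  K. As d\<beta> = 0, its differential consists of the two integrands. The orientation sign is
  locally constant and joins the scalar factor.\<close>

lemma stokes_chart:
  assumes p: "p \<in> P"
  defines "c \<equiv> ch p"
  defines "R \<equiv> chart_map c ` (Z p \<inter> K)"
  shows "(LINT x:R|lborel. \<sigma> c x * (complex_of_real (\<rho> p (chart_inv c x)) * rate c x)) = - (LINT x:R|lborel. \<sigma> c x * cut p c x)"
proof -
  have c: "c \<in> A" using ch[OF p] by (simp add: c_def)
  note E = atlasD[OF atlas c]
  have cp: "compact (Z p \<inter> K)" using Z(1)[OF p] K by (simp add: compact_Int)
  have ZK: "Z p \<inter> K \<subseteq> chart_dom c" using Z(2)[OF p] by (auto simp: c_def)
  have R: "compact R" "R \<subseteq> V c"
    using ZK KP by (auto simp: R_def intro!: compact_continuous_image[OF continuous_on_subset[OF E(3) ZK] cp])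
  let ?r = "\<lambda>x. complex_of_real (orient_sign (J c x) * \<rho> p (chart_inv c x))" and ?\<theta> = "\<lambda>x. \<tau> c x \<and>\<^sub>f \<beta> c x"
  have Ck: "Ck_on 1 (V c) ?r"
  proof (rule bounded_linear.Ck_on[OF bounded_linear_of_real V(1)[OF c] bounded_bilinear.Ck_on[OF bounded_bilinear_mult V(1)[OF c] _ \<rho>C1[OF p c]]])
    have "smooth_on (V c) (\<lambda>x. orient_sign (J c x))" by (rule smooth_on_subset[OF smooth_on_orient_sign[OF acs_c[OF c]] V(2)])
    then show "Ck_on 1 (V c) (\<lambda>x. orient_sign (J c x))" by (simp only: smooth_on_def)
  qed
  have sm: "smooth_on (chart_img c) (\<lambda>x. ?\<theta> x vs)" for vs
    by (intro wedge_smooth E(2) form_onD(3)[OF form_on_\<tau>[OF c]] form_onD(3)[OF form_on_\<beta>[OF c]])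
  then have C\<theta>: "Ck_on 1 (V c) (\<lambda>x. ?\<theta> x vs)" for vs
    using smooth_on_subset[OF sm V(2)] by (simp only: smooth_on_def)
  have z: "?r x * ?\<theta> x vs = 0" if "x \<in> V c - R" for x vs
  proof -
    obtain q where q: "q \<in> chart_dom c" "q \<notin> Z p \<or> q \<notin> K" "x = chart_map c q"
      using \<open>x \<in> V c - R\<close> by (auto simp: R_def)
    from q(2) show ?thesis
    proof
      assume "q \<notin> Z p"
      then show ?thesis by (simp add: q(3) E(6)[OF q(1)] \<rho>0[OF p])
    next
      assume "q \<notin> K"
      then have "\<tau> c x = (\<lambda>vs. 0)" unfolding q(3) by (intro ext \<tau>_off_K[OF c q(1)])
      then show ?thesis by (simp add: wedge_def)
    qed
  qed
  have pw: "\<kappa> * ((one_form (frechet_derivative ?r (at x)) \<and>\<^sub>f ?\<theta> x) std_frame + ?r x * ext_d ?\<theta> x std_frame) =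
      \<sigma> c x * (complex_of_real (\<rho> p (chart_inv c x)) * rate c x) + \<sigma> c x * cut p c x" if "x \<in> R" for x
  proof -
    have x: "x \<in> V c" "x \<in> chart_img c" using that R(2) V(2) by blast+
    have "(?r has_derivative (\<lambda>v. complex_of_real (orient_sign (J c x) * d\<rho> p c x v + 0 * \<rho> p (chart_inv c x)))) (at x)"
      by (intro bounded_linear.has_derivative[OF bounded_linear_of_real] has_derivative_mult
          orient_sign_has_derivative[OF acs_c[OF c] x(2)] d\<rho>[OF p c x(1)])
    from frechet_derivative_eqI[OF this]
    have 1: "frechet_derivative ?r (at x) = (\<lambda>v. \<sigma> c x * complex_of_real (d\<rho> p c x v))" by (simp add: fun_eq_iff)
    have 2: "(one_form (\<lambda>v. s * f v) \<and>\<^sub>f b) vs = s * (one_form f \<and>\<^sub>f b) vs" for s f b vs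
      by (simp add: wedge_one_eq sum_distrib_left mult_ac)
    have "ext_d (\<beta> c) x vs = 0" for vs
      unfolding beta_def
      by (rule ext_d_ext_d[OF E(2) x(2) form_onD(3)[OF skew_2D(1)[OF skew_2_omega_field[OF acs_0[OF c]]]]])
    then have "(twist (\<tau> c x) \<and>\<^sub>f ext_d (\<beta> c) x) vs = 0" for vs by (simp add: wedge_def)
    then have 3: "ext_d ?\<theta> x vs = (ext_d (\<tau> c) x \<and>\<^sub>f \<beta> c x) vs" for vs
      using ext_d_wedge[OF form_onD(4)[OF form_on_\<tau>[OF c] x(2)] form_onD(4)[OF form_on_\<beta>[OF c] x(2)]] by simp
    show ?thesis unfolding 1 2 3 rate_def cut_def unfolding of_real_mult by algebra
  qed
  have Rb: "R \<in> sets lborel" using R(1) by (simp add: borel_closed compact_imp_closed)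
  have int: "set_integrable lborel R (g c)" if "chart_density A K g" for g
    unfolding R_def
    by (rule density_integrable[OF atlas that c K]) (use cp ZK in \<open>auto simp: compact_imp_closed closure_closed borel_closed\<close>)
  have "(LINT x:R|lborel. \<sigma> c x * (complex_of_real (\<rho> p (chart_inv c x)) * rate c x)) + (LINT x:R|lborel. \<sigma> c x * cut p c x) =
      (LINT x:R|lborel. \<sigma> c x * (complex_of_real (\<rho> p (chart_inv c x)) * rate c x) + \<sigma> c x * cut p c x)"
    by (rule set_integral_add(2)[symmetric, OF int[OF scaled_rate_density[OF p]] int[OF cut_density[OF p]]])
  also have "\<dots> = (LINT x:R|lborel. \<kappa> * ((one_form (frechet_derivative ?r (at x)) \<and>\<^sub>f ?\<theta> x) std_frame + ?r x * ext_d ?\<theta> x std_frame))"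
    by (rule set_lebesgue_integral_cong[OF Rb]) (use pw in simp)
  also have "\<dots> = \<kappa> * (LINT x:R|lborel. (one_form (frechet_derivative ?r (at x)) \<and>\<^sub>f ?\<theta> x) std_frame + ?r x * ext_d ?\<theta> x std_frame)"
    by (rule set_integral_mult_right)
  also have "\<dots> = \<kappa> * 0"
    by (rule arg_cong[where f = "(*) \<kappa>"], rule stokes_compact[OF V(1)[OF c] Ck C\<theta> R z])
  also have "\<dots> = 0" by simp
  finally show ?thesis by (rule eq_neg_iff_add_eq_0[THEN iffD2])
qed

text \<open>The integrals are moved twice: from the common pieces to the support of one cut-off,
  where Stokes' theorem applies, and back to the common pieces, where the error terms can be added
  over p under the integral.\<close>

lemma total_rate:
  assumes B: "chart_pieces A K C B" "(\<Union>c\<in>C. B c) = K"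
  shows "(\<Sum>c\<in>C. LINT x:chart_map c ` B c|lborel. \<sigma> c x * rate c x) = 0"
proof -
  note D = chart_piecesD[OF B(1)]
  have localize: "(\<Sum>c\<in>C. LINT x:chart_map c ` B c|lborel. g c x) = (LINT x:chart_map (ch p) ` (Z p \<inter> K)|lborel. g (ch p) x)"
    if p: "p \<in> P" and g: "chart_density A K g"
      and 0: "\<And>c q. c \<in> A \<Longrightarrow> q \<in> chart_dom c \<Longrightarrow> q \<in> K \<Longrightarrow> q \<notin> Z p \<Longrightarrow> g c (chart_map c q) = 0" for p g
  proof -
    have "(\<Sum>c\<in>C. LINT x:chart_map c ` B c|lborel. g c x) = (\<Sum>c\<in>{ch p}. LINT x:chart_map c ` (Z p \<inter> K)|lborel. g c x)"
    proof (rule integral_pieces_unique[OF atlas g K B(1) support_pieces[OF p]])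
      fix c q assume c: "c \<in> C" and q: "q \<in> B c" "q \<notin> (\<Union>d\<in>{ch p}. Z p \<inter> K)"
      have "q \<in> chart_dom c" "q \<in> K" using subsetD[OF D(8)[OF c] q(1)] subsetD[OF D(5)[OF c] q(1)] .
      moreover from this have "q \<notin> Z p" using q(2) by simp
      ultimately show "g c (chart_map c q) = 0" by (intro 0 D(4)[OF c])
    qed (simp add: B(2))
    then show ?thesis by simp
  qed
  have x: "x \<in> V c" "x \<in> chart_img c" "chart_inv c x \<in> K" if c: "c \<in> C" and xB: "x \<in> chart_map c ` B c" for c x
  proof -
    obtain q where q: "q \<in> B c" "x = chart_map c q" using xB by blast
    have "q \<in> chart_dom c" "q \<in> K" using q(1) D(5,8)[OF c] by blast+
    then show "x \<in> V c" "x \<in> chart_img c" "chart_inv c x \<in> K"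
      unfolding q(2) using KP atlasD(6)[OF atlas D(4)[OF c]] by auto
  qed
  have bm: "chart_map c ` B c \<in> sets lborel" if "c \<in> C" for c
    using borel_chart_image[OF atlas D(4)[OF that] D(6)[OF that] D(8)[OF that]] by simp
  have int: "set_integrable lborel (chart_map c ` B c) (g c)" if "c \<in> C" "chart_density A K g" for c g
    by (rule density_integrable[OF atlas that(2) D(4)[OF that(1)] K D(6)[OF that(1)] D(5)[OF that(1)] D(7)[OF that(1)]])
  let ?g = "\<lambda>p c x. \<sigma> c x * (complex_of_real (\<rho> p (chart_inv c x)) * rate c x)" and ?h = "\<lambda>p c x. \<sigma> c x * cut p c x"
  have "(\<Sum>c\<in>C. LINT x:chart_map c ` B c|lborel. \<sigma> c x * rate c x) = (\<Sum>c\<in>C. LINT x:chart_map c ` B c|lborel. (\<Sum>p\<in>P. ?g p c x))"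
  proof (intro sum.cong refl set_lebesgue_integral_cong bm)
    fix c assume c: "c \<in> C"
    show "\<forall>y. y \<in> chart_map c ` B c \<longrightarrow> \<sigma> c y * rate c y = (\<Sum>p\<in>P. ?g p c y)"
    proof (intro allI impI)
      fix y assume "y \<in> chart_map c ` B c"
      from x(3)[OF c this] have "chart_inv c y \<in> N" using KP by blast
      from \<rho>1[OF this] have "(\<Sum>p\<in>P. complex_of_real (\<rho> p (chart_inv c y))) = 1" by (metis of_real_1 of_real_sum)
      then show "\<sigma> c y * rate c y = (\<Sum>p\<in>P. ?g p c y)"
        by (simp only: sum_distrib_left[symmetric] sum_distrib_right[symmetric] mult_1)
    qed
  qed
  also have "\<dots> = (\<Sum>c\<in>C. \<Sum>p\<in>P. LINT x:chart_map c ` B c|lborel. ?g p c x)"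
    by (intro sum.cong refl set_integral_sum_finite int[OF _ scaled_rate_density])
  also have "\<dots> = (\<Sum>p\<in>P. \<Sum>c\<in>C. LINT x:chart_map c ` B c|lborel. ?g p c x)" by (rule sum.swap)
  also have "\<dots> = (\<Sum>p\<in>P. - (\<Sum>c\<in>C. LINT x:chart_map c ` B c|lborel. ?h p c x))"
  proof (intro sum.cong refl)
    fix p assume p: "p \<in> P"
    have g0: "?g p c (chart_map c q) = 0" if "c \<in> A" "q \<in> chart_dom c" "q \<notin> Z p" for c q
      unfolding atlasD(6)[OF atlas that(1,2)] \<rho>0[OF p that(3)] by simp
    \<comment> \<open>The complement of \<open>Z p\<close> is open, so that not only \<rho> but also
      its derivative vanishes there.\<close>
    have h0: "?h p c (chart_map c q) = 0" if q: "c \<in> A" "q \<in> chart_dom c" "q \<in> K" "q \<notin> Z p" for c q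
    proof -
      let ?T = "chart_map c ` (chart_dom c \<inter> - Z p)"
      have T: "open ?T" by (rule open_chart_image[OF atlas q(1) open_Compl[OF compact_imp_closed[OF Z(1)[OF p]]]])
      have "((\<lambda>y. \<rho> p (chart_inv c y)) has_derivative (\<lambda>_. 0)) (at (chart_map c q))"
        by (rule has_derivative_transform_within_open[OF has_derivative_const[of 0] T])
           (use q \<rho>0[OF p] atlasD(6)[OF atlas q(1)] in auto)
      from frechet_derivative_eqI[OF this] show ?thesis by (simp add: cut_def d\<rho>_def wedge_one_eq)
    qed
    show "(\<Sum>c\<in>C. LINT x:chart_map c ` B c|lborel. ?g p c x) = - (\<Sum>c\<in>C. LINT x:chart_map c ` B c|lborel. ?h p c x)"
      by (rule trans[OF localize[where g = "?g p", OF p scaled_rate_density[OF p] g0]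
            trans[OF stokes_chart[OF p] arg_cong[OF localize[where g = "?h p", OF p cut_density[OF p] h0, symmetric], of uminus]]])
  qed
  also have "\<dots> = - (\<Sum>c\<in>C. \<Sum>p\<in>P. LINT x:chart_map c ` B c|lborel. ?h p c x)" by (simp add: sum_negf sum.swap[of _ P])
  also have "\<dots> = - (\<Sum>c\<in>C. LINT x:chart_map c ` B c|lborel. (\<Sum>p\<in>P. ?h p c x))"
    by (intro arg_cong[of _ _ uminus] sum.cong refl set_integral_sum_finite[symmetric] int[OF _ cut_density])
  also have "\<dots> = - (\<Sum>c\<in>C. LINT x:chart_map c ` B c|lborel. 0)"
  proof (intro arg_cong[of _ _ uminus] sum.cong refl set_lebesgue_integral_cong bm)
    fix c assume c: "c \<in> C"
    \<comment> \<open>The sum is 1 on the whole open set \<open>V c\<close>; knowing it over K alone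
      would not determine its derivative.\<close>
    have one: "(\<Sum>p\<in>P. \<rho> p (chart_inv c y)) = 1" if y: "y \<in> V c" for y
    proof -
      obtain q where q: "q \<in> chart_dom c" "q \<in> N" "y = chart_map c q" using y by blast
      show ?thesis unfolding q(3) atlasD(6)[OF atlas D(4)[OF c] q(1)] by (rule \<rho>1[OF q(2)])
    qed
    show "\<forall>y. y \<in> chart_map c ` B c \<longrightarrow> (\<Sum>p\<in>P. ?h p c y) = 0"
    proof (intro allI impI)
      fix y assume "y \<in> chart_map c ` B c"
      note y = x(1)[OF c this]
      have "((\<lambda>y. \<Sum>p\<in>P. \<rho> p (chart_inv c y)) has_derivative (\<lambda>v. \<Sum>p\<in>P. d\<rho> p c y v)) (at y)"
        by (intro has_derivative_sum d\<rho> D(4)[OF c] y)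
      moreover have "((\<lambda>y. \<Sum>p\<in>P. \<rho> p (chart_inv c y)) has_derivative (\<lambda>_. 0)) (at y)"
        by (rule has_derivative_transform_within_open[OF has_derivative_const[of 1] V(1)[OF D(4)[OF c]] y])
           (rule one[symmetric])
      ultimately have "(\<lambda>v. \<Sum>p\<in>P. d\<rho> p c y v) = (\<lambda>_. 0)" by (rule has_derivative_unique)
      from fun_cong[OF this] have s: "(\<Sum>p\<in>P. complex_of_real (d\<rho> p c y v)) = 0" for v by (metis of_real_0 of_real_sum)
      have "(\<Sum>p\<in>P. (one_form (\<lambda>v. complex_of_real (d\<rho> p c y v)) \<and>\<^sub>f b) vs) = 0" for b vs
        unfolding wedge_one_eq by (subst sum.swap) (simp add: sum_distrib_left[symmetric] sum_distrib_right[symmetric] s)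
      then show "(\<Sum>p\<in>P. ?h p c y) = 0" by (simp only: cut_def sum_distrib_left[symmetric] mult_zero_right)
    qed
  qed
  finally show ?thesis by (simp add: set_lebesgue_integral_def)
qed

end

lemma first_variation: "((\<lambda>t. form_integral A J K (\<lambda>c. F_form c1 c2 (Jt t c))) has_vector_derivative 0) (at 0)"
proof -
  obtain P :: "'m set" and ch G Z \<rho> where P: "finite P" "K \<subseteq> (\<Union>p\<in>P. G p)"
    "\<And>p. p \<in> P \<Longrightarrow> ch p \<in> A" "\<And>p. p \<in> P \<Longrightarrow> open (G p)" "\<And>p. p \<in> P \<Longrightarrow> G p \<subseteq> Z p"
    "\<And>p. p \<in> P \<Longrightarrow> compact (Z p)" "\<And>p. p \<in> P \<Longrightarrow> Z p \<subseteq> chart_dom (ch p)"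
    "\<And>p q. p \<in> P \<Longrightarrow> q \<notin> Z p \<Longrightarrow> \<rho> p q = (0::real)" "\<And>q. q \<in> (\<Union>p\<in>P. G p) \<Longrightarrow> (\<Sum>p\<in>P. \<rho> p q) = 1"
    "\<And>p c. p \<in> P \<Longrightarrow> c \<in> A \<Longrightarrow> Ck_on 1 (chart_map c ` (chart_dom c \<inter> (\<Union>p\<in>P. G p))) (\<lambda>x. \<rho> p (chart_inv c x))"
    by (rule partition_of_unity[OF atlas K]) blast
  have cl: "closure (G p) \<subseteq> chart_dom (ch p)" if "p \<in> P" for p
    using closure_minimal[OF P(5)[OF that] compact_imp_closed[OF P(6)[OF that]]] P(7)[OF that] by blast
  obtain C B where B: "chart_pieces A K C B" "(\<Union>c\<in>C. B c) = K"
    by (rule chart_pieces_exist[where G = G and ch = ch, OF atlas K P(1,2) conjI[OF P(4) conjI[OF P(3) cl]]])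
  have "(\<Sum>c\<in>C. LINT x:chart_map c ` B c|lborel. \<sigma> c x * rate c x) = 0" by (rule total_rate[OF P B])
  with form_integral_derivative[OF B] show ?thesis by (simp only:)
qed

end

theorem proposition2:
  fixes A :: "'m::{t2_space,second_countable_topology} chart set"
    and J :: "'m chart \<Rightarrow> real^6 \<Rightarrow> real^6^6"
  assumes "smooth_atlas A"
    and "almost_complex A J"
    and "\<forall>c\<in>A. \<forall>x\<in>chart_img c. del_bar (J c) (omega (J c)) x = (\<lambda>vs. 0)"
    and "\<forall>c\<in>A. \<forall>x\<in>chart_img c. psi (J c) x \<noteq> (\<lambda>vs. 0)"
  shows "(\<forall>c1 c2. critical A J c1 c2) \<and> real_type A J"
proof (intro conjI allI)
  note acs = almost_complex_acs_on[OF assms(1,2)]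
  have typed: "typed_3 (J c x) (beta (J c) x)" if "c \<in> A" "x \<in> chart_img c" for c x
    by (rule typed_3_beta[OF acs[OF that(1)] that(2)]) (use assms(3) that in blast)
  show "critical A J c1 c2" for c1 c2
    unfolding critical_def
  proof (intro allI impI)
    fix \<epsilon> K Jt assume "variation A J \<epsilon> K Jt"
    then interpret acs_variation A J \<epsilon> K Jt c1 c2
      by unfold_locales (use assms typed in auto)
    show "((\<lambda>t. form_integral A J K (\<lambda>c. F_form c1 c2 (Jt t c))) has_vector_derivative 0) (at 0)"
      by (rule first_variation)
  qed
  show "real_type A J"
    unfolding real_type_def
  proof (intro ballI allI impI)
    fix c x U \<alpha> assume c: "c \<in> A" and x: "x \<in> chart_img c" and U: "coframing (J c) U \<alpha> \<and> x \<in> U"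
    obtain X where X: "dual_frames (J c x) (\<lambda>i v. \<alpha> i x [v]) X"
      using coframing_dual_frame[of "J c" U \<alpha> x] U by blast
    show "\<exists>s H. (\<forall>i j. H $ i $ j = cnj (H $ j $ i)) \<and> Nij (J c) \<alpha> x = (\<chi> i j. s * H $ i $ j)"
      unfolding Nij_eq[OF acs[OF c] conjunct1[OF U] conjunct2[OF U] x X]
      by (rule real_type_local[OF acs[OF c] typed[OF c] x X assms(4)[rule_format, OF c x]])
  qed
qed

end
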